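(* Let $M$ and $N$ be smooth manifolds of dimensions $m$ and $d$ respectively, let $k\ge1$ be an integer and let $1\le p<\infty$. If $p>m$, then the weak and strong $(k,p)$-Sobolev-Whitney topologies (on the space of continuous maps $M\to N$ of class $W^{k,p}$ on compact sets in charts) are Baire, i.e. the intersection of any countable family of open and dense subsets is dense.
   Context: Manifolds are second countable and Hausdorff. Semi-norms. For $K\subset\mathbb{R}^m$ compact, let $[f]_{k,p,K}=\left(\int_K\sum_{0<j\le k}|D^jf(x)|^p\,d\mu(x)\right)^{1/p}$, where $\mu$ is Lebesgue measure on $\mathbb{R}^m$, $|\cdot|$ is the operator norm on symmetric $j$-linear maps $\mathbb{R}^m\to\mathbb{R}^d$, and $f$ is a continuous function from $K$ to $\mathbb{R}^d$ whose components all lie in the Sobolev class $W^{k,p}$, meaning that all weak derivatives of order $k$ or less exist in some neighbourhood of $K$ and lie in $L^p_\mu(K)$. Topologies. Let $\mathcal{F}=\{[\,\cdot\,]_{k,p,K}\}_K$ be this family. Put $\|\cdot\|_K=\|\cdot\|_{C^0(K,\mathbb{R}^d)}+[\,\cdot\,]_{k,p,K}$ with $\|\cdot\|_{C^0}$ the sup-norm. $C^{\mathcal{F}}(M,N)$ is the set of $f\in C^0(M,N)$ which in local charts have (well-defined and) finite norm $\|\cdot\|_K$ on each compact subset $K$. For a chart $(U,\varphi)$ of $M$, a chart $(V,\psi)$ of $N$, a compact $K\subset U$, $\epsilon\in(0,+\infty]$ and $f\in C^{\mathcal{F}}(M,N)$ with $f(K)\subset V$, let $\mathcal{N}(f;(U,\varphi),(V,\psi),K,\epsilon)$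 be the set of $g\in C^{\mathcal{F}}(M,N)$ with $g(K)\subset V$ and $\|\psi\circ f\circ\varphi^{-1}-\psi\circ g\circ\varphi^{-1}\|_{\varphi(K)}<\epsilon$. The weak $\mathcal{F}$-Whitney topology is the topology on $C^{\mathcal{F}}(M,N)$ generated by these sets (as a sub-base). For a locally finite collection of charts $\Phi=\{(U_t,\varphi_t)\}_{t\in T}$ on $M$, a collection of charts $\Psi=\{(V_t,\psi_t)\}_{t\in T}$ on $N$, compact sets $K_t\subset U_t$, $\epsilon_t\in(0,+\infty]$, and $f\in C^{\mathcal{F}}(M,N)$ with $f(K_t)\subset V_t$ for all $t$, let $\mathcal{N}_s(f;\Phi,\Psi,K,\epsilon)$ be the set of $g\in C^{\mathcal{F}}(M,N)$ such that for each $t\in T$, $g(K_t)\subset V_t$ and $\|\psi_t\circ f\circ\varphi_t^{-1}-\psi_t\circ g\circ\varphi_t^{-1}\|_{\varphi_t(K_t)}<\epsilon_t$. The strong $\mathcal{F}$-Whitney topology is the topology with these sets as a base. The weak and strong $(k,p)$-Sobolev-Whitney topologies (also called $W^{k,p}$-Whitney topologies) are the weak and strong $\mathcal{F}$-Whitney topologies for this $\mathcal{F}$. *)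

theory Defs
  imports "HOL-Analysis.Analysis" "HOL-Library.Multiset"
begin

section \<open>Smooth maps between Euclidean spaces\<close>

text \<open>\<open>dir_deriv [v\<^sub>1, \<dots>, v\<^sub>j] f\<close> is the iterated directional derivative
  \<open>\<partial>\<^bsub>v\<^sub>1\<^esub> \<dots> \<partial>\<^bsub>v\<^sub>j\<^esub> f\<close>.\<close>

fun dir_deriv :: "'e::euclidean_space list \<Rightarrow> ('e \<Rightarrow> 'f::euclidean_space) \<Rightarrow> 'e \<Rightarrow> 'f" where
  "dir_deriv [] f = f"
| "dir_deriv (v # vs) f = (\<lambda>x. frechet_derivative (dir_deriv vs f) (at x) v)"

text \<open>Meant for open \<open>S\<close>.  All iterated directional derivatives are Frechet differentiable on
  \<open>S\<close>, hence continuous there, so this is \<open>C\<^sup>\<infinity>\<close>.\<close>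

definition smooth_on :: "'e::euclidean_space set \<Rightarrow> ('e \<Rightarrow> 'f::euclidean_space) \<Rightarrow> bool" where
  "smooth_on S f \<longleftrightarrow> (\<forall>vs. \<forall>x\<in>S. dir_deriv vs f differentiable (at x))"

section \<open>Smooth manifolds\<close>

text \<open>The second component of a chart is a total function; only its values on the first
  component matter.\<close>

type_synonym ('a, 'e) chart = "'a set \<times> ('a \<Rightarrow> 'e)"

definition is_chart :: "'a topology \<Rightarrow> ('a, 'e::euclidean_space) chart \<Rightarrow> bool" where
  "is_chart X = (\<lambda>(U, \<phi>). openin X U \<and> open (\<phi> ` U) \<and>
     homeomorphic_map (subtopology X U) (top_of_set (\<phi> ` U)) \<phi>)"

definition compatible_charts ::
  "('a, 'e::euclidean_space) chart \<Rightarrow> ('a, 'e) chart \<Rightarrow> bool" where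
  "compatible_charts = (\<lambda>(U, \<phi>) (V, \<psi>).
     smooth_on (\<phi> ` (U \<inter> V)) (\<psi> \<circ> inv_into U \<phi>) \<and>
     smooth_on (\<psi> ` (U \<inter> V)) (\<phi> \<circ> inv_into V \<psi>))"

definition smooth_atlas :: "'a topology \<Rightarrow> ('a, 'e::euclidean_space) chart set \<Rightarrow> bool" where
  "smooth_atlas X \<A> \<longleftrightarrow> (\<forall>c\<in>\<A>. is_chart X c) \<and> \<Union>(fst ` \<A>) = topspace X \<and>
     (\<forall>c\<in>\<A>. \<forall>c'\<in>\<A>. compatible_charts c c')"

text \<open>A smooth structure is a maximal smooth atlas, so the charts of the manifold are exactly the
  members of \<open>\<A>\<close>.  The dimension is \<open>DIM('e)\<close>.\<close>

definition smooth_manifold :: "'a topology \<Rightarrow> ('a, 'e::euclidean_space) chart set \<Rightarrow> bool" where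
  "smooth_manifold X \<A> \<longleftrightarrow> Hausdorff_space X \<and> second_countable X \<and> smooth_atlas X \<A> \<and>
     (\<forall>c. is_chart X c \<and> (\<forall>c'\<in>\<A>. compatible_charts c c') \<longrightarrow> c \<in> \<A>)"

section \<open>Weak derivatives and Sobolev norms\<close>

text \<open>A \<open>j\<close>-linear map is represented by a function on argument lists, of which only those of
  length \<open>j\<close> matter.\<close>

definition sym_multilinear ::
  "nat \<Rightarrow> ('e::euclidean_space list \<Rightarrow> 'f::euclidean_space) \<Rightarrow> bool" where
  "sym_multilinear j L \<longleftrightarrow>
     (\<forall>vs i. length vs = j \<and> i < j \<longrightarrow> linear (\<lambda>v. L (vs[i := v]))) \<and>
     (\<forall>vs ws. length vs = j \<and> mset ws = mset vs \<longrightarrow> L ws = L vs)"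

definition multilinear_norm ::
  "nat \<Rightarrow> ('e::euclidean_space list \<Rightarrow> 'f::euclidean_space) \<Rightarrow> real" where
  "multilinear_norm j L = (SUP vs \<in> {vs. length vs = j \<and> (\<forall>v\<in>set vs. norm v \<le> 1)}. norm (L vs))"

definition locally_integrable_on ::
  "('e::euclidean_space \<Rightarrow> 'f::euclidean_space) \<Rightarrow> 'e set \<Rightarrow> bool" where
  "locally_integrable_on f G \<longleftrightarrow> (\<forall>K. compact K \<and> K \<subseteq> G \<longrightarrow> f absolutely_integrable_on K)"

definition test_function :: "'e::euclidean_space set \<Rightarrow> ('e \<Rightarrow> real) \<Rightarrow> bool" where
  "test_function G \<eta> \<longleftrightarrow> smooth_on UNIV \<eta> \<and> (\<exists>K. compact K \<and> K \<subseteq> G \<and> (\<forall>x. x \<notin> K \<longrightarrow> \<eta> x = 0))"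

text \<open>\<open>D\<close> is a version of the \<open>j\<close>-th weak derivative of \<open>f\<close> on the open set \<open>G\<close>; evaluated at
  basis vectors it yields the weak partial derivatives of order \<open>j\<close>.\<close>

definition is_weak_derivative ::
  "'e::euclidean_space set \<Rightarrow> nat \<Rightarrow> ('e \<Rightarrow> 'f::euclidean_space) \<Rightarrow> ('e \<Rightarrow> 'e list \<Rightarrow> 'f) \<Rightarrow> bool"
  where
  "is_weak_derivative G j f D \<longleftrightarrow>
     locally_integrable_on f G \<and>
     (\<forall>x\<in>G. sym_multilinear j (D x)) \<and>
     (\<forall>vs. length vs = j \<longrightarrow>
        locally_integrable_on (\<lambda>x. D x vs) G \<and>
        (\<forall>\<eta>. test_function G \<eta> \<longrightarrow>
          (LINT x:G|lebesgue. dir_deriv vs \<eta> x *\<^sub>R f x) =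
          (-1) ^ j *\<^sub>R (LINT x:G|lebesgue. \<eta> x *\<^sub>R D x vs)))"

definition sobolev_on ::
  "nat \<Rightarrow> real \<Rightarrow> 'e::euclidean_space set \<Rightarrow> ('e \<Rightarrow> 'f::euclidean_space) \<Rightarrow> bool" where
  "sobolev_on k p K f \<longleftrightarrow> continuous_on K f \<and>
     (\<forall>j\<le>k. \<exists>G D. open G \<and> K \<subseteq> G \<and> is_weak_derivative G j f D \<and>
        (\<forall>vs. length vs = j \<longrightarrow> (\<lambda>x. norm (D x vs) powr p) absolutely_integrable_on K))"

text \<open>On \<open>K\<close>, the choice below is unique up to null sets whenever a weak derivative exists on some
  neighbourhood of \<open>K\<close>, so the seminorm does not depend on it.\<close>

definition weak_derivative_near ::
  "'e::euclidean_space set \<Rightarrow> nat \<Rightarrow> ('e \<Rightarrow> 'f::euclidean_space) \<Rightarrow> 'e \<Rightarrow> 'e list \<Rightarrow> 'f" where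
  "weak_derivative_near K j f = (SOME D. \<exists>G. open G \<and> K \<subseteq> G \<and> is_weak_derivative G j f D)"

definition sobolev_seminorm ::
  "nat \<Rightarrow> real \<Rightarrow> 'e::euclidean_space set \<Rightarrow> ('e \<Rightarrow> 'f::euclidean_space) \<Rightarrow> real" where
  "sobolev_seminorm k p K f =
     (LINT x:K|lebesgue. (\<Sum>j\<in>{1..k}. multilinear_norm j (weak_derivative_near K j f x) powr p))
       powr (1 / p)"

text \<open>Inserting \<open>0\<close> gives the sup-norm over the empty set its usual value.\<close>

definition sup_norm_on :: "'e set \<Rightarrow> ('e \<Rightarrow> 'f::real_normed_vector) \<Rightarrow> real" where
  "sup_norm_on K f = Sup (insert 0 ((\<lambda>x. norm (f x)) ` K))"

definition sobolev_norm ::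
  "nat \<Rightarrow> real \<Rightarrow> 'e::euclidean_space set \<Rightarrow> ('e \<Rightarrow> 'f::euclidean_space) \<Rightarrow> real" where
  "sobolev_norm k p K f = sup_norm_on K f + sobolev_seminorm k p K f"

section \<open>The Sobolev-Whitney topologies\<close>

definition local_rep ::
  "('a, 'e) chart \<Rightarrow> ('b, 'f) chart \<Rightarrow> ('a \<Rightarrow> 'b) \<Rightarrow> 'e \<Rightarrow> 'f" where
  "local_rep c c' f = snd c' \<circ> f \<circ> inv_into (fst c) (snd c)"

text \<open>Maps are made extensional so that they are determined by their values on the manifold.\<close>

definition sobolev_maps ::
  "nat \<Rightarrow> real \<Rightarrow> 'a topology \<Rightarrow> ('a, 'e::euclidean_space) chart set \<Rightarrow>
   'b topology \<Rightarrow> ('b, 'f::euclidean_space) chart set \<Rightarrow> ('a \<Rightarrow> 'b) set" where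
  "sobolev_maps k p X \<A> Y \<B> =
     {f \<in> extensional (topspace X). continuous_map X Y f \<and>
        (\<forall>c\<in>\<A>. \<forall>c'\<in>\<B>. \<forall>K. compactin X K \<and> K \<subseteq> fst c \<and> f ` K \<subseteq> fst c' \<longrightarrow>
           sobolev_on k p (snd c ` K) (local_rep c c' f))}"

type_synonym ('a, 'e, 'b, 'f) nbhd_datum =
  "('a, 'e) chart \<times> ('b, 'f) chart \<times> 'a set \<times> ereal"

definition admissible_datum ::
  "'a topology \<Rightarrow> ('a, 'e) chart set \<Rightarrow> ('b, 'f) chart set \<Rightarrow> ('a \<Rightarrow> 'b) \<Rightarrow>
   ('a, 'e, 'b, 'f) nbhd_datum \<Rightarrow> bool" where
  "admissible_datum X \<A> \<B> f = (\<lambda>(c, c', K, \<epsilon>). c \<in> \<A> \<and> c' \<in> \<B> \<and>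
     compactin X K \<and> K \<subseteq> fst c \<and> f ` K \<subseteq> fst c' \<and> 0 < \<epsilon>)"

definition weak_nbhd ::
  "nat \<Rightarrow> real \<Rightarrow> 'a topology \<Rightarrow> ('a, 'e::euclidean_space) chart set \<Rightarrow>
   'b topology \<Rightarrow> ('b, 'f::euclidean_space) chart set \<Rightarrow> ('a \<Rightarrow> 'b) \<Rightarrow>
   ('a, 'e, 'b, 'f) nbhd_datum \<Rightarrow> ('a \<Rightarrow> 'b) set" where
  "weak_nbhd k p X \<A> Y \<B> f = (\<lambda>(c, c', K, \<epsilon>). {g \<in> sobolev_maps k p X \<A> Y \<B>. g ` K \<subseteq> fst c' \<and>
     ereal (sobolev_norm k p (snd c ` K) (\<lambda>y. local_rep c c' f y - local_rep c c' g y)) < \<epsilon>})"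

text \<open>An indexed family of data is recorded by the set of its members: repeating a member does not
  change the neighbourhood, and removing repetitions preserves local finiteness.\<close>

definition strong_nbhd ::
  "nat \<Rightarrow> real \<Rightarrow> 'a topology \<Rightarrow> ('a, 'e::euclidean_space) chart set \<Rightarrow>
   'b topology \<Rightarrow> ('b, 'f::euclidean_space) chart set \<Rightarrow> ('a \<Rightarrow> 'b) \<Rightarrow>
   ('a, 'e, 'b, 'f) nbhd_datum set \<Rightarrow> ('a \<Rightarrow> 'b) set" where
  "strong_nbhd k p X \<A> Y \<B> f T =
     {g \<in> sobolev_maps k p X \<A> Y \<B>. \<forall>t\<in>T. g \<in> weak_nbhd k p X \<A> Y \<B> f t}"

definition locally_finite_data ::
  "'a topology \<Rightarrow> ('a, 'e, 'b, 'f) nbhd_datum set \<Rightarrow> bool" where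
  "locally_finite_data X T \<longleftrightarrow>
     (\<forall>x\<in>topspace X. \<exists>W. openin X W \<and> x \<in> W \<and> finite {t\<in>T. fst (fst t) \<inter> W \<noteq> {}})"

text \<open>The whole space is inserted as the empty intersection of sub-basic sets.\<close>

definition weak_sobolev_whitney ::
  "nat \<Rightarrow> real \<Rightarrow> 'a topology \<Rightarrow> ('a, 'e::euclidean_space) chart set \<Rightarrow>
   'b topology \<Rightarrow> ('b, 'f::euclidean_space) chart set \<Rightarrow> ('a \<Rightarrow> 'b) topology" where
  "weak_sobolev_whitney k p X \<A> Y \<B> = topology_generated_by
     (insert (sobolev_maps k p X \<A> Y \<B>)
       {weak_nbhd k p X \<A> Y \<B> f t | f t.
          f \<in> sobolev_maps k p X \<A> Y \<B> \<and> admissible_datum X \<A> \<B> f t})"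

definition strong_sobolev_whitney ::
  "nat \<Rightarrow> real \<Rightarrow> 'a topology \<Rightarrow> ('a, 'e::euclidean_space) chart set \<Rightarrow>
   'b topology \<Rightarrow> ('b, 'f::euclidean_space) chart set \<Rightarrow> ('a \<Rightarrow> 'b) topology" where
  "strong_sobolev_whitney k p X \<A> Y \<B> = topology (arbitrary union_of (\<lambda>B. B \<in>
     {strong_nbhd k p X \<A> Y \<B> f T | f T.
        f \<in> sobolev_maps k p X \<A> Y \<B> \<and> locally_finite_data X T \<and>
        (\<forall>t\<in>T. admissible_datum X \<A> \<B> f t)}))"

definition Baire_space :: "'a topology \<Rightarrow> bool" where
  "Baire_space X \<longleftrightarrow> (\<forall>\<G>. countable \<G> \<and> (\<forall>U\<in>\<G>. openin X U \<and> X closure_of U = topspace X) \<longrightarrow>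
     X closure_of (topspace X \<inter> \<Inter>\<G>) = topspace X)"

end

theory Submission
  imports Defs
begin

text \<open>A sequence of maps is built as in the usual proof of Baire's theorem.  Each datum \<open>(c, c', K, \<epsilon>)\<close>
  that confines a term \<open>f\<^sub>n\<close> is enlarged to a compact \<open>L\<close> with \<open>K\<close> in its interior, on which the
  following steps of the sequence are at most \<open>b, b/2, b/4, \<dots>\<close> for a small \<open>b\<close>; data covering ever
  larger compact sets of \<open>M\<close> are added along the way.  The sequence converges in charts, weak
  derivatives pass to the limit, and the enlarged sets keep the limit inside the chosen
  neighbourhoods.

  That the limit is of class \<open>W\<^bsup>k,p\<^esup>\<close> in all pairs of charts, not only in those of the data, needs
  \<open>p > m\<close>: a map of class \<open>W\<^bsup>k,p\<^esup>\<close> is mollified locally, by Morrey's inequality all derivatives of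
  order less than \<open>k\<close> of the mollifications converge uniformly, and the products in the chain rule
  therefore stay bounded in \<open>L\<^sup>p\<close> and Cauchy in \<open>L\<^sup>1\<close>.\<close>

section \<open>Smooth functions\<close>

text \<open>No complete metric is at hand, and the strong topology over a non-compact manifold need
  not be first countable. The construction therefore speaks only of families of neighbourhood data,
  and it uses only properties that finite and locally finite families share, which settles both
  topologies at once. Convergence on a compact \<open>K\<close> alone would yield weak derivatives
  of the limit in the interior of \<open>K\<close>, whereas class W^{k,p} on \<open>K\<close> asks
  for them on a neighbourhood of \<open>K\<close>. This is why the data are enlarged. The steps
  \<open>b, b/2, ...\<close> add up to \<open>2 * b\<close>, once in the sup-norm and once in the
  seminorm; hence the conditions with \<open>2 * b\<close> and \<open>4 * b\<close>. Balls of radius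
  \<open>2 * b\<close> inside the image of a target chart also keep the limit from leaving that
  chart. The main obstacle is that the space refers to all charts of two maximal atlases, while the
  sequence is controlled in one pair of charts around each point. Changing charts requires a
  substitution in integrals; an inequality for continuous integrands, obtained from small cubes
  without any Jacobian determinant, is enough.\<close>

definition dd :: "'e::euclidean_space \<Rightarrow> ('e \<Rightarrow> 'f::euclidean_space) \<Rightarrow> 'e \<Rightarrow> 'f" where
  "dd v f x = frechet_derivative f (at x) v"

text \<open>A function-level form of the recursion. It replaces the defining equation as simp rule,
  so that iterated derivatives unfold into nested \<open>dd\<close> and not into
  \<open>frechet_derivative\<close>.\<close>

lemma dir_deriv_Cons [simp]: "dir_deriv (v # vs) f = dd v (dir_deriv vs f)"
  by (auto simp: dd_def)

declare dir_deriv.simps(2) [simp del]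

lemma dir_deriv_append: "dir_deriv (vs @ ws) f = dir_deriv vs (dir_deriv ws f)"
  by (induction vs) auto

lemma dd_eqI: "(f has_derivative f') (at x) \<Longrightarrow> dd v f x = f' v"
  by (simp add: dd_def frechet_derivative_at[symmetric])

lemma has_derivative_dd: "f differentiable (at x) \<Longrightarrow> (f has_derivative (\<lambda>v. dd v f x)) (at x)"
  by (simp add: dd_def frechet_derivative_works)

lemma linear_dd: "f differentiable (at x) \<Longrightarrow> linear (\<lambda>v. dd v f x)"
  by (simp add: dd_def linear_frechet_derivative)

lemma dd_cong:
  assumes "open S" "x \<in> S" "\<And>y. y \<in> S \<Longrightarrow> f y = g y"
  shows "dd v f x = dd v g x"
proof -
  have "(f has_derivative f') (at x) \<longleftrightarrow> (g has_derivative f') (at x)" for f'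
    using assms has_derivative_transform_within_open[of _ f' x UNIV S] by metis
  then show ?thesis by (simp add: dd_def frechet_derivative_def)
qed

lemma differentiable_cong_open:
  assumes "open S" "x \<in> S" "\<And>y. y \<in> S \<Longrightarrow> f y = g y"
  shows "f differentiable (at x) \<longleftrightarrow> g differentiable (at x)"
  unfolding differentiable_def using assms has_derivative_transform_within_open[of _ _ x UNIV S] by metis

lemma dir_deriv_cong:
  assumes "open S" "x \<in> S" "\<And>y. y \<in> S \<Longrightarrow> f y = g y"
  shows "dir_deriv vs f x = dir_deriv vs g x"
  using assms(2)
proof (induction vs arbitrary: x)
  case (Cons v vs)
  have "dd v (dir_deriv vs f) x = dd v (dir_deriv vs g) x"
    by (rule dd_cong[OF assms(1)]) (use Cons in auto)
  then show ?case by simp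
qed (use assms in auto)

text \<open>A direction appended at the end of the list is differentiated first, so smoothness
  passes to every \<open>dd v f\<close>. This recursive form suits inductions better than the
  quantifier over lists.\<close>

lemma smooth_on_iff: "smooth_on S f \<longleftrightarrow>
    (\<forall>x\<in>S. f differentiable (at x)) \<and> (\<forall>v. smooth_on S (dd v f))"
proof
  assume *: "smooth_on S f"
  then have "dir_deriv (vs @ [v]) f differentiable (at x)" if "x \<in> S" for x v vs
    using that unfolding smooth_on_def by blast
  then show "(\<forall>x\<in>S. f differentiable (at x)) \<and> (\<forall>v. smooth_on S (dd v f))"
    using *[unfolded smooth_on_def, rule_format, where vs="[]"]
    by (auto simp: smooth_on_def dir_deriv_append)
next
  assume *: "(\<forall>x\<in>S. f differentiable (at x)) \<and> (\<forall>v. smooth_on S (dd v f))"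
  show "smooth_on S f" unfolding smooth_on_def
  proof (intro allI ballI)
    fix vs x assume "x \<in> S"
    show "dir_deriv vs f differentiable (at x)"
    proof (cases vs rule: rev_cases)
      case (snoc ws w)
      then show ?thesis using * \<open>x \<in> S\<close> by (auto simp: smooth_on_def dir_deriv_append)
    qed (use * \<open>x \<in> S\<close> in auto)
  qed
qed

lemma smooth_on_differentiable: "smooth_on S f \<Longrightarrow> x \<in> S \<Longrightarrow> f differentiable (at x)"
  and smooth_on_dd: "smooth_on S f \<Longrightarrow> smooth_on S (dd v f)"
  using smooth_on_iff by blast+

lemma smooth_on_dir_deriv: "smooth_on S f \<Longrightarrow> smooth_on S (dir_deriv vs f)"
  by (induction vs) (auto intro: smooth_on_dd)

lemma smooth_on_subset: "smooth_on S f \<Longrightarrow> T \<subseteq> S \<Longrightarrow> smooth_on T f"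
  by (auto simp: smooth_on_def)

lemma smooth_on_continuous:
  assumes "smooth_on S f"
  shows "continuous_on S f"
proof (rule continuous_at_imp_continuous_on, rule ballI)
  fix x assume "x \<in> S"
  show "isCont f x"
    by (rule differentiable_imp_continuous_within[OF smooth_on_differentiable[OF assms \<open>x \<in> S\<close>]])
qed

lemma smooth_on_cong:
  assumes "open S" "\<And>y. y \<in> S \<Longrightarrow> f y = g y"
  shows "smooth_on S f \<longleftrightarrow> smooth_on S g"
proof -
  have "dir_deriv vs f differentiable (at x) \<longleftrightarrow> dir_deriv vs g differentiable (at x)" if "x \<in> S" for vs x
    by (rule differentiable_cong_open[OF assms(1) that dir_deriv_cong[OF assms(1)]]) (use assms(2) in auto)
  then show ?thesis by (simp add: smooth_on_def)
qed

text \<open>Smoothness of a fixed order permits induction on the order, as in the product and chain rules.\<close>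

primrec ndiff_on :: "nat \<Rightarrow> 'e::euclidean_space set \<Rightarrow> ('e \<Rightarrow> 'f::euclidean_space) \<Rightarrow> bool" where
  "ndiff_on 0 S f \<longleftrightarrow> (\<forall>x\<in>S. f differentiable (at x))"
| "ndiff_on (Suc n) S f \<longleftrightarrow> (\<forall>x\<in>S. f differentiable (at x)) \<and> (\<forall>v. ndiff_on n S (dd v f))"

lemma ndiff_on_pred: "ndiff_on (Suc n) S f \<Longrightarrow> ndiff_on n S f"
proof (induction n arbitrary: f)
  case (Suc n)
  then show ?case using ndiff_on.simps(2) by blast
qed auto

text \<open>Lists of directions are peeled from the right, since \<open>ndiff_on\<close> recurses on
  the derivative that is taken first.\<close>

lemma smooth_on_ndiff: "smooth_on S f \<longleftrightarrow> (\<forall>n. ndiff_on n S f)"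
proof safe
  fix n assume "smooth_on S f"
  then show "ndiff_on n S f"
    by (induction n arbitrary: f) (auto simp: smooth_on_differentiable smooth_on_dd)
next
  assume *: "\<forall>n. ndiff_on n S f"
  have "ndiff_on (length vs) S f \<Longrightarrow> x \<in> S \<Longrightarrow> dir_deriv vs f differentiable (at x)" for vs x
  proof (induction "length vs" arbitrary: f vs)
    case (Suc n)
    then obtain v ws where "vs = ws @ [v]" by (metis length_0_conv nat.distinct(1) rev_exhaust)
    with Suc.prems Suc.hyps show ?case by (simp add: dir_deriv_append)
  next
    case 0
    then show ?case by simp
  qed
  then show "smooth_on S f" using * by (auto simp: smooth_on_def)
qed

lemma ndiff_on_cong:
  assumes "open S" "\<And>y. y \<in> S \<Longrightarrow> f y = g y"
  shows "ndiff_on n S f \<longleftrightarrow> ndiff_on n S g"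
  using assms(2)
proof (induction n arbitrary: f g)
  case 0
  have "f differentiable (at x) \<longleftrightarrow> g differentiable (at x)" if "x \<in> S" for x
    by (rule differentiable_cong_open[OF assms(1) that]) (use 0 in auto)
  then show ?case by simp
next
  case (Suc n)
  have "ndiff_on n S (dd v f) \<longleftrightarrow> ndiff_on n S (dd v g)" for v
    by (rule Suc.IH, rule dd_cong[OF assms(1)]) (use Suc.prems in auto)
  moreover have "f differentiable (at x) \<longleftrightarrow> g differentiable (at x)" if "x \<in> S" for x
    by (rule differentiable_cong_open[OF assms(1) that]) (use Suc.prems in auto)
  ultimately show ?case by simp
qed

lemma dd_add: "f differentiable (at x) \<Longrightarrow> g differentiable (at x) \<Longrightarrow>
    dd v (\<lambda>x. f x + g x) x = dd v f x + dd v g x"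
  by (rule dd_eqI[OF has_derivative_add[OF has_derivative_dd has_derivative_dd]])

lemma ndiff_on_add:
  assumes "open S" "ndiff_on n S f" "ndiff_on n S g"
  shows "ndiff_on n S (\<lambda>x. f x + g x)"
  using assms(2,3)
proof (induction n arbitrary: f g)
  case (Suc n)
  have "ndiff_on n S (\<lambda>x. dd v f x + dd v g x)" for v
    using Suc by auto
  moreover have "ndiff_on n S (\<lambda>x. dd v f x + dd v g x) \<longleftrightarrow> ndiff_on n S (dd v (\<lambda>x. f x + g x))" for v
    by (rule ndiff_on_cong[OF assms(1)]) (use Suc.prems in \<open>simp add: dd_add\<close>)
  ultimately show ?case using Suc.prems by auto
qed auto

lemma dd_bounded_linear: "bounded_linear L \<Longrightarrow> f differentiable (at x) \<Longrightarrow>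
    dd v (\<lambda>x. L (f x)) x = L (dd v f x)"
  by (rule dd_eqI[OF bounded_linear.has_derivative[OF _ has_derivative_dd]])

lemma differentiable_bounded_linear:
  fixes f :: "'e::euclidean_space \<Rightarrow> 'g::euclidean_space"
  shows "bounded_linear L \<Longrightarrow> f differentiable (at x) \<Longrightarrow>
    (\<lambda>x. L (f x)) differentiable (at x)"
  using bounded_linear.has_derivative[OF _ has_derivative_dd, of L f x]
  unfolding differentiable_def[of "\<lambda>x. L (f x)"] by blast

lemma ndiff_on_bounded_linear:
  assumes "open S" "bounded_linear L" "ndiff_on n S f"
  shows "ndiff_on n S (\<lambda>x. L (f x))"
  using assms(3)
proof (induction n arbitrary: f)
  case 0
  then show ?case by (auto intro: differentiable_bounded_linear[OF assms(2)])
next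
  case (Suc n)
  have "ndiff_on n S (\<lambda>x. L (dd v f x)) \<longleftrightarrow> ndiff_on n S (dd v (\<lambda>x. L (f x)))" for v
    by (rule ndiff_on_cong[OF assms(1)]) (use Suc.prems in \<open>simp add: dd_bounded_linear[OF assms(2)]\<close>)
  with Suc show ?case by (auto intro: differentiable_bounded_linear[OF assms(2)])
qed

lemma dd_scaleR:
  fixes a :: "'e::euclidean_space \<Rightarrow> real"
  assumes "a differentiable (at x)" "f differentiable (at x)"
  shows "dd v (\<lambda>x. a x *\<^sub>R f x) x = a x *\<^sub>R dd v f x + dd v a x *\<^sub>R f x"
  by (rule dd_eqI[OF has_derivative_scaleR[OF has_derivative_dd has_derivative_dd]]) (use assms in auto)

lemma ndiff_on_scaleR:
  fixes a :: "'e::euclidean_space \<Rightarrow> real"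
  assumes "open S" "ndiff_on n S a" "ndiff_on n S f"
  shows "ndiff_on n S (\<lambda>x. a x *\<^sub>R f x)"
  using assms(2,3)
proof (induction n arbitrary: a f)
  case 0
  then show ?case by (auto intro: differentiable_scaleR)
next
  case (Suc n)
  have "ndiff_on n S (\<lambda>x. a x *\<^sub>R dd v f x + dd v a x *\<^sub>R f x)" for v
    by (intro ndiff_on_add assms Suc.IH ndiff_on_pred[OF Suc.prems(1)] ndiff_on_pred[OF Suc.prems(2)])
       (use Suc.prems in auto)
  moreover have "ndiff_on n S (\<lambda>x. a x *\<^sub>R dd v f x + dd v a x *\<^sub>R f x)
      \<longleftrightarrow> ndiff_on n S (dd v (\<lambda>x. a x *\<^sub>R f x))" for v
    by (rule ndiff_on_cong[OF assms(1)]) (use Suc.prems in \<open>simp add: dd_scaleR\<close>)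
  ultimately show ?case using Suc.prems by (auto intro: differentiable_scaleR)
qed

lemma dd_const [simp]: "dd v (\<lambda>_. c) = (\<lambda>_. 0)"
  by (auto simp: fun_eq_iff intro: dd_eqI)

lemma smooth_on_const [simp, intro]: "smooth_on S (\<lambda>_. c)"
proof -
  have "ndiff_on n S (\<lambda>_. c)" for n
    by (induction n arbitrary: c) auto
  then show ?thesis by (simp add: smooth_on_ndiff)
qed

lemma smooth_on_add: "open S \<Longrightarrow> smooth_on S f \<Longrightarrow> smooth_on S g \<Longrightarrow> smooth_on S (\<lambda>x. f x + g x)"
  by (simp add: smooth_on_ndiff ndiff_on_add)

lemma smooth_on_scaleR:
  fixes a :: "'e::euclidean_space \<Rightarrow> real"
  shows "open S \<Longrightarrow> smooth_on S a \<Longrightarrow> smooth_on S f \<Longrightarrow> smooth_on S (\<lambda>x. a x *\<^sub>R f x)"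
  by (simp add: smooth_on_ndiff ndiff_on_scaleR)

lemma smooth_on_mult:
  fixes a :: "'e::euclidean_space \<Rightarrow> real"
  shows "open S \<Longrightarrow> smooth_on S a \<Longrightarrow> smooth_on S f \<Longrightarrow> smooth_on S (\<lambda>x. a x * f x)"
  using smooth_on_scaleR[of S a f] by simp

lemma smooth_on_bounded_linear:
  "open S \<Longrightarrow> bounded_linear L \<Longrightarrow> smooth_on S f \<Longrightarrow> smooth_on S (\<lambda>x. L (f x))"
  by (simp add: smooth_on_ndiff ndiff_on_bounded_linear)

lemma smooth_on_uminus: "open S \<Longrightarrow> smooth_on S f \<Longrightarrow> smooth_on S (\<lambda>x. - f x)"
  by (rule smooth_on_bounded_linear[OF _ bounded_linear_minus[OF bounded_linear_ident]])

lemma smooth_on_diff: "open S \<Longrightarrow> smooth_on S f \<Longrightarrow> smooth_on S g \<Longrightarrow> smooth_on S (\<lambda>x. f x - g x)"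
  using smooth_on_add[of S f "\<lambda>x. - g x"] smooth_on_uminus by auto

lemma smooth_on_sum: "open S \<Longrightarrow> (\<And>i. i \<in> I \<Longrightarrow> smooth_on S (f i)) \<Longrightarrow> smooth_on S (\<lambda>x. \<Sum>i\<in>I. f i x)"
  by (induction I rule: infinite_finite_induct) (auto intro: smooth_on_add)

lemma dd_ident: "dd v (\<lambda>x. x) = (\<lambda>_. v)"
  by (auto simp: fun_eq_iff intro: dd_eqI)

lemma smooth_on_ident [simp, intro]: "smooth_on S (\<lambda>x. x)"
  by (subst smooth_on_iff) (auto simp: dd_ident)

lemma dd_compose:
  assumes "f differentiable (at x)" "F differentiable (at (f x))"
  shows "dd v (\<lambda>x. F (f x)) x = dd (dd v f x) F (f x)"
  by (rule dd_eqI[OF has_derivative_compose[OF has_derivative_dd has_derivative_dd]]) (use assms in auto)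

lemma dd_basis_sum:
  assumes "F differentiable (at y)"
  shows "dd w F y = (\<Sum>b\<in>Basis. (w \<bullet> b) *\<^sub>R dd b F y)"
proof -
  interpret linear "\<lambda>v. dd v F y" by (rule linear_dd[OF assms])
  have "dd w F y = dd (\<Sum>b\<in>Basis. (w \<bullet> b) *\<^sub>R b) F y"
    by (simp add: euclidean_representation)
  also have "\<dots> = (\<Sum>b\<in>Basis. (w \<bullet> b) *\<^sub>R dd b F y)"
    by (simp add: sum scale)
  finally show ?thesis .
qed

lemma ndiff_on_sum:
  fixes f :: "'i \<Rightarrow> 'e::euclidean_space \<Rightarrow> 'b::euclidean_space"
  shows "open S \<Longrightarrow> (\<And>i. i \<in> I \<Longrightarrow> ndiff_on n S (f i)) \<Longrightarrow> ndiff_on n S (\<lambda>x. \<Sum>i\<in>I. f i x)"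
  using smooth_on_const[of S "0::'b", THEN smooth_on_ndiff[THEN iffD1], rule_format, of n]
  by (induction I rule: infinite_finite_induct) (auto intro: ndiff_on_add)

lemma differentiable_compose_at:
  "f differentiable (at x) \<Longrightarrow> F differentiable (at (f x)) \<Longrightarrow> (\<lambda>x. F (f x)) differentiable (at x)"
  using differentiable_chain_at[of f x F] by (simp add: o_def)

text \<open>By the chain rule the derivative is a sum of components of \<open>dd v f\<close> times
  \<open>dd b F\<close> composed with the same \<open>f\<close>. So the induction generalises
  \<open>F\<close> and keeps \<open>f\<close> fixed.\<close>

lemma ndiff_on_compose:
  assumes "open S" "open T" "ndiff_on n S f" "ndiff_on n T F" "f ` S \<subseteq> T"
  shows "ndiff_on n S (\<lambda>x. F (f x))"
  using assms(3,4)
proof (induction n arbitrary: F)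
  case 0
  then show ?case using assms(5) differentiable_compose_at[of f _ F] by auto
next
  case (Suc n)
  have d: "f differentiable (at x)" "F differentiable (at (f x))" if "x \<in> S" for x
    using that Suc.prems assms(5) by auto
  have "ndiff_on n S (\<lambda>x. \<Sum>b\<in>Basis. (dd v f x \<bullet> b) *\<^sub>R dd b F (f x))" for v
    by (intro ndiff_on_sum ndiff_on_scaleR assms
        ndiff_on_bounded_linear[OF _ bounded_linear_inner_left] Suc.IH ndiff_on_pred[OF Suc.prems(1)])
      (use Suc.prems in auto)
  moreover have "ndiff_on n S (\<lambda>x. \<Sum>b\<in>Basis. (dd v f x \<bullet> b) *\<^sub>R dd b F (f x))
      \<longleftrightarrow> ndiff_on n S (dd v (\<lambda>x. F (f x)))" for v
    by (rule ndiff_on_cong[OF assms(1)]) (use d in \<open>simp add: dd_compose dd_basis_sum[symmetric]\<close>)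
  moreover have "(\<lambda>x. F (f x)) differentiable (at x)" if "x \<in> S" for x
    using differentiable_compose_at[OF d[OF that]] .
  ultimately show ?case by simp
qed

lemma smooth_on_compose:
  "open S \<Longrightarrow> open T \<Longrightarrow> smooth_on S f \<Longrightarrow> smooth_on T F \<Longrightarrow> f ` S \<subseteq> T \<Longrightarrow> smooth_on S (\<lambda>x. F (f x))"
  by (simp add: smooth_on_ndiff ndiff_on_compose)

text \<open>The derivative of \<open>inverse\<close> is a constant times its own square, so the
  product rule alone closes the induction on the order.\<close>

lemma smooth_on_inverse: "smooth_on {x::real. x \<noteq> 0} inverse"
proof -
  have op: "open {x::real. x \<noteq> 0}" by (simp add: open_Collect_neq)
  have d: "inverse differentiable (at x)" if "x \<noteq> 0" for x::real
    using that by (metis DERIV_inverse has_field_derivative_imp_has_derivative differentiableI)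
  have dv: "dd v inverse x = (- v) *\<^sub>R (inverse x *\<^sub>R inverse x)" if "x \<noteq> 0" for x v :: real
    using dd_eqI[OF has_derivative_inverse'[OF that], of v] by simp
  have "ndiff_on n {x::real. x \<noteq> 0} inverse" for n
  proof (induction n)
    case (Suc n)
    have c: "ndiff_on n {x::real. x \<noteq> 0} (\<lambda>x. - v)" for v :: real
      using smooth_on_const smooth_on_ndiff by blast
    have "ndiff_on n {x::real. x \<noteq> 0} (\<lambda>x. (- v) *\<^sub>R (inverse x *\<^sub>R inverse x))" for v
      by (intro ndiff_on_scaleR op Suc c)
    moreover have "ndiff_on n {x::real. x \<noteq> 0} (\<lambda>x. (- v) *\<^sub>R (inverse x *\<^sub>R inverse x))
       \<longleftrightarrow> ndiff_on n {x::real. x \<noteq> 0} (dd v inverse)" for v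
      by (rule ndiff_on_cong[OF op]) (use dv in auto)
    ultimately show ?case using d by auto
  qed (use d in auto)
  then show ?thesis by (simp add: smooth_on_ndiff)
qed

section \<open>Symmetry of iterated derivatives\<close>

lemma dd_line:
  assumes "f differentiable (at (x + t *\<^sub>R w))"
  shows "((\<lambda>t. f (x + t *\<^sub>R w)) has_vector_derivative dd w f (x + t *\<^sub>R w)) (at t within A)"
proof -
  have *: "((\<lambda>t. x + t *\<^sub>R w) has_derivative (\<lambda>t. t *\<^sub>R w)) (at t within A)"
    by (auto intro!: derivative_eq_intros)
  have "((\<lambda>t. f (x + t *\<^sub>R w)) has_derivative (\<lambda>h. dd (h *\<^sub>R w) f (x + t *\<^sub>R w))) (at t within A)"
    using has_derivative_compose[OF * has_derivative_dd[OF assms]] .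
  moreover have "dd (h *\<^sub>R w) f (x + t *\<^sub>R w) = h *\<^sub>R dd w f (x + t *\<^sub>R w)" for h
    using linear_cmul[OF linear_dd[OF assms]] .
  ultimately show ?thesis by (simp add: has_vector_derivative_def)
qed

text \<open>Increments of \<open>f\<close> along \<open>w\<close> are integrals of
  \<open>dd w f\<close>. Differentiating them along \<open>v\<close> under the integral sign gives
  \<open>dd v f (x + t w) - dd v f x\<close> as the integral of \<open>dd v (dd w f)\<close>, and
  the derivative in \<open>t\<close> at 0 is the claim.\<close>

lemma dd_commute:
  assumes "open S" "smooth_on S f" "x \<in> S"
  shows "dd v (dd w f) x = dd w (dd v f) x"
proof -
  obtain e where e: "e > 0" "ball x e \<subseteq> S" using assms openE by blast
  \<comment> \<open>Small enough for the parallelogram with coefficients of modulus at most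
    \<open>r\<close> to lie in the ball of radius \<open>e\<close>. The summand 1 keeps the
    denominator positive when both directions vanish.\<close>
  define r where "r = e / (2 * (1 + norm v + norm w))"
  have r: "r > 0" using e by (auto simp: r_def intro!: divide_pos_pos add_pos_nonneg)
  have aux: "a + b < 2 * (1 + a + b)" if "0 \<le> a" "0 \<le> b" for a b :: real
    using that by (simp add: algebra_simps)
  have pt: "x + s *\<^sub>R v + t *\<^sub>R w \<in> S" if "\<bar>s\<bar> \<le> r" "\<bar>t\<bar> \<le> r" for s t
  proof -
    have "norm (s *\<^sub>R v + t *\<^sub>R w) \<le> r * norm v + r * norm w"
      using that by (intro norm_triangle_mono) (auto intro: mult_right_mono)
    also have "\<dots> = r * (norm v + norm w)" by (simp add: algebra_simps)
    also have "\<dots> < r * (2 * (1 + norm v + norm w))"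
      using r aux[OF norm_ge_zero norm_ge_zero] by (intro mult_strict_left_mono)
    also have "\<dots> = e"
    proof -
      have "1 + norm v + norm w > 0" by (simp add: add_pos_nonneg)
      then show ?thesis by (simp add: r_def)
    qed
    finally have "dist (x + (s *\<^sub>R v + t *\<^sub>R w)) x < e" by (simp add: dist_norm)
    then have "x + (s *\<^sub>R v + t *\<^sub>R w) \<in> ball x e" by (simp only: mem_ball dist_commute[of x])
    then show ?thesis using e by (auto simp: add.assoc)
  qed
  have df: "f differentiable (at y)" "dd w f differentiable (at y)" "dd v f differentiable (at y)"
    "dd v (dd w f) differentiable (at y)" if "y \<in> S" for y
    using smooth_on_differentiable[OF assms(2) that] smooth_on_differentiable[OF smooth_on_dd[OF assms(2)] that]
      smooth_on_differentiable[OF smooth_on_dd[OF smooth_on_dd[OF assms(2)]] that] by blast+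
  have cont: "continuous_on S (dd v (dd w f))" "continuous_on S (dd w f)"
    using smooth_on_continuous[OF smooth_on_dd[OF assms(2)]]
      smooth_on_continuous[OF smooth_on_dd[OF smooth_on_dd[OF assms(2)]]] by blast+
  define G where "G = (\<lambda>t. dd v f (x + t *\<^sub>R w))"
  let ?c = "\<lambda>s \<tau>. x + s *\<^sub>R v + \<tau> *\<^sub>R w"
  have G: "G t - G 0 = integral {0..t} (\<lambda>\<tau>. dd v (dd w f) (x + \<tau> *\<^sub>R w))" if t: "0 \<le> t" "t \<le> r" for t
  proof -
    have ftc: "f (?c s t) - f (x + s *\<^sub>R v) = integral (cbox 0 t) (\<lambda>\<tau>. dd w f (?c s \<tau>))"
      if "\<bar>s\<bar> \<le> r" for s
    proof -
      have "((\<lambda>\<tau>. dd w f (?c s \<tau>)) has_integral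
          f (?c s t) - f (?c s 0)) {0..t}"
        by (rule fundamental_theorem_of_calculus[OF t(1)], rule dd_line, rule df, rule pt) (use t that in auto)
      then show ?thesis by (simp add: integral_unique)
    qed
    have "((\<lambda>s. integral (cbox 0 t) (\<lambda>\<tau>. dd w f (?c s \<tau>))) has_vector_derivative
        integral (cbox 0 t) (\<lambda>\<tau>. dd v (dd w f) (?c 0 \<tau>))) (at 0 within {-r..r})"
    proof (rule leibniz_rule_vector_derivative)
      fix s \<tau> assume st: "s \<in> {-r..r}" "\<tau> \<in> cbox 0 t"
      have "((\<lambda>s. dd w f ((x + \<tau> *\<^sub>R w) + s *\<^sub>R v)) has_vector_derivative dd v (dd w f) ((x + \<tau> *\<^sub>R w) + s *\<^sub>R v)) (at s within {-r..r})"
        by (rule dd_line, rule df, use pt[of s \<tau>] st t in \<open>auto simp: algebra_simps\<close>)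
      then show "((\<lambda>s. dd w f (?c s \<tau>)) has_vector_derivative dd v (dd w f) (?c s \<tau>)) (at s within {-r..r})"
        by (simp add: algebra_simps)
    next
      fix s assume s: "s \<in> {-r..r}"
      show "(\<lambda>\<tau>. dd w f (?c s \<tau>)) integrable_on cbox 0 t"
        by (intro integrable_continuous continuous_intros continuous_on_compose2[OF cont(2)])
           (use pt s t in auto)
    next
      show "continuous_on ({-r..r} \<times> cbox 0 t) (\<lambda>(s, \<tau>). dd v (dd w f) (?c s \<tau>))"
        unfolding split_beta by (intro continuous_intros continuous_on_compose2[OF cont(1)])
           (use pt t in auto)
    qed (use r in auto)
    then have "((\<lambda>s. integral (cbox 0 t) (\<lambda>\<tau>. dd w f (?c s \<tau>))) has_vector_derivative
        integral (cbox 0 t) (\<lambda>\<tau>. dd v (dd w f) (x + \<tau> *\<^sub>R w))) (at 0)"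
      using r by (simp add: at_within_interior[of 0 "{-r..r}"])
    \<comment> \<open>The same function of \<open>s\<close> differentiated directly through its
      closed form; uniqueness of derivatives equates the two results.\<close>
    moreover have "((\<lambda>s. f ((x + t *\<^sub>R w) + s *\<^sub>R v) - f (x + s *\<^sub>R v)) has_vector_derivative
       dd v f ((x + t *\<^sub>R w) + 0 *\<^sub>R v) - dd v f (x + 0 *\<^sub>R v)) (at 0)"
      by (intro has_vector_derivative_diff dd_line df) (use pt[of 0 t] pt[of 0 0] r t in auto)
    then have "((\<lambda>s. integral (cbox 0 t) (\<lambda>\<tau>. dd w f (?c s \<tau>))) has_vector_derivative
       dd v f ((x + t *\<^sub>R w) + 0 *\<^sub>R v) - dd v f (x + 0 *\<^sub>R v)) (at 0)"
      by (rule has_vector_derivative_transform_within[where d=r])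
         (use r ftc in \<open>auto simp: dist_norm algebra_simps\<close>)
    ultimately show ?thesis unfolding G_def
      using vector_derivative_unique_at by fastforce
  qed
  have "((\<lambda>t. integral {0..t} (\<lambda>\<tau>. dd v (dd w f) (x + \<tau> *\<^sub>R w))) has_vector_derivative
      dd v (dd w f) (x + 0 *\<^sub>R w)) (at 0 within {0..r})"
    by (rule integral_has_vector_derivative)
       (use r in \<open>auto intro!: continuous_intros continuous_on_compose2[OF cont(1)] simp: pt[of 0, simplified]\<close>)
  moreover have "(G has_vector_derivative dd w (dd v f) (x + 0 *\<^sub>R w)) (at 0 within {0..r})"
    unfolding G_def by (rule dd_line) (use df assms in auto)
  then have "((\<lambda>t. G t - G 0) has_vector_derivative dd w (dd v f) (x + 0 *\<^sub>R w)) (at 0 within {0..r})"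
    by (auto intro: derivative_eq_intros)
  then have "((\<lambda>t. integral {0..t} (\<lambda>\<tau>. dd v (dd w f) (x + \<tau> *\<^sub>R w))) has_vector_derivative
      dd w (dd v f) (x + 0 *\<^sub>R w)) (at 0 within {0..r})"
    by (rule has_vector_derivative_transform[rotated 2]) (use r G in auto)
  moreover have "at 0 within {0..r} \<noteq> bot" using r by (simp add: at_within_Icc_at_right)
  ultimately show ?thesis
    using vector_derivative_unique_within by fastforce
qed

lemma dir_deriv_move_front:
  assumes "open S" "smooth_on S f" "x \<in> S"
  shows "dir_deriv (us @ v # ws) f x = dir_deriv (v # us @ ws) f x"
  using assms(3)
proof (induction us arbitrary: x)
  case (Cons u us)
  have "dir_deriv ((u # us) @ v # ws) f x = dd u (dir_deriv (v # us @ ws) f) x"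
    using dd_cong[OF assms(1) Cons.prems Cons.IH] by simp
  also have "\<dots> = dd v (dd u (dir_deriv (us @ ws) f)) x"
    using dd_commute[OF assms(1) smooth_on_dir_deriv[OF assms(2)] Cons.prems] by simp
  finally show ?case by simp
qed auto

lemma dir_deriv_permute:
  assumes "open S" "smooth_on S f" "x \<in> S" "mset ws = mset vs"
  shows "dir_deriv ws f x = dir_deriv vs f x"
  using assms(3,4)
proof (induction vs arbitrary: ws x)
  case (Cons v vs)
  then obtain as bs where ws: "ws = as @ v # bs"
    by (metis in_set_conv_decomp list.set_intros(1) mset_eq_setD)
  with Cons.prems have "mset (as @ bs) = mset vs" by auto
  then have "dir_deriv (as @ bs) f y = dir_deriv vs f y" if "y \<in> S" for y
    using Cons.IH[OF that] by blast
  then have "dd v (dir_deriv (as @ bs) f) x = dd v (dir_deriv vs f) x"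
    by (rule dd_cong[OF assms(1) Cons.prems(1)])
  then show ?case using dir_deriv_move_front[OF assms(1,2) Cons.prems(1)] ws by simp
qed auto

text \<open>This makes the classical derivatives of a smooth function eligible as weak derivatives,
  whose definition demands symmetric multilinear values at every point.\<close>

lemma sym_multilinear_dir_deriv:
  assumes "open S" "smooth_on S f" "x \<in> S"
  shows "sym_multilinear j (\<lambda>vs. dir_deriv vs f x)"
  unfolding sym_multilinear_def
proof (intro conjI allI impI; elim conjE)
  fix vs :: "'a list" and i assume i: "length vs = j" "i < j"
  have "dir_deriv (vs[i := v]) f x = dd v (dir_deriv (take i vs @ drop (Suc i) vs) f) x" for v
    using dir_deriv_move_front[OF assms] i by (simp add: upd_conv_take_nth_drop)
  moreover have "linear (\<lambda>v. dd v (dir_deriv (take i vs @ drop (Suc i) vs) f) x)"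
    by (rule linear_dd[OF smooth_on_differentiable[OF smooth_on_dir_deriv[OF assms(2)] assms(3)]])
  ultimately show "linear (\<lambda>v. dir_deriv (vs[i := v]) f x)" by simp
next
  fix vs ws :: "'a list" assume "length vs = j" "mset ws = mset vs"
  then show "dir_deriv ws f x = dir_deriv vs f x" using dir_deriv_permute[OF assms] by blast
qed

section \<open>Bump functions and cutoffs\<close>

text \<open>The power of \<open>inverse t\<close> makes the family closed under differentiation: the
  derivative of a member is a linear combination of two members. Smoothness of all of them then
  follows by one induction.\<close>

definition flat_exp :: "nat \<Rightarrow> real \<Rightarrow> real" where
  "flat_exp k t = (if t > 0 then exp (- inverse t) * inverse t ^ k else 0)"

lemma flat_exp_tendsto_0: "(flat_exp k \<longlongrightarrow> 0) (at 0)"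
proof (rule filterlim_split_at)
  have "((\<lambda>t. inverse t ^ k / exp (inverse t)) \<longlongrightarrow> (0::real)) (at_right 0)"
    by (rule filterlim_compose[OF tendsto_power_div_exp_0 filterlim_inverse_at_top_right])
  moreover have "eventually (\<lambda>t. inverse t ^ k / exp (inverse t) = flat_exp k t) (at_right (0::real))"
    by (rule eventually_mono[OF eventually_at_right_less[of 0]]) (simp add: flat_exp_def exp_minus divide_simps)
  ultimately show "(flat_exp k \<longlongrightarrow> 0) (at_right 0)" by (rule Lim_transform_eventually)
  show "(flat_exp k \<longlongrightarrow> 0) (at_left 0)"
    by (rule Lim_transform_eventually[OF tendsto_const])
       (auto simp: flat_exp_def eventually_at_filter)
qed

lemma flat_exp_derivative:
  "(flat_exp k has_real_derivative (flat_exp (k+2) t - real k * flat_exp (k+1) t)) (at t)"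
proof -
  consider "t > 0" | "t < 0" | "t = 0" by linarith
  then show ?thesis
  proof cases
    case 1
    have "((\<lambda>t. exp (- inverse t) * inverse t ^ k) has_real_derivative
       (flat_exp (k+2) t - real k * flat_exp (k+1) t)) (at t)"
    proof (rule DERIV_cong)
      show "((\<lambda>t. exp (- inverse t) * inverse t ^ k) has_real_derivative
         exp (- inverse t) * (inverse t)\<^sup>2 * inverse t ^ k
         + exp (- inverse t) * (real k * inverse t ^ (k - 1) * - (inverse t)\<^sup>2)) (at t)"
        using 1 by (auto intro!: derivative_eq_intros simp: power2_eq_square)
      have "real k * inverse t ^ (k - 1) * (inverse t)\<^sup>2 = real k * inverse t ^ (k + 1)"
        by (cases k) (simp_all add: power2_eq_square)
      then show "exp (- inverse t) * (inverse t)\<^sup>2 * inverse t ^ k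
         + exp (- inverse t) * (real k * inverse t ^ (k - 1) * - (inverse t)\<^sup>2)
         = flat_exp (k+2) t - real k * flat_exp (k+1) t"
        using 1 by (auto simp: flat_exp_def power2_eq_square algebra_simps)
    qed
    then show ?thesis
      by (rule has_field_derivative_transform_within_open[where S="{0<..}"])
         (use 1 in \<open>auto simp: flat_exp_def\<close>)
  next
    case 2
    have "((\<lambda>t. 0) has_real_derivative (flat_exp (k+2) t - real k * flat_exp (k+1) t)) (at t)"
      using 2 by (auto simp: flat_exp_def)
    then show ?thesis
      by (rule has_field_derivative_transform_within_open[where S="{..<0}"])
         (use 2 in \<open>auto simp: flat_exp_def\<close>)
  next
    case 3
    \<comment> \<open>The difference quotient at 0 is \<open>flat_exp (Suc k)\<close>, which tends
      to 0.\<close>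
    have "((\<lambda>h. (flat_exp k (0 + h) - flat_exp k 0) / h) \<longlongrightarrow> 0) (at 0)"
      by (rule Lim_transform_eventually[OF flat_exp_tendsto_0[of "Suc k"]])
         (auto simp: flat_exp_def eventually_at_filter divide_simps)
    then show ?thesis using 3 by (simp add: DERIV_def flat_exp_def)
  qed
qed

lemma smooth_on_flat_exp: "smooth_on UNIV (flat_exp k)"
proof -
  have der: "(flat_exp k has_derivative (\<lambda>v. v * (flat_exp (k+2) t - real k * flat_exp (k+1) t))) (at t)" for k t
    using flat_exp_derivative[of k t] unfolding has_field_derivative_def
    by (subst (asm) mult_commute_abs[symmetric]) simp
  have dv: "dd v (flat_exp k) = (\<lambda>t. v *\<^sub>R (flat_exp (k+2) t + (- real k) *\<^sub>R flat_exp (k+1) t))" for v k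
    using dd_eqI[OF der] by (auto simp: fun_eq_iff)
  have c: "ndiff_on n UNIV (\<lambda>x::real. c)" for n and c :: real
    using smooth_on_const[of UNIV c] unfolding smooth_on_ndiff by blast
  have df: "flat_exp k differentiable (at t)" for k t
    using der by (rule differentiableI)
  have "ndiff_on n UNIV (flat_exp k)" for n
  proof (induction n arbitrary: k)
    case (Suc n)
    have "ndiff_on n UNIV (dd v (flat_exp k))" for v
      unfolding dv by (intro ndiff_on_scaleR ndiff_on_add Suc c open_UNIV)
    then show ?case using df by simp
  qed (use df in simp)
  then show ?thesis by (simp add: smooth_on_ndiff)
qed

lemma flat_exp_0: "flat_exp 0 t = (if t > 0 then exp (- inverse t) else 0)"
  by (simp add: flat_exp_def)

definition bump :: "'e::euclidean_space \<Rightarrow> real" where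
  "bump x = flat_exp 0 (1 - x \<bullet> x)"

lemma smooth_on_inner_self: "smooth_on UNIV (\<lambda>x::'e::euclidean_space. x \<bullet> x)"
proof -
  have "smooth_on UNIV (\<lambda>x::'e. \<Sum>b\<in>Basis. (x \<bullet> b) * (x \<bullet> b))"
    by (intro smooth_on_sum smooth_on_mult open_UNIV
        smooth_on_bounded_linear[OF _ bounded_linear_inner_left]) auto
  moreover have "(\<lambda>x::'e. \<Sum>b\<in>Basis. (x \<bullet> b) * (x \<bullet> b)) = (\<lambda>x. x \<bullet> x)"
    by (simp add: fun_eq_iff euclidean_inner[symmetric])
  ultimately show ?thesis by simp
qed

lemma smooth_on_bump: "smooth_on UNIV (bump :: 'e::euclidean_space \<Rightarrow> real)"
proof -
  have "smooth_on UNIV (\<lambda>x::'e. flat_exp 0 (1 - x \<bullet> x))"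
    by (rule smooth_on_compose[OF open_UNIV open_UNIV _ smooth_on_flat_exp])
       (auto intro!: smooth_on_diff smooth_on_inner_self)
  then show ?thesis by (simp add: bump_def[abs_def])
qed

lemma bump_nonneg: "bump x \<ge> 0"
  and bump_pos_iff: "bump x > 0 \<longleftrightarrow> norm x < 1"
  and bump_eq_0: "norm x \<ge> 1 \<Longrightarrow> bump x = 0"
proof -
  have "x \<bullet> x < 1 \<longleftrightarrow> norm x < 1"
    by (metis dot_square_norm abs_norm_cancel abs_square_less_1)
  then show "bump x \<ge> 0" "bump x > 0 \<longleftrightarrow> norm x < 1" "norm x \<ge> 1 \<Longrightarrow> bump x = 0"
    by (auto simp: bump_def flat_exp_0)
qed

lemma smooth_on_affine: "smooth_on UNIV (\<lambda>x. c *\<^sub>R x + a)"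
  by (intro smooth_on_add open_UNIV smooth_on_bounded_linear[OF _ bounded_linear_scaleR_right]) auto

lemma smooth_on_bump_affine: "smooth_on UNIV (\<lambda>x. bump (c *\<^sub>R x + a))"
  by (rule smooth_on_compose[OF open_UNIV open_UNIV smooth_on_affine smooth_on_bump]) auto

text \<open>The quotient of \<open>flat_exp 0 t\<close> by
  \<open>flat_exp 0 t + flat_exp 0 (1 - t)\<close>. The denominator is positive because
  \<open>t\<close> and \<open>1 - t\<close> are never both nonpositive.\<close>

lemma smooth_step: "\<exists>s::real \<Rightarrow> real. smooth_on UNIV s \<and> (\<forall>t\<le>0. s t = 0) \<and> (\<forall>t\<ge>1. s t = 1) \<and>
    (\<forall>t. 0 \<le> s t \<and> s t \<le> 1)"
proof -
  define d where "d = (\<lambda>t. flat_exp 0 t + flat_exp 0 (1 - t))"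
  have sm: "smooth_on UNIV (\<lambda>t. flat_exp 0 (1 - t))"
    by (rule smooth_on_compose[OF open_UNIV open_UNIV _ smooth_on_flat_exp]) (auto intro!: smooth_on_diff)
  have sd: "smooth_on UNIV d" unfolding d_def
    by (intro smooth_on_add smooth_on_flat_exp sm open_UNIV)
  have pos: "d t > 0" for t
    by (auto simp: d_def flat_exp_0 add_pos_pos)
  then have nz: "d t \<noteq> 0" for t by (metis less_irrefl)
  have "smooth_on UNIV (\<lambda>t. inverse (d t))"
    by (rule smooth_on_compose[OF open_UNIV _ sd smooth_on_inverse])
       (use nz in \<open>auto simp: open_Collect_neq\<close>)
  then have "smooth_on UNIV (\<lambda>t. flat_exp 0 t * inverse (d t))"
    by (intro smooth_on_mult open_UNIV smooth_on_flat_exp)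
  moreover have "0 \<le> flat_exp 0 t * inverse (d t)" "flat_exp 0 t * inverse (d t) \<le> 1" for t
  proof -
    have "0 \<le> flat_exp 0 t" "flat_exp 0 t \<le> d t" by (auto simp: d_def flat_exp_0)
    then show "0 \<le> flat_exp 0 t * inverse (d t)" "flat_exp 0 t * inverse (d t) \<le> 1"
      using pos[of t] by (auto simp: divide_inverse[symmetric])
  qed
  ultimately show ?thesis
    by (intro exI[of _ "\<lambda>t. flat_exp 0 t * inverse (d t)"] conjI) (auto simp: d_def flat_exp_0)
qed

text \<open>A finite sum of bumps is bounded away from 0 on \<open>C\<close>; composing a multiple
  of it with the smooth step flattens it to 1 there. The value 1 on an open set around
  \<open>C\<close> lets \<open>1 - h\<close> serve as a cutoff that vanishes near
  \<open>C\<close>.\<close>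

lemma smooth_cutoff:
  fixes C W :: "'e::euclidean_space set"
  assumes "compact C" "open W" "C \<subseteq> W"
  obtains h :: "'e \<Rightarrow> real" and L V where "smooth_on UNIV h" "compact L" "L \<subseteq> W"
    "\<And>x. x \<notin> L \<Longrightarrow> h x = 0" "open V" "C \<subseteq> V" "\<And>x. x \<in> V \<Longrightarrow> h x = 1" "\<And>x. 0 \<le> h x \<and> h x \<le> 1"
proof (cases "C = {}")
  case True
  then show thesis using that[of "\<lambda>_. 0" "{}" "{}"] by auto
next
  case False
  obtain e where e: "e > 0" "(\<Union>x\<in>C. cball x e) \<subseteq> W"
  proof -
    obtain e where "e > 0" "{x. infdist x C \<le> e} \<subseteq> W"
      using compact_in_open_separated[OF False assms] by blast
    moreover have "cball x e \<subseteq> {x. infdist x C \<le> e}" if "x \<in> C" for x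
      using that by (auto simp: dist_commute intro: infdist_le2)
    ultimately show thesis using that by blast
  qed
  have "C \<subseteq> (\<Union>x\<in>C. ball x e)" using e by auto
  then obtain D where D: "D \<subseteq> C" "finite D" "C \<subseteq> (\<Union>x\<in>D. ball x e)"
    using compactE_image[OF assms(1), of C "\<lambda>x. ball x e"] by auto
  define \<sigma> where "\<sigma> = (\<lambda>x. \<Sum>a\<in>D. bump ((1/e) *\<^sub>R x + (- (1/e) *\<^sub>R a)))"
  have n: "norm ((1/e) *\<^sub>R x + (- (1/e) *\<^sub>R a)) = dist a x / e" for x a :: 'e
  proof -
    have "(1/e) *\<^sub>R x + (- (1/e) *\<^sub>R a) = (1/e) *\<^sub>R (x - a)" by (simp add: algebra_simps)
    then show ?thesis using e by (simp add: dist_norm norm_minus_commute)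
  qed
  have n': "norm ((1/e) *\<^sub>R x - (1/e) *\<^sub>R a) = dist a x / e" for x a :: 'e
    using n[of x a] by simp
  have sm: "smooth_on UNIV \<sigma>"
    unfolding \<sigma>_def by (intro smooth_on_sum smooth_on_bump_affine open_UNIV)
  have pos: "\<sigma> x > 0" if "x \<in> C" for x
  proof -
    have "x \<in> (\<Union>a\<in>D. ball a e)" using D(3) that by blast
    then obtain a where "a \<in> D" "dist a x < e" by auto
    then show ?thesis unfolding \<sigma>_def using D e
      by (intro sum_pos2[where i=a]) (auto simp: bump_pos_iff bump_nonneg n')
  qed
  have zero: "\<sigma> x = 0" if "x \<notin> (\<Union>a\<in>D. cball a e)" for x
    unfolding \<sigma>_def using that e by (intro sum.neutral) (auto intro!: bump_eq_0 simp: n')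
  have cont: "continuous_on UNIV \<sigma>" using sm by (rule smooth_on_continuous)
  obtain x0 where x0: "x0 \<in> C" "\<And>x. x \<in> C \<Longrightarrow> \<sigma> x0 \<le> \<sigma> x"
    using continuous_attains_inf[OF assms(1) False continuous_on_subset[OF cont]] by auto
  obtain s :: "real \<Rightarrow> real" where s: "smooth_on UNIV s" "\<And>t. t \<le> 0 \<Longrightarrow> s t = 0" "\<And>t. t \<ge> 1 \<Longrightarrow> s t = 1" "\<And>t. 0 \<le> s t \<and> s t \<le> 1"
    using smooth_step by blast
  \<comment> \<open>Scaled so that \<open>c * \<sigma>\<close> is at least 1 wherever
    \<open>\<sigma>\<close> exceeds half of its minimum on \<open>C\<close>. This open superlevel
    set is the \<open>V\<close> of the conclusion.\<close>
  define c where "c = 2 / \<sigma> x0"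
  have c: "c > 0" using pos x0 by (simp add: c_def)
  have "smooth_on UNIV (\<lambda>x. s (c *\<^sub>R \<sigma> x))"
    by (rule smooth_on_compose[OF open_UNIV open_UNIV _ s(1)])
       (auto intro!: smooth_on_mult sm)
  moreover have "compact (\<Union>a\<in>D. cball a e)" using D by auto
  moreover have "(\<Union>a\<in>D. cball a e) \<subseteq> W" using e D by blast
  moreover have "s (c *\<^sub>R \<sigma> x) = 0" if "x \<notin> (\<Union>a\<in>D. cball a e)" for x
    using zero[OF that] s by simp
  moreover have "open {x. \<sigma> x > \<sigma> x0 / 2}"
    by (rule open_Collect_less[OF _ cont]) auto
  moreover have "C \<subseteq> {x. \<sigma> x > \<sigma> x0 / 2}"
  proof safe
    fix x assume "x \<in> C"
    then show "\<sigma> x0 / 2 < \<sigma> x" using x0(2)[of x] pos[OF x0(1)] by simp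
  qed
  moreover have "s (c *\<^sub>R \<sigma> x) = 1" if "x \<in> {x. \<sigma> x > \<sigma> x0 / 2}" for x
  proof (rule s(3))
    have "1 = c * (\<sigma> x0 / 2)" using pos[OF x0(1)] by (simp add: c_def)
    also have "\<dots> \<le> c * \<sigma> x" using that c by (intro mult_left_mono) auto
    finally show "1 \<le> c *\<^sub>R \<sigma> x" by simp
  qed
  ultimately show thesis using that[of "\<lambda>x. s (c *\<^sub>R \<sigma> x)" "\<Union>a\<in>D. cball a e" "{x. \<sigma> x > \<sigma> x0 / 2}"] s(4)
    by blast
qed

section \<open>Test functions\<close>

lemma test_functionI:
  "smooth_on UNIV \<eta> \<Longrightarrow> compact K \<Longrightarrow> K \<subseteq> G \<Longrightarrow> (\<And>x. x \<notin> K \<Longrightarrow> \<eta> x = 0) \<Longrightarrow> test_function G \<eta>"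
  unfolding test_function_def by blast

lemma test_function_mono: "test_function G \<eta> \<Longrightarrow> G \<subseteq> G' \<Longrightarrow> test_function G' \<eta>"
  unfolding test_function_def by blast

lemma dir_deriv_eq_0_outside:
  assumes "closed K" "\<And>x. x \<notin> K \<Longrightarrow> \<eta> x = 0" "x \<notin> K"
  shows "dir_deriv vs \<eta> x = 0"
proof -
  have "dir_deriv vs \<eta> x = dir_deriv vs (\<lambda>_. 0) x"
    by (rule dir_deriv_cong[of "- K"]) (use assms in auto)
  also have "dir_deriv vs (\<lambda>_. 0) = (\<lambda>_. 0)"
    by (induction vs) auto
  finally show ?thesis .
qed

lemma test_function_dir_deriv:
  assumes "test_function G \<eta>"
  shows "test_function G (dir_deriv vs \<eta>)"
proof -
  obtain K where K: "smooth_on UNIV \<eta>" "compact K" "K \<subseteq> G" "\<And>x. x \<notin> K \<Longrightarrow> \<eta> x = 0"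
    using assms unfolding test_function_def by blast
  show ?thesis
    by (rule test_functionI[OF smooth_on_dir_deriv[OF K(1)] K(2,3)],
        rule dir_deriv_eq_0_outside[OF compact_imp_closed[OF K(2)] K(4)])
qed

lemma test_function_bounded:
  assumes "test_function G \<eta>"
  obtains B where "B > 0" "\<And>x. \<bar>\<eta> x\<bar> \<le> B"
proof -
  obtain K where K: "smooth_on UNIV \<eta>" "compact K" "K \<subseteq> G" "\<And>x. x \<notin> K \<Longrightarrow> \<eta> x = 0"
    using assms(1) unfolding test_function_def by blast
  have "compact (\<eta> ` K)"
    using K(1,2) smooth_on_continuous continuous_on_subset compact_continuous_image by blast
  then obtain B where B: "B > 0" "\<And>y. y \<in> \<eta> ` K \<Longrightarrow> norm y \<le> B"
    using bounded_pos compact_imp_bounded by metis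
  then have "\<bar>\<eta> x\<bar> \<le> B" for x using K(4)[of x] B by (cases "x \<in> K") auto
  then show thesis using B that by blast
qed

lemma test_function_measurable [measurable]:
  assumes "test_function G \<eta>"
  shows "\<eta> \<in> borel_measurable borel"
  using assms borel_measurable_continuous_onI smooth_on_continuous unfolding test_function_def by blast

lemma dd_reflect:
  assumes "f differentiable (at (x - y))"
  shows "dd v (\<lambda>y. f (x - y)) y = - dd v f (x - y)"
proof -
  have "((\<lambda>y. x - y) has_derivative (\<lambda>h. - h)) (at y)"
    by (auto intro!: derivative_eq_intros)
  from has_derivative_compose[OF this has_derivative_dd[OF assms]]
  have "dd v (\<lambda>y. f (x - y)) y = dd (- v) f (x - y)" by (rule dd_eqI)
  then show ?thesis using linear_neg[OF linear_dd[OF assms]] by simp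
qed

text \<open>Test functions of the form \<open>y\<close> to \<open>mollifier n (x - y)\<close> turn
  pairings into mollifications. The sign found here cancels the one in the definition of weak
  derivatives.\<close>

lemma dir_deriv_reflect:
  assumes "smooth_on UNIV f"
  shows "dir_deriv vs (\<lambda>y. f (x - y)) = (\<lambda>y. (-1) ^ length vs *\<^sub>R dir_deriv vs f (x - y))"
proof (induction vs)
  case (Cons v vs)
  have d: "dir_deriv vs f differentiable (at z)" for z
    using smooth_on_dir_deriv[OF assms] smooth_on_differentiable by blast
  then have d': "(\<lambda>y. dir_deriv vs f (x - y)) differentiable (at y)" for y
    by (intro differentiable_compose_at[of "\<lambda>y. x - y" y "dir_deriv vs f"] derivative_intros) auto
  have "dd v (\<lambda>y. (-1) ^ length vs *\<^sub>R dir_deriv vs f (x - y)) y = (-1) ^ length vs *\<^sub>R dd v (\<lambda>y. dir_deriv vs f (x - y)) y" for y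
    by (rule dd_bounded_linear[OF bounded_linear_scaleR_right d'])
  also have "\<dots> y = (-1) ^ length (v # vs) *\<^sub>R dir_deriv (v # vs) f (x - y)" for y
    using dd_reflect[OF d] by simp
  finally show ?case unfolding dir_deriv_Cons Cons.IH by (auto simp: fun_eq_iff)
qed simp

lemma smooth_on_reflect:
  assumes "smooth_on UNIV f"
  shows "smooth_on UNIV (\<lambda>y. f (x - y))"
  by (rule smooth_on_compose[OF open_UNIV open_UNIV _ assms]) (auto intro!: smooth_on_diff)

section \<open>Mollifiers\<close>

definition mollifier :: "nat \<Rightarrow> 'e::euclidean_space \<Rightarrow> real" where
  "mollifier n x = bump (real (Suc n) *\<^sub>R x) / (LINT y|lborel. bump (real (Suc n) *\<^sub>R (y::'e)))"

lemma smooth_compact_support_integrable: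
  fixes f :: "'e::euclidean_space \<Rightarrow> 'f::euclidean_space"
  assumes "continuous_on UNIV f" "compact K" "\<And>x. x \<notin> K \<Longrightarrow> f x = 0"
  shows "integrable lborel f"
proof -
  have "integrable lborel (\<lambda>x. indicator K x *\<^sub>R f x)"
    using borel_integrable_compact[OF assms(2) continuous_on_subset[OF assms(1)]] by auto
  moreover have "(\<lambda>x. indicator K x *\<^sub>R f x) = f"
    using assms(3) by (auto simp: fun_eq_iff indicator_def)
  ultimately show ?thesis by simp
qed

lemma smooth_on_bump_scale: "smooth_on UNIV (\<lambda>x. bump (c *\<^sub>R x))"
  using smooth_on_bump_affine[of c 0] by simp

lemma bump_scale_integrable: "integrable lborel (\<lambda>x::'e::euclidean_space. bump (real (Suc n) *\<^sub>R x))"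
proof (rule smooth_compact_support_integrable)
  show "continuous_on UNIV (\<lambda>x::'e. bump (real (Suc n) *\<^sub>R x))"
    by (rule smooth_on_continuous[OF smooth_on_bump_scale])
  show "compact (cball (0::'e) (1 / real (Suc n)))" by simp
  fix x :: 'e assume "x \<notin> cball 0 (1 / real (Suc n))"
  then show "bump (real (Suc n) *\<^sub>R x) = 0"
    by (intro bump_eq_0) (auto simp: field_simps simp del: of_nat_Suc)
qed

lemma bump_scale_integral_pos: "(LINT y|lborel. bump (real (Suc n) *\<^sub>R (y::'e::euclidean_space))) > 0"
proof -
  define f where "f = (\<lambda>y::'e. bump (real (Suc n) *\<^sub>R y))"
  have int: "integrable lborel f" unfolding f_def by (rule bump_scale_integrable)
  have nn: "f y \<ge> 0" for y by (simp add: f_def bump_nonneg)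
  have "integral\<^sup>L lborel f \<noteq> 0"
  proof
    assume "integral\<^sup>L lborel f = 0"
    then have "AE y in lborel. f y = 0"
      using integral_nonneg_eq_0_iff_AE[OF int] nn by auto
    moreover have "f y > 0" if "y \<in> ball 0 (1 / real (Suc n))" for y
      using that by (auto simp: f_def bump_pos_iff field_simps simp del: of_nat_Suc)
    ultimately have "AE y in lborel. y \<notin> ball (0::'e) (1 / real (Suc n))"
      by (auto elim!: AE_mp simp: less_le)
    then have "emeasure lborel (ball (0::'e) (1 / real (Suc n))) = 0"
      by (subst (asm) AE_iff_measurable[OF _ refl]) (auto simp: ball_def)
    then show False using content_ball_pos[of "1 / real (Suc n)" "0::'e"]
      by (simp add: measure_def)
  qed
  moreover have "integral\<^sup>L lborel f \<ge> 0" using nn by (intro integral_nonneg_AE) auto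
  ultimately show ?thesis unfolding f_def by simp
qed

lemma smooth_on_mollifier: "smooth_on UNIV (mollifier n :: 'e::euclidean_space \<Rightarrow> real)"
proof -
  have "smooth_on UNIV (\<lambda>x::'e. bump (real (Suc n) *\<^sub>R x) * inverse (LINT y|lborel. bump (real (Suc n) *\<^sub>R (y::'e))))"
    by (intro smooth_on_bounded_linear[OF _ bounded_linear_mult_left] open_UNIV smooth_on_bump_scale)
  then show ?thesis by (simp add: mollifier_def[abs_def] divide_inverse)
qed

lemma mollifier_nonneg: "mollifier n x \<ge> 0"
  unfolding mollifier_def by (intro divide_nonneg_pos bump_scale_integral_pos bump_nonneg)

lemma mollifier_eq_0: "norm x \<ge> 1 / real (Suc n) \<Longrightarrow> mollifier n x = 0"
  unfolding mollifier_def by (subst bump_eq_0) (auto simp: field_simps simp del: of_nat_Suc)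

lemma mollifier_integrable: "integrable lborel (mollifier n)"
  unfolding mollifier_def[abs_def] by (intro integrable_divide_zero) (auto intro: bump_scale_integrable simp del: of_nat_Suc)

lemma mollifier_integral: "integral\<^sup>L lborel (mollifier n :: 'e::euclidean_space \<Rightarrow> real) = 1"
  using bump_scale_integral_pos[where 'e='e, of n] by (simp add: mollifier_def[abs_def] del: of_nat_Suc)

lemma mollifier_measurable [measurable]: "mollifier n \<in> borel_measurable borel"
  using borel_measurable_continuous_onI smooth_on_continuous smooth_on_mollifier by blast

lemma test_function_mollifier:
  assumes "cball x (1 / real (Suc n)) \<subseteq> G"
  shows "test_function G (\<lambda>y. mollifier n (x - y))"
  by (rule test_functionI[OF smooth_on_reflect[OF smooth_on_mollifier] compact_cball assms])
     (auto simp: dist_norm intro!: mollifier_eq_0)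

lemma lborel_reflect: "distr lborel borel (\<lambda>y. x - y) = (lborel :: 'e::euclidean_space measure)"
proof -
  show ?thesis using lborel_affine[of "-1" x] by (simp add: density_1)
qed

lemma nn_integral_reflect:
  fixes f :: "'e::euclidean_space \<Rightarrow> ennreal"
  assumes [measurable]: "f \<in> borel_measurable borel"
  shows "(\<integral>\<^sup>+y. f (x - y) \<partial>lborel) = (\<integral>\<^sup>+y. f y \<partial>lborel)"
  using nn_integral_distr[of "\<lambda>y. x - y" lborel borel f] by (simp add: lborel_reflect)

lemma integral_reflect:
  fixes f :: "'e::euclidean_space \<Rightarrow> 'f::euclidean_space"
  assumes [measurable]: "f \<in> borel_measurable borel"
  shows "(LINT y|lborel. f (x - y)) = integral\<^sup>L lborel f"
    and "integrable lborel (\<lambda>y. f (x - y)) \<longleftrightarrow> integrable lborel f"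
  using integral_distr[of "\<lambda>y. x - y" lborel borel f]
    integrable_distr_eq[of "\<lambda>y. x - y" lborel borel f] by (simp_all add: lborel_reflect)

lemma nn_integral_translate:
  fixes f :: "'e::euclidean_space \<Rightarrow> ennreal"
  assumes [measurable]: "f \<in> borel_measurable borel"
  shows "(\<integral>\<^sup>+x. f (x - y) \<partial>lborel) = (\<integral>\<^sup>+x. f x \<partial>lborel)"
proof -
  have "(\<integral>\<^sup>+x. f (x - y) \<partial>lborel) = (\<integral>\<^sup>+x. f (- (y - x)) \<partial>lborel)" by simp
  also have "\<dots> = (\<integral>\<^sup>+x. f (0 - x) \<partial>lborel)"
    by (subst nn_integral_reflect[of "\<lambda>x. f (- x)"]) auto
  also have "\<dots> = (\<integral>\<^sup>+x. f x \<partial>lborel)" by (rule nn_integral_reflect) auto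
  finally show ?thesis .
qed

section \<open>Density of continuous functions and convergence of mollifications\<close>

definition continuous_approx :: "('e::euclidean_space \<Rightarrow> 'f::euclidean_space) \<Rightarrow> bool" where
  "continuous_approx h \<longleftrightarrow> (\<forall>e>0. \<exists>g K. continuous_on UNIV g \<and> compact K \<and> (\<forall>x. x \<notin> K \<longrightarrow> g x = 0) \<and>
     (\<integral>\<^sup>+x. norm (h x - g x) \<partial>lborel) < ennreal e)"

lemma borel_measurable_continuous_UNIV: "continuous_on UNIV g \<Longrightarrow> g \<in> borel_measurable borel"
  by (rule borel_measurable_continuous_onI)

lemma nn_integral_norm_triangle:
  fixes f g h :: "'e::euclidean_space \<Rightarrow> 'f::euclidean_space"
  assumes [measurable]: "f \<in> borel_measurable borel" "g \<in> borel_measurable borel" "h \<in> borel_measurable borel"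
  shows "(\<integral>\<^sup>+x. norm (f x - h x) \<partial>lborel) \<le> (\<integral>\<^sup>+x. norm (f x - g x) \<partial>lborel) + (\<integral>\<^sup>+x. norm (g x - h x) \<partial>lborel)"
proof -
  have "(\<integral>\<^sup>+x. norm (f x - h x) \<partial>lborel) \<le> (\<integral>\<^sup>+x. ennreal (norm (f x - g x)) + ennreal (norm (g x - h x)) \<partial>lborel)"
  proof (intro nn_integral_mono)
    fix x
    show "ennreal (norm (f x - h x)) \<le> ennreal (norm (f x - g x)) + ennreal (norm (g x - h x))"
      using norm_triangle_ineq[of "f x - g x" "g x - h x"] by (simp flip: ennreal_plus add: ennreal_leI)
  qed
  also have "\<dots> = (\<integral>\<^sup>+x. norm (f x - g x) \<partial>lborel) + (\<integral>\<^sup>+x. norm (g x - h x) \<partial>lborel)"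
    by (intro nn_integral_add) auto
  finally show ?thesis .
qed

lemma continuous_approx_add:
  assumes "continuous_approx f" "continuous_approx g"
    and [measurable]: "f \<in> borel_measurable borel" "g \<in> borel_measurable borel"
  shows "continuous_approx (\<lambda>x. f x + g x)"
  unfolding continuous_approx_def
proof (intro allI impI)
  fix e :: real assume "e > 0"
  then have "e/2 > 0" by simp
  obtain f' K where f': "continuous_on UNIV f'" "compact K" "\<forall>x. x \<notin> K \<longrightarrow> f' x = 0"
     "(\<integral>\<^sup>+x. norm (f x - f' x) \<partial>lborel) < ennreal (e/2)"
    using assms(1) \<open>e/2 > 0\<close> unfolding continuous_approx_def by meson
  obtain g' L where g': "continuous_on UNIV g'" "compact L" "\<forall>x. x \<notin> L \<longrightarrow> g' x = 0"
     "(\<integral>\<^sup>+x. norm (g x - g' x) \<partial>lborel) < ennreal (e/2)"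
    using assms(2) \<open>e/2 > 0\<close> unfolding continuous_approx_def by meson
  note [measurable] = borel_measurable_continuous_UNIV[OF f'(1)] borel_measurable_continuous_UNIV[OF g'(1)]
  have "(\<integral>\<^sup>+x. norm (f x + g x - (f' x + g' x)) \<partial>lborel) \<le>
    (\<integral>\<^sup>+x. ennreal (norm (f x - f' x)) + ennreal (norm (g x - g' x)) \<partial>lborel)"
    by (intro nn_integral_mono) (simp flip: ennreal_plus add: norm_diff_triangle_ineq ennreal_leI)
  also have "\<dots> = (\<integral>\<^sup>+x. norm (f x - f' x) \<partial>lborel) + (\<integral>\<^sup>+x. norm (g x - g' x) \<partial>lborel)"
    by (intro nn_integral_add) auto
  also have "\<dots> < ennreal (e/2) + ennreal (e/2)"
    by (rule add_strict_mono[OF f'(4) g'(4)])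
  also have "\<dots> = ennreal e" using \<open>e > 0\<close> by (simp flip: ennreal_plus)
  finally show "\<exists>h K. continuous_on UNIV h \<and> compact K \<and> (\<forall>x. x \<notin> K \<longrightarrow> h x = 0) \<and>
     (\<integral>\<^sup>+x. norm (f x + g x - h x) \<partial>lborel) < ennreal e"
    using f' g' by (intro exI[of _ "\<lambda>x. f' x + g' x"] exI[of _ "K \<union> L"]) (auto intro!: continuous_intros)
qed

text \<open>The bound \<open>2 * norm (f x)\<close> is the one supplied by the limit case of
  \<open>integrable_induct\<close>; it serves as dominating function.\<close>

lemma continuous_approx_lim:
  fixes f :: "'e::euclidean_space \<Rightarrow> 'f::euclidean_space"
  assumes s: "\<And>i::nat. s i \<in> borel_measurable borel" "\<And>i. continuous_approx (s i)"
    and lim: "\<And>x. (\<lambda>i. s i x) \<longlonglongrightarrow> f x"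
    and bound: "\<And>i x. norm (s i x) \<le> 2 * norm (f x)" and f: "integrable lborel f"
  shows "continuous_approx f"
  unfolding continuous_approx_def
proof (intro allI impI)
  fix e :: real assume "e > 0"
  then have "e/2 > 0" by simp
  have [measurable]: "f \<in> borel_measurable borel" using f by auto
  note [measurable] = s(1)
  have "(\<lambda>i. \<integral>\<^sup>+x. norm (f x - s i x) \<partial>lborel) \<longlonglongrightarrow> 0"
  proof (rule nn_integral_dominated_convergence_norm[where w="\<lambda>x. 2 * norm (f x)"])
    show "(\<integral>\<^sup>+x. ennreal (2 * norm (f x)) \<partial>lborel) < \<infinity>"
      using integrable_mult_right[OF integrable_norm[OF f], of 2]
      by (subst nn_integral_eq_integral) auto
  qed (use lim bound in auto)
  then have "eventually (\<lambda>i. (\<integral>\<^sup>+x. norm (f x - s i x) \<partial>lborel) < ennreal (e/2)) sequentially"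
    using \<open>e/2 > 0\<close> by (intro order_tendstoD) auto
  then obtain i where i: "(\<integral>\<^sup>+x. norm (f x - s i x) \<partial>lborel) < ennreal (e/2)"
    by (auto simp: eventually_sequentially)
  obtain g K where g: "continuous_on UNIV g" "compact K" "\<forall>x. x \<notin> K \<longrightarrow> g x = 0"
     "(\<integral>\<^sup>+x. norm (s i x - g x) \<partial>lborel) < ennreal (e/2)"
    using s(2)[of i] \<open>e/2 > 0\<close> unfolding continuous_approx_def by meson
  note [measurable] = borel_measurable_continuous_UNIV[OF g(1)]
  have "(\<integral>\<^sup>+x. norm (f x - g x) \<partial>lborel) \<le> (\<integral>\<^sup>+x. norm (f x - s i x) \<partial>lborel) + (\<integral>\<^sup>+x. norm (s i x - g x) \<partial>lborel)"
    by (rule nn_integral_norm_triangle) auto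
  also have "\<dots> < ennreal (e/2) + ennreal (e/2)"
    by (rule add_strict_mono[OF i g(4)])
  also have "\<dots> = ennreal e" using \<open>e > 0\<close> by (simp flip: ennreal_plus)
  finally show "\<exists>g K. continuous_on UNIV g \<and> compact K \<and> (\<forall>x. x \<notin> K \<longrightarrow> g x = 0) \<and>
     (\<integral>\<^sup>+x. norm (f x - g x) \<partial>lborel) < ennreal e" using g by blast
qed

text \<open>Regularity of Lebesgue measure squeezes \<open>A\<close> between a closed and an open
  set, and a cutoff between these two approximates the indicator. Boundedness of \<open>A\<close>
  makes the inner set compact, as the cutoff requires.\<close>

lemma continuous_approx_indicator_bounded:
  fixes A :: "'e::euclidean_space set" and c :: "'f::euclidean_space"
  assumes "A \<in> sets borel" "bounded A"
  shows "continuous_approx (\<lambda>x. indicator A x *\<^sub>R c)"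
  unfolding continuous_approx_def
proof (intro allI impI)
  fix e :: real assume e: "e > 0"
  \<comment> \<open>The factor 2 accounts for the inner and the outer error; adding 1 to the norm
    covers \<open>c = 0\<close>.\<close>
  define d where "d = e / (2 * (norm c + 1))"
  have d: "d > 0" using e by (auto simp: d_def intro!: divide_pos_pos add_nonneg_pos mult_pos_pos)
  have Al: "A \<in> sets lebesgue" using assms by auto
  obtain T where T: "closed T" "T \<subseteq> A" "emeasure lebesgue (A - T) < ennreal d"
    using sets_lebesgue_inner_closed[OF Al d] by metis
  have T': "compact T" using T assms(2) bounded_subset compact_eq_bounded_closed by blast
  obtain U where U: "open U" "A \<subseteq> U" "emeasure lebesgue (U - A) < ennreal d"
    using sets_lebesgue_outer_open[OF Al d] by metis
  obtain h :: "'e \<Rightarrow> real" and L V where h: "smooth_on UNIV h" "compact L" "L \<subseteq> U"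
    "\<And>x. x \<notin> L \<Longrightarrow> h x = 0" "open V" "T \<subseteq> V" "\<And>x. x \<in> V \<Longrightarrow> h x = 1" "\<And>x. 0 \<le> h x \<and> h x \<le> 1"
    using smooth_cutoff[OF T' U(1) order_trans[OF T(2) U(2)]] by blast
  have cont: "continuous_on UNIV h" using h(1) by (rule smooth_on_continuous)
  have em: "emeasure lborel (A - T) < ennreal d" "emeasure lborel (U - A) < ennreal d"
    using T U assms by (auto simp: closed_def borel_open)
  have [measurable]: "A - T \<in> sets borel" "U - A \<in> sets borel" using T U assms by auto
  have le: "norm (indicator A x *\<^sub>R c - h x *\<^sub>R c) \<le> norm c * indicator (A - T) x + norm c * indicator (U - A) x" for x
  proof (cases "x \<in> T \<or> x \<notin> U")
    case True
    then have "indicator A x = h x" using T U h by (auto simp: indicator_def subset_iff)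
    then show ?thesis by simp
  next
    case False
    have "norm (indicator A x *\<^sub>R c - h x *\<^sub>R c) = \<bar>indicator A x - h x\<bar> * norm c"
      by (simp flip: scaleR_left_diff_distrib)
    also have "\<dots> \<le> 1 * norm c"
      using h(8)[of x] by (intro mult_right_mono) (auto simp: indicator_def)
    also have "\<dots> \<le> norm c * indicator (A - T) x + norm c * indicator (U - A) x"
      using False by (auto simp: indicator_def)
    finally show ?thesis .
  qed
  have "(\<integral>\<^sup>+x. norm (indicator A x *\<^sub>R c - h x *\<^sub>R c) \<partial>lborel) \<le>
     (\<integral>\<^sup>+x. ennreal (norm c) * indicator (A - T) x + ennreal (norm c) * indicator (U - A) x \<partial>lborel)"
    by (intro nn_integral_mono order_trans[OF ennreal_leI[OF le]]) (auto simp: indicator_def)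
  also have "\<dots> = ennreal (norm c) * emeasure lborel (A - T) + ennreal (norm c) * emeasure lborel (U - A)"
    by (subst nn_integral_add) (auto simp: nn_integral_cmult)
  also have "\<dots> \<le> ennreal (norm c) * ennreal d + ennreal (norm c) * ennreal d"
    using em by (intro add_mono mult_left_mono) auto
  also have "\<dots> = ennreal (2 * norm c * d)"
    using d by (simp flip: ennreal_plus ennreal_mult)
  also have "\<dots> < ennreal e"
  proof (rule ennreal_lessI[OF e])
    have "2 * norm c * d < 2 * (norm c + 1) * d" using d by simp
    also have "\<dots> = e"
    proof -
      have "norm c + 1 > 0" by (simp add: add_nonneg_pos)
      then show ?thesis by (simp add: d_def)
    qed
    finally show "2 * norm c * d < e" .
  qed
  finally have "(\<integral>\<^sup>+x. norm (indicator A x *\<^sub>R c - h x *\<^sub>R c) \<partial>lborel) < ennreal e" .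
  moreover have "continuous_on UNIV (\<lambda>x. h x *\<^sub>R c)" using cont by (intro continuous_intros)
  ultimately show "\<exists>g K. continuous_on UNIV g \<and> compact K \<and> (\<forall>x. x \<notin> K \<longrightarrow> g x = 0) \<and>
     (\<integral>\<^sup>+x. norm (indicator A x *\<^sub>R c - g x) \<partial>lborel) < ennreal e"
    using h by (intro exI[of _ "\<lambda>x. h x *\<^sub>R c"] exI[of _ L]) auto
qed

lemma continuous_approx_integrable:
  assumes "integrable lborel h"
  shows "continuous_approx h"
  using assms
proof (induction h rule: integrable_induct)
  case (base A c)
  then have A[measurable]: "A \<in> sets borel" by simp
  have int: "integrable lborel (\<lambda>x. indicator A x *\<^sub>R c)" using base by (intro integrable_scaleR_left) auto
  \<comment> \<open>Sets of finite measure are first cut down to balls, since indicators are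
    approximated for bounded sets.\<close>
  show ?case
  proof (rule continuous_approx_lim[of "\<lambda>i x. indicator (A \<inter> cball 0 (real i)) x *\<^sub>R c", OF _ _ _ _ int])
    show "continuous_approx (\<lambda>x. indicator (A \<inter> cball 0 (real i)) x *\<^sub>R c)" for i
      by (rule continuous_approx_indicator_bounded) (auto intro: bounded_subset[OF bounded_cball])
    show "(\<lambda>x. indicator (A \<inter> cball 0 (real i)) x *\<^sub>R c) \<in> borel_measurable borel" for i
      by (intro borel_measurable_scaleR borel_measurable_const borel_measurable_indicator) auto
    show "(\<lambda>i. indicator (A \<inter> cball 0 (real i)) x *\<^sub>R c) \<longlonglongrightarrow> indicator A x *\<^sub>R c" for x
    proof (rule tendsto_eventually)
      obtain N where "norm x \<le> real N" using real_arch_simple by blast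
      then show "\<forall>\<^sub>F i in sequentially. indicator (A \<inter> cball 0 (real i)) x *\<^sub>R c = indicator A x *\<^sub>R c"
        by (intro eventually_sequentiallyI[of N]) (auto simp: indicator_def)
    qed
  qed (auto simp: indicator_def)
next
  case (add f g)
  then show ?case by (intro continuous_approx_add) auto
next
  case (lim f s)
  then show ?case by (intro continuous_approx_lim[of s f]) auto
qed

section \<open>Mollifications: bounds in L^1 and L^p, convergence in L^1\<close>

definition mollify :: "nat \<Rightarrow> ('e::euclidean_space \<Rightarrow> 'f::euclidean_space) \<Rightarrow> 'e \<Rightarrow> 'f" where
  "mollify n h x = (LINT y|lborel. mollifier n (x - y) *\<^sub>R h y)"

lemma mollifier_bounded:
  obtains B where "B > 0" "\<And>x::'e::euclidean_space. mollifier n x \<le> B"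
proof -
  have "test_function UNIV (\<lambda>y. mollifier n (0 - y) :: real)" by (rule test_function_mollifier) simp
  then obtain B where B: "B > 0" "\<And>y::'e. \<bar>mollifier n (0 - y)\<bar> \<le> B" by (rule test_function_bounded) blast
  from B(2)[of "- x" for x] have "mollifier n x \<le> B" for x :: 'e by simp (metis abs_le_D1)
  with B(1) show thesis using that by blast
qed

lemma mollify_integrand_integrable:
  fixes h :: "'e::euclidean_space \<Rightarrow> 'f::euclidean_space"
  assumes "integrable lborel h"
  shows "integrable lborel (\<lambda>y. mollifier n (x - y) *\<^sub>R h y)"
proof -
  obtain B where B: "B > 0" "\<And>x::'e. mollifier n x \<le> B" using mollifier_bounded by blast
  have [measurable]: "h \<in> borel_measurable borel" using assms by auto
  show ?thesis
    by (rule Bochner_Integration.integrable_bound[OF integrable_scaleR_right[OF assms, of B]])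
       (auto intro!: mult_right_mono simp: abs_of_nonneg[OF mollifier_nonneg] B less_imp_le abs_of_pos)
qed

lemma mollify_measurable [measurable]:
  assumes [measurable]: "h \<in> borel_measurable borel"
  shows "mollify n h \<in> borel_measurable borel"
proof -
  have "(\<lambda>x. LINT y|lborel. mollifier n (x - y) *\<^sub>R h y) \<in> borel_measurable borel"
    by (rule lborel.borel_measurable_lebesgue_integral) measurable
  then show ?thesis by (simp add: mollify_def[abs_def])
qed

text \<open>Tonelli's theorem exchanges the integrals, and every translate of the mollifier has
  integral 1.\<close>

lemma mollify_nn_integral_le:
  fixes h :: "'e::euclidean_space \<Rightarrow> 'f::euclidean_space"
  assumes "integrable lborel h"
  shows "(\<integral>\<^sup>+x. norm (mollify n h x) \<partial>lborel) \<le> (\<integral>\<^sup>+x. norm (h x) \<partial>lborel)"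
proof -
  have [measurable]: "h \<in> borel_measurable borel" using assms by auto
  have "(\<integral>\<^sup>+x. norm (mollify n h x) \<partial>lborel) \<le> (\<integral>\<^sup>+x. (\<integral>\<^sup>+y. ennreal (mollifier n (x - y)) * ennreal (norm (h y)) \<partial>lborel) \<partial>lborel)"
  proof (rule nn_integral_mono)
    fix x
    have "ennreal (norm (mollify n h x)) \<le> (\<integral>\<^sup>+y. norm (mollifier n (x - y) *\<^sub>R h y) \<partial>lborel)"
      unfolding mollify_def by (rule integral_norm_bound_ennreal[OF mollify_integrand_integrable[OF assms]])
    also have "\<dots> = (\<integral>\<^sup>+y. ennreal (mollifier n (x - y)) * ennreal (norm (h y)) \<partial>lborel)"
      by (intro nn_integral_cong) (simp add: ennreal_mult mollifier_nonneg)
    finally show "ennreal (norm (mollify n h x)) \<le> \<dots>" .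
  qed
  also have "\<dots> = (\<integral>\<^sup>+y. (\<integral>\<^sup>+x. ennreal (mollifier n (x - y)) * ennreal (norm (h y)) \<partial>lborel) \<partial>lborel)"
    by (rule lborel_pair.Fubini'[symmetric]) measurable
  also have "\<dots> = (\<integral>\<^sup>+y. norm (h y) \<partial>lborel)"
  proof (rule nn_integral_cong)
    fix y
    have "(\<integral>\<^sup>+x. ennreal (mollifier n (x - y)) * ennreal (norm (h y)) \<partial>lborel)
      = (\<integral>\<^sup>+x. ennreal (mollifier n (x - y)) \<partial>lborel) * ennreal (norm (h y))"
      by (rule nn_integral_multc) auto
    also have "(\<integral>\<^sup>+x. ennreal (mollifier n (x - y)) \<partial>lborel) = (\<integral>\<^sup>+x. ennreal (mollifier n (x::'e)) \<partial>lborel)"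
      by (rule nn_integral_translate[of "\<lambda>x. ennreal (mollifier n x)"]) auto
    also have "\<dots> = 1"
      by (subst nn_integral_eq_integral[OF mollifier_integrable]) (auto simp: mollifier_nonneg mollifier_integral)
    finally show "(\<integral>\<^sup>+x. ennreal (mollifier n (x - y)) * ennreal (norm (h y)) \<partial>lborel) = ennreal (norm (h y))" by simp
  qed
  finally show ?thesis .
qed

lemma mollify_diff:
  assumes "integrable lborel f" "integrable lborel g"
  shows "mollify n (\<lambda>x. f x - g x) x = mollify n f x - mollify n g x"
  unfolding mollify_def scaleR_diff_right
  by (rule Bochner_Integration.integral_diff[OF mollify_integrand_integrable[OF assms(1)] mollify_integrand_integrable[OF assms(2)]])

text \<open>A mollification is a weighted average over the ball of radius \<open>1 / Suc n\<close>,
  with nonnegative weights of total mass 1, and therefore inherits every bound valid on that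
  ball.\<close>

lemma mollify_close:
  assumes g: "integrable lborel g"
    and close: "\<And>y. dist x y \<le> 1 / real (Suc n) \<Longrightarrow> norm (g y - c) \<le> d"
  shows "norm (mollify n g x - c) \<le> d"
proof -
  have i1: "integrable lborel (\<lambda>y. mollifier n (x - y))"
    using mollifier_integrable integral_reflect(2)[of "mollifier n" x] by auto
  have "norm (g x - c) \<le> d" by (rule close) simp
  then have d: "d \<ge> 0" using norm_ge_zero order_trans by blast
  have "c = (LINT y|lborel. mollifier n (x - y)) *\<^sub>R c"
    by (subst integral_reflect) (auto simp: mollifier_integral)
  also have "\<dots> = (LINT y|lborel. mollifier n (x - y) *\<^sub>R c)"
    by (rule integral_scaleR_left[symmetric]) (use i1 in simp)
  finally have "mollify n g x - c = (LINT y|lborel. mollifier n (x - y) *\<^sub>R g y) - (LINT y|lborel. mollifier n (x - y) *\<^sub>R c)"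
    by (simp add: mollify_def)
  also have "\<dots> = (LINT y|lborel. mollifier n (x - y) *\<^sub>R g y - mollifier n (x - y) *\<^sub>R c)"
    by (rule Bochner_Integration.integral_diff[symmetric])
       (auto intro: mollify_integrand_integrable[OF g] integrable_scaleR_left i1)
  also have "norm \<dots> \<le> (LINT y|lborel. mollifier n (x - y) * d)"
  proof (rule order_trans[OF integral_norm_bound integral_mono])
    show "integrable lborel (\<lambda>y. norm (mollifier n (x - y) *\<^sub>R g y - mollifier n (x - y) *\<^sub>R c))"
      by (intro integrable_norm Bochner_Integration.integrable_diff mollify_integrand_integrable[OF g] integrable_scaleR_left i1)
    show "integrable lborel (\<lambda>y. mollifier n (x - y) * d)" using i1 by simp
    fix y
    show "norm (mollifier n (x - y) *\<^sub>R g y - mollifier n (x - y) *\<^sub>R c) \<le> mollifier n (x - y) * d"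
    proof (cases "dist x y \<le> 1 / real (Suc n)")
      case True
      then show ?thesis using close[OF True]
        by (auto simp: abs_of_nonneg[OF mollifier_nonneg] mollifier_nonneg
            simp flip: scaleR_diff_right intro!: mult_left_mono)
    next
      case False
      then have "mollifier n (x - y) = 0" by (intro mollifier_eq_0) (auto simp: dist_norm)
      then show ?thesis by simp
    qed
  qed
  also have "\<dots> = d"
    using integral_reflect(1)[of "mollifier n" x] by (simp add: mollifier_integral)
  finally show ?thesis .
qed

lemma mollify_eq_0:
  assumes "\<And>y. dist x y \<le> 1 / real (Suc n) \<Longrightarrow> g y = 0"
  shows "mollify n g x = 0"
proof -
  have "(\<lambda>y. mollifier n (x - y) *\<^sub>R g y) = (\<lambda>_. 0)"
  proof
    fix y
    show "mollifier n (x - y) *\<^sub>R g y = 0"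
    using assms[of y] mollifier_eq_0[of n "x - y"] by (cases "dist x y \<le> 1 / real (Suc n)") (auto simp: dist_norm)
  qed
  then show ?thesis by (simp add: mollify_def)
qed

lemma mollify_tendsto_continuous:
  fixes g :: "'e::euclidean_space \<Rightarrow> 'f::euclidean_space"
  assumes g: "continuous_on UNIV g" "compact K" "\<forall>x. x \<notin> K \<longrightarrow> g x = 0" and e: "e > 0"
  shows "eventually (\<lambda>n. (\<integral>\<^sup>+x. norm (mollify n g x - g x) \<partial>lborel) < ennreal e) sequentially"
proof -
  have int: "integrable lborel g" using g by (intro smooth_compact_support_integrable) auto
  obtain R where R: "K \<subseteq> cball 0 R" using compact_imp_bounded[OF g(2)] by (auto simp: bounded_iff subset_iff)
  \<comment> \<open>Mollifying spreads the support by at most 1, so both functions vanish outside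
    \<open>B\<close>. Points averaged at a point of \<open>B\<close> stay within radius
    \<open>R + 2\<close>, where uniform continuity is used below.\<close>
  define B where "B = cball (0::'e) (R + 1)"
  define d where "d = e / (2 * (measure lborel B + 1))"
  have d: "d > 0" using e by (auto simp: d_def intro!: divide_pos_pos add_nonneg_pos mult_pos_pos)
  have "uniformly_continuous_on (cball 0 (R + 2)) g"
    by (rule compact_uniformly_continuous[OF continuous_on_subset[OF g(1)]]) auto
  then obtain \<delta> where \<delta>: "\<delta> > 0" "\<And>x y. x \<in> cball 0 (R+2) \<Longrightarrow> y \<in> cball 0 (R+2) \<Longrightarrow> dist y x < \<delta> \<Longrightarrow> dist (g y) (g x) < d"
    using d unfolding uniformly_continuous_on_def by metis
  obtain N where N: "1 / real (Suc N) < \<delta>" using nat_approx_posE[OF \<delta>(1)] by blast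
  have "(\<integral>\<^sup>+x. norm (mollify n g x - g x) \<partial>lborel) < ennreal e" if n: "n \<ge> N" for n
  proof -
    have n1: "1 / real (Suc n) < \<delta>" "1 / real (Suc n) \<le> 1"
    proof -
      have "1 / real (Suc n) \<le> 1 / real (Suc N)" using n by (intro divide_left_mono) auto
      then show "1 / real (Suc n) < \<delta>" using N by linarith
    qed simp
    have le: "norm (mollify n g x - g x) \<le> d * indicator B x" for x
    proof (cases "x \<in> B")
      case True
      have "norm (mollify n g x - g x) \<le> d"
      proof (rule mollify_close[OF int])
        fix y assume y: "dist x y \<le> 1 / real (Suc n)"
        have "norm y \<le> norm x + dist x y" by (metis dist_norm norm_triangle_sub norm_minus_commute add.commute)
        moreover have "norm x \<le> R + 1" using True by (simp add: B_def)
        moreover have "dist x y \<le> 1" using y n1(2) by (rule order_trans)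
        ultimately have "norm y \<le> R + 2" by linarith
        moreover have "dist y x < \<delta>" using y n1(1) by (simp add: dist_commute)
        ultimately have "dist (g y) (g x) < d" using True by (intro \<delta>) (auto simp: B_def)
        then show "norm (g y - g x) \<le> d" by (simp add: dist_norm)
      qed
      then show ?thesis using True by simp
    next
      case False
      have z: "g y = 0" if "dist x y \<le> 1 / real (Suc n)" for y
      proof -
        have "norm x \<le> norm y + dist x y" by (metis dist_norm norm_triangle_sub)
        moreover have "dist x y \<le> 1" using that n1(2) by (rule order_trans)
        moreover have "\<not> norm x \<le> R + 1" using False by (simp add: B_def)
        ultimately have "\<not> norm y \<le> R" by linarith
        then have "y \<notin> K" using R by auto
        then show ?thesis using g by blast
      qed
      then have "mollify n g x = 0" by (rule mollify_eq_0)
      moreover have "g x = 0" by (rule z) simp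
      ultimately show ?thesis using False by simp
    qed
    have "(\<integral>\<^sup>+x. norm (mollify n g x - g x) \<partial>lborel) \<le> (\<integral>\<^sup>+x. ennreal d * indicator B x \<partial>lborel)"
      by (intro nn_integral_mono order_trans[OF ennreal_leI[OF le]]) (auto simp: indicator_def)
    also have "\<dots> = ennreal d * emeasure lborel B"
      unfolding B_def by (rule nn_integral_cmult_indicator) simp
    also have "\<dots> = ennreal (d * measure lborel B)"
    proof -
      have "emeasure lborel B = ennreal (measure lborel B)"
        by (intro emeasure_eq_ennreal_measure) (use emeasure_lborel_cball_finite[of "0::'e" "R+1"] in \<open>simp add: B_def less_top\<close>)
      then show ?thesis using d by (simp add: ennreal_mult)
    qed
    also have "\<dots> < ennreal e"
    proof (rule ennreal_lessI[OF e])
      have p: "measure lborel B + 1 > 0" by (simp add: add_nonneg_pos)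
      have "d * measure lborel B < d * (2 * (measure lborel B + 1))"
        using d by (intro mult_strict_left_mono) (simp_all add: add_nonneg_pos)
      also have "\<dots> = e" using p by (simp add: d_def)
      finally show "d * measure lborel B < e" .
    qed
    finally show ?thesis .
  qed
  then show ?thesis by (auto simp: eventually_sequentially)
qed

text \<open>A three-epsilon argument: since mollifying does not increase the L^1 norm, replacing
  \<open>h\<close> by a continuous \<open>g\<close> costs an error that is uniform in
  \<open>n\<close>.\<close>

lemma mollify_tendsto:
  assumes h: "integrable lborel h"
  shows "(\<lambda>n. \<integral>\<^sup>+x. norm (mollify n h x - h x) \<partial>lborel) \<longlonglongrightarrow> 0"
proof (rule tendsto_zero_ennreal)
  fix e :: real assume e: "0 < e"
  then have e3: "e/3 > 0" by simp
  obtain g K where g: "continuous_on UNIV g" "compact K" "\<forall>x. x \<notin> K \<longrightarrow> g x = 0"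
     "(\<integral>\<^sup>+x. norm (h x - g x) \<partial>lborel) < ennreal (e/3)"
    using continuous_approx_integrable[OF h] e3 unfolding continuous_approx_def by meson
  have int: "integrable lborel g" using g by (intro smooth_compact_support_integrable) auto
  have [measurable]: "h \<in> borel_measurable borel" "g \<in> borel_measurable borel" using h int by auto
  show "\<forall>\<^sub>F n in sequentially. (\<integral>\<^sup>+x. norm (mollify n h x - h x) \<partial>lborel) < ennreal e"
    using mollify_tendsto_continuous[OF g(1-3) e3]
  proof eventually_elim
    case (elim n)
    have 1: "(\<integral>\<^sup>+x. norm (mollify n h x - mollify n g x) \<partial>lborel) < ennreal (e/3)"
      using mollify_nn_integral_le[of "\<lambda>x. h x - g x" n] g(4) h int by (simp add: mollify_diff)
    have 3: "(\<integral>\<^sup>+x. norm (g x - h x) \<partial>lborel) < ennreal (e/3)"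
      using g(4) by (simp add: norm_minus_commute)
    have "(\<integral>\<^sup>+x. norm (mollify n h x - h x) \<partial>lborel) \<le>
       (\<integral>\<^sup>+x. norm (mollify n h x - mollify n g x) \<partial>lborel) + (\<integral>\<^sup>+x. norm (mollify n g x - h x) \<partial>lborel)"
      by (rule nn_integral_norm_triangle) auto
    also have "(\<integral>\<^sup>+x. norm (mollify n g x - h x) \<partial>lborel) \<le>
       (\<integral>\<^sup>+x. norm (mollify n g x - g x) \<partial>lborel) + (\<integral>\<^sup>+x. norm (g x - h x) \<partial>lborel)"
      by (rule nn_integral_norm_triangle) auto
    also have "(\<integral>\<^sup>+x. norm (mollify n h x - mollify n g x) \<partial>lborel) +
      ((\<integral>\<^sup>+x. norm (mollify n g x - g x) \<partial>lborel) + (\<integral>\<^sup>+x. norm (g x - h x) \<partial>lborel))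
      < ennreal (e/3) + (ennreal (e/3) + ennreal (e/3))"
      by (intro add_strict_mono 1 3 elim)
    also have "\<dots> = ennreal e" using e by (simp flip: ennreal_plus)
    finally show ?case by (simp add: add_left_mono)
  qed
qed

text \<open>Replaces Hoelder's inequality throughout; \<open>s\<close> is chosen as convenient.\<close>

lemma le_add_powr:
  fixes a s p :: real
  assumes "a \<ge> 0" "s > 0" "p \<ge> 1"
  shows "a \<le> s + s powr (1 - p) * a powr p"
proof (cases "a \<le> s")
  case True
  then show ?thesis using assms by (simp add: add_increasing2)
next
  case False
  then have "1 \<le> (a / s) powr (p - 1)" using assms by (intro ge_one_powr_ge_zero) auto
  then have "a \<le> a * (a / s) powr (p - 1)" using assms by (simp add: mult_le_cancel_left1)
  also have "\<dots> = s powr (1 - p) * a powr p"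
    using assms False by (simp add: powr_divide powr_diff powr_minus divide_simps)
  finally show ?thesis using assms by simp
qed

text \<open>Jensen's inequality for the averaging measure, up to the constant
  \<open>2 powr p\<close>.\<close>

lemma mollify_powr_le:
  assumes h: "integrable lborel h" and hp: "integrable lborel (\<lambda>x. norm (h x) powr p)" and p: "p \<ge> 1"
  shows "norm (mollify n h x) powr p \<le> 2 powr p * mollify n (\<lambda>x. norm (h x) powr p) x"
proof (cases "mollify n h x = 0")
  case True
  have "mollify n (\<lambda>x. norm (h x) powr p) x \<ge> 0"
    unfolding mollify_def by (intro integral_nonneg_AE) (auto simp: mollifier_nonneg)
  then show ?thesis using True p by simp
next
  case False
  define A where "A = norm (mollify n h x)"
  define I where "I = mollify n (\<lambda>x. norm (h x) powr p) x"
  have A: "A > 0" using False by (simp add: A_def)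
  \<comment> \<open>Half of the quantity to be bounded: the summand \<open>s\<close> is absorbed
    into the left side, and \<open>s powr p \<le> I\<close> remains.\<close>
  define s where "s = A / 2"
  have s: "s > 0" using A by (simp add: s_def)
  have i1: "integrable lborel (\<lambda>y. mollifier n (x - y))"
    using mollifier_integrable integral_reflect(2)[of "mollifier n" x] by auto
  have i2: "integrable lborel (\<lambda>y. mollifier n (x - y) * norm (h y) powr p)"
    using mollify_integrand_integrable[OF hp, of n x] by simp
  have "A \<le> (LINT y|lborel. norm (mollifier n (x - y) *\<^sub>R h y))"
    unfolding A_def mollify_def by (rule integral_norm_bound)
  also have "\<dots> \<le> (LINT y|lborel. s * mollifier n (x - y) + s powr (1 - p) * (mollifier n (x - y) * norm (h y) powr p))"
  proof (rule integral_mono)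
    fix y
    have "mollifier n (x - y) * norm (h y) \<le> mollifier n (x - y) * (s + s powr (1 - p) * norm (h y) powr p)"
      by (intro mult_left_mono le_add_powr s p mollifier_nonneg) auto
    then show "norm (mollifier n (x - y) *\<^sub>R h y) \<le> s * mollifier n (x - y) + s powr (1 - p) * (mollifier n (x - y) * norm (h y) powr p)"
      by (simp add: abs_of_nonneg[OF mollifier_nonneg] algebra_simps)
  qed (use i1 i2 in \<open>auto intro: integrable_norm[OF mollify_integrand_integrable[OF h]] simp del: norm_scaleR\<close>)
  also have "\<dots> = s + s powr (1 - p) * I"
    using i1 i2 integral_reflect(1)[of "mollifier n" x] by (simp add: I_def mollify_def mollifier_integral)
  finally have "s \<le> s powr (1 - p) * I" by (simp add: s_def)
  then have "s powr p \<le> I"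
    using s by (simp add: powr_diff divide_simps powr_add[symmetric] mult.commute)
  then have "(A / 2) powr p \<le> I" by (simp add: s_def)
  then show ?thesis using A by (simp add: A_def[symmetric] I_def[symmetric] powr_divide divide_simps mult.commute)
qed

lemma mollify_powr_nn_integral_le:
  assumes h: "integrable lborel h" and hp: "integrable lborel (\<lambda>x. norm (h x) powr p)" and p: "p \<ge> 1"
  shows "(\<integral>\<^sup>+x. norm (mollify n h x) powr p \<partial>lborel) \<le> 2 powr p * (\<integral>\<^sup>+x. norm (h x) powr p \<partial>lborel)"
proof -
  have [measurable]: "h \<in> borel_measurable borel" using h by auto
  have "(\<integral>\<^sup>+x. norm (mollify n h x) powr p \<partial>lborel) \<le> (\<integral>\<^sup>+x. ennreal (2 powr p) * norm (mollify n (\<lambda>x. norm (h x) powr p) x) \<partial>lborel)"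
  proof (rule nn_integral_mono)
    fix x
    have "norm (mollify n h x) powr p \<le> 2 powr p * norm (mollify n (\<lambda>x. norm (h x) powr p) x)"
      using mollify_powr_le[OF assms, of n x] by (rule order_trans) (auto intro: mult_left_mono)
    then show "ennreal (norm (mollify n h x) powr p) \<le> ennreal (2 powr p) * ennreal (norm (mollify n (\<lambda>x. norm (h x) powr p) x))"
      by (simp flip: ennreal_mult add: ennreal_leI)
  qed
  also have "\<dots> = 2 powr p * (\<integral>\<^sup>+x. norm (mollify n (\<lambda>x. norm (h x) powr p) x) \<partial>lborel)"
    by (rule nn_integral_cmult) auto
  also have "\<dots> \<le> 2 powr p * (\<integral>\<^sup>+x. norm (norm (h x) powr p) \<partial>lborel)"
    by (intro mult_left_mono mollify_nn_integral_le hp) auto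
  finally show ?thesis by simp
qed

section \<open>Weak derivatives\<close>

text \<open>Weak derivatives are only Lebesgue measurable, while Tonelli's theorem and the
  convolution estimates are used for Borel functions. The version is assembled from one for each
  coordinate.\<close>

lemma lebesgue_borel_version:
  fixes f :: "'e::euclidean_space \<Rightarrow> 'f::euclidean_space"
  assumes f: "integrable lebesgue f"
  obtains f' where "integrable lborel f'" "AE x in lebesgue. f' x = f x"
proof -
  have "(\<lambda>x. f x \<bullet> b) \<in> borel_measurable (completion lborel)" for b
    using f by (intro borel_measurable_inner) auto
  then have "\<forall>b. \<exists>g\<in>borel_measurable lborel. AE x in lborel. f x \<bullet> b = g x"
    by (intro allI completion_ex_borel_measurable_real)
  then obtain g where g: "\<And>b. g b \<in> borel_measurable lborel" "\<And>b. AE x in lborel. f x \<bullet> b = g b x"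
    by metis
  define f' where "f' = (\<lambda>x. \<Sum>b\<in>Basis. g b x *\<^sub>R b :: 'f)"
  have [measurable]: "f' \<in> borel_measurable borel" unfolding f'_def using g(1) by auto
  have "AE x in lborel. \<forall>b\<in>Basis. f x \<bullet> b = g b x"
    using g(2) by (intro AE_finite_allI) auto
  then have "AE x in lborel. f' x = f x"
  proof eventually_elim
    case (elim x)
    then show ?case using euclidean_representation[of "f x"] by (simp add: f'_def)
  qed
  then have ae: "AE x in lebesgue. f' x = f x" by (rule AE_completion)
  have m': "f' \<in> borel_measurable lebesgue" by (rule measurable_completion) auto
  have "integrable lebesgue f'"
    by (rule integrable_cong_AE_imp[OF f m']) (use ae in eventually_elim, simp)
  then have "integrable lborel f'" by (subst (asm) integrable_completion) auto
  with ae show thesis using that by blast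
qed

lemma set_integrable_borel_version:
  fixes f :: "'e::euclidean_space \<Rightarrow> 'f::euclidean_space"
  assumes f: "set_integrable lebesgue S f"
  obtains f' where "integrable lborel f'" "AE x in lebesgue. f' x = indicator S x *\<^sub>R f x"
  using lebesgue_borel_version[OF f[unfolded set_integrable_def]] by blast

lemma integral_borel_version:
  fixes f f' :: "'e::euclidean_space \<Rightarrow> 'f::euclidean_space"
  assumes "integrable lborel f'" "AE x in lebesgue. f' x = f x" "integrable lebesgue f" "a \<in> borel_measurable borel"
  shows "(LINT x|lebesgue. a x *\<^sub>R f x) = (LINT x|lborel. a x *\<^sub>R f' x)"
proof -
  have [measurable]: "f' \<in> borel_measurable borel" "a \<in> borel_measurable borel" using assms by auto
  have [measurable]: "a \<in> borel_measurable lebesgue" "f \<in> borel_measurable lebesgue"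
    using borel_measurable_integrable[OF assms(3)] by (simp_all add: measurable_completion)
  have "(LINT x|lborel. a x *\<^sub>R f' x) = (LINT x|lebesgue. a x *\<^sub>R f' x)"
    by (rule integral_completion[symmetric]) auto
  also have "\<dots> = (LINT x|lebesgue. a x *\<^sub>R f x)"
  proof (rule integral_cong_AE)
    show "(\<lambda>x. a x *\<^sub>R f' x) \<in> borel_measurable lebesgue" by (rule measurable_completion) simp
    show "(\<lambda>x. a x *\<^sub>R f x) \<in> borel_measurable lebesgue" by (intro borel_measurable_scaleR) simp_all
    show "AE x in lebesgue. a x *\<^sub>R f' x = a x *\<^sub>R f x" using assms(2) by eventually_elim simp
  qed
  finally show ?thesis by simp
qed

lemma test_integral_UNIV:
  assumes "test_function G \<eta>"
  shows "(LINT x:G|lebesgue. \<eta> x *\<^sub>R h x) = (LINT x|lebesgue. \<eta> x *\<^sub>R h x)"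
proof -
  have eq: "(\<lambda>x. indicator G x *\<^sub>R (\<eta> x *\<^sub>R h x)) = (\<lambda>x. \<eta> x *\<^sub>R h x)"
    using assms by (auto simp: test_function_def indicator_def fun_eq_iff)
  show ?thesis unfolding set_lebesgue_integral_def by (simp only: eq)
qed

lemma test_integrable:
  assumes "test_function G \<eta>" "locally_integrable_on h G"
  shows "integrable lebesgue (\<lambda>x. \<eta> x *\<^sub>R h x)"
proof -
  obtain K where K: "smooth_on UNIV \<eta>" "compact K" "K \<subseteq> G" "\<And>x. x \<notin> K \<Longrightarrow> \<eta> x = 0"
    using assms(1) unfolding test_function_def by blast
  obtain B where B: "B > 0" "\<And>x. \<bar>\<eta> x\<bar> \<le> B" using test_function_bounded[OF assms(1)] by blast
  have int: "integrable lebesgue (\<lambda>x. indicator K x *\<^sub>R h x)"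
    using assms(2) K by (auto simp: locally_integrable_on_def set_integrable_def)
  have eq: "(\<lambda>x. \<eta> x *\<^sub>R h x) = (\<lambda>x. \<eta> x *\<^sub>R (indicator K x *\<^sub>R h x))"
    using K(4) by (auto simp: fun_eq_iff indicator_def)
  show ?thesis unfolding eq
  proof (rule Bochner_Integration.integrable_bound[OF integrable_scaleR_right[OF int, of B]])
    show "(\<lambda>x. \<eta> x *\<^sub>R (indicator K x *\<^sub>R h x)) \<in> borel_measurable lebesgue"
    proof (rule borel_measurable_scaleR)
      show "\<eta> \<in> borel_measurable lebesgue"
        using test_function_measurable[OF assms(1)] by (intro measurable_completion) simp
      show "(\<lambda>x. indicator K x *\<^sub>R h x) \<in> borel_measurable lebesgue" using int by (rule borel_measurable_integrable)
    qed
    show "AE x in lebesgue. norm (\<eta> x *\<^sub>R (indicator K x *\<^sub>R h x)) \<le> norm (B *\<^sub>R (indicator K x *\<^sub>R h x))"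
    proof (rule AE_I2)
      fix x
      have "\<bar>\<eta> x\<bar> * norm (indicator K x *\<^sub>R h x) \<le> B * norm (indicator K x *\<^sub>R h x)"
        using B by (intro mult_right_mono) auto
      then show "norm (\<eta> x *\<^sub>R (indicator K x *\<^sub>R h x)) \<le> norm (B *\<^sub>R (indicator K x *\<^sub>R h x))"
        using B(1) by (simp add: abs_of_pos abs_mult mult.assoc)
    qed
  qed
qed

text \<open>Test functions and their derivatives vanish off \<open>G\<close>, so the integrals may
  run over the whole space. This rids later arguments of indicators of \<open>G\<close>.\<close>

lemma is_weak_derivative_iff:
  "is_weak_derivative G j f D \<longleftrightarrow>
     locally_integrable_on f G \<and> (\<forall>x\<in>G. sym_multilinear j (D x)) \<and>
     (\<forall>vs. length vs = j \<longrightarrow> locally_integrable_on (\<lambda>x. D x vs) G \<and>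
        (\<forall>\<eta>. test_function G \<eta> \<longrightarrow>
          (LINT x|lebesgue. dir_deriv vs \<eta> x *\<^sub>R f x) = (-1) ^ j *\<^sub>R (LINT x|lebesgue. \<eta> x *\<^sub>R D x vs)))"
  unfolding is_weak_derivative_def
  by (intro conj_cong refl arg_cong[where f=All] ext imp_cong)
     (simp add: test_integral_UNIV test_integral_UNIV[OF test_function_dir_deriv])

lemma locally_integrable_on_subset: "locally_integrable_on f G \<Longrightarrow> G' \<subseteq> G \<Longrightarrow> locally_integrable_on f G'"
  by (auto simp: locally_integrable_on_def)

lemma locally_integrable_on_diff:
  "locally_integrable_on f G \<Longrightarrow> locally_integrable_on g G \<Longrightarrow> locally_integrable_on (\<lambda>x. f x - g x) G"
  unfolding locally_integrable_on_def by (blast intro: set_integral_diff(1))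

lemma is_weak_derivative_subset:
  assumes "is_weak_derivative G j f D" "G' \<subseteq> G"
  shows "is_weak_derivative G' j f D"
  unfolding is_weak_derivative_iff
proof (intro conjI allI impI ballI)
  note a = assms(1)[unfolded is_weak_derivative_iff]
  show "locally_integrable_on f G'" using a assms(2) locally_integrable_on_subset by blast
  show "sym_multilinear j (D x)" if "x \<in> G'" for x using a that assms(2) by blast
  fix vs :: "'a list" assume vs: "length vs = j"
  show "locally_integrable_on (\<lambda>x. D x vs) G'"
    using a vs locally_integrable_on_subset[OF _ assms(2)] by blast
  fix \<eta> :: "'a \<Rightarrow> real" assume "test_function G' \<eta>"
  then show "(LINT x|lebesgue. dir_deriv vs \<eta> x *\<^sub>R f x) = (-1) ^ j *\<^sub>R (LINT x|lebesgue. \<eta> x *\<^sub>R D x vs)"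
    using a vs test_function_mono[OF _ assms(2)] by blast
qed

lemma is_weak_derivative_diff:
  assumes f: "is_weak_derivative G j f D" and g: "is_weak_derivative G j g E"
  shows "is_weak_derivative G j (\<lambda>x. f x - g x) (\<lambda>x vs. D x vs - E x vs)"
  unfolding is_weak_derivative_iff
proof (intro conjI allI impI ballI)
  note f' = f[unfolded is_weak_derivative_iff] and g' = g[unfolded is_weak_derivative_iff]
  show "locally_integrable_on (\<lambda>x. f x - g x) G"
    by (rule locally_integrable_on_diff[OF conjunct1[OF f'] conjunct1[OF g']])
  fix x assume "x \<in> G"
  then have "sym_multilinear j (D x)" "sym_multilinear j (E x)" using f' g' by blast+
  then show "sym_multilinear j (\<lambda>vs. D x vs - E x vs)"
    unfolding sym_multilinear_def
  proof (intro conjI allI impI, goal_cases)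
    case (1 vs i)
    then show ?case by (intro linear_compose_sub) auto
  next
    case (2 vs ws)
    then show ?case by metis
  qed
next
  note f' = f[unfolded is_weak_derivative_iff] and g' = g[unfolded is_weak_derivative_iff]
  fix vs :: "'a list" assume vs: "length vs = j"
  have D: "locally_integrable_on (\<lambda>x. D x vs) G" and E: "locally_integrable_on (\<lambda>x. E x vs) G"
    using f' g' vs by blast+
  then show "locally_integrable_on (\<lambda>x. D x vs - E x vs) G" by (rule locally_integrable_on_diff)
  fix \<eta> :: "'a \<Rightarrow> real" assume \<eta>: "test_function G \<eta>"
  note ints = test_integrable[OF test_function_dir_deriv[OF \<eta>] conjunct1[OF f']]
     test_integrable[OF test_function_dir_deriv[OF \<eta>] conjunct1[OF g']] test_integrable[OF \<eta> D] test_integrable[OF \<eta> E]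
  have "(LINT x|lebesgue. dir_deriv vs \<eta> x *\<^sub>R f x) = (-1) ^ j *\<^sub>R (LINT x|lebesgue. \<eta> x *\<^sub>R D x vs)"
    "(LINT x|lebesgue. dir_deriv vs \<eta> x *\<^sub>R g x) = (-1) ^ j *\<^sub>R (LINT x|lebesgue. \<eta> x *\<^sub>R E x vs)"
    using f' g' vs \<eta> by blast+
  then show "(LINT x|lebesgue. dir_deriv vs \<eta> x *\<^sub>R (f x - g x)) = (- 1) ^ j *\<^sub>R (LINT x|lebesgue. \<eta> x *\<^sub>R (D x vs - E x vs))"
    using ints by (simp add: scaleR_diff_right)
qed

lemma is_weak_derivative_cong:
  assumes "is_weak_derivative G j f D" "\<And>x. x \<in> G \<Longrightarrow> f x = g x"
  shows "is_weak_derivative G j g D"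
proof -
  have "(LINT x|lebesgue. dir_deriv vs \<eta> x *\<^sub>R g x) = (LINT x|lebesgue. dir_deriv vs \<eta> x *\<^sub>R f x)"
    if "test_function G \<eta>" for \<eta> vs
  proof -
    have "dir_deriv vs \<eta> x *\<^sub>R g x = dir_deriv vs \<eta> x *\<^sub>R f x" for x
      using assms(2)[of x] test_function_dir_deriv[OF that, of vs] unfolding test_function_def
      by (cases "x \<in> G") auto
    then show ?thesis by presburger
  qed
  moreover have "locally_integrable_on g G"
    unfolding locally_integrable_on_def
  proof (intro allI impI)
    fix K assume K: "compact K \<and> K \<subseteq> G"
    then have "set_integrable lebesgue K f" using assms(1) by (auto simp: is_weak_derivative_iff locally_integrable_on_def)
    then show "set_integrable lebesgue K g"
      by (rule set_integrable_cong[THEN iffD1, rotated 3]) (use K assms(2) in auto)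
  qed
  ultimately show ?thesis using assms(1) by (simp add: is_weak_derivative_iff)
qed

lemma compact_neighbourhood:
  fixes C G :: "'e::euclidean_space set"
  assumes "compact C" "open G" "C \<subseteq> G"
  obtains e L where "e > 0" "compact L" "L \<subseteq> G" "\<And>x. x \<in> C \<Longrightarrow> cball x e \<subseteq> L"
proof (cases "C = {}")
  case False
  obtain e where e: "e > 0" "{x. infdist x C \<le> e} \<subseteq> G"
    using compact_in_open_separated[OF False assms] by blast
  have "cball x e \<subseteq> {x. infdist x C \<le> e}" if "x \<in> C" for x
    using that by (auto simp: dist_commute intro: infdist_le2)
  moreover have "compact {x. infdist x C \<le> e}"
    by (rule compact_infdist_le[OF False assms(1) e(1)])
  ultimately show thesis using e that by blast
qed (use that[of 1 "{}"] in auto)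

text \<open>The mollifier centred at \<open>x\<close> is supported inside \<open>L\<close>, where
  the Borel version agrees with \<open>h\<close> almost everywhere. A mollification is thereby a
  pairing of \<open>h\<close> with a test function.\<close>

lemma mollify_weak:
  assumes h': "integrable lborel h'" "AE x in lebesgue. h' x = indicator L x *\<^sub>R h x"
    and L: "set_integrable lebesgue L h" "cball x (1 / real (Suc n)) \<subseteq> L"
  shows "mollify n h' x = (LINT y|lebesgue. mollifier n (x - y) *\<^sub>R h y)"
proof -
  have "mollify n h' x = (LINT y|lebesgue. mollifier n (x - y) *\<^sub>R (indicator L y *\<^sub>R h y))"
    unfolding mollify_def
    by (rule integral_borel_version[OF h'(1,2), symmetric]) (use L in \<open>auto simp: set_integrable_def\<close>)
  also have "(\<lambda>y. mollifier n (x - y) *\<^sub>R (indicator L y *\<^sub>R h y)) = (\<lambda>y. mollifier n (x - y) *\<^sub>R h y)"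
  proof
    fix y
    show "mollifier n (x - y) *\<^sub>R (indicator L y *\<^sub>R h y) = mollifier n (x - y) *\<^sub>R h y"
    proof (cases "dist x y \<le> 1 / real (Suc n)")
      case True
      then show ?thesis using L(2) by (auto simp: subset_iff simp del: of_nat_Suc)
    next
      case False
      then show ?thesis using mollifier_eq_0[of n "x - y"] by (simp add: dist_norm)
    qed
  qed
  finally show ?thesis .
qed

text \<open>On a compact subset, mollifications of small radius are pairings with test functions,
  hence 0; but they converge to \<open>h\<close> in L^1. Countably many compact sets exhaust
  \<open>G\<close>.\<close>

lemma fundamental_lemma:
  fixes h :: "'e::euclidean_space \<Rightarrow> 'f::euclidean_space"
  assumes G: "open G" and h: "locally_integrable_on h G"
    and 0: "\<And>\<eta>. test_function G \<eta> \<Longrightarrow> (LINT x|lebesgue. \<eta> x *\<^sub>R h x) = 0"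
  shows "AE x in lebesgue. x \<in> G \<longrightarrow> h x = 0"
proof -
  have cpt: "AE x in lebesgue. x \<in> C \<longrightarrow> h x = 0" if C: "compact C" "C \<subseteq> G" for C
  proof -
    obtain e L where L: "e > 0" "compact L" "L \<subseteq> G" "\<And>x. x \<in> C \<Longrightarrow> cball x e \<subseteq> L"
      using compact_neighbourhood[OF C(1) G C(2)] by blast
    have hL: "set_integrable lebesgue L h" using h L by (auto simp: locally_integrable_on_def)
    obtain h' where h': "integrable lborel h'" "AE x in lebesgue. h' x = indicator L x *\<^sub>R h x"
      using set_integrable_borel_version[OF hL] by blast
    have [measurable]: "h' \<in> borel_measurable borel" "C \<in> sets borel" using h' borel_compact[OF C(1)] by auto
    obtain N where N: "1 / real (Suc N) < e" using nat_approx_posE[OF L(1)] by blast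
    have "(\<integral>\<^sup>+x. norm (h' x) * indicator C x \<partial>lborel) \<le> (\<integral>\<^sup>+x. norm (mollify n h' x - h' x) \<partial>lborel)" if "n \<ge> N" for n
    proof (rule nn_integral_mono)
      fix x
      have "mollify n h' x = 0" if "x \<in> C"
      proof -
        have "1 / real (Suc n) \<le> 1 / real (Suc N)" using \<open>n \<ge> N\<close> by (intro divide_left_mono) auto
        then have "1 / real (Suc n) \<le> e" using N by linarith
        then have sub: "cball x (1 / real (Suc n)) \<subseteq> L" using L(4)[OF that] by (auto simp: subset_iff)
        then have "mollify n h' x = (LINT y|lebesgue. mollifier n (x - y) *\<^sub>R h y)"
          using h' hL by (intro mollify_weak)
        also have "\<dots> = 0"
          by (rule 0, rule test_function_mollifier) (use sub L in blast)
        finally show ?thesis .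
      qed
      then show "ennreal (norm (h' x) * indicator C x) \<le> ennreal (norm (mollify n h' x - h' x))"
        by (auto simp: indicator_def)
    qed
    then have "(\<integral>\<^sup>+x. norm (h' x) * indicator C x \<partial>lborel) \<le> 0"
      by (intro LIMSEQ_le_const[OF mollify_tendsto[OF h'(1)]]) auto
    then have "AE x in lborel. ennreal (norm (h' x) * indicator C x) = 0"
      by (subst (asm) le_zero_eq, subst (asm) nn_integral_0_iff_AE) auto
    then have "AE x in lebesgue. ennreal (norm (h' x) * indicator C x) = 0"
      by (rule AE_completion)
    with h'(2) show ?thesis
    proof eventually_elim
      case (elim x)
      show ?case
      proof
        assume x: "x \<in> C"
        then have "x \<in> L" using L(1) L(4)[OF x] by auto
        then show "h x = 0" using elim x by simp
      qed
    qed
  qed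
  obtain C :: "nat \<Rightarrow> 'e set" where C: "\<And>n. compact (C n)" "\<And>n. C n \<subseteq> G" "\<Union>(range C) = G"
    using open_Union_compact_subsets[OF G] by metis
  have "AE x in lebesgue. \<forall>n. x \<in> C n \<longrightarrow> h x = 0"
    unfolding AE_all_countable using cpt C by blast
  then show ?thesis using C(3) by (auto elim!: eventually_mono)
qed

lemma weak_derivative_unique:
  assumes "open G" "is_weak_derivative G j f D" "is_weak_derivative G j f E" "length vs = j"
  shows "AE x in lebesgue. x \<in> G \<longrightarrow> D x vs = E x vs"
proof -
  have "AE x in lebesgue. x \<in> G \<longrightarrow> D x vs - E x vs = 0"
  proof (rule fundamental_lemma[OF assms(1)])
    note d = is_weak_derivative_diff[OF assms(2,3), unfolded is_weak_derivative_iff,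
        THEN conjunct2, THEN conjunct2, rule_format, OF assms(4)]
    show "locally_integrable_on (\<lambda>x. D x vs - E x vs) G" using d by blast
    show "(LINT x|lebesgue. \<eta> x *\<^sub>R (D x vs - E x vs)) = 0" if "test_function G \<eta>" for \<eta>
      using d that by auto
  qed
  then show ?thesis by simp
qed

text \<open>Difference quotients integrate to 0 by translation invariance, and they converge to the
  directional derivative with a common integrable bound.\<close>

lemma integral_dd_eq_0:
  fixes h :: "'e::euclidean_space \<Rightarrow> 'f::euclidean_space"
  assumes h: "smooth_on UNIV h" and K: "compact K" "\<And>x. x \<notin> K \<Longrightarrow> h x = 0"
  shows "(LINT x|lborel. dd v h x) = 0"
proof -
  have cont: "continuous_on UNIV h" "continuous_on UNIV (dd v h)"
    using h smooth_on_continuous smooth_on_dd by blast+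
  have [measurable]: "h \<in> borel_measurable borel" "dd v h \<in> borel_measurable borel"
    using cont borel_measurable_continuous_onI by blast+
  have int: "integrable lborel h" by (rule smooth_compact_support_integrable[OF cont(1) K])
  have dd0: "dd v h x = 0" if "x \<notin> K" for x
    using dir_deriv_eq_0_outside[of K h x "[v]"] K that compact_imp_closed by auto
  obtain B where B: "B > 0" "\<And>x. norm (dd v h x) \<le> B"
  proof -
    have "compact (dd v h ` K)" using cont K by (intro compact_continuous_image) (auto intro: continuous_on_subset)
    then obtain B where B: "B > 0" "\<And>y. y \<in> dd v h ` K \<Longrightarrow> norm y \<le> B"
      using bounded_pos compact_imp_bounded by metis
    then have "norm (dd v h x) \<le> B" for x using dd0[of x] B by (cases "x \<in> K") auto
    with B show thesis using that by blast
  qed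
  obtain R where R: "K \<subseteq> cball 0 R" using compact_imp_bounded[OF K(1)] by (auto simp: bounded_iff subset_iff)
  define t where "t n = 1 / real (Suc n)" for n
  have t: "t n > 0" "t n \<le> 1" "t n \<noteq> 0" for n by (auto simp: t_def)
  have t0: "t \<longlonglongrightarrow> 0" unfolding t_def using LIMSEQ_inverse_real_of_nat by (simp add: inverse_eq_divide)
  define q where "q n x = (1 / t n) *\<^sub>R (h (x + t n *\<^sub>R v) - h x)" for n x
  \<comment> \<open>As \<open>t n \<le> 1\<close>, this ball contains the support of
    \<open>h\<close> and of all its translates that occur.\<close>
  define S where "S = cball (0::'e) (R + norm v)"
  have line: "((\<lambda>s. h (x + s *\<^sub>R v)) has_vector_derivative dd v h (x + s *\<^sub>R v)) (at s within A)" for s A x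
    by (rule dd_line) (use smooth_on_differentiable[OF h] in auto)
  have qbound: "norm (q n x) \<le> B * indicator S x" for n x
  proof (cases "x \<in> S")
    case True
    have "norm (h (x + t n *\<^sub>R v) - h (x + 0 *\<^sub>R v)) \<le> B * \<bar>t n - 0\<bar>"
    proof -
      have "((\<lambda>s. h (x + s *\<^sub>R v)) has_derivative (\<lambda>y. y *\<^sub>R dd v h (x + s *\<^sub>R v))) (at s within {0..t n})" for s
        using line by (simp add: has_vector_derivative_def)
      moreover have "onorm (\<lambda>y. y *\<^sub>R dd v h (x + s *\<^sub>R v)) \<le> B" for s
        using B(2)[of "x + s *\<^sub>R v"] by (intro onorm_bound) (auto simp: mult.commute[of B] B less_imp_le intro!: mult_left_mono)
      ultimately have "norm (h (x + t n *\<^sub>R v) - h (x + 0 *\<^sub>R v)) \<le> B * norm (t n - 0)"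
        using t[of n] by (intro differentiable_bound[where S="{0..t n}" and f="\<lambda>s. h (x + s *\<^sub>R v)"]) auto
      then show ?thesis by simp
    qed
    then show ?thesis using True t[of n] by (simp add: q_def divide_simps mult.commute)
  next
    case False
    have "x \<notin> K" using False R by (auto simp: S_def subset_iff) (smt (verit) norm_ge_zero)
    moreover have "x + t n *\<^sub>R v \<notin> K"
    proof
      assume "x + t n *\<^sub>R v \<in> K"
      then have "norm (x + t n *\<^sub>R v) \<le> R" using R by auto
      moreover have "norm x \<le> norm (x + t n *\<^sub>R v) + norm (t n *\<^sub>R v)"
        by (metis add_diff_cancel norm_triangle_ineq4)
      moreover have "norm (t n *\<^sub>R v) \<le> norm v" using t[of n] by (simp add: mult_left_le_one_le)
      ultimately show False using False by (simp add: S_def)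
    qed
    ultimately show ?thesis using K(2) False by (simp add: q_def)
  qed
  have qlim: "(\<lambda>n. q n x) \<longlonglongrightarrow> dd v h x" for x
  proof -
    have "((\<lambda>s. h (x + s *\<^sub>R v)) has_vector_derivative dd v h (x + 0 *\<^sub>R v)) (at 0)"
      by (rule line)
    then have "((\<lambda>s. norm (h (x + s *\<^sub>R v) - h x - s *\<^sub>R dd v h x) / norm s) \<longlongrightarrow> 0) (at 0)"
      unfolding has_vector_derivative_def has_derivative_at by simp
    then have "((\<lambda>s. norm ((1/s) *\<^sub>R (h (x + s *\<^sub>R v) - h x) - dd v h x)) \<longlongrightarrow> 0) (at 0)"
    proof (rule Lim_transform_eventually)
      have "norm (h (x + s *\<^sub>R v) - h x - s *\<^sub>R dd v h x) / norm s
          = norm ((1/s) *\<^sub>R (h (x + s *\<^sub>R v) - h x) - dd v h x)" if "s \<noteq> 0" for s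
      proof -
        have "(1/s) *\<^sub>R (h (x + s *\<^sub>R v) - h x) - dd v h x = (1/s) *\<^sub>R (h (x + s *\<^sub>R v) - h x - s *\<^sub>R dd v h x)"
          using that by (simp add: scaleR_diff_right)
        then show ?thesis by simp
      qed
      then show "\<forall>\<^sub>F s in at 0. norm (h (x + s *\<^sub>R v) - h x - s *\<^sub>R dd v h x) / norm s
          = norm ((1/s) *\<^sub>R (h (x + s *\<^sub>R v) - h x) - dd v h x)"
        by (simp add: eventually_at_filter)
    qed
    then have "((\<lambda>s. (1/s) *\<^sub>R (h (x + s *\<^sub>R v) - h x)) \<longlongrightarrow> dd v h x) (at 0)"
      using Lim_null tendsto_norm_zero_iff by blast
    moreover have "filterlim t (at 0) sequentially"
      using t0 t by (auto simp: filterlim_at)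
    ultimately show ?thesis unfolding q_def by (rule filterlim_compose)
  qed
  have "(\<lambda>n. LINT x|lborel. q n x) \<longlonglongrightarrow> (LINT x|lborel. dd v h x)"
  proof (rule integral_dominated_convergence[where w="\<lambda>x. B * indicator S x"])
    show "integrable lborel (\<lambda>x. B * indicator S x)"
      using emeasure_lborel_cball_finite by (intro integrable_mult_right integrable_real_indicator) (auto simp: S_def)
    show "q n \<in> borel_measurable lborel" for n unfolding q_def[abs_def] by measurable
  qed (use qlim qbound in auto)
  moreover have "(LINT x|lborel. q n x) = 0" for n
  proof -
    have [simp]: "(LINT x|lborel. h (x + c)) = integral\<^sup>L lborel h" "integrable lborel (\<lambda>x. h (x + c))" for c
    proof -
      have "lborel = distr lborel borel (\<lambda>x::'e. c + x)" by (simp add: lborel_distr_plus)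
      then show "(LINT x|lborel. h (x + c)) = integral\<^sup>L lborel h" "integrable lborel (\<lambda>x. h (x + c))"
        using integral_distr[of "\<lambda>x. c + x" lborel borel h] integrable_distr_eq[of "\<lambda>x. c + x" lborel borel h] int
        by (simp_all add: add.commute)
    qed
    show ?thesis unfolding q_def using int by simp
  qed
  ultimately show ?thesis by (simp add: LIMSEQ_const_iff)
qed

lemma smooth_on_Un: "smooth_on S f \<Longrightarrow> smooth_on T f \<Longrightarrow> smooth_on (S \<union> T) f"
  by (auto simp: smooth_on_def)

text \<open>Outside \<open>G\<close> nothing is known about \<open>w\<close>, but the product
  vanishes off \<open>K\<close>; the open sets \<open>G\<close> and the complement of
  \<open>K\<close> cover the space.\<close>

lemma smooth_on_test_scaleR:
  fixes w :: "'e::euclidean_space \<Rightarrow> 'f::euclidean_space"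
  assumes "open G" "smooth_on G w" "test_function G \<eta>"
  obtains K where "smooth_on UNIV (\<lambda>x. \<eta> x *\<^sub>R w x)" "compact K" "\<And>x. x \<notin> K \<Longrightarrow> \<eta> x *\<^sub>R w x = 0"
proof -
  obtain K where K: "smooth_on UNIV \<eta>" "compact K" "K \<subseteq> G" "\<And>x. x \<notin> K \<Longrightarrow> \<eta> x = 0"
    using assms(3) unfolding test_function_def by blast
  have "smooth_on G (\<lambda>x. \<eta> x *\<^sub>R w x)"
    by (intro smooth_on_scaleR assms smooth_on_subset[OF K(1)]) auto
  moreover have "smooth_on (- K) (\<lambda>x. \<eta> x *\<^sub>R w x) \<longleftrightarrow> smooth_on (- K) (\<lambda>x. 0::'f)"
    by (rule smooth_on_cong) (use K compact_imp_closed in auto)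
  ultimately have "smooth_on (G \<union> - K) (\<lambda>x. \<eta> x *\<^sub>R w x)" by (intro smooth_on_Un) auto
  moreover have "G \<union> - K = UNIV" using K by auto
  ultimately show thesis using that[of K] K by auto
qed

text \<open>The derivative of the product integrates to 0. The product rule also holds at points
  outside \<open>G\<close>, because all of its terms vanish there.\<close>

lemma integral_by_parts:
  assumes G: "open G" and w: "smooth_on G w" and \<eta>: "test_function G \<eta>"
  shows "(LINT x|lborel. dd v \<eta> x *\<^sub>R w x) = - (LINT x|lborel. \<eta> x *\<^sub>R dd v w x)"
proof -
  have s\<eta>: "smooth_on UNIV \<eta>" using \<eta> by (auto simp: test_function_def)
  have ddw: "smooth_on G (dd v w)" using w by (rule smooth_on_dd)
  have dd\<eta>: "test_function G (dd v \<eta>)" using test_function_dir_deriv[OF \<eta>, of "[v]"] by simp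
  obtain K where K: "smooth_on UNIV (\<lambda>x. \<eta> x *\<^sub>R w x)" "compact K" "\<And>x. x \<notin> K \<Longrightarrow> \<eta> x *\<^sub>R w x = 0"
    using smooth_on_test_scaleR[OF G w \<eta>] by blast
  obtain K1 where K1: "smooth_on UNIV (\<lambda>x. \<eta> x *\<^sub>R dd v w x)" "compact K1" "\<And>x. x \<notin> K1 \<Longrightarrow> \<eta> x *\<^sub>R dd v w x = 0"
    using smooth_on_test_scaleR[OF G ddw \<eta>] by blast
  obtain K2 where K2: "smooth_on UNIV (\<lambda>x. dd v \<eta> x *\<^sub>R w x)" "compact K2" "\<And>x. x \<notin> K2 \<Longrightarrow> dd v \<eta> x *\<^sub>R w x = 0"
    using smooth_on_test_scaleR[OF G w dd\<eta>] by blast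
  have i1: "integrable lborel (\<lambda>x. \<eta> x *\<^sub>R dd v w x)"
    by (rule smooth_compact_support_integrable[OF smooth_on_continuous[OF K1(1)] K1(2,3)])
  have i2: "integrable lborel (\<lambda>x. dd v \<eta> x *\<^sub>R w x)"
    by (rule smooth_compact_support_integrable[OF smooth_on_continuous[OF K2(1)] K2(2,3)])
  have eq: "dd v (\<lambda>x. \<eta> x *\<^sub>R w x) x = \<eta> x *\<^sub>R dd v w x + dd v \<eta> x *\<^sub>R w x" for x
  proof (cases "x \<in> G")
    case True
    then show ?thesis
      by (intro dd_scaleR smooth_on_differentiable[OF s\<eta>] smooth_on_differentiable[OF w]) auto
  next
    case False
    obtain L where L: "compact L" "L \<subseteq> G" "\<And>x. x \<notin> L \<Longrightarrow> \<eta> x = 0"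
      using \<eta> unfolding test_function_def by blast
    have x: "x \<notin> L" using False L by auto
    have "dd v (\<lambda>x. \<eta> x *\<^sub>R w x) x = 0" "dd v \<eta> x = 0"
      using dir_deriv_eq_0_outside[of L "\<lambda>x. \<eta> x *\<^sub>R w x" x "[v]"] dir_deriv_eq_0_outside[of L \<eta> x "[v]"]
        L x compact_imp_closed by auto
    then show ?thesis using L x by simp
  qed
  have "0 = (LINT x|lborel. dd v (\<lambda>x. \<eta> x *\<^sub>R w x) x)"
    by (rule integral_dd_eq_0[OF K, symmetric])
  also have "\<dots> = (LINT x|lborel. \<eta> x *\<^sub>R dd v w x) + (LINT x|lborel. dd v \<eta> x *\<^sub>R w x)"
    unfolding eq by (rule Bochner_Integration.integral_add[OF i1 i2])
  finally show ?thesis by (simp add: eq_neg_iff_add_eq_0 add.commute)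
qed

text \<open>Each step strips the outermost direction from \<open>\<eta>\<close> and applies it to
  \<open>w\<close> first, as the innermost one. Symmetry of iterated derivatives moves it back to
  the front.\<close>

lemma integral_by_parts_iterated:
  assumes G: "open G" and w: "smooth_on G w" and \<eta>: "test_function G \<eta>"
  shows "(LINT x|lborel. dir_deriv vs \<eta> x *\<^sub>R w x) = (-1) ^ length vs *\<^sub>R (LINT x|lborel. \<eta> x *\<^sub>R dir_deriv vs w x)"
  using w
proof (induction vs arbitrary: w)
  case (Cons v vs)
  have "(LINT x|lborel. dir_deriv (v # vs) \<eta> x *\<^sub>R w x) = - (LINT x|lborel. dir_deriv vs \<eta> x *\<^sub>R dd v w x)"
    using integral_by_parts[OF G Cons.prems test_function_dir_deriv[OF \<eta>]] by simp
  also have "\<dots> = (-1) ^ length (v # vs) *\<^sub>R (LINT x|lborel. \<eta> x *\<^sub>R dir_deriv vs (dd v w) x)"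
    using Cons.IH[OF smooth_on_dd[OF Cons.prems]] by simp
  also have "(\<lambda>x. \<eta> x *\<^sub>R dir_deriv vs (dd v w) x) = (\<lambda>x. \<eta> x *\<^sub>R dir_deriv (v # vs) w x)"
  proof
    fix x
    show "\<eta> x *\<^sub>R dir_deriv vs (dd v w) x = \<eta> x *\<^sub>R dir_deriv (v # vs) w x"
    proof (cases "x \<in> G")
      case True
      have "dir_deriv vs (dd v w) x = dir_deriv (vs @ [v]) w x" by (simp add: dir_deriv_append)
      also have "\<dots> = dir_deriv (v # vs) w x"
        using dir_deriv_move_front[OF G Cons.prems True, of vs v "[]"] by simp
      finally show ?thesis by simp
    next
      case False
      then have "\<eta> x = 0" using \<eta> by (auto simp: test_function_def)
      then show ?thesis by simp
    qed
  qed
  finally show ?case .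
qed simp

lemma locally_integrable_continuous:
  assumes "continuous_on G w"
  shows "locally_integrable_on w G"
  unfolding locally_integrable_on_def set_integrable_def
proof (intro allI impI, elim conjE)
  fix K assume K: "compact K" "K \<subseteq> G"
  then have i: "integrable lborel (\<lambda>x. indicator K x *\<^sub>R w x)"
    by (intro borel_integrable_compact continuous_on_subset[OF assms])
  then show "integrable lebesgue (\<lambda>x. indicator K x *\<^sub>R w x)"
    by (subst integrable_completion) auto
qed

lemma weak_derivative_smooth:
  fixes w :: "'e::euclidean_space \<Rightarrow> 'f::euclidean_space"
  assumes G: "open G" and w: "smooth_on G w"
  shows "is_weak_derivative G j w (\<lambda>x vs. dir_deriv vs w x)"
  unfolding is_weak_derivative_iff
proof (intro conjI allI impI ballI)
  show "locally_integrable_on w G" by (intro locally_integrable_continuous smooth_on_continuous w)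
  show "sym_multilinear j (\<lambda>vs. dir_deriv vs w x)" if "x \<in> G" for x
    by (rule sym_multilinear_dir_deriv[OF G w that])
  fix vs :: "'e list" assume vs: "length vs = j"
  show "locally_integrable_on (dir_deriv vs w) G"
    by (intro locally_integrable_continuous smooth_on_continuous smooth_on_dir_deriv w)
  fix \<eta> :: "'e \<Rightarrow> real" assume \<eta>: "test_function G \<eta>"
  have c: "(LINT x|lebesgue. \<theta> x *\<^sub>R u x) = (LINT x|lborel. \<theta> x *\<^sub>R u x)"
    if \<theta>: "test_function G \<theta>" and u: "smooth_on G u" for \<theta> and u :: "'e \<Rightarrow> 'f"
  proof (rule integral_completion)
    obtain K where K: "smooth_on UNIV (\<lambda>x. \<theta> x *\<^sub>R u x)"
      using smooth_on_test_scaleR[OF G u \<theta>] by blast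
    show "(\<lambda>x. \<theta> x *\<^sub>R u x) \<in> borel_measurable lborel"
      using borel_measurable_continuous_onI[OF smooth_on_continuous[OF K]] by simp
  qed
  show "(LINT x|lebesgue. dir_deriv vs \<eta> x *\<^sub>R w x) = (- 1) ^ j *\<^sub>R (LINT x|lebesgue. \<eta> x *\<^sub>R dir_deriv vs w x)"
    using integral_by_parts_iterated[OF G w \<eta>, of vs] vs
    by (simp add: c[OF \<eta> smooth_on_dir_deriv[OF w]] c[OF test_function_dir_deriv[OF \<eta>] w])
qed

section \<open>Multilinear maps and their norm\<close>

definition multilin :: "nat \<Rightarrow> ('e::euclidean_space list \<Rightarrow> 'f::euclidean_space) \<Rightarrow> bool" where
  "multilin j L \<longleftrightarrow> (\<forall>vs i. length vs = j \<and> i < j \<longrightarrow> linear (\<lambda>v. L (vs[i := v])))"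

definition basis_lists :: "nat \<Rightarrow> 'e::euclidean_space list set" where
  "basis_lists j = {bs. set bs \<subseteq> Basis \<and> length bs = j}"

lemma finite_basis_lists [simp]: "finite (basis_lists j)"
  unfolding basis_lists_def by (rule finite_lists_length_eq) simp

lemma basis_lists_length: "bs \<in> basis_lists j \<Longrightarrow> length bs = j"
  by (simp add: basis_lists_def)

lemma basis_lists_0 [simp]: "basis_lists 0 = {[]}"
  by (auto simp: basis_lists_def)

lemma basis_lists_Suc: "basis_lists (Suc j) = (\<lambda>(b, bs). b # bs) ` (Basis \<times> basis_lists j)"
  by (auto simp: basis_lists_def length_Suc_conv image_iff)

lemma sym_multilinear_imp_multilin: "sym_multilinear j L \<Longrightarrow> multilin j L"
  by (simp add: sym_multilinear_def multilin_def)

lemma multilin_Cons: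
  assumes "multilin (Suc j) L"
  shows "multilin j (\<lambda>ws. L (v # ws))" and "length ws = j \<Longrightarrow> linear (\<lambda>v. L (v # ws))"
proof -
  show "multilin j (\<lambda>ws. L (v # ws))" unfolding multilin_def
  proof (intro allI impI, elim conjE)
    fix vs :: "'a list" and i assume "length vs = j" "i < j"
    then have "linear (\<lambda>u. L ((v # vs)[Suc i := u]))"
      using assms unfolding multilin_def by (metis Suc_less_eq length_Cons)
    then show "linear (\<lambda>u. L (v # vs[i := u]))" by simp
  qed
  assume "length ws = j"
  then have "linear (\<lambda>u. L ((0 # ws)[0 := u]))"
    using assms unfolding multilin_def by (metis length_Cons zero_less_Suc)
  then show "linear (\<lambda>v. L (v # ws))" by simp
qed

text \<open>Reduces statements about all argument lists to the finitely many lists of basis vectors.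
  In this way almost-everywhere statements hold off a null set that is common to all
  arguments.\<close>

lemma multilin_expand:
  assumes "multilin j L" "length vs = j"
  shows "L vs = (\<Sum>bs\<in>basis_lists j. prod_list (map2 (\<bullet>) vs bs) *\<^sub>R L bs)"
  using assms
proof (induction j arbitrary: L vs)
  case (Suc j)
  then obtain v ws where vs: "vs = v # ws" "length ws = j" by (auto simp: length_Suc_conv)
  have lin: "linear (\<lambda>v. L (v # ws))" by (rule multilin_Cons(2)[OF Suc.prems(1) vs(2)])
  have "L vs = L ((\<Sum>b\<in>Basis. (v \<bullet> b) *\<^sub>R b) # ws)"
    using vs by (simp add: euclidean_representation)
  also have "\<dots> = (\<Sum>b\<in>Basis. (v \<bullet> b) *\<^sub>R L (b # ws))"
    using linear_sum[OF lin, of "\<lambda>b. (v \<bullet> b) *\<^sub>R b" Basis] linear_cmul[OF lin] by simp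
  also have "\<dots> = (\<Sum>b\<in>Basis. (v \<bullet> b) *\<^sub>R (\<Sum>bs\<in>basis_lists j. prod_list (map2 (\<bullet>) ws bs) *\<^sub>R L (b # bs)))"
    using Suc.IH[OF multilin_Cons(1)[OF Suc.prems(1)] vs(2)] by simp
  also have "\<dots> = (\<Sum>(b, bs)\<in>Basis \<times> basis_lists j. prod_list (map2 (\<bullet>) vs (b # bs)) *\<^sub>R L (b # bs))"
    by (simp add: vs scaleR_sum_right sum.cartesian_product)
  also have "\<dots> = (\<Sum>bs\<in>basis_lists (Suc j). prod_list (map2 (\<bullet>) vs bs) *\<^sub>R L bs)"
    unfolding basis_lists_Suc by (subst sum.reindex) (auto simp: inj_on_def case_prod_unfold)
  finally show ?case .
qed simp

lemma prod_list_map2_le_1: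
  assumes "\<forall>v\<in>set vs. norm v \<le> 1" "bs \<in> basis_lists (length vs)"
  shows "\<bar>prod_list (map2 (\<bullet>) vs bs)\<bar> \<le> 1"
  using assms
proof (induction vs arbitrary: bs)
  case (Cons v vs)
  then obtain b cs where bs: "bs = b # cs" "b \<in> Basis" "cs \<in> basis_lists (length vs)"
    by (auto simp: basis_lists_Suc)
  have "\<bar>v \<bullet> b\<bar> \<le> 1" using Basis_le_norm[OF bs(2), of v] Cons.prems by auto
  moreover have "\<bar>prod_list (map2 (\<bullet>) vs cs)\<bar> \<le> 1" using Cons bs by auto
  ultimately show ?case using bs by (simp add: abs_mult mult_le_one)
qed simp

definition unit_lists :: "nat \<Rightarrow> 'e::euclidean_space list set" where
  "unit_lists j = {vs. length vs = j \<and> (\<forall>v\<in>set vs. norm v \<le> 1)}"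

lemma multilinear_norm_alt: "multilinear_norm j L = (SUP vs\<in>unit_lists j. norm (L vs))"
  by (simp add: multilinear_norm_def unit_lists_def)

lemma basis_lists_unit: "bs \<in> basis_lists j \<Longrightarrow> bs \<in> unit_lists j"
  by (auto simp: basis_lists_def unit_lists_def)

lemma unit_lists_nonempty: "unit_lists j \<noteq> ({} :: 'e::euclidean_space list set)"
proof -
  have "replicate j (0::'e) \<in> unit_lists j" by (auto simp: unit_lists_def)
  then show ?thesis by blast
qed

lemma multilin_bound:
  assumes "multilin j L" "vs \<in> unit_lists j"
  shows "norm (L vs) \<le> (\<Sum>bs\<in>basis_lists j. norm (L bs))"
proof -
  have vs: "length vs = j" "\<forall>v\<in>set vs. norm v \<le> 1" using assms(2) by (auto simp: unit_lists_def)
  have "norm (L vs) \<le> (\<Sum>bs\<in>basis_lists j. norm (prod_list (map2 (\<bullet>) vs bs) *\<^sub>R L bs))"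
    by (subst multilin_expand[OF assms(1) vs(1)]) (rule norm_sum)
  also have "\<dots> \<le> (\<Sum>bs\<in>basis_lists j. norm (L bs))"
  proof (rule sum_mono)
    fix bs :: "'a list" assume "bs \<in> basis_lists j"
    then have "\<bar>prod_list (map2 (\<bullet>) vs bs)\<bar> * norm (L bs) \<le> 1 * norm (L bs)"
      using vs by (intro mult_right_mono prod_list_map2_le_1) auto
    then show "norm (prod_list (map2 (\<bullet>) vs bs) *\<^sub>R L bs) \<le> norm (L bs)" by simp
  qed
  finally show ?thesis .
qed

lemma multilin_bdd: "multilin j L \<Longrightarrow> bdd_above ((\<lambda>vs. norm (L vs)) ` unit_lists j)"
  using multilin_bound by (intro bdd_aboveI2) blast

lemma multilinear_norm_upper: "multilin j L \<Longrightarrow> vs \<in> unit_lists j \<Longrightarrow> norm (L vs) \<le> multilinear_norm j L"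
  unfolding multilinear_norm_alt by (rule cSUP_upper[OF _ multilin_bdd])

lemma multilinear_norm_le_sum: "multilin j L \<Longrightarrow> multilinear_norm j L \<le> (\<Sum>bs\<in>basis_lists j. norm (L bs))"
  unfolding multilinear_norm_alt using multilin_bound by (intro cSUP_least unit_lists_nonempty) blast

lemma multilinear_norm_nonneg: "multilin j L \<Longrightarrow> 0 \<le> multilinear_norm j L"
proof -
  assume L: "multilin j L"
  obtain vs :: "'a list" where "vs \<in> unit_lists j" using unit_lists_nonempty by blast
  then show ?thesis using multilinear_norm_upper[OF L] norm_ge_zero order_trans by blast
qed

lemma multilinear_norm_cong: "(\<And>vs. length vs = j \<Longrightarrow> L vs = L' vs) \<Longrightarrow> multilinear_norm j L = multilinear_norm j L'"
  unfolding multilinear_norm_alt by (intro SUP_cong) (auto simp: unit_lists_def)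

lemma multilin_diff: "multilin j L \<Longrightarrow> multilin j L' \<Longrightarrow> multilin j (\<lambda>vs. L vs - L' vs)"
  unfolding multilin_def by (auto intro: linear_compose_sub)

lemma multilinear_norm_triangle:
  assumes "multilin j L" "multilin j L'" "\<And>vs. length vs = j \<Longrightarrow> norm (L'' vs) \<le> norm (L vs) + norm (L' vs)"
  shows "multilinear_norm j L'' \<le> multilinear_norm j L + multilinear_norm j L'"
  unfolding multilinear_norm_alt[of j L'']
proof (rule cSUP_least[OF unit_lists_nonempty])
  fix vs :: "'a list" assume vs: "vs \<in> unit_lists j"
  then have "norm (L'' vs) \<le> norm (L vs) + norm (L' vs)" by (intro assms) (simp add: unit_lists_def)
  also have "\<dots> \<le> multilinear_norm j L + multilinear_norm j L'"
    by (intro add_mono multilinear_norm_upper assms vs)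
  finally show "norm (L'' vs) \<le> multilinear_norm j L + multilinear_norm j L'" .
qed

text \<open>The tail is replaced first by the induction hypothesis, then the head by continuity of
  the resulting linear map.\<close>

lemma multilin_approx:
  assumes Q: "Q \<subseteq> cball 0 1" "cball 0 1 \<subseteq> closure Q" and "multilin j L" "vs \<in> unit_lists j" "e > 0"
  shows "\<exists>ws. length ws = j \<and> set ws \<subseteq> Q \<and> norm (L vs - L ws) < e"
  using assms(3-5)
proof (induction j arbitrary: L vs e)
  case (Suc j)
  then obtain v us where vs: "vs = v # us" "length us = j" "norm v \<le> 1" "us \<in> unit_lists j"
    by (auto simp: unit_lists_def length_Suc_conv)
  have "e/2 > 0" using Suc.prems by simp
  then obtain ws where ws: "length ws = j" "set ws \<subseteq> Q" "norm (L (v # us) - L (v # ws)) < e/2"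
    using Suc.IH[OF multilin_Cons(1)[OF Suc.prems(1), of v] vs(4)] by blast
  have "linear (\<lambda>v. L (v # ws))" by (rule multilin_Cons(2)[OF Suc.prems(1) ws(1)])
  then have "isCont (\<lambda>v. L (v # ws)) v"
    by (simp add: linear_continuous_at linear_conv_bounded_linear)
  then obtain d where d: "d > 0" "\<And>u. dist u v < d \<Longrightarrow> dist (L (u # ws)) (L (v # ws)) < e/2"
    using \<open>e/2 > 0\<close> unfolding continuous_at_eps_delta by blast
  obtain q where q: "q \<in> Q" "dist q v < d"
    using Q(2) vs(3) d(1) by (auto simp: closure_approachable subset_iff)
  have "norm (L vs - L (q # ws)) \<le> norm (L (v # us) - L (v # ws)) + norm (L (v # ws) - L (q # ws))"
    using norm_triangle_ineq[of "L (v # us) - L (v # ws)" "L (v # ws) - L (q # ws)"] vs by simp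
  also have "\<dots> < e/2 + e/2" using ws(3) d(2)[OF q(2)] by (intro add_strict_mono) (auto simp: dist_norm norm_minus_commute)
  finally show ?case using ws q by (intro exI[of _ "q # ws"]) auto
qed (auto simp: unit_lists_def)

text \<open>The supremum over all unit lists equals the supremum over lists from a countable dense
  subset of the unit ball.\<close>

lemma multilinear_norm_measurable:
  fixes D :: "'x \<Rightarrow> 'e::euclidean_space list \<Rightarrow> 'f::euclidean_space"
  assumes D: "\<And>x. x \<in> space N \<Longrightarrow> multilin j (D x)"
    and meas: "\<And>vs. length vs = j \<Longrightarrow> (\<lambda>x. D x vs) \<in> borel_measurable N"
  shows "(\<lambda>x. multilinear_norm j (D x)) \<in> borel_measurable N"
proof -
  obtain Q :: "'e set" where Q: "countable Q" "Q \<subseteq> cball 0 1" "cball 0 1 \<subseteq> closure Q"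
    using separable[of "cball (0::'e) 1"] by blast
  define I where "I = {ws. length ws = j \<and> set ws \<subseteq> Q}"
  have cI: "countable I"
    by (rule countable_subset[of _ "lists Q"]) (use Q in \<open>auto simp: I_def\<close>)
  have IU: "I \<subseteq> unit_lists j" using Q by (auto simp: I_def unit_lists_def subset_iff)
  have "Q \<noteq> {}" using Q by auto
  then obtain q where "q \<in> Q" by blast
  then have "replicate j q \<in> I" by (auto simp: I_def)
  then have ne: "I \<noteq> {}" by blast
  have bdd: "bdd_above ((\<lambda>vs. norm (D x vs)) ` I)" if "x \<in> space N" for x
    using multilin_bdd[OF D[OF that]] IU by (meson bdd_above_mono image_mono)
  have eq: "multilinear_norm j (D x) = (SUP vs\<in>I. norm (D x vs))" if x: "x \<in> space N" for x
  proof (rule antisym)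
    show "multilinear_norm j (D x) \<le> (SUP vs\<in>I. norm (D x vs))"
      unfolding multilinear_norm_alt
    proof (rule cSUP_least[OF unit_lists_nonempty], rule field_le_epsilon)
      fix vs :: "'e list" and e :: real assume "vs \<in> unit_lists j" "e > 0"
      then obtain ws where ws: "ws \<in> I" "norm (D x vs - D x ws) < e"
        using multilin_approx[OF Q(2,3) D[OF x]] unfolding I_def by blast
      have "norm (D x vs) \<le> norm (D x ws) + norm (D x vs - D x ws)" by (metis norm_triangle_sub)
      also have "\<dots> \<le> (SUP vs\<in>I. norm (D x vs)) + e"
        using ws cSUP_upper[OF ws(1) bdd[OF x]] by simp
      finally show "norm (D x vs) \<le> (SUP vs\<in>I. norm (D x vs)) + e" .
    qed
    show "(SUP vs\<in>I. norm (D x vs)) \<le> multilinear_norm j (D x)"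
      using IU multilinear_norm_upper[OF D[OF x]] by (intro cSUP_least ne) auto
  qed
  have "(\<lambda>x. SUP vs\<in>I. norm (D x vs)) \<in> borel_measurable N"
    by (rule borel_measurable_cSUP[OF cI]) (use meas bdd in \<open>auto simp: I_def\<close>)
  then show ?thesis by (subst measurable_cong[OF eq])
qed

section \<open>Minkowski's inequality\<close>

text \<open>For positive arguments this is convexity of the power; if one argument is 0 it reduces
  to \<open>s powr p \<le> s\<close> on the unit interval.\<close>

lemma powr_convex_nonneg:
  fixes t u v p :: real
  assumes t: "0 \<le> t" "t \<le> 1" and uv: "0 \<le> u" "0 \<le> v" and p: "1 \<le> p"
  shows "(t * u + (1 - t) * v) powr p \<le> t * u powr p + (1 - t) * v powr p"
proof -
  have s: "s powr p \<le> s" if "0 \<le> s" "s \<le> 1" for s :: real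
    using that p powr_mono'[of 1 p s] by simp
  consider "u = 0" | "v = 0" | "u > 0" "v > 0" using uv by linarith
  then show ?thesis
  proof cases
    case 1
    then show ?thesis using t uv s[of "1 - t"] by (simp add: powr_mult mult_right_mono)
  next
    case 2
    then show ?thesis using t uv s[of t] by (simp add: powr_mult mult_right_mono)
  next
    case 3
    then show ?thesis
      using convex_onD[OF powr_convex[OF p], of "1 - t" u v] t by (simp add: algebra_simps)
  qed
qed

text \<open>Crude but sufficient: every summand is at most the largest one, whose power is among the
  summands on the right.\<close>

lemma sum_powr_le:
  fixes a :: "'i \<Rightarrow> real"
  assumes "finite I" "\<And>i. i \<in> I \<Longrightarrow> 0 \<le> a i" "0 \<le> p"
  shows "(\<Sum>i\<in>I. a i) powr p \<le> real (card I) powr p * (\<Sum>i\<in>I. a i powr p)"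
proof (cases "I = {}")
  case False
  define m where "m = Max (a ` I)"
  have m: "m \<in> a ` I" "\<And>i. i \<in> I \<Longrightarrow> a i \<le> m"
    unfolding m_def using assms(1) False by auto
  then obtain i where i: "i \<in> I" "m = a i" by blast
  have "(\<Sum>i\<in>I. a i) powr p \<le> (real (card I) * m) powr p"
    using assms m by (intro powr_mono2 sum_nonneg) (auto intro: sum_bounded_above)
  also have "\<dots> = real (card I) powr p * a i powr p"
    using assms i by (simp add: powr_mult)
  also have "\<dots> \<le> real (card I) powr p * (\<Sum>i\<in>I. a i powr p)"
    using assms i by (intro mult_left_mono member_le_sum) auto
  finally show ?thesis .
qed simp

text \<open>Minkowski's inequality for the norm that combines L^p in \<open>x\<close> with the p-sum
  over the orders \<open>j\<close>. After division by the norms \<open>A\<close> and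
  \<open>B\<close> it is convexity of the power with weights \<open>A / (A + B)\<close> and
  \<open>B / (A + B)\<close>.\<close>

lemma Minkowski_sum:
  fixes a b c :: "'i \<Rightarrow> 'x \<Rightarrow> real"
  assumes J: "finite J" and p: "1 \<le> p"
    and nn: "\<And>j x. j \<in> J \<Longrightarrow> 0 \<le> a j x" "\<And>j x. j \<in> J \<Longrightarrow> 0 \<le> b j x" "\<And>j x. j \<in> J \<Longrightarrow> 0 \<le> c j x"
    and le: "\<And>j x. j \<in> J \<Longrightarrow> c j x \<le> a j x + b j x"
    and a: "\<And>j. j \<in> J \<Longrightarrow> integrable N (\<lambda>x. a j x powr p)"
    and b: "\<And>j. j \<in> J \<Longrightarrow> integrable N (\<lambda>x. b j x powr p)"
    and c: "\<And>j. j \<in> J \<Longrightarrow> integrable N (\<lambda>x. c j x powr p)"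
  shows "(LINT x|N. (\<Sum>j\<in>J. c j x powr p)) powr (1/p) \<le>
     (LINT x|N. (\<Sum>j\<in>J. a j x powr p)) powr (1/p) + (LINT x|N. (\<Sum>j\<in>J. b j x powr p)) powr (1/p)"
    (is "?C powr _ \<le> ?A powr _ + ?B powr _")
proof (rule field_le_epsilon)
  fix e :: real assume e: "e > 0"
  \<comment> \<open>The surplus \<open>e / 2\<close> makes both normalising constants positive even
    if an integral vanishes.\<close>
  define A where "A = ?A powr (1/p) + e / 2"
  define B where "B = ?B powr (1/p) + e / 2"
  have pos: "A > 0" "B > 0" using e by (simp_all add: A_def B_def add_nonneg_pos)
  define t where "t = A / (A + B)"
  have t: "0 \<le> t" "t \<le> 1" "t * (A + B) = A" "(1 - t) * (A + B) = B" using pos by (auto simp: t_def field_simps)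
  have nA: "0 \<le> ?A" "0 \<le> ?B" "0 \<le> ?C" by (intro integral_nonneg_AE AE_I2 sum_nonneg; simp)+
  have "?A = (?A powr (1/p)) powr p" using nA p by (simp add: powr_powr)
  also have "\<dots> \<le> A powr p" using e p by (intro powr_mono2) (auto simp: A_def)
  finally have AA: "?A \<le> A powr p" .
  have "?B = (?B powr (1/p)) powr p" using nA p by (simp add: powr_powr)
  also have "\<dots> \<le> B powr p" using e p by (intro powr_mono2) (auto simp: B_def)
  finally have BB: "?B \<le> B powr p" .
  have pt: "c j x powr p \<le> (A + B) powr p * (t * (a j x powr p / A powr p) + (1 - t) * (b j x powr p / B powr p))" if j: "j \<in> J" for j x
  proof -
    have "a j x + b j x = (A + B) * (t * (a j x / A) + (1 - t) * (b j x / B))"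
    proof -
      have "(A + B) * (t * X + (1 - t) * Y) = (t * (A + B)) * X + ((1 - t) * (A + B)) * Y" for X Y
        by (simp add: algebra_simps)
      then have "(A + B) * (t * (a j x / A) + (1 - t) * (b j x / B)) = (t * (A + B)) * (a j x / A) + ((1 - t) * (A + B)) * (b j x / B)" .
      also have "\<dots> = a j x + b j x" unfolding t(3,4) using pos by simp
      finally show ?thesis by simp
    qed
    then have "c j x \<le> (A + B) * (t * (a j x / A) + (1 - t) * (b j x / B))" using le[OF j, of x] by simp
    then have "c j x powr p \<le> ((A + B) * (t * (a j x / A) + (1 - t) * (b j x / B))) powr p"
      using nn j p by (intro powr_mono2) auto
    also have "\<dots> = (A + B) powr p * (t * (a j x / A) + (1 - t) * (b j x / B)) powr p"
      by (rule powr_mult)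
    also have "\<dots> \<le> (A + B) powr p * (t * (a j x / A) powr p + (1 - t) * (b j x / B) powr p)"
      using pos nn j by (intro mult_left_mono powr_convex_nonneg t p) auto
    also have "\<dots> = (A + B) powr p * (t * (a j x powr p / A powr p) + (1 - t) * (b j x powr p / B powr p))"
      using pos nn j by (simp add: powr_divide)
    finally show ?thesis .
  qed
  have "?C \<le> (LINT x|N. (\<Sum>j\<in>J. (A + B) powr p * (t * (a j x powr p / A powr p) + (1 - t) * (b j x powr p / B powr p))))"
    using a b c pt by (intro integral_mono Bochner_Integration.integrable_sum sum_mono) auto
  also have "\<dots> = (A + B) powr p * (t * (?A / A powr p) + (1 - t) * (?B / B powr p))"
    using a b by (simp add: Bochner_Integration.integral_sum sum_distrib_left[symmetric] sum.distrib sum_divide_distrib[symmetric])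
  also have "\<dots> \<le> (A + B) powr p * (t * 1 + (1 - t) * 1)"
    using pos t AA BB by (intro mult_left_mono add_mono) (auto simp: divide_le_eq)
  also have "\<dots> = (A + B) powr p" by simp
  finally have "?C powr (1/p) \<le> ((A + B) powr p) powr (1/p)"
    using p nA by (intro powr_mono2) auto
  also have "\<dots> = A + B" using pos p by (simp add: powr_powr)
  finally show "?C powr (1/p) \<le> ?A powr (1/p) + ?B powr (1/p) + e" by (simp add: A_def B_def)
qed

section \<open>The Sobolev norm\<close>

text \<open>One neighbourhood serves all orders, whereas in \<open>sobolev_on\<close> it may vary
  with the order. The finitely many neighbourhoods are intersected to pass from one form to the
  other.\<close>

definition sobolev_data ::
  "nat \<Rightarrow> real \<Rightarrow> 'e::euclidean_space set \<Rightarrow> 'e set \<Rightarrow> ('e \<Rightarrow> 'f::euclidean_space) \<Rightarrow> (nat \<Rightarrow> 'e \<Rightarrow> 'e list \<Rightarrow> 'f) \<Rightarrow> bool" where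
  "sobolev_data k p K G f D \<longleftrightarrow> open G \<and> K \<subseteq> G \<and> (\<forall>j\<le>k. is_weak_derivative G j f (D j) \<and>
     (\<forall>vs. length vs = j \<longrightarrow> set_integrable lebesgue K (\<lambda>x. norm (D j x vs) powr p)))"

lemma sobolev_on_iff: "sobolev_on k p K f \<longleftrightarrow> continuous_on K f \<and> (\<exists>G D. sobolev_data k p K G f D)"
proof
  assume *: "sobolev_on k p K f"
  then have "\<forall>j. \<exists>G D. j \<le> k \<longrightarrow> open G \<and> K \<subseteq> G \<and> is_weak_derivative G j f D \<and>
        (\<forall>vs. length vs = j \<longrightarrow> (\<lambda>x. norm (D x vs) powr p) absolutely_integrable_on K)"
    unfolding sobolev_on_def by blast
  then obtain G where "\<forall>j. \<exists>D. j \<le> k \<longrightarrow> open (G j) \<and> K \<subseteq> G j \<and> is_weak_derivative (G j) j f D \<and>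
        (\<forall>vs. length vs = j \<longrightarrow> (\<lambda>x. norm (D x vs) powr p) absolutely_integrable_on K)"
    unfolding choice_iff by blast
  then obtain D where GD: "\<And>j. j \<le> k \<Longrightarrow> open (G j) \<and> K \<subseteq> G j \<and> is_weak_derivative (G j) j f (D j) \<and>
        (\<forall>vs. length vs = j \<longrightarrow> (\<lambda>x. norm (D j x vs) powr p) absolutely_integrable_on K)"
    unfolding choice_iff by blast
  have "sobolev_data k p K (\<Inter>j\<in>{..k}. G j) f D"
    unfolding sobolev_data_def using GD by (auto intro!: open_INT intro: is_weak_derivative_subset)
  then show "continuous_on K f \<and> (\<exists>G D. sobolev_data k p K G f D)" using * by (auto simp: sobolev_on_def)
next
  assume "continuous_on K f \<and> (\<exists>G D. sobolev_data k p K G f D)"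
  then show "sobolev_on k p K f" unfolding sobolev_on_def sobolev_data_def by meson
qed

lemma indicator_weak_measurable:
  assumes "is_weak_derivative G j f D" "compact K" "K \<subseteq> G" "length vs = j"
  shows "(\<lambda>x. indicator K x *\<^sub>R D x vs) \<in> borel_measurable lebesgue"
proof -
  have "set_integrable lebesgue K (\<lambda>x. D x vs)"
    using assms unfolding is_weak_derivative_iff locally_integrable_on_def by blast
  then show ?thesis unfolding set_integrable_def by (rule borel_measurable_integrable)
qed

lemma indicator_weak_multilin:
  assumes "is_weak_derivative G j f D" "K \<subseteq> G"
  shows "multilin j (\<lambda>vs. indicator K x *\<^sub>R D x vs)"
proof (cases "x \<in> K")
  case True
  then have "sym_multilinear j (D x)" using assms by (auto simp: is_weak_derivative_iff)
  then show ?thesis using True by (simp add: sym_multilinear_imp_multilin)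
next
  case False
  then show ?thesis by (simp add: multilin_def linear_zero)
qed

lemma weak_norm_measurable:
  assumes "is_weak_derivative G j f D" "compact K" "K \<subseteq> G"
  shows "(\<lambda>x. multilinear_norm j (\<lambda>vs. indicator K x *\<^sub>R D x vs)) \<in> borel_measurable lebesgue"
  by (rule multilinear_norm_measurable)
     (use assms in \<open>auto intro: indicator_weak_measurable indicator_weak_multilin\<close>)

text \<open>A single null set suffices for all argument lists: it is taken for the finitely many
  basis lists, and multilinearity does the rest.\<close>

lemma weak_derivative_unique_all:
  fixes f :: "'e::euclidean_space \<Rightarrow> 'f::euclidean_space"
  assumes "open G" "is_weak_derivative G j f D" "is_weak_derivative G j f E"
  shows "AE x in lebesgue. x \<in> G \<longrightarrow> (\<forall>vs. length vs = j \<longrightarrow> D x vs = E x vs)"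
proof -
  have "AE x in lebesgue. \<forall>bs\<in>basis_lists j. x \<in> G \<longrightarrow> D x bs = E x bs"
    using weak_derivative_unique[OF assms] basis_lists_length by (intro AE_finite_allI) auto
  then show ?thesis
  proof eventually_elim
    case (elim x)
    show ?case
    proof (intro impI allI)
      fix vs :: "'e list" assume x: "x \<in> G" and vs: "length vs = j"
      have "multilin j (D x)" "multilin j (E x)"
        using assms(2,3) x by (auto simp: is_weak_derivative_iff intro: sym_multilinear_imp_multilin)
      then show "D x vs = E x vs" using elim x multilin_expand[OF _ vs] by (metis (no_types, lifting) sum.cong)
    qed
  qed
qed

lemma indicator_powr_eq:
  "p \<noteq> 0 \<Longrightarrow> indicator K x *\<^sub>R (a powr p) = (indicator K x * a) powr p"
  by (simp add: indicator_def)

lemma multilinear_norm_0: "multilinear_norm j (\<lambda>vs::'e::euclidean_space list. 0::'f::euclidean_space) = 0"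
  using unit_lists_nonempty[of j, where 'e='e] by (simp add: multilinear_norm_alt)

lemma multilinear_norm_indicator:
  shows "multilinear_norm j (\<lambda>vs. indicator K x *\<^sub>R L vs) = indicator K x * multilinear_norm j L"
proof (cases "x \<in> K")
  case False
  then show ?thesis by (simp add: multilinear_norm_0)
qed simp

text \<open>With the indicator inside the norm, the map is multilinear at every point of the space
  as soon as \<open>K\<close> lies in the domain of the weak derivative, and integrals over
  \<open>K\<close> become integrals over the whole space.\<close>

definition deriv_norm :: "nat \<Rightarrow> 'e set \<Rightarrow> ('e \<Rightarrow> 'e::euclidean_space list \<Rightarrow> 'f::euclidean_space) \<Rightarrow> 'e \<Rightarrow> real" where
  "deriv_norm j K D x = multilinear_norm j (\<lambda>vs. indicator K x *\<^sub>R D x vs)"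

lemma deriv_norm_integrable:
  fixes f :: "'e::euclidean_space \<Rightarrow> 'f::euclidean_space"
  assumes D: "is_weak_derivative G j f D" and K: "compact K" "K \<subseteq> G" and p: "1 \<le> p"
    and int: "\<And>vs. length vs = j \<Longrightarrow> set_integrable lebesgue K (\<lambda>x. norm (D x vs) powr p)"
  shows "integrable lebesgue (\<lambda>x. deriv_norm j K D x powr p)"
proof -
  have ml: "multilin j (\<lambda>vs. indicator K x *\<^sub>R D x vs)" for x by (rule indicator_weak_multilin[OF D K(2)])
  define C where "C = real (card (basis_lists j :: 'e list set)) powr p"
  have i: "integrable lebesgue (\<lambda>x. C * (\<Sum>bs\<in>basis_lists j. norm (indicator K x *\<^sub>R D x bs) powr p))"
  proof (intro integrable_mult_right Bochner_Integration.integrable_sum)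
    fix bs :: "'e list" assume "bs \<in> basis_lists j"
    then have "integrable lebesgue (\<lambda>x. indicator K x *\<^sub>R (norm (D x bs) powr p))"
      using int basis_lists_length by (auto simp: set_integrable_def)
    then show "integrable lebesgue (\<lambda>x. norm (indicator K x *\<^sub>R D x bs) powr p)"
      using p by (simp add: indicator_powr_eq del: real_scaleR_def)
  qed
  show ?thesis
  proof (rule Bochner_Integration.integrable_bound[OF i])
    show "(\<lambda>x. deriv_norm j K D x powr p) \<in> borel_measurable lebesgue"
      unfolding deriv_norm_def using weak_norm_measurable[OF D K] by (intro powr_real_measurable) auto
    show "AE x in lebesgue. norm (deriv_norm j K D x powr p) \<le> norm (C * (\<Sum>bs\<in>basis_lists j. norm (indicator K x *\<^sub>R D x bs) powr p))"
    proof (rule AE_I2)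
      fix x
      have "deriv_norm j K D x powr p \<le> (\<Sum>bs\<in>basis_lists j. norm (indicator K x *\<^sub>R D x bs)) powr p"
        unfolding deriv_norm_def using p
        by (intro powr_mono2 multilinear_norm_le_sum multilinear_norm_nonneg ml) auto
      also have "\<dots> \<le> C * (\<Sum>bs\<in>basis_lists j. norm (indicator K x *\<^sub>R D x bs) powr p)"
        unfolding C_def using p by (intro sum_powr_le) auto
      finally show "norm (deriv_norm j K D x powr p) \<le> norm (C * (\<Sum>bs\<in>basis_lists j. norm (indicator K x *\<^sub>R D x bs) powr p))"
        by (simp add: C_def sum_nonneg)
    qed
  qed
qed

text \<open>Frees the seminorm from the choice in \<open>weak_derivative_near\<close>: the chosen
  derivative and the given one agree almost everywhere on the intersection of their
  neighbourhoods.\<close>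

lemma sobolev_seminorm_eq:
  assumes D: "sobolev_data k p K G f D" and K: "compact K" and p: "1 \<le> p"
  shows "sobolev_seminorm k p K f = (LINT x|lebesgue. (\<Sum>j\<in>{1..k}. deriv_norm j K (D j) x powr p)) powr (1/p)"
    and "\<And>j. j \<le> k \<Longrightarrow> integrable lebesgue (\<lambda>x. deriv_norm j K (D j) x powr p)"
proof -
  note d = D[unfolded sobolev_data_def]
  define E where "E j = weak_derivative_near K j f" for j
  show int: "integrable lebesgue (\<lambda>x. deriv_norm j K (D j) x powr p)" if "j \<le> k" for j
    using d that by (intro deriv_norm_integrable[OF _ K _ p, of G j f]) auto
  have E: "\<exists>G'. open G' \<and> K \<subseteq> G' \<and> is_weak_derivative G' j f (E j)" if "j \<le> k" for j
    unfolding E_def weak_derivative_near_def using d that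
    by (intro someI_ex[where P="\<lambda>D. \<exists>G. open G \<and> K \<subseteq> G \<and> is_weak_derivative G j f D"]) blast
  have meas: "(\<lambda>x. deriv_norm j K (E j) x) \<in> borel_measurable lebesgue" if j: "j \<le> k" for j
  proof -
    obtain G' where G': "K \<subseteq> G'" "is_weak_derivative G' j f (E j)" using E[OF j] by blast
    show ?thesis unfolding deriv_norm_def by (rule weak_norm_measurable[OF G'(2) K G'(1)])
  qed
  have ae: "AE x in lebesgue. deriv_norm j K (E j) x = deriv_norm j K (D j) x" if j: "j \<le> k" for j
  proof -
    obtain G' where G': "open G'" "K \<subseteq> G'" "is_weak_derivative G' j f (E j)" using E[OF j] by blast
    have "AE x in lebesgue. x \<in> G \<inter> G' \<longrightarrow> (\<forall>vs. length vs = j \<longrightarrow> E j x vs = D j x vs)"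
      by (rule weak_derivative_unique_all[where f=f]) (use d j G' in \<open>auto intro: is_weak_derivative_subset\<close>)
    then show ?thesis
    proof eventually_elim
      case (elim x)
      show ?case unfolding deriv_norm_def
        by (rule multilinear_norm_cong) (use elim d G' in \<open>auto simp: indicator_def\<close>)
    qed
  qed
  have "indicator K x *\<^sub>R (\<Sum>j\<in>{1..k}. multilinear_norm j (E j x) powr p) = (\<Sum>j\<in>{1..k}. deriv_norm j K (E j) x powr p)" for x
    using p by (auto simp: deriv_norm_def multilinear_norm_indicator multilinear_norm_0 indicator_def)
  then have "(LINT x:K|lebesgue. (\<Sum>j\<in>{1..k}. multilinear_norm j (E j x) powr p)) =
    (LINT x|lebesgue. (\<Sum>j\<in>{1..k}. deriv_norm j K (E j) x powr p))"
    unfolding set_lebesgue_integral_def by presburger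
  also have "\<dots> = (LINT x|lebesgue. (\<Sum>j\<in>{1..k}. deriv_norm j K (D j) x powr p))"
  proof (rule integral_cong_AE)
    show "(\<lambda>x. \<Sum>j\<in>{1..k}. deriv_norm j K (E j) x powr p) \<in> borel_measurable lebesgue"
      using meas by (intro borel_measurable_sum powr_real_measurable) auto
    show "(\<lambda>x. \<Sum>j\<in>{1..k}. deriv_norm j K (D j) x powr p) \<in> borel_measurable lebesgue"
      using int by (intro borel_measurable_sum borel_measurable_integrable) auto
    have "AE x in lebesgue. \<forall>j\<in>{1..k}. deriv_norm j K (E j) x = deriv_norm j K (D j) x"
      using ae by (intro AE_finite_allI) auto
    then show "AE x in lebesgue. (\<Sum>j\<in>{1..k}. deriv_norm j K (E j) x powr p) = (\<Sum>j\<in>{1..k}. deriv_norm j K (D j) x powr p)"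
      by eventually_elim simp
  qed
  finally show "sobolev_seminorm k p K f = (LINT x|lebesgue. (\<Sum>j\<in>{1..k}. deriv_norm j K (D j) x powr p)) powr (1/p)"
    unfolding sobolev_seminorm_def E_def by simp
qed

lemma diff_powr_integrable:
  fixes f g :: "'e::euclidean_space \<Rightarrow> 'f::euclidean_space"
  assumes f: "set_integrable lebesgue K (\<lambda>x. norm (f x) powr p)" and g: "set_integrable lebesgue K (\<lambda>x. norm (g x) powr p)"
    and m: "(\<lambda>x. indicator K x *\<^sub>R f x) \<in> borel_measurable lebesgue" "(\<lambda>x. indicator K x *\<^sub>R g x) \<in> borel_measurable lebesgue"
    and p: "1 \<le> p"
  shows "set_integrable lebesgue K (\<lambda>x. norm (f x - g x) powr p)"
proof -
  have eq: "(\<lambda>x. indicator K x *\<^sub>R (norm (f x - g x) powr p)) = (\<lambda>x. norm (indicator K x *\<^sub>R f x - indicator K x *\<^sub>R g x) powr p)"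
    using p by (auto simp: indicator_def)
  have i: "integrable lebesgue (\<lambda>x. 2 powr p * (indicator K x *\<^sub>R (norm (f x) powr p) + indicator K x *\<^sub>R (norm (g x) powr p)))"
    using f g by (intro integrable_mult_right Bochner_Integration.integrable_add) (simp_all add: set_integrable_def)
  show ?thesis unfolding set_integrable_def eq
  proof (rule Bochner_Integration.integrable_bound[OF i])
    show "(\<lambda>x. norm (indicator K x *\<^sub>R f x - indicator K x *\<^sub>R g x) powr p) \<in> borel_measurable lebesgue"
      using m by (intro powr_real_measurable borel_measurable_norm borel_measurable_diff) auto
    show "AE x in lebesgue. norm (norm (indicator K x *\<^sub>R f x - indicator K x *\<^sub>R g x) powr p)
       \<le> norm (2 powr p * (indicator K x *\<^sub>R (norm (f x) powr p) + indicator K x *\<^sub>R (norm (g x) powr p)))"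
    proof (rule AE_I2)
      fix x
      \<comment> \<open>The two summands are indexed by truth values so that
        \<open>sum_powr_le\<close> applies and gives the factor \<open>2 powr p\<close>.\<close>
      have "norm (f x - g x) powr p \<le> (\<Sum>i\<in>{True, False}. if i then norm (f x) else norm (g x)) powr p"
        using p norm_triangle_ineq4[of "f x" "g x"] by (intro powr_mono2) auto
      also have "\<dots> \<le> real (card {True, False}) powr p * (\<Sum>i\<in>{True, False}. (if i then norm (f x) else norm (g x)) powr p)"
        using p by (intro sum_powr_le) auto
      finally show "norm (norm (indicator K x *\<^sub>R f x - indicator K x *\<^sub>R g x) powr p)
       \<le> norm (2 powr p * (indicator K x *\<^sub>R (norm (f x) powr p) + indicator K x *\<^sub>R (norm (g x) powr p)))"
        using p by (simp add: indicator_def)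
    qed
  qed
qed

lemma sobolev_data_diff:
  fixes f g :: "'e::euclidean_space \<Rightarrow> 'f::euclidean_space"
  assumes f: "sobolev_data k p K G f D" and g: "sobolev_data k p K G' g E" and K: "compact K" and p: "1 \<le> p"
  shows "sobolev_data k p K (G \<inter> G') (\<lambda>x. f x - g x) (\<lambda>j x vs. D j x vs - E j x vs)"
  unfolding sobolev_data_def
proof (intro conjI allI impI)
  show "open (G \<inter> G')" "K \<subseteq> G \<inter> G'" using f g by (auto simp: sobolev_data_def)
  fix j assume j: "j \<le> k"
  have D: "is_weak_derivative G j f (D j)" "K \<subseteq> G" "\<And>vs. length vs = j \<Longrightarrow> set_integrable lebesgue K (\<lambda>x. norm (D j x vs) powr p)"
    using f j by (auto simp: sobolev_data_def)
  have E: "is_weak_derivative G' j g (E j)" "K \<subseteq> G'" "\<And>vs. length vs = j \<Longrightarrow> set_integrable lebesgue K (\<lambda>x. norm (E j x vs) powr p)"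
    using g j by (auto simp: sobolev_data_def)
  show "is_weak_derivative (G \<inter> G') j (\<lambda>x. f x - g x) (\<lambda>x vs. D j x vs - E j x vs)"
    by (intro is_weak_derivative_diff is_weak_derivative_subset[OF D(1)] is_weak_derivative_subset[OF E(1)]) auto
  fix vs :: "'e list" assume vs: "length vs = j"
  show "set_integrable lebesgue K (\<lambda>x. norm (D j x vs - E j x vs) powr p)"
    by (rule diff_powr_integrable[OF D(3)[OF vs] E(3)[OF vs] indicator_weak_measurable[OF D(1) K D(2) vs]
        indicator_weak_measurable[OF E(1) K E(2) vs] p])
qed

lemma sobolev_on_diff:
  assumes "sobolev_on k p K f" "sobolev_on k p K g" "compact K" "1 \<le> p"
  shows "sobolev_on k p K (\<lambda>x. f x - g x)"
  using assms sobolev_data_diff unfolding sobolev_on_iff by (blast intro: continuous_on_diff)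

lemma deriv_norm_triangle:
  assumes "is_weak_derivative G j f D" "is_weak_derivative G' j g E" "is_weak_derivative G'' j h F" "K \<subseteq> G" "K \<subseteq> G'" "K \<subseteq> G''"
  shows "deriv_norm j K (\<lambda>x vs. D x vs - F x vs) x \<le> deriv_norm j K (\<lambda>x vs. D x vs - E x vs) x + deriv_norm j K (\<lambda>x vs. E x vs - F x vs) x"
  unfolding deriv_norm_def
proof (rule multilinear_norm_triangle)
  have m: "multilin j (\<lambda>vs. indicator K x *\<^sub>R D x vs)" "multilin j (\<lambda>vs. indicator K x *\<^sub>R E x vs)" "multilin j (\<lambda>vs. indicator K x *\<^sub>R F x vs)"
    by (rule indicator_weak_multilin[OF assms(1,4)] indicator_weak_multilin[OF assms(2,5)] indicator_weak_multilin[OF assms(3,6)])+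
  show "multilin j (\<lambda>vs. indicator K x *\<^sub>R (D x vs - E x vs))" "multilin j (\<lambda>vs. indicator K x *\<^sub>R (E x vs - F x vs))"
    unfolding scaleR_diff_right by (intro multilin_diff m)+
  fix vs
  have "D x vs - F x vs = (D x vs - E x vs) + (E x vs - F x vs)" by simp
  then have "norm (D x vs - F x vs) \<le> norm (D x vs - E x vs) + norm (E x vs - F x vs)" by (metis norm_triangle_ineq)
  then show "norm (indicator K x *\<^sub>R (D x vs - F x vs)) \<le> norm (indicator K x *\<^sub>R (D x vs - E x vs)) + norm (indicator K x *\<^sub>R (E x vs - F x vs))"
    by (auto simp: indicator_def)
qed

lemma deriv_norm_nonneg: "is_weak_derivative G j f D \<Longrightarrow> K \<subseteq> G \<Longrightarrow> 0 \<le> deriv_norm j K D x"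
  unfolding deriv_norm_def by (intro multilinear_norm_nonneg indicator_weak_multilin)

lemma sobolev_seminorm_triangle:
  assumes f: "sobolev_on k p K f" and g: "sobolev_on k p K g" and h: "sobolev_on k p K h" and K: "compact K" and p: "1 \<le> p"
  shows "sobolev_seminorm k p K (\<lambda>x. f x - h x) \<le>
    sobolev_seminorm k p K (\<lambda>x. f x - g x) + sobolev_seminorm k p K (\<lambda>x. g x - h x)"
proof -
  obtain G D where D: "sobolev_data k p K G f D" using f by (auto simp: sobolev_on_iff)
  obtain G' E where E: "sobolev_data k p K G' g E" using g by (auto simp: sobolev_on_iff)
  obtain G'' F where F: "sobolev_data k p K G'' h F" using h by (auto simp: sobolev_on_iff)
  note DE = sobolev_data_diff[OF D E K p] and EF = sobolev_data_diff[OF E F K p] and DF = sobolev_data_diff[OF D F K p]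
  note d = DE[unfolded sobolev_data_def] EF[unfolded sobolev_data_def] DF[unfolded sobolev_data_def]
  show ?thesis
    unfolding sobolev_seminorm_eq(1)[OF DE K p] sobolev_seminorm_eq(1)[OF EF K p] sobolev_seminorm_eq(1)[OF DF K p]
  proof (rule Minkowski_sum)
    fix j x assume "j \<in> {1..k}"
    then have j: "j \<le> k" by simp
    show "0 \<le> deriv_norm j K (\<lambda>x vs. D j x vs - E j x vs) x" using d(1) j by (intro deriv_norm_nonneg) blast+
    show "0 \<le> deriv_norm j K (\<lambda>x vs. E j x vs - F j x vs) x" using d(2) j by (intro deriv_norm_nonneg) blast+
    show "0 \<le> deriv_norm j K (\<lambda>x vs. D j x vs - F j x vs) x" using d(3) j by (intro deriv_norm_nonneg) blast+
    show "deriv_norm j K (\<lambda>x vs. D j x vs - F j x vs) x \<le> deriv_norm j K (\<lambda>x vs. D j x vs - E j x vs) x + deriv_norm j K (\<lambda>x vs. E j x vs - F j x vs) x"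
      using D E F j unfolding sobolev_data_def by (intro deriv_norm_triangle[of G j f _ G' g _ G'' h]) blast+
  qed (use p sobolev_seminorm_eq(2)[OF DE K p] sobolev_seminorm_eq(2)[OF EF K p] sobolev_seminorm_eq(2)[OF DF K p] in auto)
qed

section \<open>The sup-norm and the full Sobolev norm\<close>

lemma sup_norm_on_bdd:
  fixes f :: "'e::topological_space \<Rightarrow> 'f::real_normed_vector"
  assumes "compact K" "continuous_on K f"
  shows "bdd_above (insert 0 ((\<lambda>x. norm (f x)) ` K))"
proof -
  have "compact ((\<lambda>x. norm (f x)) ` K)" using assms by (intro compact_continuous_image continuous_intros)
  then show ?thesis by (simp add: compact_imp_bounded bounded_imp_bdd_above)
qed

lemma sup_norm_on_upper:
  fixes f :: "'e::topological_space \<Rightarrow> 'f::real_normed_vector"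
  assumes "compact K" "continuous_on K f" "x \<in> K"
  shows "norm (f x) \<le> sup_norm_on K f"
  unfolding sup_norm_on_def by (rule cSup_upper[OF _ sup_norm_on_bdd[OF assms(1,2)]]) (use assms in auto)

lemma sup_norm_on_nonneg:
  fixes f :: "'e::topological_space \<Rightarrow> 'f::real_normed_vector"
  assumes "compact K" "continuous_on K f"
  shows "0 \<le> sup_norm_on K f"
  unfolding sup_norm_on_def by (rule cSup_upper[OF _ sup_norm_on_bdd[OF assms(1,2)]]) auto

lemma sup_norm_on_least: "0 \<le> B \<Longrightarrow> (\<And>x. x \<in> K \<Longrightarrow> norm (f x) \<le> B) \<Longrightarrow> sup_norm_on K f \<le> B"
  unfolding sup_norm_on_def by (rule cSup_least) auto

lemma sobolev_seminorm_nonneg: "0 \<le> sobolev_seminorm k p K f"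
  by (simp add: sobolev_seminorm_def)

lemma sobolev_norm_triangle:
  assumes f: "sobolev_on k p K f" and g: "sobolev_on k p K g" and h: "sobolev_on k p K h" and K: "compact K" and p: "1 \<le> p"
  shows "sobolev_norm k p K (\<lambda>x. f x - h x) \<le>
    sobolev_norm k p K (\<lambda>x. f x - g x) + sobolev_norm k p K (\<lambda>x. g x - h x)"
proof -
  have c: "continuous_on K f" "continuous_on K g" "continuous_on K h" using f g h by (auto simp: sobolev_on_iff)
  have "sup_norm_on K (\<lambda>x. f x - h x) \<le> sup_norm_on K (\<lambda>x. f x - g x) + sup_norm_on K (\<lambda>x. g x - h x)"
  proof (rule sup_norm_on_least)
    show "0 \<le> sup_norm_on K (\<lambda>x. f x - g x) + sup_norm_on K (\<lambda>x. g x - h x)"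
      using c by (intro add_nonneg_nonneg sup_norm_on_nonneg K continuous_intros)
    fix x assume x: "x \<in> K"
    have "norm (f x - h x) \<le> norm (f x - g x) + norm (g x - h x)"
      using norm_triangle_ineq[of "f x - g x" "g x - h x"] by simp
    also have "\<dots> \<le> sup_norm_on K (\<lambda>x. f x - g x) + sup_norm_on K (\<lambda>x. g x - h x)"
      using c x by (intro add_mono sup_norm_on_upper[OF K] continuous_intros)
    finally show "norm (f x - h x) \<le> sup_norm_on K (\<lambda>x. f x - g x) + sup_norm_on K (\<lambda>x. g x - h x)" .
  qed
  then show ?thesis using sobolev_seminorm_triangle[OF assms] by (simp add: sobolev_norm_def)
qed

lemma sobolev_norm_0:
  fixes K :: "'e::euclidean_space set"
  assumes K: "compact K" and p: "1 \<le> p"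
  shows "sobolev_norm k p K (\<lambda>x. (0::'f::euclidean_space)) = 0"
proof -
  have ddl: "dir_deriv vs (\<lambda>_::'e. 0::'f) = (\<lambda>_. 0)" for vs by (induction vs) auto
  have "sobolev_data k p K UNIV (\<lambda>x. (0::'f)) (\<lambda>j x vs. 0)"
    unfolding sobolev_data_def using p weak_derivative_smooth[OF open_UNIV smooth_on_const[of "UNIV::'e set" "0::'f"]]
    by (simp add: ddl set_integrable_def)
  from sobolev_seminorm_eq(1)[OF this K p]
  have "sobolev_seminorm k p K (\<lambda>x. (0::'f)) = 0"
    using p by (simp add: deriv_norm_def multilinear_norm_0)
  moreover have "sup_norm_on K (\<lambda>x. 0::'f) = 0"
  proof -
    have "insert 0 ((\<lambda>x. norm (0::'f)) ` K) = {0}" by auto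
    then show ?thesis by (simp only: sup_norm_on_def cSup_singleton)
  qed
  ultimately show ?thesis by (simp add: sobolev_norm_def)
qed

section \<open>Limits of weak derivatives\<close>

lemma AE_summable_norm:
  fixes f :: "nat \<Rightarrow> 'x \<Rightarrow> 'f::euclidean_space"
  assumes f: "\<And>n. integrable M (f n)" and s: "summable (\<lambda>n. LINT x|M. norm (f n x))"
  shows "AE x in M. summable (\<lambda>n. norm (f n x))"
    and "integrable M (\<lambda>x. \<Sum>n. norm (f n x))"
proof -
  have [measurable]: "f n \<in> borel_measurable M" for n using f by auto
  have "(\<integral>\<^sup>+x. (\<Sum>n. ennreal (norm (f n x))) \<partial>M) = (\<Sum>n. \<integral>\<^sup>+x. ennreal (norm (f n x)) \<partial>M)"
    by (rule nn_integral_suminf) auto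
  also have "\<dots> = (\<Sum>n. ennreal (LINT x|M. norm (f n x)))"
    using f by (intro suminf_cong nn_integral_eq_integral) auto
  also have "\<dots> \<noteq> top"
    using s by (intro ennreal_suminf_neq_top) (auto intro!: integral_nonneg_AE)
  finally have "AE x in M. (\<Sum>n. ennreal (norm (f n x))) \<noteq> \<infinity>"
    by (intro nn_integral_PInf_AE) auto
  then show ae: "AE x in M. summable (\<lambda>n. norm (f n x))"
    by eventually_elim (auto intro: summable_suminf_not_top)
  show "integrable M (\<lambda>x. \<Sum>n. norm (f n x))"
    by (rule integrable_suminf) (use f ae s in auto)
qed

text \<open>Summable L^1 differences force almost-everywhere convergence on basis lists, under one
  integrable bound. In the defining identity the side with the derivatives then passes to the limit
  by dominated convergence, the other side by uniform convergence of the functions.\<close>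

lemma weak_derivative_limit:
  fixes u :: "nat \<Rightarrow> 'e::euclidean_space \<Rightarrow> 'f::euclidean_space"
  assumes G: "open G" and wd: "\<And>n. is_weak_derivative G j (u n) (D n)"
    and int: "\<And>n bs. bs \<in> basis_lists j \<Longrightarrow> set_integrable lebesgue G (\<lambda>x. D n x bs)"
    and summ: "\<And>bs. bs \<in> basis_lists j \<Longrightarrow> summable (\<lambda>n. LINT x:G|lebesgue. norm (D (Suc n) x bs - D n x bs))"
    and unif: "uniform_limit G u v sequentially" and v: "locally_integrable_on v G"
  obtains E where "is_weak_derivative G j v E"
    "AE x in lebesgue. x \<in> G \<longrightarrow> (\<forall>vs. length vs = j \<longrightarrow> (\<lambda>n. D n x vs) \<longlonglongrightarrow> E x vs)"
    "\<And>vs. length vs = j \<Longrightarrow> set_integrable lebesgue G (\<lambda>x. E x vs)"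
proof -
  define d where "d n vs x = indicator G x *\<^sub>R D n x vs" for n vs x
  have ml: "multilin j (D n x)" if "x \<in> G" for n x
    using wd that by (auto simp: is_weak_derivative_iff intro: sym_multilinear_imp_multilin)
  have dexp: "d n vs x = (\<Sum>bs\<in>basis_lists j. prod_list (map2 (\<bullet>) vs bs) *\<^sub>R d n bs x)" if "length vs = j" for n vs x
  proof (cases "x \<in> G")
    case True
    then show ?thesis using multilin_expand[OF ml[OF True] that] by (simp add: d_def)
  qed (simp add: d_def)
  have dint: "integrable lebesgue (d n bs)" if "bs \<in> basis_lists j" for n bs
    using int[OF that] unfolding set_integrable_def d_def .
  have dint': "integrable lebesgue (d n vs)" if "length vs = j" for n vs
  proof -
    have "integrable lebesgue (\<lambda>x. \<Sum>bs\<in>basis_lists j. prod_list (map2 (\<bullet>) vs bs) *\<^sub>R d n bs x)"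
      using dint by (intro Bochner_Integration.integrable_sum integrable_scaleR_right) auto
    then show ?thesis using dexp[OF that] by (metis (no_types, lifting) Bochner_Integration.integrable_cong)
  qed
  have dsum: "summable (\<lambda>n. LINT x|lebesgue. norm (d (Suc n) bs x - d n bs x))" if "bs \<in> basis_lists j" for bs
  proof -
    have "(\<lambda>x. indicator G x *\<^sub>R norm (D (Suc n) x bs - D n x bs)) = (\<lambda>x. norm (d (Suc n) bs x - d n bs x))" for n
      by (auto simp: d_def indicator_def)
    then show ?thesis using summ[OF that] by (simp add: set_lebesgue_integral_def)
  qed
  \<comment> \<open>Telescoping shows that this function dominates the entire sequence at every
    point where the sum converges.\<close>
  define W where "W bs x = norm (d 0 bs x) + (\<Sum>n. norm (d (Suc n) bs x - d n bs x))" for bs x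
  have diffint: "integrable lebesgue (\<lambda>x. d (Suc n) bs x - d n bs x)" if "bs \<in> basis_lists j" for bs n
    using dint[OF that] by (intro Bochner_Integration.integrable_diff)
  have Wint: "integrable lebesgue (W bs)" if "bs \<in> basis_lists j" for bs
    unfolding W_def using dint[OF that] AE_summable_norm(2)[OF diffint[OF that] dsum[OF that]]
    by (intro Bochner_Integration.integrable_add integrable_norm)
  have "AE x in lebesgue. \<forall>bs\<in>basis_lists j. summable (\<lambda>n. norm (d (Suc n) bs x - d n bs x))"
    using AE_summable_norm(1)[OF diffint dsum] by (intro AE_finite_allI) auto
  moreover have "Cauchy (\<lambda>n. d n bs x) \<and> (\<forall>n. norm (d n bs x) \<le> W bs x)"
    if s: "summable (\<lambda>n. norm (d (Suc n) bs x - d n bs x))" for bs x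
  proof -
    have tele: "d n bs x = d 0 bs x + (\<Sum>i<n. d (Suc i) bs x - d i bs x)" for n
      using sum_lessThan_telescope[of "\<lambda>i. d i bs x" n] by (simp add: algebra_simps)
    have "summable (\<lambda>n. d (Suc n) bs x - d n bs x)" by (rule summable_norm_cancel[OF s])
    then have "convergent (\<lambda>n. d 0 bs x + (\<Sum>i<n. d (Suc i) bs x - d i bs x))"
      by (intro convergent_add convergent_const) (simp add: summable_iff_convergent)
    then have "Cauchy (\<lambda>n. d n bs x)" unfolding tele[symmetric] by (rule convergent_Cauchy)
    moreover have "norm (d n bs x) \<le> W bs x" for n
    proof -
      have "norm (d n bs x) \<le> norm (d 0 bs x) + norm (\<Sum>i<n. d (Suc i) bs x - d i bs x)"
        by (subst tele) (rule norm_triangle_ineq)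
      also have "norm (\<Sum>i<n. d (Suc i) bs x - d i bs x) \<le> (\<Sum>i<n. norm (d (Suc i) bs x - d i bs x))"
        by (rule norm_sum)
      also have "\<dots> \<le> (\<Sum>i. norm (d (Suc i) bs x - d i bs x))"
        by (rule sum_le_suminf[OF s]) auto
      finally show ?thesis by (simp add: W_def)
    qed
    ultimately show ?thesis by blast
  qed
  ultimately have good: "AE x in lebesgue. \<forall>bs\<in>basis_lists j. Cauchy (\<lambda>n. d n bs x) \<and> (\<forall>n. norm (d n bs x) \<le> W bs x)"
    by (auto elim!: eventually_mono)
  define good where "good x \<longleftrightarrow> (\<forall>bs\<in>basis_lists j. Cauchy (\<lambda>n. d n bs x))" for x
  have conv: "convergent (\<lambda>n. d n vs x)" if "good x" "length vs = j" for vs x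
  proof -
    have gx: "good x" by fact
    have "convergent (\<lambda>n. \<Sum>bs\<in>basis_lists j. prod_list (map2 (\<bullet>) vs bs) *\<^sub>R d n bs x)"
    proof (rule convergent_sum)
      fix bs :: "'e list" assume "bs \<in> basis_lists j"
      then obtain l where "(\<lambda>n. d n bs x) \<longlonglongrightarrow> l" using gx by (auto simp: good_def Cauchy_convergent_iff convergent_def)
      then show "convergent (\<lambda>n. prod_list (map2 (\<bullet>) vs bs) *\<^sub>R d n bs x)"
        unfolding convergent_def by (intro exI) (rule tendsto_scaleR[OF tendsto_const])
    qed
    then show ?thesis unfolding dexp[OF that(2)] .
  qed
  \<comment> \<open>The value 0 at points without convergence keeps \<open>E x\<close> symmetric and
    multilinear at every point of \<open>G\<close>, as the definition of a weak derivative
    demands.\<close>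
  define E where "E x vs = (if good x then lim (\<lambda>n. d n vs x) else 0)" for x vs
  have lim: "(\<lambda>n. d n vs x) \<longlonglongrightarrow> E x vs" if "good x" "length vs = j" for vs x
    using conv[OF that] that by (simp add: E_def convergent_LIMSEQ_iff)
  have symE: "sym_multilinear j (E x)" if x: "x \<in> G" for x
  proof (cases "good x")
    case True
    have symD: "sym_multilinear j (\<lambda>vs. d n vs x)" for n
    proof -
      have "sym_multilinear j (D n x)" using wd[of n] x unfolding is_weak_derivative_iff by blast
      then show ?thesis using x by (simp add: d_def)
    qed
    show ?thesis unfolding sym_multilinear_def
    proof (intro conjI allI impI; elim conjE)
      fix vs ws :: "'e list" assume "length vs = j" "mset ws = mset vs"
      then have "d n ws x = d n vs x" for n
        using symD[of n] unfolding sym_multilinear_def by blast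
      then show "E x ws = E x vs" by (simp add: E_def)
    next
      fix vs :: "'e list" and i assume vs: "length vs = j" "i < j"
      have l: "linear (\<lambda>v. d n (vs[i := v]) x)" for n using symD vs by (simp add: sym_multilinear_def)
      have lm: "(\<lambda>n. d n (vs[i := v]) x) \<longlonglongrightarrow> E x (vs[i := v])" for v
        using vs by (intro lim True) simp
      show "linear (\<lambda>v. E x (vs[i := v]))"
      proof (rule linearI)
        fix a b
        have "(\<lambda>n. d n (vs[i := a + b]) x) \<longlonglongrightarrow> E x (vs[i := a]) + E x (vs[i := b])"
          unfolding linear_add[OF l] by (intro tendsto_add lm)
        then show "E x (vs[i := a + b]) = E x (vs[i := a]) + E x (vs[i := b])"
          using LIMSEQ_unique lm by blast
      next
        fix c a
        have "(\<lambda>n. d n (vs[i := c *\<^sub>R a]) x) \<longlonglongrightarrow> c *\<^sub>R E x (vs[i := a])"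
          unfolding linear_cmul[OF l] by (intro tendsto_scaleR tendsto_const lm)
        then show "E x (vs[i := c *\<^sub>R a]) = c *\<^sub>R E x (vs[i := a])"
          using LIMSEQ_unique lm by blast
      qed
    qed
  next
    case False
    then show ?thesis by (simp add: sym_multilinear_def E_def linear_zero)
  qed
  have goodm: "{x \<in> space lebesgue. good x} \<in> sets lebesgue"
    unfolding good_def
  proof (intro sets.sets_Collect_finite_All)
    show "{x \<in> space lebesgue. Cauchy (\<lambda>n. d n bs x)} \<in> sets lebesgue" if "bs \<in> basis_lists j" for bs
      using dint[OF that] by (intro sets_Collect_Cauchy borel_measurable_integrable)
  qed simp
  have Em: "(\<lambda>x. E x vs) \<in> borel_measurable lebesgue" if "length vs = j" for vs
    unfolding E_def using dint'[OF that] goodm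
    by (intro measurable_If borel_measurable_lim_metric borel_measurable_integrable) auto
  define c where "c vs = (\<Sum>bs\<in>basis_lists j. \<bar>prod_list (map2 (\<bullet>) vs bs)\<bar>)" for vs :: "'e list"
  define V where "V x = (\<Sum>bs\<in>basis_lists j. W bs x)" for x
  have Vint: "integrable lebesgue V" unfolding V_def using Wint by (intro Bochner_Integration.integrable_sum)
  have dom: "AE x in lebesgue. good x \<and> (\<forall>n vs. length vs = j \<longrightarrow> norm (d n vs x) \<le> c vs * V x)"
    using good
  proof eventually_elim
    case (elim x)
    have "norm (d n vs x) \<le> c vs * V x" if "length vs = j" for n vs
    proof -
      have "norm (d n vs x) \<le> (\<Sum>bs\<in>basis_lists j. norm (prod_list (map2 (\<bullet>) vs bs) *\<^sub>R d n bs x))"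
        by (subst dexp[OF that]) (rule norm_sum)
      also have "\<dots> \<le> (\<Sum>bs\<in>basis_lists j. \<bar>prod_list (map2 (\<bullet>) vs bs)\<bar> * V x)"
      proof (rule sum_mono)
        fix bs :: "'e list" assume bs: "bs \<in> basis_lists j"
        have nn: "0 \<le> W b x" if "b \<in> basis_lists j" for b using elim that norm_ge_zero order_trans by blast
        have "norm (d n bs x) \<le> W bs x" using elim bs by blast
        also have "\<dots> \<le> V x" unfolding V_def using bs nn by (intro member_le_sum) auto
        finally show "norm (prod_list (map2 (\<bullet>) vs bs) *\<^sub>R d n bs x) \<le> \<bar>prod_list (map2 (\<bullet>) vs bs)\<bar> * V x"
          by (simp add: mult_left_mono)
      qed
      finally show ?thesis by (simp add: c_def sum_distrib_right)
    qed
    then show ?case using elim by (simp add: good_def)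
  qed
  have E_out: "indicator G x *\<^sub>R E x vs = E x vs" if "length vs = j" for x vs
  proof (cases "x \<in> G \<or> \<not> good x")
    case False
    then have "(\<lambda>n. 0) \<longlonglongrightarrow> E x vs" using lim[of x vs] that by (simp add: d_def)
    then have "E x vs = 0" by (simp add: LIMSEQ_const_iff)
    then show ?thesis by simp
  qed (auto simp: E_def)
  have Eint: "integrable lebesgue (\<lambda>x. E x vs)" if "length vs = j" for vs
  proof (rule integrable_dominated_convergence[where s="\<lambda>n. d n vs" and w="\<lambda>x. c vs * V x"])
    show "(\<lambda>x. E x vs) \<in> borel_measurable lebesgue" by (rule Em[OF that])
    show "d n vs \<in> borel_measurable lebesgue" for n using dint'[OF that] by (rule borel_measurable_integrable)
    show "integrable lebesgue (\<lambda>x. c vs * V x)" using Vint by (rule integrable_mult_right)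
    show "AE x in lebesgue. (\<lambda>n. d n vs x) \<longlonglongrightarrow> E x vs"
      using dom by eventually_elim (use lim that in blast)
    show "AE x in lebesgue. norm (d n vs x) \<le> c vs * V x" for n
      using dom by eventually_elim (use that in blast)
  qed
  have wdE: "is_weak_derivative G j v E"
    unfolding is_weak_derivative_iff
  proof (intro conjI allI impI ballI v symE)
    fix vs :: "'e list" assume vs: "length vs = j"
    show Eloc: "locally_integrable_on (\<lambda>x. E x vs) G"
      unfolding locally_integrable_on_def
    proof (intro allI impI, elim conjE)
      fix K assume "compact K" "K \<subseteq> G"
      then show "set_integrable lebesgue K (\<lambda>x. E x vs)"
        unfolding set_integrable_def using borel_compact[of K]
        by (intro integrable_mult_indicator Eint vs) auto
    qed
    fix \<eta> :: "'e \<Rightarrow> real" assume \<eta>: "test_function G \<eta>"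
    obtain B where B: "B > 0" "\<And>x. \<bar>\<eta> x\<bar> \<le> B" using test_function_bounded[OF \<eta>] by blast
    have \<eta>m: "\<eta> \<in> borel_measurable lebesgue"
      using test_function_measurable[OF \<eta>] by (intro measurable_completion) simp
    have \<eta>0: "\<eta> x = 0" if "x \<notin> G" for x using \<eta> that by (auto simp: test_function_def)
    have "(\<lambda>n. LINT x|lebesgue. \<eta> x *\<^sub>R d n vs x) \<longlonglongrightarrow> (LINT x|lebesgue. \<eta> x *\<^sub>R E x vs)"
    proof (rule integral_dominated_convergence[where w="\<lambda>x. B * (c vs * V x)"])
      show "(\<lambda>x. \<eta> x *\<^sub>R E x vs) \<in> borel_measurable lebesgue" by (intro borel_measurable_scaleR \<eta>m Em vs)
      show "(\<lambda>x. \<eta> x *\<^sub>R d n vs x) \<in> borel_measurable lebesgue" for n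
        using dint'[OF vs] by (intro borel_measurable_scaleR \<eta>m borel_measurable_integrable)
      show "integrable lebesgue (\<lambda>x. B * (c vs * V x))" using Vint by (intro integrable_mult_right)
      show "AE x in lebesgue. (\<lambda>n. \<eta> x *\<^sub>R d n vs x) \<longlonglongrightarrow> \<eta> x *\<^sub>R E x vs"
        using dom by eventually_elim (intro tendsto_scaleR tendsto_const lim vs, blast)
      show "AE x in lebesgue. norm (\<eta> x *\<^sub>R d n vs x) \<le> B * (c vs * V x)" for n
        using dom
      proof eventually_elim
        case (elim x)
        then show ?case using B vs by (auto intro!: mult_mono)
      qed
    qed
    moreover have "(\<lambda>x. \<eta> x *\<^sub>R d n vs x) = (\<lambda>x. \<eta> x *\<^sub>R D n x vs)" for n
      using \<eta>0 by (auto simp: d_def indicator_def fun_eq_iff)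
    ultimately have "(\<lambda>n. LINT x|lebesgue. \<eta> x *\<^sub>R D n x vs) \<longlonglongrightarrow> (LINT x|lebesgue. \<eta> x *\<^sub>R E x vs)" by simp
    then have R: "(\<lambda>n. (-1) ^ j *\<^sub>R (LINT x|lebesgue. \<eta> x *\<^sub>R D n x vs)) \<longlonglongrightarrow> (-1) ^ j *\<^sub>R (LINT x|lebesgue. \<eta> x *\<^sub>R E x vs)"
      by (intro tendsto_scaleR tendsto_const)
    have wdn: "(LINT x|lebesgue. dir_deriv vs \<eta> x *\<^sub>R u n x) = (-1) ^ j *\<^sub>R (LINT x|lebesgue. \<eta> x *\<^sub>R D n x vs)"
      "locally_integrable_on (u n) G" for n
      using wd[of n] vs \<eta> unfolding is_weak_derivative_iff by blast+
    have t': "test_function G (dir_deriv vs \<eta>)" by (rule test_function_dir_deriv[OF \<eta>])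
    have t'int: "integrable lborel (dir_deriv vs \<eta>)"
    proof -
      obtain L where L: "smooth_on UNIV (dir_deriv vs \<eta>)" "compact L" "\<And>x. x \<notin> L \<Longrightarrow> dir_deriv vs \<eta> x = 0"
        using t' unfolding test_function_def by blast
      show ?thesis by (rule smooth_compact_support_integrable[OF smooth_on_continuous[OF L(1)] L(2,3)])
    qed
    then have t'int: "integrable lebesgue (\<lambda>x. \<bar>dir_deriv vs \<eta> x\<bar>)"
      by (subst integrable_completion) auto
    have L: "(\<lambda>n. LINT x|lebesgue. dir_deriv vs \<eta> x *\<^sub>R u n x) \<longlonglongrightarrow> (LINT x|lebesgue. dir_deriv vs \<eta> x *\<^sub>R v x)"
    proof (rule LIMSEQ_I)
      fix r :: real assume r: "r > 0"
      define I where "I = (LINT x|lebesgue. \<bar>dir_deriv vs \<eta> x\<bar>)"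
      have I: "I \<ge> 0" unfolding I_def by (intro integral_nonneg_AE) auto
      define e where "e = r / (I + 1)"
      have e: "e > 0" using r I by (simp add: e_def)
      have "\<forall>\<^sub>F n in sequentially. \<forall>x\<in>G. dist (u n x) (v x) < e" using unif e by (simp add: uniform_limit_iff)
      then obtain N where N: "\<And>n x. n \<ge> N \<Longrightarrow> x \<in> G \<Longrightarrow> dist (u n x) (v x) < e" by (auto simp: eventually_sequentially)
      have "norm ((LINT x|lebesgue. dir_deriv vs \<eta> x *\<^sub>R u n x) - (LINT x|lebesgue. dir_deriv vs \<eta> x *\<^sub>R v x)) < r" if "n \<ge> N" for n
      proof -
        note i = test_integrable[OF t' wdn(2)] test_integrable[OF t' v]
        have "(LINT x|lebesgue. dir_deriv vs \<eta> x *\<^sub>R u n x) - (LINT x|lebesgue. dir_deriv vs \<eta> x *\<^sub>R v x)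
           = (LINT x|lebesgue. dir_deriv vs \<eta> x *\<^sub>R (u n x - v x))"
          using i by (simp add: scaleR_diff_right)
        also have "norm \<dots> \<le> (LINT x|lebesgue. e * \<bar>dir_deriv vs \<eta> x\<bar>)"
        proof (rule order_trans[OF integral_norm_bound integral_mono])
          show "integrable lebesgue (\<lambda>x. norm (dir_deriv vs \<eta> x *\<^sub>R (u n x - v x)))"
            unfolding scaleR_diff_right by (intro integrable_norm Bochner_Integration.integrable_diff i)
          show "integrable lebesgue (\<lambda>x. e * \<bar>dir_deriv vs \<eta> x\<bar>)" using t'int by simp
          fix x
          show "norm (dir_deriv vs \<eta> x *\<^sub>R (u n x - v x)) \<le> e * \<bar>dir_deriv vs \<eta> x\<bar>"
          proof (cases "x \<in> G")
            case True
            then have "norm (u n x - v x) \<le> e" using N[OF that True] by (simp add: dist_norm)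
            then show ?thesis by (simp add: mult.commute[of e] mult_left_mono)
          next
            case False
            then have "dir_deriv vs \<eta> x = 0" using t' by (auto simp: test_function_def)
            then show ?thesis by simp
          qed
        qed
        also have "\<dots> = e * I" by (simp add: I_def)
        also have "\<dots> < e * (I + 1)" using e by simp
        also have "\<dots> = r" using I by (simp add: e_def)
        finally show ?thesis .
      qed
      then show "\<exists>N. \<forall>n\<ge>N. norm ((LINT x|lebesgue. dir_deriv vs \<eta> x *\<^sub>R u n x) - (LINT x|lebesgue. dir_deriv vs \<eta> x *\<^sub>R v x)) < r" by blast
    qed
    show "(LINT x|lebesgue. dir_deriv vs \<eta> x *\<^sub>R v x) = (-1) ^ j *\<^sub>R (LINT x|lebesgue. \<eta> x *\<^sub>R E x vs)"
      using LIMSEQ_unique[OF L] R unfolding wdn(1) by blast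
  qed
  have "AE x in lebesgue. x \<in> G \<longrightarrow> (\<forall>vs. length vs = j \<longrightarrow> (\<lambda>n. D n x vs) \<longlonglongrightarrow> E x vs)"
    using dom
  proof eventually_elim
    case (elim x)
    then show ?case using lim[of x] by (auto simp: d_def)
  qed
  moreover have "set_integrable lebesgue G (\<lambda>x. E x vs)" if "length vs = j" for vs
    unfolding set_integrable_def E_out[OF that] by (rule Eint[OF that])
  ultimately show thesis using that wdE by blast
qed

section \<open>Limits in the Sobolev norm\<close>

lemma weak_derivative_0:
  assumes "locally_integrable_on f G"
  shows "is_weak_derivative G 0 f (\<lambda>x vs. f x)"
  using assms by (auto simp: is_weak_derivative_iff sym_multilinear_def)

lemma set_integrable_continuous_compact:
  fixes w :: "'e::euclidean_space \<Rightarrow> 'f::euclidean_space"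
  assumes "compact K" "continuous_on K w"
  shows "set_integrable lebesgue K w"
  using locally_integrable_continuous[OF assms(2)] assms(1) by (simp add: locally_integrable_on_def)

lemma deriv_norm_bound:
  assumes D: "is_weak_derivative G j f D" "K \<subseteq> G" and vs: "length vs = j"
  shows "norm (indicator K x *\<^sub>R D x vs) \<le> (\<Sum>bs\<in>basis_lists j. \<bar>prod_list (map2 (\<bullet>) vs bs)\<bar>) * deriv_norm j K D x"
proof -
  have ml: "multilin j (\<lambda>vs. indicator K x *\<^sub>R D x vs)" by (rule indicator_weak_multilin[OF D])
  have "norm (indicator K x *\<^sub>R D x vs) \<le> (\<Sum>bs\<in>basis_lists j. norm (prod_list (map2 (\<bullet>) vs bs) *\<^sub>R (indicator K x *\<^sub>R D x bs)))"
    by (subst multilin_expand[OF ml vs]) (rule norm_sum)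
  also have "\<dots> \<le> (\<Sum>bs\<in>basis_lists j. \<bar>prod_list (map2 (\<bullet>) vs bs)\<bar> * deriv_norm j K D x)"
  proof (rule sum_mono)
    fix bs :: "'a list" assume "bs \<in> basis_lists j"
    then have "norm (indicator K x *\<^sub>R D x bs) \<le> deriv_norm j K D x"
      unfolding deriv_norm_def by (intro multilinear_norm_upper[OF ml] basis_lists_unit)
    then show "norm (prod_list (map2 (\<bullet>) vs bs) *\<^sub>R (indicator K x *\<^sub>R D x bs)) \<le> \<bar>prod_list (map2 (\<bullet>) vs bs)\<bar> * deriv_norm j K D x"
      by (subst norm_scaleR) (rule mult_left_mono, auto)
  qed
  finally show ?thesis by (simp add: sum_distrib_right)
qed

lemma powr_integrable_if_deriv_norm:
  assumes D: "is_weak_derivative G j f D" "compact K" "K \<subseteq> G" and p: "1 \<le> p" and vs: "length vs = j"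
    and int: "integrable lebesgue (\<lambda>x. deriv_norm j K D x powr p)"
  shows "set_integrable lebesgue K (\<lambda>x. norm (D x vs) powr p)"
proof -
  define c where "c = (\<Sum>bs\<in>basis_lists j. \<bar>prod_list (map2 (\<bullet>) vs bs)\<bar>)"
  have c: "c \<ge> 0" by (simp add: c_def sum_nonneg)
  have eq: "(\<lambda>x. indicator K x *\<^sub>R norm (D x vs) powr p) = (\<lambda>x. norm (indicator K x *\<^sub>R D x vs) powr p)"
    using p by (auto simp: indicator_def)
  show ?thesis unfolding set_integrable_def eq
  proof (rule Bochner_Integration.integrable_bound[OF integrable_mult_right[OF int, of "c powr p"]])
    show "(\<lambda>x. norm (indicator K x *\<^sub>R D x vs) powr p) \<in> borel_measurable lebesgue"
      by (rule powr_real_measurable[OF measurable_compose[OF indicator_weak_measurable[OF D vs] borel_measurable_norm] borel_measurable_const])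
    show "AE x in lebesgue. norm (norm (indicator K x *\<^sub>R D x vs) powr p) \<le> norm (c powr p * deriv_norm j K D x powr p)"
    proof (rule AE_I2)
      fix x
      have "norm (indicator K x *\<^sub>R D x vs) powr p \<le> (c * deriv_norm j K D x) powr p"
        using deriv_norm_bound[OF D(1,3) vs] p unfolding c_def by (intro powr_mono2) auto
      then show "norm (norm (indicator K x *\<^sub>R D x vs) powr p) \<le> norm (c powr p * deriv_norm j K D x powr p)"
        by (simp add: powr_mult)
    qed
  qed
qed

text \<open>The bound is the exact geometric sum of the steps. With the subtracted term the
  induction closes, and dropping that term afterwards leaves
  \<open>2 * b * (1/2) ^ n\<close>.\<close>

lemma geometric_chain:
  fixes N :: "nat \<Rightarrow> nat \<Rightarrow> real"
  assumes tri: "\<And>i j l. N i l \<le> N i j + N j l" and 0: "\<And>i. N i i = 0" and step: "\<And>n. N n (Suc n) \<le> b * (1/2) ^ n"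
  shows "N n (n + m) \<le> 2 * b * (1/2) ^ n - 2 * b * (1/2) ^ (n + m)"
proof (induction m)
  case (Suc m)
  have "N n (n + Suc m) \<le> N n (n + m) + N (n + m) (Suc (n + m))" using tri[of n "Suc (n + m)" "n + m"] by simp
  also have "\<dots> \<le> (2 * b * (1/2) ^ n - 2 * b * (1/2) ^ (n + m)) + b * (1/2) ^ (n + m)"
    by (intro add_mono Suc step)
  finally show ?case by simp
qed (simp add: 0)

text \<open>On a set of finite measure the L^1 norm is controlled by the L^p norm. Taking the bound
  \<open>s\<close> on the L^p norm as the parameter of \<open>le_add_powr\<close> makes the final
  estimate linear in \<open>s\<close>, so that summability of the steps carries over.\<close>

lemma integral_norm_le_powr:
  fixes g h :: "'x \<Rightarrow> real"
  assumes h: "integrable M h" "integrable M (\<lambda>x. g x powr p)" and le: "AE x in M. 0 \<le> h x \<and> h x \<le> g x"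
    and S: "S \<in> sets M" "emeasure M S < \<infinity>" "\<And>x. x \<notin> S \<Longrightarrow> h x = 0"
    and p: "1 \<le> p" and s: "0 < s" "(LINT x|M. g x powr p) \<le> s powr p"
  shows "integral\<^sup>L M h \<le> s * (measure M S + 1)"
proof -
  have "integral\<^sup>L M h \<le> (LINT x|M. s * indicator S x + s powr (1 - p) * g x powr p)"
  proof (rule integral_mono_AE[OF h(1)])
    show "integrable M (\<lambda>x. s * indicator S x + s powr (1 - p) * g x powr p)"
      using S h(2) by (intro Bochner_Integration.integrable_add integrable_mult_right integrable_real_indicator)
    show "AE x in M. h x \<le> s * indicator S x + s powr (1 - p) * g x powr p"
      using le
    proof eventually_elim
      case (elim x)
      show ?case
      proof (cases "x \<in> S")
        case True
        have "g x \<le> s + s powr (1 - p) * g x powr p" using elim s p by (intro le_add_powr) auto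
        then show ?thesis using elim True by simp
      next
        case False
        then show ?thesis using S(3) by simp
      qed
    qed
  qed
  also have "\<dots> = s * measure M S + s powr (1 - p) * (LINT x|M. g x powr p)"
    using S h(2) by (subst Bochner_Integration.integral_add) (auto intro: integrable_mult_right integrable_real_indicator)
  also have "\<dots> \<le> s * measure M S + s powr (1 - p) * s powr p"
    using s by (intro add_left_mono mult_left_mono) auto
  also have "s powr (1 - p) * s powr p = s" using s by (simp flip: powr_add)
  finally show ?thesis by (simp add: algebra_simps)
qed

text \<open>Fatou's lemma, in the form used for uniform bounds on integrals of real
  functions.\<close>

lemma nn_integral_le_limit:
  fixes S :: "nat \<Rightarrow> 'x \<Rightarrow> real"
  assumes meas: "\<And>m. S m \<in> borel_measurable M" and lim: "AE x in M. (\<lambda>m. S m x) \<longlonglongrightarrow> L x"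
    and le: "\<And>m. (\<integral>\<^sup>+x. ennreal (S m x) \<partial>M) \<le> C"
  shows "(\<integral>\<^sup>+x. ennreal (L x) \<partial>M) \<le> C"
proof -
  have "(\<integral>\<^sup>+x. ennreal (L x) \<partial>M) = (\<integral>\<^sup>+x. liminf (\<lambda>m. ennreal (S m x)) \<partial>M)"
  proof (rule nn_integral_cong_AE)
    show "AE x in M. ennreal (L x) = liminf (\<lambda>m. ennreal (S m x))"
      using lim
    proof eventually_elim
      case (elim x)
      then have "(\<lambda>m. ennreal (S m x)) \<longlonglongrightarrow> ennreal (L x)" by (rule tendsto_ennrealI)
      then show ?case by (intro lim_imp_Liminf[symmetric]) auto
    qed
  qed
  also have "\<dots> \<le> liminf (\<lambda>m. \<integral>\<^sup>+x. ennreal (S m x) \<partial>M)"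
    using meas by (intro nn_integral_liminf) auto
  also have "\<dots> \<le> C" using le by (intro Liminf_le) auto
  finally show ?thesis .
qed

text \<open>The limit has weak derivatives only in the interior of \<open>K'\<close>, so membership
  and the norm bound are claimed on the smaller \<open>K\<close>, while continuity and the sup-bound
  hold on all of \<open>K'\<close>. The steps add up to \<open>2 * b\<close> in the sup-norm and
  again in the seminorm, in total \<open>4 * b\<close>.\<close>

lemma sobolev_limit:
  fixes u :: "nat \<Rightarrow> 'e::euclidean_space \<Rightarrow> 'f::euclidean_space"
  assumes K: "compact K" "compact K'" "K \<subseteq> interior K'" and p: "1 \<le> p" and b: "0 < b"
    and u: "\<And>n. sobolev_on k p K' (u n)"
    and step: "\<And>n. sobolev_norm k p K' (\<lambda>x. u n x - u (Suc n) x) \<le> b * (1/2) ^ n"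
    and lim: "\<And>x. x \<in> K' \<Longrightarrow> (\<lambda>n. u n x) \<longlonglongrightarrow> v x"
  shows "continuous_on K' v" "\<And>x. x \<in> K' \<Longrightarrow> norm (u 0 x - v x) \<le> 2 * b"
    "sobolev_on k p K v" "sobolev_norm k p K (\<lambda>x. u 0 x - v x) \<le> 4 * b"
proof -
  define G where "G = interior K'"
  have G: "open G" "G \<subseteq> K'" "K \<subseteq> G" using K interior_subset by (auto simp: G_def)
  have cu: "continuous_on K' (u n)" for n using u by (simp add: sobolev_on_iff)
  have cd: "continuous_on K' (\<lambda>x. u i x - u l x)" for i l by (intro continuous_intros cu)
  have chain: "sobolev_norm k p K' (\<lambda>x. u n x - u (n + m) x) \<le> 2 * b * (1/2) ^ n" for n m
  proof -
    have "sobolev_norm k p K' (\<lambda>x. u n x - u (n + m) x) \<le> 2 * b * (1/2) ^ n - 2 * b * (1/2) ^ (n + m)"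
      by (rule geometric_chain[where N="\<lambda>i l. sobolev_norm k p K' (\<lambda>x. u i x - u l x)"])
         (use sobolev_norm_triangle[OF u u u K(2) p] step sobolev_norm_0[OF K(2) p] in auto)
    also have "\<dots> \<le> 2 * b * (1/2) ^ n" using b by simp
    finally show ?thesis .
  qed
  have sup: "norm (u n x - u (n + m) x) \<le> 2 * b * (1/2) ^ n" if "x \<in> K'" for n m x
    using sup_norm_on_upper[OF K(2) cd that, of n "n + m"] sobolev_seminorm_nonneg[of k p K'] chain[of n m]
    unfolding sobolev_norm_def by (meson add_increasing2 order_refl order_trans)
  have supv: "norm (u n x - v x) \<le> 2 * b * (1/2) ^ n" if x: "x \<in> K'" for n x
  proof -
    have "(\<lambda>m. u (m + n) x) \<longlonglongrightarrow> v x" using lim[OF x] by (rule LIMSEQ_ignore_initial_segment)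
    then have "(\<lambda>m. norm (u n x - u (n + m) x)) \<longlonglongrightarrow> norm (u n x - v x)"
      by (intro tendsto_intros) (simp add: add.commute)
    then show ?thesis by (rule LIMSEQ_le_const2) (use sup[OF x] in auto)
  qed
  from supv[of _ 0] show sup0: "\<And>x. x \<in> K' \<Longrightarrow> norm (u 0 x - v x) \<le> 2 * b" by simp
  have unif: "uniform_limit K' u v sequentially"
  proof (rule uniform_limitI)
    fix e :: real assume e: "e > 0"
    have "(\<lambda>n. 2 * b * (1/2) ^ n) \<longlonglongrightarrow> 2 * b * 0" by (intro tendsto_intros) auto
    then have "eventually (\<lambda>n. 2 * b * (1/2) ^ n < e) sequentially" using e by (intro order_tendstoD) auto
    then show "\<forall>\<^sub>F n in sequentially. \<forall>x\<in>K'. dist (u n x) (v x) < e"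
      by eventually_elim (use supv in \<open>auto simp: dist_norm intro: le_less_trans\<close>)
  qed
  show cv: "continuous_on K' v"
    by (rule uniform_limit_theorem[OF _ unif]) (use cu in auto)
  have "\<forall>n. \<exists>G D. sobolev_data k p K' G (u n) D" using u by (auto simp: sobolev_on_iff)
  then obtain GG D where D: "\<And>n. sobolev_data k p K' (GG n) (u n) (D n)" by metis
  have GG: "open (GG n)" "K' \<subseteq> GG n" for n using D by (auto simp: sobolev_data_def)
  have wd: "is_weak_derivative (GG n) j (u n) (D n j)" if "j \<le> k" for n j
    using D that by (auto simp: sobolev_data_def)
  have wdG: "is_weak_derivative G j (u n) (D n j)" if "j \<le> k" for n j
    by (rule is_weak_derivative_subset[OF wd[OF that, of n]]) (use G GG[of n] in blast)
  have semi: "sobolev_seminorm k p K' (\<lambda>x. u n x - u (n + m) x) \<le> 2 * b * (1/2) ^ n" for n m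
    using sup_norm_on_nonneg[OF K(2) cd] chain[of n m]
    unfolding sobolev_norm_def by (meson add_increasing order_refl order_trans)
  note Ddiff = sobolev_data_diff[OF D D K(2) p]
  define g where "g n m j x = deriv_norm j K' (\<lambda>x vs. D n j x vs - D m j x vs) x" for n m j x
  let ?T = "\<lambda>n m x. \<Sum>j\<in>{1..k}. g n m j x powr p"
  have gint: "integrable lebesgue (\<lambda>x. g n m j x powr p)" if "j \<le> k" for n m j
    unfolding g_def by (rule sobolev_seminorm_eq(2)[OF Ddiff K(2) p that])
  have gnn: "0 \<le> g n m j x" if "j \<le> k" for n m j x
    unfolding g_def using Ddiff[of n m] that unfolding sobolev_data_def by (intro deriv_norm_nonneg) blast+
  have gI: "(LINT x|lebesgue. (?T n (n + m) x)) \<le> (2 * b * (1/2) ^ n) powr p" for n m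
  proof -
    have I0: "0 \<le> (LINT x|lebesgue. (?T n (n + m) x))" by (intro integral_nonneg_AE AE_I2 sum_nonneg) simp
    have "(LINT x|lebesgue. (?T n (n + m) x)) powr (1/p) \<le> 2 * b * (1/2) ^ n"
      using semi[of n m] sobolev_seminorm_eq(1)[OF Ddiff[of n "n + m"] K(2) p] by (simp add: g_def)
    then have "((LINT x|lebesgue. (?T n (n + m) x)) powr (1/p)) powr p \<le> (2 * b * (1/2) ^ n) powr p"
      using p by (intro powr_mono2) auto
    then show ?thesis using I0 p by (simp add: powr_powr)
  qed
  have gIj: "(LINT x|lebesgue. g n (n + m) j x powr p) \<le> (2 * b * (1/2) ^ n) powr p" if "j \<in> {1..k}" for n m j
  proof -
    have "(LINT x|lebesgue. g n (n + m) j x powr p) \<le> (LINT x|lebesgue. (?T n (n + m) x))"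
    proof (rule integral_mono)
      show "integrable lebesgue (\<lambda>x. g n (n + m) j x powr p)" using gint that by auto
      show "integrable lebesgue (\<lambda>x. \<Sum>j\<in>{1..k}. g n (n + m) j x powr p)" using gint by (intro Bochner_Integration.integrable_sum) auto
      show "g n (n + m) j x powr p \<le> (?T n (n + m) x)" for x
        by (rule member_le_sum[OF that, of "\<lambda>j. g n (n + m) j x powr p"]) auto
    qed
    then show ?thesis using gI[of n m] by linarith
  qed
  have vloc: "locally_integrable_on v G" by (intro locally_integrable_continuous continuous_on_subset[OF cv] G)
  have "\<exists>E. is_weak_derivative G j v E \<and>
     (AE x in lebesgue. x \<in> G \<longrightarrow> (\<forall>vs. length vs = j \<longrightarrow> (\<lambda>n. D n j x vs) \<longlonglongrightarrow> E x vs))" if j: "j \<in> {1..k}" for j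
  proof -
    have jk: "j \<le> k" using j by simp
    have Dint: "set_integrable lebesgue K' (\<lambda>x. D n j x vs)" if "length vs = j" for n vs
      using wd[OF jk, of n] that K(2) GG[of n] unfolding is_weak_derivative_iff locally_integrable_on_def by blast
    have Gm: "G \<in> sets lebesgue" using G by simp
    have DintG: "set_integrable lebesgue G (\<lambda>x. D n j x vs)" if "length vs = j" for n vs
      by (rule set_integrable_subset[OF Dint[OF that] Gm G(2)])
    have summ: "summable (\<lambda>n. LINT x:G|lebesgue. norm (D (Suc n) j x bs - D n j x bs))" if bs: "bs \<in> basis_lists j" for bs
    proof (rule summable_comparison_test')
      show "summable (\<lambda>n. (2 * b * (measure lebesgue K' + 1)) * (1/2) ^ n)"
        by (intro summable_mult summable_geometric) simp
      fix n
      have len: "length bs = j" using bs by (rule basis_lists_length)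
      have i: "integrable lebesgue (\<lambda>x. indicator G x *\<^sub>R (norm (D (Suc n) j x bs - D n j x bs)))"
        using set_integrable_norm[OF set_integral_diff(1)[OF DintG[OF len, of "Suc n"] DintG[OF len, of n]]]
        by (simp add: set_integrable_def)
      have "(LINT x|lebesgue. indicator G x *\<^sub>R (norm (D (Suc n) j x bs - D n j x bs))) \<le> (2 * b * (1/2) ^ n) * (measure lebesgue K' + 1)"
      proof (rule integral_norm_le_powr[OF i gint[OF jk, of n "n + 1"]])
        show "AE x in lebesgue. 0 \<le> indicator G x *\<^sub>R norm (D (Suc n) j x bs - D n j x bs) \<and>
            indicator G x *\<^sub>R norm (D (Suc n) j x bs - D n j x bs) \<le> g n (n + 1) j x"
        proof (rule AE_I2)
          fix x
          have "norm (indicator K' x *\<^sub>R (D n j x bs - D (n + 1) j x bs)) \<le> g n (n + 1) j x"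
            unfolding g_def deriv_norm_def
          proof (rule multilinear_norm_upper[OF _ basis_lists_unit[OF bs], of "\<lambda>vs. indicator K' x *\<^sub>R (D n j x vs - D (n + 1) j x vs)"])
            show "multilin j (\<lambda>vs. indicator K' x *\<^sub>R (D n j x vs - D (n + 1) j x vs))"
              using Ddiff[of n "n + 1"] jk unfolding sobolev_data_def by (intro indicator_weak_multilin) blast+
          qed
          then show "0 \<le> indicator G x *\<^sub>R norm (D (Suc n) j x bs - D n j x bs) \<and>
            indicator G x *\<^sub>R norm (D (Suc n) j x bs - D n j x bs) \<le> g n (n + 1) j x"
            using gnn[OF jk, of n "n + 1" x] G(2) by (auto simp: indicator_def norm_minus_commute split: if_splits)
        qed
        show "K' \<in> sets lebesgue" using borel_compact[OF K(2)] by simp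
        show "emeasure lebesgue K' < \<infinity>" using emeasure_compact_finite[OF K(2)] borel_compact[OF K(2)] by simp
        show "indicator G x *\<^sub>R norm (D (Suc n) j x bs - D n j x bs) = 0" if "x \<notin> K'" for x
          using that G by (auto simp: indicator_def)
        show "0 < 2 * b * (1/2) ^ n" using b by simp
        show "(LINT x|lebesgue. g n (n + 1) j x powr p) \<le> (2 * b * (1/2) ^ n) powr p" by (rule gIj[OF j])
      qed (rule p)
      moreover have "0 \<le> (LINT x|lebesgue. indicator G x *\<^sub>R (norm (D (Suc n) j x bs - D n j x bs)))"
        by (intro integral_nonneg_AE AE_I2) auto
      ultimately show "norm (LINT x:G|lebesgue. norm (D (Suc n) j x bs - D n j x bs)) \<le> (2 * b * (measure lebesgue K' + 1)) * (1/2) ^ n"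
        by (simp add: set_lebesgue_integral_def algebra_simps)
    qed
    have DintG': "set_integrable lebesgue G (\<lambda>x. D n j x bs)" if "bs \<in> basis_lists j" for n bs
      by (rule DintG[OF basis_lists_length[OF that]])
    show ?thesis
      using weak_derivative_limit[OF G(1) wdG[OF jk] DintG' summ uniform_limit_on_subset[OF unif G(2)] vloc] by blast
  qed
  then have "\<forall>j. \<exists>E. j \<in> {1..k} \<longrightarrow> is_weak_derivative G j v E \<and>
     (AE x in lebesgue. x \<in> G \<longrightarrow> (\<forall>vs. length vs = j \<longrightarrow> (\<lambda>n. D n j x vs) \<longlonglongrightarrow> E x vs))" by blast
  then obtain E' where E': "\<And>j. j \<in> {1..k} \<Longrightarrow> is_weak_derivative G j v (E' j)"
     "\<And>j. j \<in> {1..k} \<Longrightarrow> AE x in lebesgue. x \<in> G \<longrightarrow> (\<forall>vs. length vs = j \<longrightarrow> (\<lambda>n. D n j x vs) \<longlonglongrightarrow> E' j x vs)"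
    unfolding choice_iff by blast
  \<comment> \<open>The seminorm starts at order 1; at order 0 the limit itself is the weak
    derivative, and its integrability comes from continuity.\<close>
  define E where "E j = (if j = 0 then (\<lambda>x vs. v x) else E' j)" for j
  have E: "is_weak_derivative G j v (E j)" if "j \<le> k" for j
    using E'(1)[of j] weak_derivative_0[OF vloc] that by (auto simp: E_def)
  define F where "F j x = deriv_norm j K (\<lambda>x vs. D 0 j x vs - E j x vs) x" for j x
  let ?S = "\<lambda>x. \<Sum>j\<in>{1..k}. F j x powr p"
  have D0: "sobolev_data k p K (GG 0) (u 0) (D 0)"
  proof -
    have "K \<in> sets lebesgue" "K \<subseteq> K'" using borel_compact[OF K(1)] G by auto
    then show ?thesis using D[of 0] unfolding sobolev_data_def by (blast intro: set_integrable_subset)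
  qed
  have wdDE: "is_weak_derivative (GG 0 \<inter> G) j (\<lambda>x. u 0 x - v x) (\<lambda>x vs. D 0 j x vs - E j x vs)" if "j \<le> k" for j
    by (intro is_weak_derivative_diff is_weak_derivative_subset[OF wd[OF that]] is_weak_derivative_subset[OF E[OF that]]) auto
  have KGG: "K \<subseteq> GG 0 \<inter> G" using G GG[of 0] by blast
  have Fm: "(\<lambda>x. F j x) \<in> borel_measurable lebesgue" if "j \<le> k" for j
    unfolding F_def deriv_norm_def by (rule weak_norm_measurable[OF wdDE[OF that] K(1) KGG])
  have Fnn: "0 \<le> F j x" if "j \<le> k" for j x
    unfolding F_def by (rule deriv_norm_nonneg[OF wdDE[OF that] KGG])
  \<comment> \<open>A remainder that tends to 0 almost everywhere and dominates the operator norm of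
    \<open>D m j - E j\<close> on \<open>K\<close>.\<close>
  define r where "r m j x = (\<Sum>bs\<in>basis_lists j. norm (indicator K x *\<^sub>R (D m j x bs - E j x bs)))" for m j x
  have wdK: "is_weak_derivative (GG m \<inter> G) j (\<lambda>x. u m x - v x) (\<lambda>x vs. D m j x vs - E j x vs)" if "j \<le> k" for m j
    by (intro is_weak_derivative_diff is_weak_derivative_subset[OF wd[OF that]] is_weak_derivative_subset[OF E[OF that]]) auto
  have KG: "K \<subseteq> GG m \<inter> G" for m using G GG[of m] by blast
  have rm: "r m j \<in> borel_measurable lebesgue" if "j \<le> k" for m j
    unfolding r_def
    by (intro borel_measurable_sum, rule measurable_compose[OF indicator_weak_measurable[OF wdK[OF that] K(1) KG basis_lists_length] borel_measurable_norm])
  have Fle: "F j x \<le> g 0 m j x + r m j x" if j: "j \<le> k" for m j x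
  proof -
    have "F j x \<le> deriv_norm j K (\<lambda>x vs. D 0 j x vs - D m j x vs) x + deriv_norm j K (\<lambda>x vs. D m j x vs - E j x vs) x"
      unfolding F_def using KG by (intro deriv_norm_triangle[OF wd[OF j, of 0] wd[OF j, of m] E[OF j]]) auto
    moreover have "deriv_norm j K (\<lambda>x vs. D m j x vs - E j x vs) x \<le> r m j x"
      unfolding deriv_norm_def r_def
      by (rule multilinear_norm_le_sum[OF indicator_weak_multilin[OF wdK[OF j] KG]])
    moreover have "deriv_norm j K (\<lambda>x vs. D 0 j x vs - D m j x vs) x \<le> g 0 m j x"
    proof (cases "x \<in> K")
      case True
      then have "x \<in> K'" using G by auto
      then show ?thesis using True by (simp add: g_def deriv_norm_def)
    next
      case False
      then show ?thesis using gnn[OF j] by (simp add: deriv_norm_def multilinear_norm_0)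
    qed
    ultimately show ?thesis by linarith
  qed
  have rlim: "AE x in lebesgue. (\<lambda>m. r m j x) \<longlonglongrightarrow> 0" if j: "j \<in> {1..k}" for j
    using E'(2)[OF j]
  proof eventually_elim
    case (elim x)
    have "(\<lambda>m. norm (indicator K x *\<^sub>R (D m j x bs - E j x bs))) \<longlonglongrightarrow> 0" if bs: "bs \<in> basis_lists j" for bs
    proof (cases "x \<in> K")
      case True
      then have "(\<lambda>m. D m j x bs) \<longlonglongrightarrow> E j x bs" using elim G basis_lists_length[OF bs] j by (auto simp: E_def)
      then have "(\<lambda>m. norm (D m j x bs - E j x bs)) \<longlonglongrightarrow> 0" by (simp add: LIM_zero tendsto_norm_zero)
      then show ?thesis using True by simp
    qed simp
    then show ?case unfolding r_def by (intro tendsto_null_sum)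
  qed
  \<comment> \<open>The derivatives are known to converge only almost everywhere. The positive part
    of \<open>F - r m\<close> converges to \<open>F\<close> and is at most \<open>g 0 m\<close>,
    whose integral is bounded uniformly in \<open>m\<close>; Fatou's lemma then bounds the distance
    from the first term to the limit.\<close>
  have Fatou: "(\<integral>\<^sup>+x. ennreal (?S x) \<partial>lebesgue) \<le> ennreal ((2 * b) powr p)"
  proof (rule nn_integral_le_limit[where S="\<lambda>m x. \<Sum>j\<in>{1..k}. (max 0 (F j x - r m j x)) powr p"])
    show "(\<lambda>x. \<Sum>j\<in>{1..k}. (max 0 (F j x - r m j x)) powr p) \<in> borel_measurable lebesgue" for m
      by (intro borel_measurable_sum powr_real_measurable borel_measurable_max borel_measurable_diff Fm rm) auto
    have "AE x in lebesgue. \<forall>j\<in>{1..k}. (\<lambda>m. r m j x) \<longlonglongrightarrow> 0" using rlim by (intro AE_finite_allI) auto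
    then show "AE x in lebesgue. (\<lambda>m. \<Sum>j\<in>{1..k}. (max 0 (F j x - r m j x)) powr p) \<longlonglongrightarrow> (?S x)"
    proof eventually_elim
      case (elim x)
      show ?case
      proof (rule tendsto_sum)
        fix j assume j: "j \<in> {1..k}"
        have "(\<lambda>m. max 0 (F j x - r m j x)) \<longlonglongrightarrow> max 0 (F j x - 0)"
          using elim j by (intro tendsto_max tendsto_diff tendsto_const) auto
        then have "(\<lambda>m. max 0 (F j x - r m j x)) \<longlonglongrightarrow> F j x" using Fnn[of j x] j by (simp add: max_def)
        then show "(\<lambda>m. (max 0 (F j x - r m j x)) powr p) \<longlonglongrightarrow> F j x powr p"
          using p by (intro tendsto_powr2 tendsto_const) auto
      qed
    qed
    fix m
    have "(\<integral>\<^sup>+x. ennreal (\<Sum>j\<in>{1..k}. (max 0 (F j x - r m j x)) powr p) \<partial>lebesgue) \<le> (\<integral>\<^sup>+x. ennreal (\<Sum>j\<in>{1..k}. g 0 m j x powr p) \<partial>lebesgue)"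
    proof (intro nn_integral_mono ennreal_leI sum_mono powr_mono2)
      fix x j assume j: "j \<in> {1..k}"
      show "max 0 (F j x - r m j x) \<le> g 0 m j x" using Fle[of j x m] gnn[of j 0 m x] j by auto
    qed (use p in auto)
    also have "\<dots> = ennreal (LINT x|lebesgue. (\<Sum>j\<in>{1..k}. g 0 m j x powr p))"
      using gint by (intro nn_integral_eq_integral Bochner_Integration.integrable_sum AE_I2 sum_nonneg) auto
    also have "\<dots> \<le> ennreal ((2 * b) powr p)"
      using gI[of 0 m] by (intro ennreal_leI) simp
    finally show "(\<integral>\<^sup>+x. ennreal (\<Sum>j\<in>{1..k}. (max 0 (F j x - r m j x)) powr p) \<partial>lebesgue) \<le> ennreal ((2 * b) powr p)" .
  qed
  have Fsum_m: "(\<lambda>x. \<Sum>j\<in>{1..k}. F j x powr p) \<in> borel_measurable lebesgue"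
    by (intro borel_measurable_sum powr_real_measurable Fm) auto
  have Fsum: "integrable lebesgue (\<lambda>x. \<Sum>j\<in>{1..k}. F j x powr p)"
  proof (rule integrableI_bounded[OF Fsum_m])
    have "(\<integral>\<^sup>+x. ennreal (norm (?S x)) \<partial>lebesgue) = (\<integral>\<^sup>+x. ennreal (?S x) \<partial>lebesgue)"
      by (simp add: sum_nonneg)
    also have "\<dots> < \<infinity>" by (rule le_less_trans[OF Fatou]) simp
    finally show "(\<integral>\<^sup>+x. ennreal (norm (?S x)) \<partial>lebesgue) < \<infinity>" .
  qed
  have FI: "(LINT x|lebesgue. (?S x)) \<le> (2 * b) powr p"
  proof -
    have "ennreal (LINT x|lebesgue. (?S x)) \<le> ennreal ((2 * b) powr p)"
      using Fatou by (subst nn_integral_eq_integral[OF Fsum, symmetric]) (auto intro!: AE_I2 sum_nonneg)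
    then show ?thesis by (simp add: ennreal_le_iff)
  qed
  have Fint: "integrable lebesgue (\<lambda>x. F j x powr p)" if j: "j \<in> {1..k}" for j
  proof (rule Bochner_Integration.integrable_bound[OF Fsum])
    show "(\<lambda>x. F j x powr p) \<in> borel_measurable lebesgue" using j by (intro powr_real_measurable Fm) auto
    show "AE x in lebesgue. norm (F j x powr p) \<le> norm (?S x)"
    proof (rule AE_I2)
      fix x
      have "F j x powr p \<le> (?S x)" by (rule member_le_sum[OF j, of "\<lambda>j. F j x powr p"]) auto
      then show "norm (F j x powr p) \<le> norm (?S x)" by (simp add: sum_nonneg)
    qed
  qed
  have cvK: "continuous_on K v" by (rule continuous_on_subset[OF cv]) (use G in auto)
  have dataE: "sobolev_data k p K G v E"
    unfolding sobolev_data_def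
  proof (intro conjI allI impI G E)
    fix j and vs :: "'e list" assume j: "j \<le> k" and vs: "length vs = j"
    show "set_integrable lebesgue K (\<lambda>x. norm (E j x vs) powr p)"
    proof (cases "j = 0")
      case True
      have "continuous_on K (\<lambda>x. norm (v x) powr p)"
        using p by (intro continuous_on_powr' continuous_intros cvK) auto
      then show ?thesis using True by (simp add: E_def set_integrable_continuous_compact[OF K(1)])
    next
      case False
      then have j': "j \<in> {1..k}" using j by auto
      have "set_integrable lebesgue K (\<lambda>x. norm (D 0 j x vs - E j x vs) powr p)"
        by (rule powr_integrable_if_deriv_norm[OF wdDE[OF j] K(1) KGG p vs]) (use Fint[OF j'] in \<open>simp add: F_def\<close>)
      moreover have "set_integrable lebesgue K (\<lambda>x. norm (D 0 j x vs) powr p)" using D0 j vs by (auto simp: sobolev_data_def)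
      \<comment> \<open>The derivative of the limit is recovered as \<open>D 0\<close> minus the
        difference whose integrability has just been shown.\<close>
      ultimately have "set_integrable lebesgue K (\<lambda>x. norm (D 0 j x vs - (D 0 j x vs - E j x vs)) powr p)"
        using KGG by (intro diff_powr_integrable[OF _ _ indicator_weak_measurable[OF wd[OF j] K(1) _ vs]
           indicator_weak_measurable[OF wdDE[OF j] K(1) KGG vs] p]) auto
      then show ?thesis by simp
    qed
  qed
  then show "sobolev_on k p K v" using cvK by (auto simp: sobolev_on_iff)
  have "sobolev_seminorm k p K (\<lambda>x. u 0 x - v x) = (LINT x|lebesgue. (?S x)) powr (1/p)"
    using sobolev_seminorm_eq(1)[OF sobolev_data_diff[OF D0 dataE K(1) p] K(1) p] by (simp add: F_def)
  also have "\<dots> \<le> ((2 * b) powr p) powr (1/p)"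
    using FI p by (intro powr_mono2 integral_nonneg_AE AE_I2 sum_nonneg) auto
  also have "\<dots> = 2 * b" using b p by (simp add: powr_powr)
  finally have "sobolev_seminorm k p K (\<lambda>x. u 0 x - v x) \<le> 2 * b" .
  moreover have "sup_norm_on K (\<lambda>x. u 0 x - v x) \<le> 2 * b"
    using b sup0 G by (intro sup_norm_on_least) auto
  ultimately show "sobolev_norm k p K (\<lambda>x. u 0 x - v x) \<le> 4 * b" by (simp add: sobolev_norm_def)
qed

section \<open>Morrey's inequality for smooth functions\<close>

lemma cube_facts:
  fixes x :: "'e::euclidean_space"
  assumes r: "r \<ge> 0"
  shows "cbox x (x + r *\<^sub>R One) \<noteq> {}" "measure lborel (cbox x (x + r *\<^sub>R One)) = r ^ DIM('e)"
    "y \<in> cbox x (x + r *\<^sub>R One) \<Longrightarrow> b \<in> Basis \<Longrightarrow> \<bar>(y - x) \<bullet> b\<bar> \<le> r"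
    "y \<in> cbox x (x + r *\<^sub>R One) \<Longrightarrow> 0 \<le> t \<Longrightarrow> t \<le> 1 \<Longrightarrow> x + t *\<^sub>R (y - x) \<in> cbox x (x + (t * r) *\<^sub>R One)"
    "0 \<le> t \<Longrightarrow> t \<le> 1 \<Longrightarrow> cbox x (x + (t * r) *\<^sub>R One) \<subseteq> cbox x (x + r *\<^sub>R One)"
proof -
  show ne: "cbox x (x + r *\<^sub>R One) \<noteq> {}" using r by (auto simp: box_ne_empty inner_add_left)
  show "measure lborel (cbox x (x + r *\<^sub>R One)) = r ^ DIM('e)"
    using content_cbox'[OF ne] by (simp add: inner_add_left)
  show "\<bar>(y - x) \<bullet> b\<bar> \<le> r" if "y \<in> cbox x (x + r *\<^sub>R One)" "b \<in> Basis"
    using that by (auto simp: mem_box inner_add_left inner_diff_left)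
  show "x + t *\<^sub>R (y - x) \<in> cbox x (x + (t * r) *\<^sub>R One)" if "y \<in> cbox x (x + r *\<^sub>R One)" "0 \<le> t" "t \<le> 1"
    using that by (auto simp: mem_box inner_add_left inner_diff_left intro!: mult_left_mono)
  show "cbox x (x + (t * r) *\<^sub>R One) \<subseteq> cbox x (x + r *\<^sub>R One)" if "0 \<le> t" "t \<le> 1"
    using that r by (auto simp: subset_box inner_add_left mult_left_le_one_le)
qed

text \<open>Scaling by \<open>t\<close> about the corner \<open>x\<close> carries the cube onto a
  subcube and contributes the factor \<open>1 / t ^ DIM('e)\<close>; as \<open>h\<close> is
  nonnegative, the integral over the subcube is at most that over the cube.\<close>

lemma integral_shrink_le:
  fixes x :: "'e::euclidean_space" and h :: "'e \<Rightarrow> real"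
  assumes r: "r > 0" and t: "0 < t" "t \<le> 1" and h: "continuous_on (cbox x (x + r *\<^sub>R One)) h" "\<And>y. 0 \<le> h y"
  shows "integral (cbox x (x + r *\<^sub>R One)) (\<lambda>y. h (x + t *\<^sub>R (y - x))) \<le> integral (cbox x (x + r *\<^sub>R One)) h / t ^ DIM('e)"
proof -
  define Q where "Q = cbox x (x + r *\<^sub>R One)"
  define Qt where "Qt = cbox x (x + (t * r) *\<^sub>R One)"
  have sub: "Qt \<subseteq> Q" unfolding Q_def Qt_def using cube_facts(5)[of r t x] r t by simp
  have iQt: "h integrable_on Qt" unfolding Qt_def by (intro integrable_continuous continuous_on_subset[OF h(1)] sub[unfolded Q_def Qt_def])
  have iQ: "h integrable_on Q" unfolding Q_def by (intro integrable_continuous h(1))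
  have "((\<lambda>y. h (t *\<^sub>R y + (x - t *\<^sub>R x))) has_integral (integral Qt h /\<^sub>R t ^ DIM('e)))
     (cbox ((x - (x - t *\<^sub>R x)) /\<^sub>R t) ((x + (t * r) *\<^sub>R One - (x - t *\<^sub>R x)) /\<^sub>R t))"
    unfolding Qt_def by (rule has_integral_affinity'[OF integrable_integral[OF iQt[unfolded Qt_def]] t(1)])
  moreover have "(x - (x - t *\<^sub>R x)) /\<^sub>R t = x" "(x + (t * r) *\<^sub>R One - (x - t *\<^sub>R x)) /\<^sub>R t = x + r *\<^sub>R One"
    using t by (simp_all add: scaleR_add_right)
  moreover have "(\<lambda>y. h (t *\<^sub>R y + (x - t *\<^sub>R x))) = (\<lambda>y. h (x + t *\<^sub>R (y - x)))"
    by (auto simp: algebra_simps)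
  ultimately have "((\<lambda>y. h (x + t *\<^sub>R (y - x))) has_integral (integral Qt h /\<^sub>R t ^ DIM('e))) Q"
    by (simp add: Q_def)
  then have "integral Q (\<lambda>y. h (x + t *\<^sub>R (y - x))) = integral Qt h / t ^ DIM('e)"
    by (simp add: integral_unique divide_inverse mult.commute)
  also have "\<dots> \<le> integral Q h / t ^ DIM('e)"
    using t h(2) by (intro divide_right_mono integral_subset_le sub iQt iQ) auto
  finally show ?thesis by (simp add: Q_def)
qed

text \<open>\<open>A t\<close> integrates \<open>w\<close> along the segments from \<open>x\<close>,
  contracted by \<open>t\<close>: \<open>A 1\<close> is the integral over the cube and
  \<open>A 0\<close> is \<open>w x\<close> times the volume. The derivative of \<open>A\<close> is
  bounded by a multiple of \<open>t powr (\<alpha> - 1)\<close>, which is integrable at 0 exactly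
  because \<open>p\<close> exceeds the dimension.\<close>

lemma Morrey_cube:
  fixes w :: "'e::euclidean_space \<Rightarrow> 'f::euclidean_space"
  assumes G: "open G" and w: "smooth_on G w" and r: "r > 0" and Q: "cbox x (x + r *\<^sub>R One) \<subseteq> G"
    and p: "p > real DIM('e)"
    and M: "(\<Sum>b\<in>Basis. integral (cbox x (x + r *\<^sub>R One)) (\<lambda>y. norm (dd b w y) powr p)) \<le> M"
  shows "norm ((1 / r ^ DIM('e)) *\<^sub>R integral (cbox x (x + r *\<^sub>R One)) w - w x)
    \<le> (real DIM('e) + M) / (1 - real DIM('e) / p) * r powr (1 - real DIM('e) / p)"
proof -
  define m where "m = real DIM('e)"
  define \<alpha> where "\<alpha> = 1 - m / p"
  define c where "c = cbox x (x + r *\<^sub>R One)"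
  have m: "m \<ge> 1" unfolding m_def using DIM_positive[where 'a='e] by linarith
  have p1: "p > 1" using p m unfolding m_def by linarith
  have \<alpha>: "\<alpha> > 0" using p m by (simp add: \<alpha>_def m_def)
  have df: "w differentiable (at y)" if "y \<in> G" for y by (rule smooth_on_differentiable[OF w that])
  have cw: "continuous_on G w" "\<And>b. continuous_on G (dd b w)"
    using smooth_on_continuous[OF w] smooth_on_continuous[OF smooth_on_dd[OF w]] by blast+
  have inQ: "x + t *\<^sub>R (y - x) \<in> c" if "t \<in> {0..1}" "y \<in> c" for t y
    using cube_facts(4)[of r y x t] cube_facts(5)[of r t x] r that by (auto simp: c_def)
  then have inG: "x + t *\<^sub>R (y - x) \<in> G" if "t \<in> {0..1}" "y \<in> c" for t y
    using that Q by (auto simp: c_def)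
  have cmp: "continuous_on ({0..1} \<times> c) (\<lambda>z. dd b w (x + fst z *\<^sub>R (snd z - x)))" for b
    by (rule continuous_on_compose2[OF cw(2)[of b]]) (use inG in \<open>auto intro!: continuous_intros\<close>)
  have ddeq: "dd (y - x) w (x + t *\<^sub>R (y - x)) = (\<Sum>b\<in>Basis. ((y - x) \<bullet> b) *\<^sub>R dd b w (x + t *\<^sub>R (y - x)))"
    if "t \<in> {0..1}" "y \<in> c" for t y
    by (rule dd_basis_sum[OF df[OF inG[OF that]]])
  define A where "A t = integral c (\<lambda>y. w (x + t *\<^sub>R (y - x)))" for t
  define A' where "A' t = integral c (\<lambda>y. dd (y - x) w (x + t *\<^sub>R (y - x)))" for t
  have contdd: "continuous_on ({0..1} \<times> c) (\<lambda>(t, y). dd (y - x) w (x + t *\<^sub>R (y - x)))"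
  proof -
    have "continuous_on ({0..1} \<times> c) (\<lambda>z. \<Sum>b\<in>Basis. ((snd z - x) \<bullet> b) *\<^sub>R dd b w (x + fst z *\<^sub>R (snd z - x)))"
      by (intro continuous_intros cmp)
    then show ?thesis
      by (rule continuous_on_eq) (use ddeq in auto)
  qed
  have Aderiv: "(A has_vector_derivative A' t) (at t within {0..1})" if t: "t \<in> {0..1}" for t
    unfolding A_def A'_def c_def
  proof (rule leibniz_rule_vector_derivative)
    fix s y assume s: "s \<in> {0..1::real}" and y: "y \<in> cbox x (x + r *\<^sub>R One)"
    show "((\<lambda>s. w (x + s *\<^sub>R (y - x))) has_vector_derivative dd (y - x) w (x + s *\<^sub>R (y - x))) (at s within {0..1})"
      by (rule dd_line[OF df[OF inG]]) (use s y in \<open>auto simp: c_def\<close>)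
  next
    fix s assume s: "s \<in> {0..1::real}"
    show "(\<lambda>y. w (x + s *\<^sub>R (y - x))) integrable_on cbox x (x + r *\<^sub>R One)"
      by (intro integrable_continuous continuous_on_compose2[OF cw(1)])
         (use inG s in \<open>auto intro!: continuous_intros simp: c_def\<close>)
  qed (use contdd t in \<open>auto simp: c_def\<close>)
  define I where "I b = integral c (\<lambda>y. norm (dd b w y) powr p)" for b
  have bound: "norm (A' t) \<le> (r ^ DIM('e) * (m + M)) * (r powr \<alpha> * t powr (\<alpha> - 1))" if t: "0 < t" "t < 1" for t
  proof -
    have t': "t \<in> {0..1}" using t by simp
    \<comment> \<open>The parameter for \<open>le_add_powr\<close>: \<open>s powr (- p)\<close>
      equals the volume of the contracted cube and so cancels the factor lost in
      \<open>integral_shrink_le\<close>.\<close>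
    define s where "s = (t * r) powr (- (m / p))"
    have s: "s > 0" using t r by (simp add: s_def)
    have cb: "continuous_on c (\<lambda>y. dd b w (x + t *\<^sub>R (y - x)))" for b
      by (rule continuous_on_compose2[OF cw(2)[of b]]) (use inG t' in \<open>auto intro!: continuous_intros\<close>)
    have cbp: "continuous_on c (\<lambda>y. norm (dd b w y) powr p)" for b
      by (intro continuous_on_powr' continuous_intros continuous_on_subset[OF cw(2)])
         (use Q p1 in \<open>auto simp: c_def\<close>)
    have cbp': "continuous_on c (\<lambda>y. norm (dd b w (x + t *\<^sub>R (y - x))) powr p)" for b
      by (intro continuous_on_powr' continuous_intros cb) (use p1 in auto)
    have one: "integral c (\<lambda>y. norm (dd b w (x + t *\<^sub>R (y - x)))) \<le> s * r ^ DIM('e) * (1 + I b)" for b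
    proof -
      have "integral c (\<lambda>y. norm (dd b w (x + t *\<^sub>R (y - x)))) \<le>
         integral c (\<lambda>y. s + s powr (1 - p) * norm (dd b w (x + t *\<^sub>R (y - x))) powr p)"
        unfolding c_def
        by (intro integral_le integrable_continuous continuous_intros cb[unfolded c_def] cbp'[unfolded c_def] le_add_powr)
           (use s p1 in auto)
      also have "\<dots> = s * r ^ DIM('e) + s powr (1 - p) * integral c (\<lambda>y. norm (dd b w (x + t *\<^sub>R (y - x))) powr p)"
        unfolding c_def using cube_facts(2)[of r x] r
        by (subst integral_add) (auto intro!: integrable_continuous continuous_intros cbp'[unfolded c_def])
      also have "\<dots> \<le> s * r ^ DIM('e) + s powr (1 - p) * (I b / t ^ DIM('e))"
        unfolding I_def c_def using integral_shrink_le[OF r t(1) _ cbp[unfolded c_def]] t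
        by (intro add_left_mono mult_left_mono) auto
      also have "s powr (1 - p) * (I b / t ^ DIM('e)) = s * r ^ DIM('e) * I b"
      proof -
        have "s powr (1 - p) = s * s powr (- p)" using s by (simp add: powr_diff powr_minus divide_inverse)
        also have "s powr (- p) = (t * r) powr m" using p1 by (simp add: s_def powr_powr)
        also have "\<dots> = t ^ DIM('e) * r ^ DIM('e)" using t r by (simp add: m_def powr_realpow power_mult_distrib)
        finally show ?thesis using t by simp
      qed
      finally show ?thesis by (simp add: algebra_simps)
    qed
    have "norm (A' t) \<le> integral c (\<lambda>y. \<Sum>b\<in>Basis. r * norm (dd b w (x + t *\<^sub>R (y - x))))"
      unfolding A'_def
    proof (rule integral_norm_bound_integral)
      show "(\<lambda>y. dd (y - x) w (x + t *\<^sub>R (y - x))) integrable_on c"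
      proof -
        have "continuous_on c (\<lambda>y. \<Sum>b\<in>Basis. ((y - x) \<bullet> b) *\<^sub>R dd b w (x + t *\<^sub>R (y - x)))"
          by (intro continuous_intros cb)
        then have "continuous_on c (\<lambda>y. dd (y - x) w (x + t *\<^sub>R (y - x)))"
          by (rule continuous_on_eq) (use ddeq t' in auto)
        then show ?thesis unfolding c_def by (rule integrable_continuous)
      qed
      show "(\<lambda>y. \<Sum>b\<in>Basis. r * norm (dd b w (x + t *\<^sub>R (y - x)))) integrable_on c"
        unfolding c_def by (intro integrable_continuous continuous_intros cb[unfolded c_def])
      fix y assume y: "y \<in> c"
      show "norm (dd (y - x) w (x + t *\<^sub>R (y - x))) \<le> (\<Sum>b\<in>Basis. r * norm (dd b w (x + t *\<^sub>R (y - x))))"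
        unfolding ddeq[OF t' y]
        by (intro sum_norm_le) (use cube_facts(3)[of r y x] r y in \<open>auto simp: c_def intro!: mult_right_mono\<close>)
    qed
    also have "\<dots> = (\<Sum>b\<in>Basis. r * integral c (\<lambda>y. norm (dd b w (x + t *\<^sub>R (y - x)))))"
      unfolding c_def
      by (subst integral_sum) (auto intro!: integrable_continuous continuous_intros cb[unfolded c_def])
    also have "\<dots> \<le> (\<Sum>b\<in>Basis. r * (s * r ^ DIM('e) * (1 + I b)))"
      using r one by (intro sum_mono mult_left_mono) auto
    also have "\<dots> = (r * s) * r ^ DIM('e) * (m + (\<Sum>b\<in>Basis. I b))"
      by (simp add: m_def sum_distrib_left[symmetric] sum.distrib mult.assoc[symmetric])
    also have "\<dots> \<le> (r * s) * r ^ DIM('e) * (m + M)"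
      using r s M by (intro mult_left_mono add_left_mono) (auto simp: I_def c_def)
    also have "r * s = r powr \<alpha> * t powr (\<alpha> - 1)"
    proof -
      have "r powr \<alpha> = r * r powr (- (m / p))" using r by (simp add: \<alpha>_def powr_diff powr_minus divide_inverse)
      moreover have "t powr (\<alpha> - 1) = t powr (- (m / p))" by (simp add: \<alpha>_def)
      ultimately show ?thesis using t r by (simp add: s_def powr_mult)
    qed
    finally show ?thesis by (simp add: mult_ac)
  qed
  \<comment> \<open>The bound on \<open>A'\<close> blows up at \<open>t = 0\<close>. The mean value
    inequality is therefore used in the form that compares with a primitive,
    \<open>t powr \<alpha> / \<alpha>\<close>, continuous on the closed interval and differentiable
    inside.\<close>
  have "norm (A 1 - A 0) \<le> (r ^ DIM('e) * (m + M)) * (r powr \<alpha> * (1 powr \<alpha> / \<alpha>)) - (r ^ DIM('e) * (m + M)) * (r powr \<alpha> * (0 powr \<alpha> / \<alpha>))"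
  proof (rule differentiable_bound_general[where f'=A' and \<phi>'="\<lambda>t. (r ^ DIM('e) * (m + M)) * (r powr \<alpha> * t powr (\<alpha> - 1))"])
    show "continuous_on {0..1} A"
      using Aderiv by (meson has_vector_derivative_continuous continuous_on_eq_continuous_within)
    show "continuous_on {0..1} (\<lambda>t. (r ^ DIM('e) * (m + M)) * (r powr \<alpha> * (t powr \<alpha> / \<alpha>)))"
      using \<alpha> by (intro continuous_intros continuous_on_powr') auto
    fix t :: real assume t: "0 < t" "t < 1"
    show "(A has_vector_derivative A' t) (at t)"
      using Aderiv[of t] t by (simp add: at_within_interior[of t "{0..1}"])
    show "((\<lambda>t. (r ^ DIM('e) * (m + M)) * (r powr \<alpha> * (t powr \<alpha> / \<alpha>))) has_vector_derivative (r ^ DIM('e) * (m + M)) * (r powr \<alpha> * t powr (\<alpha> - 1))) (at t)"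
      using t \<alpha> unfolding has_real_derivative_iff_has_vector_derivative[symmetric]
      by (auto intro!: derivative_eq_intros)
  qed (use bound in auto)
  then have AA: "norm (A 1 - A 0) \<le> r ^ DIM('e) * ((m + M) / \<alpha> * r powr \<alpha>)" using \<alpha> by (simp add: mult_ac)
  have A0: "A 0 = r ^ DIM('e) *\<^sub>R w x" using cube_facts(2)[of r x] r by (simp add: A_def c_def)
  have A1: "A 1 = integral c w" by (simp add: A_def)
  have "norm ((1 / r ^ DIM('e)) *\<^sub>R integral c w - w x) = norm ((1 / r ^ DIM('e)) *\<^sub>R (A 1 - A 0))"
    using r by (simp add: A0 A1 scaleR_diff_right)
  also have "\<dots> = (1 / r ^ DIM('e)) * norm (A 1 - A 0)" using r by simp
  also have "\<dots> \<le> (1 / r ^ DIM('e)) * (r ^ DIM('e) * ((m + M) / \<alpha> * r powr \<alpha>))"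
    using r AA by (intro mult_left_mono) auto
  also have "\<dots> = (m + M) / \<alpha> * r powr \<alpha>" using r by simp
  finally show ?thesis by (simp add: c_def m_def \<alpha>_def)
qed

section \<open>Sequences of smooth functions\<close>

text \<open>Boundedness in \<open>L\<^sup>p\<close> with convergence in \<open>L\<^sup>1\<close> only is enough, by Fatou's lemma, for the limit
  to be in \<open>L\<^sup>p\<close>, and it is stable under products with uniformly convergent factors.\<close>

definition Lp_seq :: "real \<Rightarrow> 'e::euclidean_space set \<Rightarrow> (nat \<Rightarrow> 'e \<Rightarrow> 'f::euclidean_space) \<Rightarrow> bool" where
  "Lp_seq p G u \<longleftrightarrow> (\<forall>n. continuous_on G (u n)) \<and> (\<forall>K. compact K \<and> K \<subseteq> G \<longrightarrow>
     (\<exists>B. \<forall>n. (LINT x:K|lebesgue. norm (u n x) powr p) \<le> B) \<and>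
     (\<forall>e>0. \<exists>N. \<forall>n\<ge>N. \<forall>l\<ge>N. (LINT x:K|lebesgue. norm (u n x - u l x)) < e))"

definition UC_seq :: "'e::euclidean_space set \<Rightarrow> (nat \<Rightarrow> 'e \<Rightarrow> 'f::euclidean_space) \<Rightarrow> bool" where
  "UC_seq G u \<longleftrightarrow> (\<forall>n. continuous_on G (u n)) \<and> (\<forall>K. compact K \<and> K \<subseteq> G \<longrightarrow> uniformly_Cauchy_on K u)"

text \<open>Derivatives of order below \<open>k\<close> are locally uniformly Cauchy, those of order
  \<open>k\<close> only satisfy \<open>Lp_seq\<close>. Recursion on the first derivative matches the
  product and chain rules.\<close>

primrec Sob_seq :: "nat \<Rightarrow> real \<Rightarrow> 'e::euclidean_space set \<Rightarrow> (nat \<Rightarrow> 'e \<Rightarrow> 'f::euclidean_space) \<Rightarrow> bool" where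
  "Sob_seq 0 p G u \<longleftrightarrow> (\<forall>n. smooth_on G (u n)) \<and> Lp_seq p G u"
| "Sob_seq (Suc k) p G u \<longleftrightarrow> (\<forall>n. smooth_on G (u n)) \<and> UC_seq G u \<and> (\<forall>v. Sob_seq k p G (\<lambda>n. dd v (u n)))"

section \<open>Calculus of locally uniform and L^p-bounded sequences\<close>

lemma integral_mono_compact:
  fixes f g :: "'e::euclidean_space \<Rightarrow> real"
  assumes "compact K" "continuous_on K f" "continuous_on K g" "\<And>x. x \<in> K \<Longrightarrow> f x \<le> g x"
  shows "(LINT x:K|lebesgue. f x) \<le> (LINT x:K|lebesgue. g x)"
  using assms by (intro set_integral_mono set_integrable_continuous_compact)

lemma integral_const_compact:
  assumes "compact K"
  shows "(LINT x:K|lebesgue. c) = measure lebesgue K * (c::real)"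
  by (simp add: set_lebesgue_integral_def)

lemma integral_nonneg_compact:
  fixes f :: "'e::euclidean_space \<Rightarrow> real"
  shows "(\<And>x. x \<in> K \<Longrightarrow> 0 \<le> f x) \<Longrightarrow> 0 \<le> (LINT x:K|lebesgue. f x)"
  unfolding set_lebesgue_integral_def by (intro integral_nonneg_AE AE_I2) (auto simp: indicator_def)

lemma continuous_on_norm_powr:
  fixes f :: "'e::topological_space \<Rightarrow> 'f::real_normed_vector"
  assumes "continuous_on S f" "1 \<le> (p::real)"
  shows "continuous_on S (\<lambda>x. norm (f x) powr p)"
  by (rule continuous_on_powr'[OF continuous_on_norm[OF assms(1)] continuous_on_const]) (use assms(2) in auto)

lemma UC_seq_continuous:
  assumes "UC_seq G u" "K \<subseteq> G"
  shows "continuous_on K (u n)"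
proof -
  have "continuous_on G (u n)" using assms(1) unfolding UC_seq_def by blast
  then show ?thesis using assms(2) by (rule continuous_on_subset)
qed

lemma Lp_seq_continuous:
  assumes "Lp_seq p G u" "K \<subseteq> G"
  shows "continuous_on K (u n)"
proof -
  have "continuous_on G (u n)" using assms(1) unfolding Lp_seq_def by blast
  then show ?thesis using assms(2) by (rule continuous_on_subset)
qed

lemma Lp_seq_bound:
  assumes "Lp_seq p G u" "compact K" "K \<subseteq> G"
  obtains B where "\<And>n. (LINT x:K|lebesgue. norm (u n x) powr p) \<le> B"
proof -
  have "\<exists>B. \<forall>n. (LINT x:K|lebesgue. norm (u n x) powr p) \<le> B"
    using assms unfolding Lp_seq_def by blast
  then show thesis using that by blast
qed

lemma UC_seqD: "UC_seq G u \<Longrightarrow> compact K \<Longrightarrow> K \<subseteq> G \<Longrightarrow> uniformly_Cauchy_on K u"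
  by (simp add: UC_seq_def)

lemma UC_seq_subset:
  assumes "UC_seq G u" "S \<subseteq> G"
  shows "UC_seq S u"
  unfolding UC_seq_def
proof (intro conjI allI impI)
  show "continuous_on S (u n)" for n by (rule UC_seq_continuous[OF assms])
  show "uniformly_Cauchy_on K u" if "compact K \<and> K \<subseteq> S" for K
    using assms that unfolding UC_seq_def by blast
qed

text \<open>Finitely many members are bounded by compactness, and all later ones stay within
  distance 1 of the \<open>M\<close>-th.\<close>

lemma UC_seq_bounded:
  assumes u: "UC_seq G u" and K: "compact K" "K \<subseteq> G"
  obtains B where "B > 0" "\<And>n x. x \<in> K \<Longrightarrow> norm (u n x) \<le> B"
proof -
  have "uniformly_Cauchy_on K u" using u K by (auto simp: UC_seq_def)
  then obtain M where M: "\<And>x m n. x \<in> K \<Longrightarrow> m \<ge> M \<Longrightarrow> n \<ge> M \<Longrightarrow> dist (u m x) (u n x) < 1"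
    unfolding uniformly_Cauchy_on_def by (metis zero_less_one)
  have "\<exists>B. \<forall>x\<in>K. norm (u n x) \<le> B" for n
  proof -
    have "continuous_on K (u n)" by (rule UC_seq_continuous[OF u K(2)])
    then have "bounded (u n ` K)" by (intro compact_imp_bounded compact_continuous_image K)
    then show ?thesis by (auto simp: bounded_iff)
  qed
  then obtain C where C: "\<And>n x. x \<in> K \<Longrightarrow> norm (u n x) \<le> C n" by metis
  define B where "B = (\<Sum>n\<le>M. \<bar>C n\<bar>) + 1"
  have "norm (u n x) \<le> B" if x: "x \<in> K" for n x
  proof -
    have le: "norm (u i x) \<le> (\<Sum>n\<le>M. \<bar>C n\<bar>)" if "i \<le> M" for i
    proof -
      have "norm (u i x) \<le> \<bar>C i\<bar>" using C[OF x, of i] by linarith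
      also have "\<dots> \<le> (\<Sum>n\<le>M. \<bar>C n\<bar>)" using that by (intro member_le_sum) auto
      finally show ?thesis .
    qed
    show ?thesis
    proof (cases "n \<le> M")
      case True
      then show ?thesis using le[OF True] by (simp add: B_def)
    next
      case False
      have "norm (u n x) \<le> norm (u M x) + dist (u n x) (u M x)" by (metis dist_norm norm_triangle_sub add.commute)
      also have "\<dots> \<le> (\<Sum>n\<le>M. \<bar>C n\<bar>) + 1" using le[of M] M[OF x, of n M] False by simp
      finally show ?thesis by (simp add: B_def)
    qed
  qed
  moreover have "B > 0" unfolding B_def by (simp add: add_nonneg_pos sum_nonneg)
  ultimately show thesis using that by blast
qed

lemma Lp_seq_L1_bounded:
  assumes u: "Lp_seq p G u" and K: "compact K" "K \<subseteq> G" and p: "1 \<le> p"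
  obtains B where "B > 0" "\<And>n. (LINT x:K|lebesgue. norm (u n x)) \<le> B"
proof -
  obtain B where B: "\<And>n. (LINT x:K|lebesgue. norm (u n x) powr p) \<le> B" using Lp_seq_bound[OF u K] by blast
  have c: "continuous_on K (u n)" for n by (rule Lp_seq_continuous[OF u K(2)])
  have cp: "continuous_on K (\<lambda>x. norm (u n x) powr p)" for n
    by (rule continuous_on_norm_powr[OF c p])
  have "(LINT x:K|lebesgue. norm (u n x)) \<le> measure lebesgue K + \<bar>B\<bar> + 1" for n
  proof -
    have "(LINT x:K|lebesgue. norm (u n x)) \<le> (LINT x:K|lebesgue. 1 + norm (u n x) powr p)"
      using le_add_powr[of "norm (u n x)" 1 p for x] p by (intro integral_mono_compact K continuous_intros c cp) auto
    also have "\<dots> = measure lebesgue K + (LINT x:K|lebesgue. norm (u n x) powr p)"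
      by (subst set_integral_add(2))
         (auto simp: integral_const_compact[OF K(1)] intro!: set_integrable_continuous_compact K cp continuous_intros)
    finally show ?thesis using B[of n] abs_ge_self[of B] by linarith
  qed
  moreover have "measure lebesgue K + \<bar>B\<bar> + 1 > 0" by (simp add: add_nonneg_pos)
  ultimately show thesis using that by blast
qed

text \<open>Only the two norm estimates typical of a product are assumed, so the lemma covers
  products with the uniformly convergent factor on either side, images under bounded linear maps,
  and uniformly convergent sequences themselves.\<close>

lemma Lp_seq_dominated_product:
  fixes f :: "nat \<Rightarrow> 'e::euclidean_space \<Rightarrow> 'f::euclidean_space" and g :: "nat \<Rightarrow> 'e \<Rightarrow> 'g::euclidean_space"
    and w :: "nat \<Rightarrow> 'e \<Rightarrow> 'h::euclidean_space"
  assumes f: "UC_seq G f" and g: "Lp_seq p G g" and p: "1 \<le> p" and w: "\<And>n. continuous_on G (w n)"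
    and le1: "\<And>n x. x \<in> G \<Longrightarrow> norm (w n x) \<le> norm (f n x) * norm (g n x)"
    and le2: "\<And>n l x. x \<in> G \<Longrightarrow> norm (w n x - w l x) \<le> norm (f n x - f l x) * norm (g n x) + norm (f l x) * norm (g n x - g l x)"
  shows "Lp_seq p G w"
  unfolding Lp_seq_def
proof (intro conjI allI impI w; elim conjE)
  fix K assume K: "compact K" "K \<subseteq> G"
  have cont: "continuous_on K (f n)" "continuous_on K (g n)" "continuous_on K (w n)" for n
    by (rule UC_seq_continuous[OF f K(2)] Lp_seq_continuous[OF g K(2)] continuous_on_subset[OF w K(2)])+
  have cp: "continuous_on K (\<lambda>x. norm (g n x) powr p)" "continuous_on K (\<lambda>x. norm (w n x) powr p)" for n
    by (rule continuous_on_norm_powr[OF cont(2) p] continuous_on_norm_powr[OF cont(3) p])+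
  obtain B where B: "B > 0" "\<And>n x. x \<in> K \<Longrightarrow> norm (f n x) \<le> B" using UC_seq_bounded[OF f K] by blast
  obtain C where C: "\<And>n. (LINT x:K|lebesgue. norm (g n x) powr p) \<le> C" using Lp_seq_bound[OF g K] by blast
  show "\<exists>B. \<forall>n. (LINT x:K|lebesgue. norm (w n x) powr p) \<le> B"
  proof (intro exI allI)
    fix n
    have "(LINT x:K|lebesgue. norm (w n x) powr p) \<le> (LINT x:K|lebesgue. B powr p * norm (g n x) powr p)"
    proof (intro integral_mono_compact K cp continuous_intros)
      fix x assume x: "x \<in> K"
      have "norm (w n x) \<le> B * norm (g n x)"
        using le1[of x n] B(2)[OF x, of n] K x by (meson mult_right_mono norm_ge_zero order_trans subsetD)
      then have "norm (w n x) powr p \<le> (B * norm (g n x)) powr p" using p by (intro powr_mono2) auto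
      then show "norm (w n x) powr p \<le> B powr p * norm (g n x) powr p" by (simp add: powr_mult)
    qed
    also have "\<dots> = B powr p * (LINT x:K|lebesgue. norm (g n x) powr p)" by simp
    also have "\<dots> \<le> B powr p * C" using C by (intro mult_left_mono) auto
    finally show "(LINT x:K|lebesgue. norm (w n x) powr p) \<le> B powr p * C" .
  qed
  obtain D where D: "D > 0" "\<And>n. (LINT x:K|lebesgue. norm (g n x)) \<le> D" using Lp_seq_L1_bounded[OF g K p] by blast
  fix e :: real assume e: "e > 0"
  define d1 where "d1 = e / (2 * D)"
  define d2 where "d2 = e / (2 * B)"
  have d: "d1 > 0" "d2 > 0" using e B D by (auto simp: d1_def d2_def)
  obtain N1 where N1: "\<And>x m n. x \<in> K \<Longrightarrow> m \<ge> N1 \<Longrightarrow> n \<ge> N1 \<Longrightarrow> dist (f m x) (f n x) < d1"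
    using f K d unfolding UC_seq_def uniformly_Cauchy_on_def by metis
  obtain N2 where N2: "\<And>m n. m \<ge> N2 \<Longrightarrow> n \<ge> N2 \<Longrightarrow> (LINT x:K|lebesgue. norm (g m x - g n x)) < d2"
    using g K d unfolding Lp_seq_def by metis
  have "(LINT x:K|lebesgue. norm (w n x - w l x)) < e" if n: "n \<ge> max N1 N2" "l \<ge> max N1 N2" for n l
  proof -
    have "(LINT x:K|lebesgue. norm (w n x - w l x)) \<le> (LINT x:K|lebesgue. d1 * norm (g n x) + B * norm (g n x - g l x))"
    proof (intro integral_mono_compact K cont continuous_intros)
      fix x assume x: "x \<in> K"
      have "norm (w n x - w l x) \<le> norm (f n x - f l x) * norm (g n x) + norm (f l x) * norm (g n x - g l x)"
        using le2 x K by blast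
      also have "\<dots> \<le> d1 * norm (g n x) + B * norm (g n x - g l x)"
        using N1[OF x, of n l] n B(2)[OF x] by (intro add_mono mult_right_mono) (auto simp: dist_norm)
      finally show "norm (w n x - w l x) \<le> d1 * norm (g n x) + B * norm (g n x - g l x)" .
    qed
    also have "\<dots> = d1 * (LINT x:K|lebesgue. norm (g n x)) + B * (LINT x:K|lebesgue. norm (g n x - g l x))"
      by (subst set_integral_add(2)) (auto intro!: set_integrable_continuous_compact K cont continuous_intros)
    also have "\<dots> < d1 * D + B * d2"
      using d B D N2[of n l] n by (intro add_le_less_mono mult_left_mono mult_strict_left_mono) auto
    also have "\<dots> = e" using B D by (simp add: d1_def d2_def)
    finally show ?thesis .
  qed
  then show "\<exists>N. \<forall>n\<ge>N. \<forall>l\<ge>N. (LINT x:K|lebesgue. norm (w n x - w l x)) < e" by blast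
qed

lemma UC_seq_const: "continuous_on G f \<Longrightarrow> UC_seq G (\<lambda>n. f)"
  by (auto simp: UC_seq_def uniformly_Cauchy_on_def)

lemma Lp_seq_one:
  shows "Lp_seq p G (\<lambda>n x. 1 :: real)"
  unfolding Lp_seq_def by (auto simp: set_lebesgue_integral_def)

lemma UC_imp_Lp_seq:
  assumes u: "UC_seq G u" and p: "1 \<le> p"
  shows "Lp_seq p G u"
  by (rule Lp_seq_dominated_product[OF u Lp_seq_one p]) (use u in \<open>auto simp: UC_seq_def\<close>)

lemma Lp_seq_bounded_linear:
  assumes u: "Lp_seq p G u" and p: "1 \<le> p" and L: "bounded_linear L"
  shows "Lp_seq p G (\<lambda>n x. L (u n x))"
proof -
  obtain C where C: "C \<ge> 0" "\<And>y. norm (L y) \<le> C * norm y"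
    using bounded_linear.nonneg_bounded[OF L] by (auto simp: mult.commute)
  show ?thesis
  proof (rule Lp_seq_dominated_product[OF UC_seq_const[of G "\<lambda>_. C"] u p])
    show "continuous_on G (\<lambda>x. L (u n x))" for n
      using u by (intro bounded_linear.continuous_on[OF L]) (auto simp: Lp_seq_def)
    show "norm (L (u n x)) \<le> norm C * norm (u n x)" for n x using C by simp
    show "norm (L (u n x) - L (u l x)) \<le> norm (C - C) * norm (u n x) + norm C * norm (u n x - u l x)" for n l x
      using C by (simp flip: linear_diff[OF bounded_linear.linear[OF L]])
  qed simp
qed

lemma UC_seq_bounded_linear:
  assumes u: "UC_seq G u" and L: "bounded_linear L"
  shows "UC_seq G (\<lambda>n x. L (u n x))"
  unfolding UC_seq_def
proof (intro conjI allI impI)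
  show "continuous_on G (\<lambda>x. L (u n x))" for n
    using u by (intro bounded_linear.continuous_on[OF L]) (auto simp: UC_seq_def)
  fix K assume K: "compact K \<and> K \<subseteq> G"
  obtain C where C: "C > 0" "\<And>y. norm (L y) \<le> C * norm y"
    using bounded_linear.pos_bounded[OF L] by (auto simp: mult.commute)
  show "uniformly_Cauchy_on K (\<lambda>n x. L (u n x))"
  proof (rule uniformly_Cauchy_onI)
    fix e :: real assume "e > 0"
    then have "e / C > 0" using C by simp
    then obtain M where M: "\<And>x m n. x \<in> K \<Longrightarrow> m \<ge> M \<Longrightarrow> n \<ge> M \<Longrightarrow> dist (u m x) (u n x) < e / C"
      using u K unfolding UC_seq_def uniformly_Cauchy_on_def by metis
    have "dist (L (u m x)) (L (u n x)) < e" if "x \<in> K" "m \<ge> M" "n \<ge> M" for x m n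
    proof -
      have "dist (L (u m x)) (L (u n x)) \<le> C * dist (u m x) (u n x)"
        using C(2)[of "u m x - u n x"] by (simp add: dist_norm linear_diff[OF bounded_linear.linear[OF L]])
      also have "\<dots> < e" using M[OF that] C(1) by (simp add: pos_less_divide_eq mult.commute)
      finally show ?thesis .
    qed
    then show "\<exists>M. \<forall>x\<in>K. \<forall>m\<ge>M. \<forall>n\<ge>M. dist (L (u m x)) (L (u n x)) < e" by blast
  qed
qed

lemma UC_seq_Pair:
  assumes "UC_seq G u" "UC_seq G w"
  shows "UC_seq G (\<lambda>n x. (u n x, w n x))"
  unfolding UC_seq_def
proof (intro conjI allI impI)
  show "continuous_on G (\<lambda>x. (u n x, w n x))" for n using assms by (intro continuous_intros) (auto simp: UC_seq_def)
  fix K assume K: "compact K \<and> K \<subseteq> G"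
  show "uniformly_Cauchy_on K (\<lambda>n x. (u n x, w n x))"
  proof (rule uniformly_Cauchy_onI)
    fix e :: real assume "e > 0"
    then have e2: "e / 2 > 0" by simp
    obtain M1 where M1: "\<And>x m n. x \<in> K \<Longrightarrow> m \<ge> M1 \<Longrightarrow> n \<ge> M1 \<Longrightarrow> dist (u m x) (u n x) < e / 2"
      using assms(1) K e2 unfolding UC_seq_def uniformly_Cauchy_on_def by metis
    obtain M2 where M2: "\<And>x m n. x \<in> K \<Longrightarrow> m \<ge> M2 \<Longrightarrow> n \<ge> M2 \<Longrightarrow> dist (w m x) (w n x) < e / 2"
      using assms(2) K e2 unfolding UC_seq_def uniformly_Cauchy_on_def by metis
    have "dist (u m x, w m x) (u n x, w n x) < e" if "x \<in> K" "m \<ge> max M1 M2" "n \<ge> max M1 M2" for x m n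
    proof -
      have "dist (u m x, w m x) (u n x, w n x) \<le> dist (u m x) (u n x) + dist (w m x) (w n x)"
        unfolding dist_Pair_Pair by (rule sqrt_sum_squares_le_sum) auto
      then show ?thesis using M1[of x m n] M2[of x m n] that by fastforce
    qed
    then show "\<exists>M. \<forall>x\<in>K. \<forall>m\<ge>M. \<forall>n\<ge>M. dist (u m x, w m x) (u n x, w n x) < e" by blast
  qed
qed

lemma UC_seq_compose:
  assumes u: "UC_seq G u" and B: "\<And>n. u n ` G \<subseteq> B" "compact B" and F: "continuous_on B F"
  shows "UC_seq G (\<lambda>n x. F (u n x))"
  unfolding UC_seq_def
proof (intro conjI allI impI)
  show "continuous_on G (\<lambda>x. F (u n x))" for n
    using u B by (intro continuous_on_compose2[OF F]) (auto simp: UC_seq_def)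
  fix K assume K: "compact K \<and> K \<subseteq> G"
  show "uniformly_Cauchy_on K (\<lambda>n x. F (u n x))"
  proof (rule uniformly_Cauchy_onI)
    fix e :: real assume "e > 0"
    then obtain d where d: "d > 0" "\<And>y z. y \<in> B \<Longrightarrow> z \<in> B \<Longrightarrow> dist z y < d \<Longrightarrow> dist (F z) (F y) < e"
      using compact_uniformly_continuous[OF F B(2)] unfolding uniformly_continuous_on_def by metis
    then obtain M where M: "\<And>x m n. x \<in> K \<Longrightarrow> m \<ge> M \<Longrightarrow> n \<ge> M \<Longrightarrow> dist (u m x) (u n x) < d"
      using u K unfolding UC_seq_def uniformly_Cauchy_on_def by metis
    have "u n x \<in> B" if "x \<in> K" for n x using B(1) K that by blast
    then show "\<exists>M. \<forall>x\<in>K. \<forall>m\<ge>M. \<forall>n\<ge>M. dist (F (u m x)) (F (u n x)) < e" using M d(2) by meson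
  qed
qed

text \<open>Over a compact set both sequences stay in fixed balls, and \<open>F\<close> is uniformly
  continuous on the product of these balls.\<close>

lemma UC_seq_combine:
  fixes F :: "'f::euclidean_space \<times> 'g::euclidean_space \<Rightarrow> 'h::euclidean_space"
  assumes u: "UC_seq G u" "UC_seq G w" and F: "continuous_on UNIV F"
  shows "UC_seq G (\<lambda>n x. F (u n x, w n x))"
  unfolding UC_seq_def
proof (intro conjI allI impI; (elim conjE)?)
  show "continuous_on G (\<lambda>x. F (u n x, w n x))" for n
    by (intro continuous_on_compose2[OF F] continuous_on_Pair UC_seq_continuous[OF u(1)] UC_seq_continuous[OF u(2)]) auto
  fix K assume K: "compact K" "K \<subseteq> G"
  obtain B where B: "B > 0" "\<And>n x. x \<in> K \<Longrightarrow> norm (u n x) \<le> B" using UC_seq_bounded[OF u(1) K] by blast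
  obtain C where C: "C > 0" "\<And>n x. x \<in> K \<Longrightarrow> norm (w n x) \<le> C" using UC_seq_bounded[OF u(2) K] by blast
  have "UC_seq K (\<lambda>n x. (u n x, w n x))"
    by (rule UC_seq_subset[OF UC_seq_Pair[OF u] K(2)])
  then have "UC_seq K (\<lambda>n x. F (u n x, w n x))"
    by (rule UC_seq_compose[where B="cball 0 B \<times> cball 0 C"])
       (use B(2) C(2) in \<open>auto intro!: compact_Times continuous_on_subset[OF F]\<close>)
  then show "uniformly_Cauchy_on K (\<lambda>n x. F (u n x, w n x))" by (rule UC_seqD[OF _ K(1) order_refl])
qed

lemma UC_seq_add: "UC_seq G u \<Longrightarrow> UC_seq G w \<Longrightarrow> UC_seq G (\<lambda>n x. u n x + w n x)"
  using UC_seq_combine[of G u w "\<lambda>z. fst z + snd z"] by (simp add: continuous_on_add continuous_on_fst continuous_on_snd)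

lemma UC_seq_scaleR: "UC_seq G a \<Longrightarrow> UC_seq G u \<Longrightarrow> UC_seq G (\<lambda>n x. a n x *\<^sub>R u n x)"
  using UC_seq_combine[of G a u "\<lambda>z. fst z *\<^sub>R snd z"] by (simp add: continuous_on_scaleR continuous_on_fst continuous_on_snd)

lemma Lp_seq_add:
  assumes u: "Lp_seq p G u" and w: "Lp_seq p G w" and p: "1 \<le> p"
  shows "Lp_seq p G (\<lambda>n x. u n x + w n x)"
  unfolding Lp_seq_def
proof (intro conjI allI impI; (elim conjE)?)
  show "continuous_on G (\<lambda>x. u n x + w n x)" for n using u w by (intro continuous_intros) (auto simp: Lp_seq_def)
  fix K assume K: "compact K" "K \<subseteq> G"
  have cont: "continuous_on K (u n)" "continuous_on K (w n)" for n
    by (rule Lp_seq_continuous[OF u K(2)] Lp_seq_continuous[OF w K(2)])+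
  have cp: "continuous_on K (\<lambda>x. norm (u n x) powr p)" "continuous_on K (\<lambda>x. norm (w n x) powr p)"
    "continuous_on K (\<lambda>x. norm (u n x + w n x) powr p)" for n
    by (rule continuous_on_norm_powr[OF cont(1) p] continuous_on_norm_powr[OF cont(2) p] continuous_on_norm_powr[OF continuous_on_add[OF cont] p])+
  obtain B where B: "\<And>n. (LINT x:K|lebesgue. norm (u n x) powr p) \<le> B" using Lp_seq_bound[OF u K] by blast
  obtain C where C: "\<And>n. (LINT x:K|lebesgue. norm (w n x) powr p) \<le> C" using Lp_seq_bound[OF w K] by blast
  show "\<exists>B. \<forall>n. (LINT x:K|lebesgue. norm (u n x + w n x) powr p) \<le> B"
  proof (intro exI allI)
    fix n
    have "(LINT x:K|lebesgue. norm (u n x + w n x) powr p) \<le> (LINT x:K|lebesgue. 2 powr p * (norm (u n x) powr p + norm (w n x) powr p))"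
    proof (intro integral_mono_compact K cp continuous_intros)
      fix x
      have "norm (u n x + w n x) powr p \<le> (\<Sum>i\<in>{True, False}. if i then norm (u n x) else norm (w n x)) powr p"
        using p norm_triangle_ineq[of "u n x" "w n x"] by (intro powr_mono2) auto
      also have "\<dots> \<le> real (card {True, False}) powr p * (\<Sum>i\<in>{True, False}. (if i then norm (u n x) else norm (w n x)) powr p)"
        using p by (intro sum_powr_le) auto
      finally show "norm (u n x + w n x) powr p \<le> 2 powr p * (norm (u n x) powr p + norm (w n x) powr p)" by simp
    qed
    also have "\<dots> = 2 powr p * ((LINT x:K|lebesgue. norm (u n x) powr p) + (LINT x:K|lebesgue. norm (w n x) powr p))"
      by (simp add: set_integral_add(2) set_integrable_continuous_compact K cp)
    also have "\<dots> \<le> 2 powr p * (B + C)" using B C by (intro mult_left_mono add_mono) auto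
    finally show "(LINT x:K|lebesgue. norm (u n x + w n x) powr p) \<le> 2 powr p * (B + C)" .
  qed
  fix e :: real assume "e > 0"
  then have e2: "e / 2 > 0" by simp
  obtain N1 where N1: "\<And>m n. m \<ge> N1 \<Longrightarrow> n \<ge> N1 \<Longrightarrow> (LINT x:K|lebesgue. norm (u m x - u n x)) < e/2"
    using u K e2 unfolding Lp_seq_def by metis
  obtain N2 where N2: "\<And>m n. m \<ge> N2 \<Longrightarrow> n \<ge> N2 \<Longrightarrow> (LINT x:K|lebesgue. norm (w m x - w n x)) < e/2"
    using w K e2 unfolding Lp_seq_def by metis
  have "(LINT x:K|lebesgue. norm (u n x + w n x - (u l x + w l x))) < e" if "n \<ge> max N1 N2" "l \<ge> max N1 N2" for n l
  proof -
    have "(LINT x:K|lebesgue. norm (u n x + w n x - (u l x + w l x))) \<le> (LINT x:K|lebesgue. norm (u n x - u l x) + norm (w n x - w l x))"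
      by (intro integral_mono_compact K continuous_intros cont norm_diff_triangle_ineq)
    also have "\<dots> = (LINT x:K|lebesgue. norm (u n x - u l x)) + (LINT x:K|lebesgue. norm (w n x - w l x))"
      by (intro set_integral_add(2) set_integrable_continuous_compact K continuous_intros cont)
    also have "\<dots> < e/2 + e/2" using that by (intro add_strict_mono N1 N2) auto
    finally show ?thesis by simp
  qed
  then show "\<exists>N. \<forall>n\<ge>N. \<forall>l\<ge>N. (LINT x:K|lebesgue. norm (u n x + w n x - (u l x + w l x))) < e" by blast
qed

lemma Lp_seq_cong_imp:
  assumes eq: "\<And>n x. x \<in> G \<Longrightarrow> u n x = w n x" and u: "Lp_seq p G u"
  shows "Lp_seq p G w"
  unfolding Lp_seq_def
proof (intro conjI allI impI; (elim conjE)?)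
  show "continuous_on G (w n)" for n
    using Lp_seq_continuous[OF u order_refl, of n] eq by (simp cong: continuous_on_cong)
  fix K assume K: "compact K" "K \<subseteq> G"
  have 1: "(LINT x:K|lebesgue. norm (w n x) powr p) = (LINT x:K|lebesgue. norm (u n x) powr p)" for n
  proof -
    have "(\<lambda>x. indicator K x *\<^sub>R (norm (w n x) powr p)) = (\<lambda>x. indicator K x *\<^sub>R (norm (u n x) powr p))"
      using eq K(2) by (auto simp: fun_eq_iff indicator_def)
    then show ?thesis unfolding set_lebesgue_integral_def by presburger
  qed
  have 2: "(LINT x:K|lebesgue. norm (w n x - w l x)) = (LINT x:K|lebesgue. norm (u n x - u l x))" for n l
  proof -
    have "(\<lambda>x. indicator K x *\<^sub>R norm (w n x - w l x)) = (\<lambda>x. indicator K x *\<^sub>R norm (u n x - u l x))"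
      using eq K(2) by (auto simp: fun_eq_iff indicator_def)
    then show ?thesis unfolding set_lebesgue_integral_def by presburger
  qed
  show "\<exists>B. \<forall>n. (LINT x:K|lebesgue. norm (w n x) powr p) \<le> B"
    unfolding 1 using Lp_seq_bound[OF u K] by blast
  fix e :: real assume "e > 0"
  then show "\<exists>N. \<forall>n\<ge>N. \<forall>l\<ge>N. (LINT x:K|lebesgue. norm (w n x - w l x)) < e"
    unfolding 2 using u K unfolding Lp_seq_def by blast
qed

lemma Lp_seq_cong:
  assumes "\<And>n x. x \<in> G \<Longrightarrow> u n x = w n x"
  shows "Lp_seq p G u \<longleftrightarrow> Lp_seq p G w"
  using Lp_seq_cong_imp[of G u w p] Lp_seq_cong_imp[of G w u p] assms by metis

lemma UC_seq_cong:
  assumes "\<And>n x. x \<in> G \<Longrightarrow> u n x = w n x"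
  shows "UC_seq G u \<longleftrightarrow> UC_seq G w"
proof -
  have c: "continuous_on G (u n) \<longleftrightarrow> continuous_on G (w n)" for n using assms by (intro continuous_on_cong) auto
  have "uniformly_Cauchy_on K u \<longleftrightarrow> uniformly_Cauchy_on K w" if "K \<subseteq> G" for K
  proof -
    have "u n x = w n x" if "x \<in> K" for n x using assms that \<open>K \<subseteq> G\<close> by blast
    then show ?thesis unfolding uniformly_Cauchy_on_def by simp
  qed
  then show ?thesis unfolding UC_seq_def c by blast
qed

section \<open>Product and chain rules for Sobolev sequences\<close>

lemma Sob_seq_cong:
  assumes G: "open G" and eq: "\<And>n x. x \<in> G \<Longrightarrow> u n x = w n x"
  shows "Sob_seq k p G u \<longleftrightarrow> Sob_seq k p G w"
  using eq
proof (induction k arbitrary: u w)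
  case 0
  have "smooth_on G (u n) \<longleftrightarrow> smooth_on G (w n)" for n by (rule smooth_on_cong[OF G 0])
  then show ?case using Lp_seq_cong[of G u w, OF 0] by simp
next
  case (Suc k)
  have "smooth_on G (u n) \<longleftrightarrow> smooth_on G (w n)" for n by (rule smooth_on_cong[OF G Suc.prems])
  moreover have "Sob_seq k p G (\<lambda>n. dd v (u n)) \<longleftrightarrow> Sob_seq k p G (\<lambda>n. dd v (w n))" for v
    by (rule Suc.IH, rule dd_cong[OF G]) (use Suc.prems in auto)
  ultimately show ?case using UC_seq_cong[of G u w, OF Suc.prems] by simp
qed

lemma Sob_seq_smooth: "Sob_seq k p G u \<Longrightarrow> smooth_on G (u n)"
  by (cases k) auto

lemma Sob_seq_differentiable: "Sob_seq k p G u \<Longrightarrow> x \<in> G \<Longrightarrow> u n differentiable (at x)"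
  by (rule smooth_on_differentiable[OF Sob_seq_smooth])

lemma Sob_seq_pred:
  assumes "1 \<le> p" "Sob_seq (Suc k) p G u"
  shows "Sob_seq k p G u"
  using assms(2)
proof (induction k arbitrary: u)
  case 0
  then show ?case using UC_imp_Lp_seq[OF _ assms(1)] by auto
next
  case (Suc k)
  have "Sob_seq k p G (\<lambda>n. dd v (u n))" for v
    by (rule Suc.IH) (use Suc.prems in auto)
  then show ?case using Suc.prems by auto
qed

lemma Sob_seq_add:
  assumes G: "open G" and p: "1 \<le> p" and "Sob_seq k p G u" "Sob_seq k p G w"
  shows "Sob_seq k p G (\<lambda>n x. u n x + w n x)"
  using assms(3,4)
proof (induction k arbitrary: u w)
  case 0
  then show ?case by (auto intro: smooth_on_add[OF G] Lp_seq_add[OF _ _ p])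
next
  case (Suc k)
  have "Sob_seq k p G (\<lambda>n x. dd v (u n) x + dd v (w n) x)" for v
    using Suc.prems by (intro Suc.IH) auto
  moreover have "Sob_seq k p G (\<lambda>n x. dd v (u n) x + dd v (w n) x) \<longleftrightarrow> Sob_seq k p G (\<lambda>n. dd v (\<lambda>x. u n x + w n x))" for v
    by (rule Sob_seq_cong[OF G], rule dd_add[symmetric])
       (rule Sob_seq_differentiable[OF Suc.prems(1)] Sob_seq_differentiable[OF Suc.prems(2)]; assumption)+
  ultimately show ?case using Suc.prems by (auto intro: smooth_on_add[OF G] UC_seq_add)
qed

lemma Sob_seq_const:
  assumes p: "1 \<le> p" and f: "smooth_on G f"
  shows "Sob_seq k p G (\<lambda>n. f)"
  using f
proof (induction k arbitrary: f)
  case 0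
  then show ?case by (auto intro!: UC_imp_Lp_seq[OF UC_seq_const[OF smooth_on_continuous] p])
next
  case (Suc k)
  then show ?case by (auto intro: UC_seq_const[OF smooth_on_continuous] smooth_on_dd)
qed

lemma Sob_seq_sum:
  fixes u :: "'i \<Rightarrow> nat \<Rightarrow> 'e::euclidean_space \<Rightarrow> 'f::euclidean_space"
  assumes G: "open G" and p: "1 \<le> p" and u: "\<And>i. i \<in> I \<Longrightarrow> Sob_seq k p G (u i)"
  shows "Sob_seq k p G (\<lambda>n x. \<Sum>i\<in>I. u i n x)"
  using u
proof (induction I rule: infinite_finite_induct)
  case (insert i I)
  then show ?case using Sob_seq_add[OF G p, of k "u i" "\<lambda>n x. \<Sum>i\<in>I. u i n x"] by simp
qed (use Sob_seq_const[OF p smooth_on_const] in auto)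

lemma Sob_seq_bounded_linear:
  assumes G: "open G" and p: "1 \<le> p" and L: "bounded_linear L" and "Sob_seq k p G u"
  shows "Sob_seq k p G (\<lambda>n x. L (u n x))"
  using assms(4)
proof (induction k arbitrary: u)
  case 0
  then show ?case by (auto intro: smooth_on_bounded_linear[OF G L] Lp_seq_bounded_linear[OF _ p L])
next
  case (Suc k)
  have "Sob_seq k p G (\<lambda>n x. L (dd v (u n) x))" for v using Suc.prems by (intro Suc.IH) auto
  moreover have "Sob_seq k p G (\<lambda>n x. L (dd v (u n) x)) \<longleftrightarrow> Sob_seq k p G (\<lambda>n. dd v (\<lambda>x. L (u n x)))" for v
    by (rule Sob_seq_cong[OF G], rule dd_bounded_linear[OF L, symmetric])
       (rule Sob_seq_differentiable[OF Suc.prems])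
  ultimately show ?case using Suc.prems by (auto intro: smooth_on_bounded_linear[OF G L] UC_seq_bounded_linear[OF _ L])
qed

lemma Lp_seq_scaleR:
  fixes a :: "nat \<Rightarrow> 'e::euclidean_space \<Rightarrow> real" and u :: "nat \<Rightarrow> 'e \<Rightarrow> 'f::euclidean_space"
  assumes p: "1 \<le> p" and "UC_seq G a \<and> Lp_seq p G u \<or> Lp_seq p G a \<and> UC_seq G u"
  shows "Lp_seq p G (\<lambda>n x. a n x *\<^sub>R u n x)"
proof -
  have c: "continuous_on G (\<lambda>x. a n x *\<^sub>R u n x)" for n
    using assms(2) by (intro continuous_intros) (auto simp: UC_seq_def Lp_seq_def)
  have d1: "norm (a n x *\<^sub>R u n x - a l x *\<^sub>R u l x) \<le> norm (a n x - a l x) * norm (u n x) + norm (a l x) * norm (u n x - u l x)" for n l x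
  proof -
    have "a n x *\<^sub>R u n x - a l x *\<^sub>R u l x = (a n x - a l x) *\<^sub>R u n x + a l x *\<^sub>R (u n x - u l x)" by (simp add: algebra_simps)
    then show ?thesis by (metis norm_scaleR norm_triangle_ineq real_norm_def)
  qed
  have d2: "norm (a n x *\<^sub>R u n x - a l x *\<^sub>R u l x) \<le> norm (u n x - u l x) * norm (a n x) + norm (u l x) * norm (a n x - a l x)" for n l x
  proof -
    have "a n x *\<^sub>R u n x - a l x *\<^sub>R u l x = a n x *\<^sub>R (u n x - u l x) + (a n x - a l x) *\<^sub>R u l x" by (simp add: algebra_simps)
    then show ?thesis by (metis norm_scaleR norm_triangle_ineq real_norm_def mult.commute)
  qed
  show ?thesis using assms(2)
  proof
    assume *: "UC_seq G a \<and> Lp_seq p G u"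
    show ?thesis by (rule Lp_seq_dominated_product[of G a p u]) (use * p c d1 in auto)
  next
    assume *: "Lp_seq p G a \<and> UC_seq G u"
    show ?thesis by (rule Lp_seq_dominated_product[of G u p a]) (use * p c d2 in \<open>auto simp: mult.commute\<close>)
  qed
qed

text \<open>In the product rule the derivative falls on one factor, and the other factor, of
  positive order, is locally uniformly Cauchy. The disjunction carries this fact down to order 0,
  where two factors bounded in L^p would not suffice.\<close>

lemma Sob_seq_scaleR:
  fixes a :: "nat \<Rightarrow> 'e::euclidean_space \<Rightarrow> real" and u :: "nat \<Rightarrow> 'e \<Rightarrow> 'f::euclidean_space"
  assumes G: "open G" and p: "1 \<le> p" and "Sob_seq k p G a" "Sob_seq k p G u" "UC_seq G a \<or> UC_seq G u"
  shows "Sob_seq k p G (\<lambda>n x. a n x *\<^sub>R u n x)"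
  using assms(3-5)
proof (induction k arbitrary: a u)
  case 0
  then show ?case using Lp_seq_scaleR[OF p] by (auto intro: smooth_on_scaleR[OF G])
next
  case (Suc k)
  have a: "Sob_seq k p G a" and u: "Sob_seq k p G u" using Sob_seq_pred[OF p] Suc.prems by blast+
  have "Sob_seq k p G (\<lambda>n x. a n x *\<^sub>R dd v (u n) x + dd v (a n) x *\<^sub>R u n x)" for v
    by (intro Sob_seq_add[OF G p] Suc.IH a u) (use Suc.prems in auto)
  moreover have "Sob_seq k p G (\<lambda>n x. a n x *\<^sub>R dd v (u n) x + dd v (a n) x *\<^sub>R u n x) \<longleftrightarrow> Sob_seq k p G (\<lambda>n. dd v (\<lambda>x. a n x *\<^sub>R u n x))" for v
    by (rule Sob_seq_cong[OF G], rule dd_scaleR[symmetric])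
       (rule Sob_seq_differentiable[OF Suc.prems(1)] Sob_seq_differentiable[OF Suc.prems(2)]; assumption)+
  ultimately show ?case using Suc.prems by (auto intro: smooth_on_scaleR[OF G] UC_seq_scaleR)
qed

text \<open>In each product of the chain rule the factor \<open>dd b F\<close> composed with
  \<open>u\<close> converges locally uniformly, since \<open>dd b F\<close> is uniformly continuous
  on the compact \<open>B\<close>; the other factor may then be of top order.\<close>

lemma Sob_seq_compose_left:
  fixes u :: "nat \<Rightarrow> 'e::euclidean_space \<Rightarrow> 'f::euclidean_space" and F :: "'f \<Rightarrow> 'g::euclidean_space"
  assumes G: "open G" and p: "1 \<le> p" and T: "open T" "B \<subseteq> T" "compact B" and u: "\<And>n. u n ` G \<subseteq> B"
    and F: "smooth_on T F" and uc: "UC_seq G u" and "Sob_seq k p G u"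
  shows "Sob_seq k p G (\<lambda>n x. F (u n x))"
  using F assms(9)
proof (induction k arbitrary: F)
  have sm: "smooth_on G (\<lambda>x. F (u n x))" if "smooth_on T F" "Sob_seq k p G u" for F :: "'f \<Rightarrow> 'g" and n k
    by (rule smooth_on_compose[OF G T(1) Sob_seq_smooth[OF that(2)] that(1)]) (use u T in blast)
  have UC: "UC_seq G (\<lambda>n x. F (u n x))" if "smooth_on T F" for F :: "'f \<Rightarrow> 'g"
    by (rule UC_seq_compose[OF uc u T(3) continuous_on_subset[OF smooth_on_continuous[OF that] T(2)]])
  {
    case 0
    then show ?case using sm[OF 0] UC_imp_Lp_seq[OF UC[OF 0(1)] p] by simp
  next
    case (Suc k)
    have uk: "Sob_seq k p G u" using Sob_seq_pred[OF p Suc.prems(2)] .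
    have "Sob_seq k p G (\<lambda>n x. \<Sum>b\<in>Basis. (dd v (u n) x \<bullet> b) *\<^sub>R dd b F (u n x))" for v
    proof (intro Sob_seq_sum[OF G p] Sob_seq_scaleR[OF G p] disjI2)
      fix b :: 'f
      show "Sob_seq k p G (\<lambda>n x. dd v (u n) x \<bullet> b)"
        using Suc.prems(2) by (intro Sob_seq_bounded_linear[OF G p bounded_linear_inner_left]) auto
      show "Sob_seq k p G (\<lambda>n x. dd b F (u n x))" by (rule Suc.IH[OF smooth_on_dd[OF Suc.prems(1)] uk])
      show "UC_seq G (\<lambda>n x. dd b F (u n x))" by (rule UC[OF smooth_on_dd[OF Suc.prems(1)]])
    qed
    moreover have "Sob_seq k p G (\<lambda>n x. \<Sum>b\<in>Basis. (dd v (u n) x \<bullet> b) *\<^sub>R dd b F (u n x)) \<longleftrightarrow> Sob_seq k p G (\<lambda>n. dd v (\<lambda>x. F (u n x)))" for v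
    proof (rule Sob_seq_cong[OF G])
      fix n x assume x: "x \<in> G"
      have "u n differentiable (at x)" "F differentiable (at (u n x))"
        using smooth_on_differentiable[OF Sob_seq_smooth[OF Suc.prems(2)] x] smooth_on_differentiable[OF Suc.prems(1)] u T(2) x by blast+
      then show "(\<Sum>b\<in>Basis. (dd v (u n) x \<bullet> b) *\<^sub>R dd b F (u n x)) = dd v (\<lambda>x. F (u n x)) x"
        by (simp add: dd_compose dd_basis_sum[symmetric])
    qed
    ultimately show ?case using sm[OF Suc.prems] UC[OF Suc.prems(1)] by simp
  }
qed

text \<open>The factors \<open>dd v H\<close> do not depend on \<open>n\<close>, so the chain rule
  is harmless. What the top order requires is stability of \<open>Lp_seq\<close> under the
  substitution; it enters as a hypothesis, to be supplied by the change of variables.\<close>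

lemma Sob_seq_compose_right:
  fixes u :: "nat \<Rightarrow> 'e::euclidean_space \<Rightarrow> 'f::euclidean_space" and H :: "'g::euclidean_space \<Rightarrow> 'e"
  assumes G: "open G" and S: "open S" and p: "1 \<le> p" and H: "smooth_on S H" "H ` S \<subseteq> G"
    and Lp: "\<And>w :: nat \<Rightarrow> 'e \<Rightarrow> 'f. Lp_seq p G w \<Longrightarrow> Lp_seq p S (\<lambda>n x. w n (H x))" and "Sob_seq k p G u"
  shows "Sob_seq k p S (\<lambda>n x. u n (H x))"
  using assms(7)
proof (induction k arbitrary: u)
  have sm: "smooth_on S (\<lambda>x. u n (H x))" if "Sob_seq k p G u" for u :: "nat \<Rightarrow> 'e \<Rightarrow> 'f" and n k
    by (rule smooth_on_compose[OF S G H(1) Sob_seq_smooth[OF that] H(2)])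
  have UC: "UC_seq S (\<lambda>n x. u n (H x))" if u: "UC_seq G u" for u :: "nat \<Rightarrow> 'e \<Rightarrow> 'f"
    unfolding UC_seq_def
  proof (intro conjI allI impI; (elim conjE)?)
    have cH: "continuous_on S H" by (rule smooth_on_continuous[OF H(1)])
    show "continuous_on S (\<lambda>x. u n (H x))" for n
      using u H(2) by (intro continuous_on_compose2[OF _ cH, of G]) (auto simp: UC_seq_def)
    fix K assume K: "compact K" "K \<subseteq> S"
    have "compact (H ` K)" "H ` K \<subseteq> G" using K H(2) continuous_on_subset[OF cH] by (auto intro!: compact_continuous_image)
    then have "uniformly_Cauchy_on (H ` K) u" using u by (auto simp: UC_seq_def)
    then show "uniformly_Cauchy_on K (\<lambda>n x. u n (H x))" unfolding uniformly_Cauchy_on_def by blast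
  qed
  {
    case 0
    then show ?case using sm[OF 0] Lp by simp
  next
    case (Suc k)
    have "Sob_seq k p S (\<lambda>n x. \<Sum>b\<in>Basis. (dd v H x \<bullet> b) *\<^sub>R dd b (u n) (H x))" for v
    proof (intro Sob_seq_sum[OF S p] Sob_seq_scaleR[OF S p] disjI1)
      fix b :: 'e
      have "smooth_on S (\<lambda>x. dd v H x \<bullet> b)"
        by (intro smooth_on_bounded_linear[OF S bounded_linear_inner_left] smooth_on_dd H)
      then show "Sob_seq k p S (\<lambda>n x. dd v H x \<bullet> b)" "UC_seq S (\<lambda>n x. dd v H x \<bullet> b)"
        by (auto intro: Sob_seq_const[OF p] UC_seq_const smooth_on_continuous)
      show "Sob_seq k p S (\<lambda>n x. dd b (u n) (H x))" using Suc.prems by (intro Suc.IH) auto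
    qed
    moreover have "Sob_seq k p S (\<lambda>n x. \<Sum>b\<in>Basis. (dd v H x \<bullet> b) *\<^sub>R dd b (u n) (H x)) \<longleftrightarrow> Sob_seq k p S (\<lambda>n. dd v (\<lambda>x. u n (H x)))" for v
    proof (rule Sob_seq_cong[OF S])
      fix n x assume x: "x \<in> S"
      have "H differentiable (at x)" "u n differentiable (at (H x))"
        using smooth_on_differentiable[OF H(1) x] smooth_on_differentiable[OF Sob_seq_smooth[OF Suc.prems]] H(2) x by blast+
      then show "(\<Sum>b\<in>Basis. (dd v H x \<bullet> b) *\<^sub>R dd b (u n) (H x)) = dd v (\<lambda>x. u n (H x)) x"
        by (simp add: dd_compose dd_basis_sum[symmetric])
    qed
    ultimately show ?case using sm[OF Suc.prems] UC Suc.prems by simp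
  }
qed

lemma Sob_seq_dir_deriv:
  assumes p: "1 \<le> p" and "Sob_seq k p G u" "length vs \<le> k"
  shows "Lp_seq p G (\<lambda>n. dir_deriv vs (u n))"
  using assms(2,3)
proof (induction vs arbitrary: u k rule: rev_induct)
  case Nil
  have "Sob_seq 0 p G u" using Nil.prems(1)
  proof (induction k)
    case (Suc k)
    then show ?case using Sob_seq_pred[OF p] by blast
  qed
  then show ?case by simp
next
  case (snoc v vs)
  then obtain l where l: "k = Suc l" by (cases k) auto
  have "Sob_seq l p G (\<lambda>n. dd v (u n))" using snoc.prems(1) l by simp
  from snoc.IH[OF this] show ?case unfolding dir_deriv_append using snoc.prems(2) l by simp
qed

text \<open>Morrey's inequality compares \<open>u n x\<close> with its mean over a small cube,
  uniformly in \<open>n\<close>, because the gradients are bounded in L^p. For a fixed side length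
  the means are uniformly Cauchy, because the sequence is Cauchy in L^1.\<close>

lemma UC_seq_Morrey:
  fixes u :: "nat \<Rightarrow> 'e::euclidean_space \<Rightarrow> 'f::euclidean_space"
  assumes G: "open G" and p: "p > real DIM('e)" and sm: "\<And>n. smooth_on G (u n)"
    and u: "Lp_seq p G u" and du: "\<And>b. b \<in> Basis \<Longrightarrow> Lp_seq p G (\<lambda>n. dd b (u n))"
  shows "UC_seq G u"
  unfolding UC_seq_def
proof (intro conjI allI impI; (elim conjE)?)
  show "continuous_on G (u n)" for n by (rule smooth_on_continuous[OF sm])
  fix K assume K: "compact K" "K \<subseteq> G"
  obtain \<delta> L where L: "\<delta> > 0" "compact L" "L \<subseteq> G" "\<And>x. x \<in> K \<Longrightarrow> cball x \<delta> \<subseteq> L"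
    using compact_neighbourhood[OF K(1) G K(2)] by blast
  define m where "m = real DIM('e)"
  have m: "m \<ge> 1" unfolding m_def using DIM_positive[where 'a='e] by linarith
  have p1: "p \<ge> 1" using p m unfolding m_def by linarith
  define \<alpha> where "\<alpha> = 1 - m / p"
  have \<alpha>: "\<alpha> > 0" using p m by (simp add: \<alpha>_def m_def)
  have cont: "continuous_on L (u n)" "continuous_on L (dd b (u n))" for n b
    using smooth_on_continuous[OF sm] smooth_on_continuous[OF smooth_on_dd[OF sm]] continuous_on_subset[OF _ L(3)] by blast+
  have cp: "continuous_on L (\<lambda>x. norm (dd b (u n) x) powr p)" for n b
    by (rule continuous_on_norm_powr[OF cont(2) p1])
  have "\<forall>b. \<exists>B. b \<in> Basis \<longrightarrow> (\<forall>n. (LINT x:L|lebesgue. norm (dd b (u n) x) powr p) \<le> B)"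
    using du L unfolding Lp_seq_def by meson
  then obtain B where B: "\<And>b n. b \<in> Basis \<Longrightarrow> (LINT x:L|lebesgue. norm (dd b (u n) x) powr p) \<le> B b" by metis
  define M where "M = (\<Sum>b\<in>Basis. B b)"
  have B0: "B b \<ge> 0" if "b \<in> Basis" for b
    using B[OF that, of 0] integral_nonneg_compact[of L "\<lambda>x. norm (dd b (u 0) x) powr p"] by simp
  have M: "M \<ge> 0" unfolding M_def by (intro sum_nonneg B0)
  have leb: "(LINT x:S|lebesgue. g x) = integral S g" if "continuous_on S g" "compact S" for S and g :: "'e \<Rightarrow> 'x::euclidean_space"
    using set_lebesgue_integral_eq_integral(2)[OF set_integrable_continuous_compact[OF that(2,1)]] .
  define C where "C = (m + M) / \<alpha>"
  have C: "C > 0" using m M \<alpha> by (simp add: C_def)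
  show "uniformly_Cauchy_on K u"
  proof (rule uniformly_Cauchy_onI)
    fix e :: real assume e: "e > 0"
    have "((\<lambda>r. C * r powr \<alpha>) \<longlongrightarrow> C * 0) (at_right 0)"
      using \<alpha> by (intro tendsto_intros tendsto_zero_powrI[where b=\<alpha>] tendsto_ident_at) (auto simp: eventually_at_right_less eventually_at_filter)
    then have "eventually (\<lambda>r. C * r powr \<alpha> < e / 3) (at_right 0)" using e by (intro order_tendstoD) auto
    moreover have "eventually (\<lambda>r. r < \<delta> / m) (at_right 0)"
      using eventually_at_right_real[of 0 "\<delta> / m"] L m by (auto elim!: eventually_mono)
    moreover have "eventually (\<lambda>r. r > (0::real)) (at_right 0)" by (rule eventually_at_right_less)
    ultimately have "eventually (\<lambda>r. C * r powr \<alpha> < e / 3 \<and> r < \<delta> / m \<and> r > 0) (at_right (0::real))" by eventually_elim auto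
    \<comment> \<open>The side length makes Morrey's error less than \<open>e / 3\<close> for all
      \<open>n\<close>, and it keeps the cubes at points of \<open>K\<close> inside
      \<open>L\<close>.\<close>
    then obtain r where r: "C * r powr \<alpha> < e / 3" "r < \<delta> / m" "r > 0"
      using eventually_happens trivial_limit_at_right_real by blast
    have sub: "cbox x (x + r *\<^sub>R One) \<subseteq> L" if x: "x \<in> K" for x
    proof
      fix y assume y: "y \<in> cbox x (x + r *\<^sub>R One)"
      have "norm (y - x) \<le> (\<Sum>b\<in>Basis. \<bar>(y - x) \<bullet> b\<bar>)" by (rule norm_le_l1)
      also have "\<dots> \<le> (\<Sum>b\<in>(Basis::'e set). r)" using cube_facts(3)[OF _ y] r by (intro sum_mono) auto
      also have "\<dots> \<le> \<delta>" using r m by (simp add: m_def pos_less_divide_eq mult.commute less_imp_le)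
      finally show "y \<in> L" using L(4)[OF x] by (auto simp: dist_norm norm_minus_commute)
    qed
    have morrey: "norm ((1 / r ^ DIM('e)) *\<^sub>R integral (cbox x (x + r *\<^sub>R One)) (u n) - u n x) < e / 3" if x: "x \<in> K" for n x
    proof -
      have "(\<Sum>b\<in>Basis. integral (cbox x (x + r *\<^sub>R One)) (\<lambda>y. norm (dd b (u n) y) powr p)) \<le> M"
        unfolding M_def
      proof (rule sum_mono)
        fix b :: 'e assume b: "b \<in> Basis"
        have "integral (cbox x (x + r *\<^sub>R One)) (\<lambda>y. norm (dd b (u n) y) powr p) = (LINT y:cbox x (x + r *\<^sub>R One)|lebesgue. norm (dd b (u n) y) powr p)"
          by (rule leb[symmetric]) (auto intro: continuous_on_subset[OF cp sub[OF x]])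
        also have "\<dots> \<le> (LINT y:L|lebesgue. norm (dd b (u n) y) powr p)"
        proof -
          have "integrable lebesgue (\<lambda>y. indicator L y *\<^sub>R (norm (dd b (u n) y) powr p))"
            using set_integrable_continuous_compact[OF L(2) cp[of b n]] by (simp add: set_integrable_def)
          moreover have "integrable lebesgue (\<lambda>y. indicator (cbox x (x + r *\<^sub>R One)) y *\<^sub>R (norm (dd b (u n) y) powr p))"
            using set_integrable_continuous_compact[OF compact_cbox continuous_on_subset[OF cp[of b n] sub[OF x]]] by (simp add: set_integrable_def)
          ultimately show ?thesis
            unfolding set_lebesgue_integral_def using sub[OF x] by (intro integral_mono) (auto simp: indicator_def)
        qed
        also have "\<dots> \<le> B b" by (rule B[OF b])
        finally show "integral (cbox x (x + r *\<^sub>R One)) (\<lambda>y. norm (dd b (u n) y) powr p) \<le> B b" .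
      qed
      from Morrey_cube[OF G sm r(3) _ p this] sub[OF x] L(3)
      have "norm ((1 / r ^ DIM('e)) *\<^sub>R integral (cbox x (x + r *\<^sub>R One)) (u n) - u n x) \<le> C * r powr \<alpha>"
        unfolding C_def \<alpha>_def m_def by blast
      then show ?thesis using r(1) by linarith
    qed
    have e3: "r ^ DIM('e) * (e / 3) > 0" using r e by simp
    then obtain N where N: "\<And>n l. n \<ge> N \<Longrightarrow> l \<ge> N \<Longrightarrow> (LINT x:L|lebesgue. norm (u n x - u l x)) < r ^ DIM('e) * (e / 3)"
      using u L unfolding Lp_seq_def by metis
    have "dist (u n x) (u l x) < e" if x: "x \<in> K" and n: "n \<ge> N" "l \<ge> N" for x n l
    proof -
      define Q where "Q = cbox x (x + r *\<^sub>R One)"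
      have Q: "Q \<subseteq> L" "compact Q" using sub[OF x] by (auto simp: Q_def)
      have cQ: "continuous_on Q (u n)" for n using cont Q continuous_on_subset by blast
      have iQ: "(u n) integrable_on Q" for n using cQ unfolding Q_def by (rule integrable_continuous)
      have "norm (integral Q (u n) - integral Q (u l)) = norm (integral Q (\<lambda>y. u n y - u l y))"
        by (simp add: integral_diff iQ)
      also have "\<dots> = norm (LINT y:Q|lebesgue. u n y - u l y)"
        using leb[of Q "\<lambda>y. u n y - u l y"] cQ Q by (simp add: continuous_on_diff)
      also have "\<dots> \<le> (LINT y:Q|lebesgue. norm (u n y - u l y))"
        by (rule set_integral_norm_bound) (intro set_integrable_continuous_compact Q continuous_intros cQ)
      also have "\<dots> \<le> (LINT y:L|lebesgue. norm (u n y - u l y))"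
      proof -
        have "set_integrable lebesgue L (\<lambda>y. norm (u n y - u l y))" "set_integrable lebesgue Q (\<lambda>y. norm (u n y - u l y))"
          by (intro set_integrable_continuous_compact L Q continuous_intros cont cQ)+
        then show ?thesis
          unfolding set_lebesgue_integral_def set_integrable_def using Q by (intro integral_mono) (auto simp: indicator_def)
      qed
      also have "\<dots> < r ^ DIM('e) * (e / 3)" by (rule N[OF n])
      finally have i: "norm (integral Q (u n) - integral Q (u l)) < r ^ DIM('e) * (e / 3)" .
      define A where "A n = (1 / r ^ DIM('e)) *\<^sub>R integral Q (u n)" for n
      have "norm (A n - A l) = (1 / r ^ DIM('e)) * norm (integral Q (u n) - integral Q (u l))"
        using r by (simp add: A_def flip: scaleR_diff_right)
      also have "\<dots> < (1 / r ^ DIM('e)) * (r ^ DIM('e) * (e / 3))"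
        using r i by (intro mult_strict_left_mono) auto
      also have "\<dots> = e / 3" using r by simp
      finally have 1: "norm (A n - A l) < e / 3" .
      have "u n x - u l x = (A n - A l) - (A n - u n x) + (A l - u l x)" by simp
      then have "norm (u n x - u l x) \<le> norm (A n - A l) + norm (A n - u n x) + norm (A l - u l x)"
        by (metis (no_types, lifting) add_right_mono norm_triangle_ineq norm_triangle_ineq4 order_trans)
      also have "\<dots> < e / 3 + e / 3 + e / 3"
        using 1 morrey[OF x] by (intro add_strict_mono) (auto simp: A_def Q_def)
      finally show ?thesis by (simp add: dist_norm)
    qed
    then show "\<exists>M. \<forall>x\<in>K. \<forall>m\<ge>M. \<forall>n\<ge>M. dist (u m x) (u n x) < e" by blast
  qed
qed

text \<open>Control in the sense of \<open>Lp_seq\<close> up to order \<open>k\<close> improves to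
  locally uniform convergence in every order below \<open>k\<close>, by Morrey's inequality applied
  to each derivative.\<close>

lemma Sob_seqI:
  fixes u :: "nat \<Rightarrow> 'e::euclidean_space \<Rightarrow> 'f::euclidean_space"
  assumes G: "open G" and p: "p > real DIM('e)" and "\<And>n. smooth_on G (u n)"
    and "\<And>vs. length vs \<le> k \<Longrightarrow> Lp_seq p G (\<lambda>n. dir_deriv vs (u n))"
  shows "Sob_seq k p G u"
  using assms(3,4)
proof (induction k arbitrary: u)
  case 0
  then show ?case using 0(2)[of "[]"] by simp
next
  case (Suc k)
  have "UC_seq G u"
    by (rule UC_seq_Morrey[OF G p Suc.prems(1)]) (use Suc.prems(2)[of "[]"] Suc.prems(2)[of "[b]" for b] in auto)
  moreover have "Sob_seq k p G (\<lambda>n. dd v (u n))" for v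
  proof (rule Suc.IH)
    show "smooth_on G (dd v (u n))" for n by (rule smooth_on_dd[OF Suc.prems(1)])
    show "Lp_seq p G (\<lambda>n. dir_deriv vs (dd v (u n)))" if "length vs \<le> k" for vs
      using Suc.prems(2)[of "vs @ [v]"] that by (simp add: dir_deriv_append)
  qed
  ultimately show ?case using Suc.prems(1) by simp
qed

section \<open>Change of variables\<close>

lemma emeasure_lborel_cube:
  fixes x :: "'e::euclidean_space"
  assumes "r \<ge> 0"
  shows "emeasure lborel (cbox (x - r *\<^sub>R One) (x + r *\<^sub>R One)) = ennreal ((2 * r) ^ DIM('e))"
proof -
  have "emeasure lborel (cbox (x - r *\<^sub>R One) (x + r *\<^sub>R One)) = ennreal (\<Prod>b\<in>(Basis::'e set). 2 * r)"
    using assms by (subst emeasure_lborel_cbox) (auto simp: inner_diff_left inner_add_left intro!: arg_cong[where f=ennreal] prod.cong)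
  then show ?thesis by simp
qed

lemma dist_le_cube:
  fixes y z :: "'e::euclidean_space"
  assumes "y \<in> cbox c d" "z \<in> cbox c d" "\<And>b. b \<in> Basis \<Longrightarrow> d \<bullet> b - c \<bullet> b = \<sigma>"
  shows "dist y z \<le> real DIM('e) * \<sigma>"
proof -
  have "dist y z \<le> (\<Sum>b\<in>Basis. \<bar>(y - z) \<bullet> b\<bar>)" unfolding dist_norm by (rule norm_le_l1)
  also have "\<dots> \<le> (\<Sum>b\<in>(Basis::'e set). \<sigma>)"
  proof (rule sum_mono)
    fix b :: 'e assume b: "b \<in> Basis"
    then have "c \<bullet> b \<le> y \<bullet> b" "y \<bullet> b \<le> d \<bullet> b" "c \<bullet> b \<le> z \<bullet> b" "z \<bullet> b \<le> d \<bullet> b" using assms(1,2) by (auto simp: mem_box)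
    then show "\<bar>(y - z) \<bullet> b\<bar> \<le> \<sigma>" using assms(3)[OF b] by (simp add: inner_diff_left abs_le_iff)
  qed
  finally show ?thesis by simp
qed

text \<open>On a small subcube \<open>D\<close> the function \<open>g\<close> is almost constant, and the points mapped to \<open>D\<close> lie in a
  cube of comparable size because \<open>H\<close> is expanding.\<close>

lemma nn_integral_compose_le:
  fixes H :: "'e::euclidean_space \<Rightarrow> 'e" and g :: "'e \<Rightarrow> real"
  assumes K: "compact K" and H: "continuous_on K H" "H ` K \<subseteq> cbox a b" and box: "box a b \<noteq> {}"
    and cube: "\<And>i. i \<in> Basis \<Longrightarrow> b \<bullet> i - a \<bullet> i = s"
    and L: "L > 0" "\<And>x y. x \<in> K \<Longrightarrow> y \<in> K \<Longrightarrow> dist x y \<le> L * dist (H x) (H y)"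
    and g: "continuous_on (cbox a b) g" "\<And>y. 0 \<le> g y"
  shows "(\<integral>\<^sup>+x. ennreal (indicator K x *\<^sub>R g (H x)) \<partial>lborel)
    \<le> ennreal ((2 * L * real DIM('e)) ^ DIM('e)) * (\<integral>\<^sup>+x. ennreal (indicator (cbox a b) x *\<^sub>R g x) \<partial>lborel)"
proof -
  \<comment> \<open>Points of \<open>K\<close> sent into a cube of side \<open>\<sigma>\<close> are
    at distance at most \<open>L * m * \<sigma>\<close> from one another, hence lie in a cube of
    twice that side; \<open>C\<close> is the ratio of the two volumes.\<close>
  define C where "C = (2 * L * real DIM('e)) ^ DIM('e)"
  define Q where "Q = cbox a b"
  define m where "m = real DIM('e)"
  have m: "m > 0" unfolding m_def by simp
  have C: "C > 0" using L m unfolding C_def m_def by simp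
  have cgH: "continuous_on K (\<lambda>x. g (H x))" by (rule continuous_on_compose2[OF g(1) H(1)]) (use H(2) in auto)
  define \<phi> where "\<phi> x = indicator K x *\<^sub>R g (H x)" for x
  have "integrable lborel \<phi>" unfolding \<phi>_def by (rule borel_integrable_compact[OF K cgH])
  then have [measurable]: "\<phi> \<in> borel_measurable borel" by auto
  have \<phi>0: "\<phi> x \<ge> 0" for x using g(2) by (simp add: \<phi>_def)
  define \<psi> where "\<psi> x = indicator Q x *\<^sub>R g x" for x
  have \<psi>i: "integrable lborel \<psi>" unfolding \<psi>_def Q_def by (rule borel_integrable_compact[OF compact_cbox g(1)])
  then have [measurable]: "\<psi> \<in> borel_measurable borel" by auto
  have \<psi>0: "\<psi> x \<ge> 0" for x using g(2) by (simp add: \<psi>_def)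
  have Qfin: "emeasure lborel Q < \<infinity>" unfolding Q_def by (rule emeasure_compact_finite[OF compact_cbox])
  have main: "(\<integral>\<^sup>+x. ennreal (\<phi> x) \<partial>lborel) \<le> ennreal C * ((\<integral>\<^sup>+x. ennreal (\<psi> x) \<partial>lborel) + ennreal e * emeasure lborel Q)"
    if e: "e > 0" for e
  proof -
    obtain \<delta> where \<delta>: "\<delta> > 0" "\<And>y z. y \<in> Q \<Longrightarrow> z \<in> Q \<Longrightarrow> dist z y < \<delta> \<Longrightarrow> dist (g z) (g y) < e"
      using compact_uniformly_continuous[OF g(1) compact_cbox] e unfolding uniformly_continuous_on_def Q_def by metis
    have gauge: "gauge (\<lambda>x::'e. ball x (\<delta>/2))" using \<delta>(1) by (intro gauge_ball_dependent) auto
    obtain \<D> where D: "countable \<D>" "\<Union>\<D> \<subseteq> Q"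
      "\<And>D. D \<in> \<D> \<Longrightarrow> interior D \<noteq> {} \<and> (\<exists>c d. D = cbox c d)"
      "pairwise (\<lambda>A B. interior A \<inter> interior B = {}) \<D>"
      "\<And>D. D \<in> \<D> \<Longrightarrow> \<exists>x \<in> Q \<inter> D. D \<subseteq> ball x (\<delta>/2)"
      "\<And>u v. cbox u v \<in> \<D> \<Longrightarrow> \<exists>n. \<forall>i \<in> Basis. v \<bullet> i - u \<bullet> i = (b \<bullet> i - a \<bullet> i) / 2^n"
      "Q \<subseteq> \<Union>\<D>"
      using covering_lemma[OF order_refl box gauge] unfolding Q_def by metis
    have one: "(\<integral>\<^sup>+x. ennreal (\<phi> x) * indicator (K \<inter> H -` D) x \<partial>lborel)
        \<le> ennreal C * (\<integral>\<^sup>+x. ennreal (\<psi> x + e) * indicator (interior D) x \<partial>lborel)" if D': "D \<in> \<D>" for D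
    proof -
      obtain c d where cd: "D = cbox c d" using D(3)[OF D'] by blast
      obtain n where n: "\<And>i. i \<in> Basis \<Longrightarrow> d \<bullet> i - c \<bullet> i = (b \<bullet> i - a \<bullet> i) / 2^n" using D(6) D' cd by blast
      \<comment> \<open>The covering cells divide all sides of the box by the same power of 2; as
        the box is a cube, each cell is a cube too.\<close>
      define \<sigma> where "\<sigma> = s / 2 ^ n"
      have \<sigma>: "d \<bullet> i - c \<bullet> i = \<sigma>" if "i \<in> Basis" for i using n[OF that] cube[OF that] by (simp add: \<sigma>_def)
      have ic: "interior D = box c d" unfolding cd by (rule interior_cbox)
      have \<sigma>0: "\<sigma> > 0"
      proof -
        obtain i :: 'e where i: "i \<in> Basis" using nonempty_Basis by blast
        have "box c d \<noteq> {}" using D(3)[OF D'] ic by simp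
        then have "c \<bullet> i < d \<bullet> i" using i by (auto simp: box_ne_empty)
        then show ?thesis using \<sigma>[OF i] by simp
      qed
      have DQ: "D \<subseteq> Q" using D' D(2) by blast
      define P where "P = K \<inter> H -` D"
      have Pc: "compact P"
      proof -
        have "closed P" unfolding P_def cd
          by (rule continuous_closed_preimage[OF H(1) compact_imp_closed[OF K] closed_cbox])
        then show ?thesis using K by (metis P_def closed_Int_compact inf.left_idem inf_commute)
      qed
      have Pm: "P \<in> sets borel" by (rule borel_compact[OF Pc])
      show ?thesis
      proof (cases "P = {}")
        case True
        then show ?thesis by (simp add: P_def[symmetric])
      next
        case False
        obtain x0 where x0: "x0 \<in> P" "\<And>x. x \<in> P \<Longrightarrow> g (H x) \<le> g (H x0)"
          using continuous_attains_sup[OF Pc False continuous_on_subset[OF cgH]] unfolding P_def by auto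
        have gz: "g (H x0) \<le> g z + e" if "z \<in> D" for z
        proof -
          obtain x where x: "D \<subseteq> ball x (\<delta>/2)" using D(5)[OF D'] by blast
          have "H x0 \<in> D" using x0 by (simp add: P_def)
          then have "dist (H x0) z < \<delta>" using x that by - (rule dist_triangle_half_r[of x]; auto)
          then have "dist (g (H x0)) (g z) < e" using \<open>H x0 \<in> D\<close> that DQ by - (rule \<delta>(2); auto simp: dist_commute)
          then show ?thesis by (simp add: dist_real_def abs_less_iff)
        qed
        have eP: "emeasure lborel P \<le> ennreal C * emeasure lborel (box c d)"
        proof -
          define \<rho> where "\<rho> = L * (m * \<sigma>)"
          have \<rho>: "\<rho> \<ge> 0" using L m \<sigma>0 by (simp add: \<rho>_def)
          have "P \<subseteq> cbox (x0 - \<rho> *\<^sub>R One) (x0 + \<rho> *\<^sub>R One)"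
          proof
            fix x assume x: "x \<in> P"
            have "dist x x0 \<le> L * dist (H x) (H x0)" using x x0 by (intro L) (auto simp: P_def)
            also have "\<dots> \<le> \<rho>" unfolding \<rho>_def m_def using x x0 L cd \<sigma>
              by (intro mult_left_mono dist_le_cube) (auto simp: P_def)
            finally have d: "norm (x - x0) \<le> \<rho>" by (simp add: dist_norm)
            show "x \<in> cbox (x0 - \<rho> *\<^sub>R One) (x0 + \<rho> *\<^sub>R One)"
            proof (subst mem_box, intro ballI conjI)
              fix i :: 'e assume i: "i \<in> Basis"
              have "\<bar>(x - x0) \<bullet> i\<bar> \<le> \<rho>" using Basis_le_norm[OF i, of "x - x0"] d by linarith
              then show "(x0 - \<rho> *\<^sub>R One) \<bullet> i \<le> x \<bullet> i" "x \<bullet> i \<le> (x0 + \<rho> *\<^sub>R One) \<bullet> i"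
                using i by (auto simp: inner_diff_left inner_add_left abs_le_iff)
            qed
          qed
          then have "emeasure lborel P \<le> emeasure lborel (cbox (x0 - \<rho> *\<^sub>R One) (x0 + \<rho> *\<^sub>R One))"
            by (intro emeasure_mono) auto
          also have "\<dots> = ennreal ((2 * \<rho>) ^ DIM('e))" by (rule emeasure_lborel_cube[OF \<rho>])
          also have "(2 * \<rho>) ^ DIM('e) = C * \<sigma> ^ DIM('e)"
            unfolding C_def \<rho>_def m_def power_mult_distrib[symmetric] by (simp add: mult_ac)
          also have "ennreal (C * \<sigma> ^ DIM('e)) = ennreal C * ennreal (\<sigma> ^ DIM('e))"
            using C \<sigma>0 by (intro ennreal_mult) auto
          also have "ennreal (\<sigma> ^ DIM('e)) = emeasure lborel (box c d)"
          proof -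
            have "emeasure lborel (box c d) = ennreal (\<Prod>i\<in>Basis. (d - c) \<bullet> i)"
              using \<sigma> \<sigma>0 by (intro emeasure_lborel_box) (smt (verit))
            also have "(\<Prod>i\<in>Basis. (d - c) \<bullet> i) = (\<Prod>i\<in>(Basis::'e set). \<sigma>)"
              by (intro prod.cong) (auto simp: inner_diff_left \<sigma>)
            finally show ?thesis by simp
          qed
          finally show ?thesis .
        qed
        have "(\<integral>\<^sup>+x. ennreal (\<phi> x) * indicator P x \<partial>lborel) \<le> (\<integral>\<^sup>+x. ennreal (g (H x0)) * indicator P x \<partial>lborel)"
          using x0(2) by (intro nn_integral_mono) (auto simp: indicator_def \<phi>_def P_def intro!: ennreal_leI)
        also have "\<dots> = ennreal (g (H x0)) * emeasure lborel P"
          using Pm by (intro nn_integral_cmult_indicator) simp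
        also have "\<dots> \<le> ennreal (g (H x0)) * (ennreal C * emeasure lborel (box c d))"
          by (intro mult_left_mono eP) simp
        also have "\<dots> = ennreal C * (\<integral>\<^sup>+x. ennreal (g (H x0)) * indicator (box c d) x \<partial>lborel)"
          by (subst nn_integral_cmult_indicator) (auto simp: mult_ac)
        also have "\<dots> \<le> ennreal C * (\<integral>\<^sup>+x. ennreal (\<psi> x + e) * indicator (interior D) x \<partial>lborel)"
        proof (intro mult_left_mono nn_integral_mono)
          fix x
          show "ennreal (g (H x0)) * indicator (box c d) x \<le> ennreal (\<psi> x + e) * indicator (interior D) x"
          proof (cases "x \<in> box c d")
            case True
            then have "x \<in> D" using cd box_subset_cbox by auto
            then have "g (H x0) \<le> \<psi> x + e" using gz DQ by (auto simp: \<psi>_def)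
            then show ?thesis using True ic by (simp add: ennreal_leI)
          qed simp
        qed simp
        finally show ?thesis by (simp add: P_def)
      qed
    qed
    \<comment> \<open>The countable family of cells is enumerated by naturals, with the empty set at
      the remaining indices, so that each cell occurs once and the interiors form a disjoint
      sequence.\<close>
    define I where "I = to_nat_on \<D> ` \<D>"
    define DD where "DD i = (if i \<in> I then from_nat_into \<D> i else {})" for i
    have DDin: "DD i \<in> \<D>" if "i \<in> I" for i
      using that D(1) by (auto simp: DD_def I_def)
    have DDall: "\<exists>i. DD i = X" if "X \<in> \<D>" for X
      using that D(1) by (intro exI[of _ "to_nat_on \<D> X"]) (auto simp: DD_def I_def)
    have DDinj: "i = j" if "i \<in> I" "j \<in> I" "DD i = DD j" for i j
      using that D(1) by (auto simp: DD_def I_def)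
    have Pm: "K \<inter> H -` DD i \<in> sets borel" for i
    proof (cases "i \<in> I")
      case True
      then obtain c d where "DD i = cbox c d" using D(3)[OF DDin] by blast
      then have "closed (K \<inter> H -` DD i)"
        using continuous_closed_preimage[OF H(1) compact_imp_closed[OF K] closed_cbox] by simp
      then show ?thesis by (rule borel_closed)
    qed (simp add: DD_def)
    have "(\<integral>\<^sup>+x. ennreal (\<phi> x) \<partial>lborel) \<le> (\<integral>\<^sup>+x. (\<Sum>i. ennreal (\<phi> x) * indicator (K \<inter> H -` DD i) x) \<partial>lborel)"
    proof (rule nn_integral_mono)
      fix x
      show "ennreal (\<phi> x) \<le> (\<Sum>i. ennreal (\<phi> x) * indicator (K \<inter> H -` DD i) x)"
      proof (cases "x \<in> K")
        case True
        then obtain X where "X \<in> \<D>" "H x \<in> X" using H(2) D(7) unfolding Q_def by blast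
        then obtain i where i: "H x \<in> DD i" using DDall by metis
        have "ennreal (\<phi> x) = (\<Sum>j\<in>{i}. ennreal (\<phi> x) * indicator (K \<inter> H -` DD j) x)" using True i by simp
        also have "\<dots> \<le> (\<Sum>i. ennreal (\<phi> x) * indicator (K \<inter> H -` DD i) x)"
          by (rule sum_le_suminf) auto
        finally show ?thesis .
      qed (simp add: \<phi>_def)
    qed
    also have "\<dots> = (\<Sum>i. \<integral>\<^sup>+x. ennreal (\<phi> x) * indicator (K \<inter> H -` DD i) x \<partial>lborel)"
      using Pm by (intro nn_integral_suminf) auto
    also have "\<dots> \<le> (\<Sum>i. ennreal C * (\<integral>\<^sup>+x. ennreal (\<psi> x + e) * indicator (interior (DD i)) x \<partial>lborel))"
    proof (intro suminf_le)
      fix i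
      show "(\<integral>\<^sup>+x. ennreal (\<phi> x) * indicator (K \<inter> H -` DD i) x \<partial>lborel) \<le> ennreal C * (\<integral>\<^sup>+x. ennreal (\<psi> x + e) * indicator (interior (DD i)) x \<partial>lborel)"
        using one[OF DDin] by (cases "i \<in> I") (auto simp: DD_def)
    qed auto
    also have "\<dots> = ennreal C * (\<Sum>i. \<integral>\<^sup>+x. ennreal (\<psi> x + e) * indicator (interior (DD i)) x \<partial>lborel)"
      by simp
    also have "(\<Sum>i. \<integral>\<^sup>+x. ennreal (\<psi> x + e) * indicator (interior (DD i)) x \<partial>lborel) = (\<integral>\<^sup>+x. ennreal (\<psi> x + e) * indicator (\<Union>i. interior (DD i)) x \<partial>lborel)"
    proof (rule nn_integral_disjoint_family[symmetric])
      show "disjoint_family (\<lambda>i. interior (DD i))"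
        unfolding disjoint_family_on_def
      proof (intro ballI impI)
        fix i j :: nat assume "i \<noteq> j"
        show "interior (DD i) \<inter> interior (DD j) = {}"
        proof (cases "i \<in> I \<and> j \<in> I")
          case True
          then have "DD i \<noteq> DD j" using DDinj \<open>i \<noteq> j\<close> by blast
          then show ?thesis using D(4) DDin True unfolding pairwise_def by blast
        qed (auto simp: DD_def)
      qed
    qed auto
    also have "\<dots> \<le> (\<integral>\<^sup>+x. ennreal (\<psi> x) + ennreal e * indicator Q x \<partial>lborel)"
    proof (rule nn_integral_mono)
      fix x
      have "interior (DD i) \<subseteq> Q" for i
      proof (cases "i \<in> I")
        case True
        then have "DD i \<subseteq> Q" using DDin D(2) by blast
        then show ?thesis using interior_subset by blast
      qed (simp add: DD_def)
      then show "ennreal (\<psi> x + e) * indicator (\<Union>i. interior (DD i)) x \<le> ennreal (\<psi> x) + ennreal e * indicator Q x"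
        using e \<psi>0[of x] by (cases "x \<in> (\<Union>i. interior (DD i))") (auto simp: indicator_def)
    qed
    also have "\<dots> = (\<integral>\<^sup>+x. ennreal (\<psi> x) \<partial>lborel) + ennreal e * emeasure lborel Q"
      unfolding Q_def by (subst nn_integral_add) (auto simp: nn_integral_cmult_indicator)
    finally show ?thesis by (simp add: mult_left_mono)
  qed
  have "(\<integral>\<^sup>+x. ennreal (\<phi> x) \<partial>lborel) \<le> ennreal C * (\<integral>\<^sup>+x. ennreal (\<psi> x) \<partial>lborel)"
  proof (rule ennreal_le_epsilon)
    fix \<epsilon> :: real assume \<epsilon>: "\<epsilon> > 0"
    define q where "q = measure lborel Q"
    have q: "emeasure lborel Q = ennreal q" "q \<ge> 0" using Qfin by (simp_all add: q_def emeasure_eq_ennreal_measure less_top)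
    define e where "e = \<epsilon> / (C * q + 1)"
    have Cq: "C * q + 1 > 0" using C q by (simp add: add_nonneg_pos)
    have e: "e > 0" using \<epsilon> Cq by (simp add: e_def)
    have "(\<integral>\<^sup>+x. ennreal (\<phi> x) \<partial>lborel) \<le> ennreal C * (\<integral>\<^sup>+x. ennreal (\<psi> x) \<partial>lborel) + ennreal C * (ennreal e * ennreal q)"
      using main[OF e] by (simp add: q distrib_left)
    also have "ennreal C * (ennreal e * ennreal q) = ennreal (C * e * q)"
      using C e q by (simp add: ennreal_mult mult.assoc)
    also have "ennreal (C * e * q) \<le> ennreal \<epsilon>"
    proof (rule ennreal_leI)
      have "C * e * q \<le> e * (C * q + 1)" using e by (simp add: algebra_simps)
      also have "\<dots> = \<epsilon>" using Cq by (simp add: e_def)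
      finally show "C * e * q \<le> \<epsilon>" .
    qed
    finally show "(\<integral>\<^sup>+x. ennreal (\<phi> x) \<partial>lborel) \<le> ennreal C * (\<integral>\<^sup>+x. ennreal (\<psi> x) \<partial>lborel) + ennreal \<epsilon>"
      by (simp add: add_left_mono)
  qed
  then show ?thesis by (simp add: \<phi>_def \<psi>_def C_def Q_def)
qed

lemma ennreal_set_integral_compact:
  fixes f :: "'e::euclidean_space \<Rightarrow> real"
  assumes "compact K" "continuous_on K f" "\<And>x. x \<in> K \<Longrightarrow> 0 \<le> f x"
  shows "ennreal (LINT x:K|lebesgue. f x) = (\<integral>\<^sup>+x. ennreal (indicator K x *\<^sub>R f x) \<partial>lborel)"
proof -
  have i: "integrable lborel (\<lambda>x. indicator K x *\<^sub>R f x)" by (rule borel_integrable_compact[OF assms(1,2)])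
  have "(LINT x:K|lebesgue. f x) = (LINT x|lborel. indicator K x *\<^sub>R f x)"
    unfolding set_lebesgue_integral_def by (rule integral_completion) (use i in auto)
  then show ?thesis using nn_integral_eq_integral[OF i] assms(3) by (simp add: indicator_def)
qed

lemma integral_compose_le:
  fixes H :: "'e::euclidean_space \<Rightarrow> 'e" and g :: "'e \<Rightarrow> real"
  assumes K: "compact K" and H: "continuous_on K H" "H ` K \<subseteq> cbox a b" and box: "box a b \<noteq> {}"
    and cube: "\<And>i. i \<in> Basis \<Longrightarrow> b \<bullet> i - a \<bullet> i = s"
    and L: "L > 0" "\<And>x y. x \<in> K \<Longrightarrow> y \<in> K \<Longrightarrow> dist x y \<le> L * dist (H x) (H y)"
    and g: "continuous_on (cbox a b) g" "\<And>y. 0 \<le> g y"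
  shows "(LINT x:K|lebesgue. g (H x)) \<le> (2 * L * real DIM('e)) ^ DIM('e) * (LINT x:cbox a b|lebesgue. g x)"
proof -
  have cgH: "continuous_on K (\<lambda>x. g (H x))" by (rule continuous_on_compose2[OF g(1) H(1)]) (use H(2) in auto)
  have "ennreal (LINT x:K|lebesgue. g (H x)) \<le> ennreal ((2 * L * real DIM('e)) ^ DIM('e)) * ennreal (LINT x:cbox a b|lebesgue. g x)"
    using nn_integral_compose_le[OF assms]
    by (simp add: ennreal_set_integral_compact[OF K cgH g(2)] ennreal_set_integral_compact[OF compact_cbox g])
  also have "\<dots> = ennreal ((2 * L * real DIM('e)) ^ DIM('e) * (LINT x:cbox a b|lebesgue. g x))"
    using L g(2) by (intro ennreal_mult[symmetric] integral_nonneg_compact) auto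
  finally show ?thesis
    using L g(2) by (subst (asm) ennreal_le_iff) (auto intro!: mult_nonneg_nonneg integral_nonneg_compact)
qed

lemma Lp_seq_compose:
  fixes H :: "'e::euclidean_space \<Rightarrow> 'e" and w :: "nat \<Rightarrow> 'e \<Rightarrow> 'f::euclidean_space"
  assumes w: "Lp_seq p G w" and p: "1 \<le> p" and H: "continuous_on S H" "H ` S \<subseteq> cbox a b" and Q: "cbox a b \<subseteq> G"
    and box: "box a b \<noteq> {}" and cube: "\<And>i. i \<in> Basis \<Longrightarrow> b \<bullet> i - a \<bullet> i = s"
    and L: "L > 0" "\<And>x y. x \<in> S \<Longrightarrow> y \<in> S \<Longrightarrow> dist x y \<le> L * dist (H x) (H y)"
  shows "Lp_seq p S (\<lambda>n x. w n (H x))"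
  unfolding Lp_seq_def
proof (intro conjI allI impI; (elim conjE)?)
  have cw: "continuous_on (cbox a b) (w n)" for n by (rule Lp_seq_continuous[OF w Q])
  show "continuous_on S (\<lambda>x. w n (H x))" for n by (rule continuous_on_compose2[OF cw H(1)]) (use H in auto)
  fix K assume K: "compact K" "K \<subseteq> S"
  define C where "C = (2 * L * real DIM('e)) ^ DIM('e)"
  have C: "C > 0" using L unfolding C_def by simp
  have le: "(LINT x:K|lebesgue. g (H x)) \<le> C * (LINT x:cbox a b|lebesgue. g x)"
    if "continuous_on (cbox a b) g" "\<And>y. 0 \<le> g y" for g :: "'e \<Rightarrow> real"
    unfolding C_def
  proof (rule integral_compose_le[OF K(1) _ _ box cube L(1) _ that])
    show "continuous_on K H" by (rule continuous_on_subset[OF H(1) K(2)])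
    show "H ` K \<subseteq> cbox a b" using H(2) K(2) by blast
    show "dist x y \<le> L * dist (H x) (H y)" if "x \<in> K" "y \<in> K" for x y using L(2) K(2) that by blast
  qed
  obtain B where B: "\<And>n. (LINT x:cbox a b|lebesgue. norm (w n x) powr p) \<le> B" using Lp_seq_bound[OF w compact_cbox Q] by blast
  show "\<exists>B. \<forall>n. (LINT x:K|lebesgue. norm (w n (H x)) powr p) \<le> B"
  proof (intro exI allI)
    fix n
    have "(LINT x:K|lebesgue. norm (w n (H x)) powr p) \<le> C * (LINT x:cbox a b|lebesgue. norm (w n x) powr p)"
      by (rule le[of "\<lambda>y. norm (w n y) powr p"]) (use continuous_on_norm_powr[OF cw p] in auto)
    also have "\<dots> \<le> C * B" using B C by (intro mult_left_mono) auto
    finally show "(LINT x:K|lebesgue. norm (w n (H x)) powr p) \<le> C * B" .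
  qed
  fix e :: real assume "e > 0"
  then have "e / C > 0" using C by simp
  then obtain N where N: "\<And>n l. n \<ge> N \<Longrightarrow> l \<ge> N \<Longrightarrow> (LINT x:cbox a b|lebesgue. norm (w n x - w l x)) < e / C"
    using w Q compact_cbox unfolding Lp_seq_def by metis
  have "(LINT x:K|lebesgue. norm (w n (H x) - w l (H x))) < e" if "n \<ge> N" "l \<ge> N" for n l
  proof -
    have "(LINT x:K|lebesgue. norm (w n (H x) - w l (H x))) \<le> C * (LINT x:cbox a b|lebesgue. norm (w n x - w l x))"
      by (rule le[of "\<lambda>y. norm (w n y - w l y)"]) (intro continuous_intros cw, simp)
    also have "\<dots> < C * (e / C)" using N[OF that] C by (intro mult_strict_left_mono)
    finally show ?thesis using C by simp
  qed
  then show "\<exists>N. \<forall>n\<ge>N. \<forall>l\<ge>N. (LINT x:K|lebesgue. norm (w n (H x) - w l (H x))) < e" by blast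
qed

text \<open>Applied to the inverse of a coordinate change: its Lipschitz bound is the lower bound on
  the expansion of the change itself that the substitution estimate asks for.\<close>

lemma smooth_lipschitz:
  assumes R: "open R" and h: "smooth_on R h" and Q: "cbox a b \<subseteq> R"
  obtains L where "L > 0" "\<And>x y. x \<in> cbox a b \<Longrightarrow> y \<in> cbox a b \<Longrightarrow> dist (h x) (h y) \<le> L * dist x y"
proof -
  have "continuous_on (cbox a b) (\<lambda>x. \<Sum>c\<in>Basis. norm (dd c h x))"
    by (intro continuous_intros continuous_on_subset[OF smooth_on_continuous[OF smooth_on_dd[OF h]] Q])
  then have "bounded ((\<lambda>x. \<Sum>c\<in>Basis. norm (dd c h x)) ` cbox a b)"
    by (intro compact_imp_bounded compact_continuous_image compact_cbox)
  then obtain L where L: "L > 0" "\<And>x. x \<in> cbox a b \<Longrightarrow> norm (\<Sum>c\<in>Basis. norm (dd c h x)) \<le> L"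
    unfolding bounded_pos by blast
  have "norm (h x - h y) \<le> L * norm (x - y)" if xy: "x \<in> cbox a b" "y \<in> cbox a b" for x y
  proof (rule differentiable_bound[OF convex_box(1) _ _ xy, where f'="\<lambda>x v. dd v h x"])
    fix z assume z: "z \<in> cbox a b"
    have df: "h differentiable (at z)" by (rule smooth_on_differentiable[OF h]) (use z Q in blast)
    show "(h has_derivative (\<lambda>v. dd v h z)) (at z within cbox a b)"
      by (rule has_derivative_at_withinI[OF has_derivative_dd[OF df]])
    show "onorm (\<lambda>v. dd v h z) \<le> L"
    proof (rule onorm_bound)
      show "0 \<le> L" using L by simp
      fix v
      have "norm (dd v h z) \<le> (\<Sum>c\<in>Basis. norm ((v \<bullet> c) *\<^sub>R dd c h z))"
        unfolding dd_basis_sum[OF df, of v] by (rule norm_sum)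
      also have "\<dots> \<le> (\<Sum>c\<in>Basis. norm v * norm (dd c h z))"
        by (intro sum_mono) (simp add: Basis_le_norm mult_right_mono)
      also have "\<dots> \<le> L * norm v"
      proof -
        have "(\<Sum>c\<in>Basis. norm (dd c h z)) \<le> L" using L(2)[OF z] by simp
        then have "norm v * (\<Sum>c\<in>Basis. norm (dd c h z)) \<le> norm v * L" by (intro mult_left_mono) auto
        then show ?thesis by (simp add: sum_distrib_left mult.commute)
      qed
      finally show "norm (dd v h z) \<le> L * norm v" .
    qed
  qed
  then show thesis using that L(1) by (simp add: dist_norm)
qed

section \<open>Convolutions\<close>

text \<open>The same kernel integral as in \<open>mollify\<close>, but as a gauge integral over a
  box on which \<open>f\<close> is continuous; this form admits differentiation under the integral
  sign.\<close>

definition convolve :: "'e::euclidean_space \<Rightarrow> 'e \<Rightarrow> ('e \<Rightarrow> 'f::euclidean_space) \<Rightarrow> ('e \<Rightarrow> real) \<Rightarrow> 'e \<Rightarrow> 'f" where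
  "convolve a b f \<eta> x = integral (cbox a b) (\<lambda>y. \<eta> (x - y) *\<^sub>R f y)"

lemma convolve_has_derivative:
  fixes f :: "'e::euclidean_space \<Rightarrow> 'f::euclidean_space"
  assumes f: "continuous_on (cbox a b) f" and \<eta>: "smooth_on UNIV \<eta>"
  shows "(convolve a b f \<eta> has_derivative (\<lambda>v. convolve a b f (dd v \<eta>) x)) (at x)"
proof -
  have c: "continuous_on UNIV \<eta>" "\<And>v. continuous_on UNIV (dd v \<eta>)"
    using smooth_on_continuous[OF \<eta>] smooth_on_continuous[OF smooth_on_dd[OF \<eta>]] by blast+
  \<comment> \<open>The derivative in \<open>x\<close> as a bounded linear map. Expanding it in the
    basis makes its joint continuity in \<open>x\<close> and \<open>y\<close> a matter of the
    continuous functions \<open>dd i \<eta>\<close> and \<open>f\<close>.\<close>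
  define fx :: "'e \<Rightarrow> 'e \<Rightarrow> 'e \<Rightarrow>\<^sub>L 'f" where
    "fx x y = (\<Sum>i\<in>Basis. blinfun_scaleR_left (dd i \<eta> (x - y) *\<^sub>R f y) o\<^sub>L blinfun_inner_left i)" for x y
  have df: "\<eta> differentiable (at z)" for z using smooth_on_differentiable[OF \<eta>] by blast
  have fx: "blinfun_apply (fx x y) = (\<lambda>v. dd v \<eta> (x - y) *\<^sub>R f y)" for x y
  proof
    fix v
    have "blinfun_apply (fx x y) v = (\<Sum>i\<in>Basis. (v \<bullet> i) *\<^sub>R (dd i \<eta> (x - y) *\<^sub>R f y))"
      by (simp add: fx_def blinfun.sum_left inner_commute)
    also have "\<dots> = dd v \<eta> (x - y) *\<^sub>R f y"
      by (subst dd_basis_sum[OF df, of v]) (simp add: scaleR_sum_left)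
    finally show "blinfun_apply (fx x y) v = dd v \<eta> (x - y) *\<^sub>R f y" .
  qed
  have cfx: "continuous_on (UNIV \<times> cbox a b) (\<lambda>(x, y). fx x y)"
  proof -
    have "continuous_on (UNIV \<times> cbox a b) (\<lambda>z. \<Sum>i\<in>Basis. blinfun_scaleR_left (dd i \<eta> (fst z - snd z) *\<^sub>R f (snd z)) o\<^sub>L blinfun_inner_left i)"
      by (intro continuous_on_sum bounded_bilinear.continuous_on[OF bounded_bilinear_blinfun_compose] continuous_on_const
          bounded_linear.continuous_on[OF bounded_linear_blinfun_scaleR_left] continuous_on_scaleR
          continuous_on_compose2[OF c(2)] continuous_on_compose2[OF f] continuous_intros) auto
    then show ?thesis by (simp add: fx_def case_prod_unfold)
  qed
  have ic: "continuous_on (cbox a b) (\<lambda>y. \<eta> (x - y) *\<^sub>R f y)" for x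
    by (intro continuous_on_scaleR f continuous_on_compose2[OF c(1)] continuous_intros) auto
  have "((\<lambda>x. integral (cbox a b) (\<lambda>y. \<eta> (x - y) *\<^sub>R f y)) has_derivative blinfun_apply (integral (cbox a b) (fx x))) (at x within UNIV)"
  proof (rule leibniz_rule)
    fix x y :: 'e
    have "((\<lambda>x. x - y) has_derivative (\<lambda>v. v)) (at x)" by (auto intro!: derivative_eq_intros)
    from has_derivative_compose[OF this has_derivative_dd[OF df]]
    have "((\<lambda>x. \<eta> (x - y)) has_derivative (\<lambda>v. dd v \<eta> (x - y))) (at x)" .
    then show "((\<lambda>x. \<eta> (x - y) *\<^sub>R f y) has_derivative blinfun_apply (fx x y)) (at x within UNIV)"
      unfolding fx by (rule has_derivative_scaleR_left)
    show "(\<lambda>y. \<eta> (x - y) *\<^sub>R f y) integrable_on cbox a b" by (rule integrable_continuous[OF ic])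
  qed (use cfx in auto)
  moreover have "blinfun_apply (integral (cbox a b) (fx x)) = (\<lambda>v. integral (cbox a b) (\<lambda>y. dd v \<eta> (x - y) *\<^sub>R f y))"
  proof
    fix v
    have "continuous_on (cbox a b) (\<lambda>y. (\<lambda>(x, y). fx x y) (x, y))"
      by (rule continuous_on_compose2[OF cfx]) (auto intro!: continuous_on_Pair continuous_on_const continuous_on_id)
    then have "continuous_on (cbox a b) (fx x)" by simp
    then have "fx x integrable_on cbox a b" by (rule integrable_continuous)
    then show "blinfun_apply (integral (cbox a b) (fx x)) v = integral (cbox a b) (\<lambda>y. dd v \<eta> (x - y) *\<^sub>R f y)"
      by (simp add: blinfun_apply_integral fx)
  qed
  ultimately show ?thesis by (simp add: convolve_def[abs_def])
qed

lemma dd_convolve: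
  assumes "continuous_on (cbox a b) f" "smooth_on UNIV \<eta>"
  shows "dd v (convolve a b f \<eta>) = convolve a b f (dd v \<eta>)"
  using dd_eqI[OF convolve_has_derivative[OF assms]] by blast

lemma smooth_convolve:
  assumes f: "continuous_on (cbox a b) f" and \<eta>: "smooth_on UNIV \<eta>"
  shows "smooth_on UNIV (convolve a b f \<eta>)"
proof -
  have d: "convolve a b f \<eta> differentiable (at x)" if "smooth_on UNIV \<eta>" for \<eta> x
    using convolve_has_derivative[OF f that] by (rule differentiableI)
  have "ndiff_on n UNIV (convolve a b f \<eta>)" for n
    using \<eta>
  proof (induction n arbitrary: \<eta>)
    case (Suc n)
    then show ?case using d by (simp add: dd_convolve[OF f] smooth_on_dd)
  qed (use d in simp)
  then show ?thesis by (simp add: smooth_on_ndiff)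
qed

lemma dir_deriv_convolve:
  assumes f: "continuous_on (cbox a b) f" and \<eta>: "smooth_on UNIV \<eta>"
  shows "dir_deriv vs (convolve a b f \<eta>) = convolve a b f (dir_deriv vs \<eta>)"
  by (induction vs) (auto simp: dd_convolve[OF f] smooth_on_dir_deriv[OF \<eta>])

section \<open>Approximation by smooth functions\<close>

text \<open>\<open>f\<close> is mollified on a box \<open>Q\<close> around \<open>y0\<close>. On a
  smaller ball, derivatives of the mollifications are mollifications of the weak derivatives, hence
  bounded in L^p and Cauchy in L^1; this is what \<open>Sob_seqI\<close> takes as input.\<close>

lemma smooth_approximation:
  fixes f :: "'e::euclidean_space \<Rightarrow> 'f::euclidean_space"
  assumes p: "p > real DIM('e)" and f: "sobolev_on k p K f" and K: "compact K" and y0: "y0 \<in> interior K" and \<rho>: "\<rho> > 0"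
  obtains W u where "open W" "y0 \<in> W" "W \<subseteq> K" "Sob_seq k p W u" "uniform_limit W u f sequentially"
    "\<And>n. u n ` W \<subseteq> cball (f y0) \<rho>"
proof -
  have p1: "p \<ge> 1" using p DIM_positive[where 'a='e] by linarith
  obtain GG D where D: "sobolev_data k p K GG f D" and cf: "continuous_on K f" using f by (auto simp: sobolev_on_iff)
  have GG: "open GG" "K \<subseteq> GG" using D by (auto simp: sobolev_data_def)
  obtain R0 where R0: "R0 > 0" "ball y0 R0 \<subseteq> interior K" using y0 open_contains_ball by (meson open_interior)
  have "continuous (at y0) f"
    using cf y0 continuous_on_interior by blast
  then obtain R1 where R1: "R1 > 0" "\<And>y. dist y y0 < R1 \<Longrightarrow> dist (f y) (f y0) < \<rho>"
    using \<rho> unfolding continuous_at_eps_delta by blast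
  define m where "m = real DIM('e)"
  have m: "m \<ge> 1" unfolding m_def using DIM_positive[where 'a='e] by linarith
  \<comment> \<open>The box has side \<open>2 * R\<close>, so all its points are within
    \<open>m * (2 * R)\<close> of the centre, which is less than both radii.\<close>
  define R where "R = min R0 R1 / (4 * m)"
  have R: "R > 0" using R0 R1 m by (simp add: R_def)
  have R4: "m * (2 * R) < R0" "m * (2 * R) < R1"
    using R0 R1 m by (auto simp: R_def)
  define a where "a = y0 - R *\<^sub>R One"
  define b where "b = y0 + R *\<^sub>R One"
  define Q where "Q = cbox a b"
  have dQ: "dist y y0 \<le> m * (2 * R)" if "y \<in> Q" for y
    unfolding m_def
  proof (rule dist_le_cube[of _ a b])
    show "y \<in> cbox a b" using that by (simp add: Q_def)
    show "y0 \<in> cbox a b" using R by (auto simp: a_def b_def mem_box inner_diff_left inner_add_left)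
    show "b \<bullet> i - a \<bullet> i = 2 * R" if "i \<in> Basis" for i using that by (simp add: a_def b_def inner_diff_left inner_add_left)
  qed
  have QK: "Q \<subseteq> interior K"
  proof
    fix y assume "y \<in> Q"
    then have "dist y y0 < R0" using dQ[of y] R4 by linarith
    then show "y \<in> interior K" using R0 by (auto simp: dist_commute)
  qed
  have fQ: "dist (f y0) (f y) \<le> \<rho>" if "y \<in> Q" for y
    using R1(2)[of y] dQ[OF that] R4 by (simp add: dist_commute less_imp_le)
  have ballQ: "ball y0 R \<subseteq> Q"
  proof
    fix y assume "y \<in> ball y0 R"
    then have d: "norm (y - y0) < R" by (simp add: dist_norm norm_minus_commute)
    show "y \<in> Q" unfolding Q_def
    proof (subst mem_box, intro ballI conjI)
      fix i :: 'e assume i: "i \<in> Basis"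
      have "\<bar>(y - y0) \<bullet> i\<bar> \<le> R" using Basis_le_norm[OF i, of "y - y0"] d by linarith
      then show "a \<bullet> i \<le> y \<bullet> i" "y \<bullet> i \<le> b \<bullet> i"
        using i by (auto simp: a_def b_def inner_diff_left inner_add_left abs_le_iff)
    qed
  qed
  define W where "W = ball y0 (R/2)"
  \<comment> \<open>The index shift makes all mollification radii smaller than \<open>R / 2\<close>,
    so that balls around points of \<open>W\<close> stay inside the ball of radius \<open>R\<close>
    and thus inside \<open>Q\<close>.\<close>
  obtain N where N: "1 / real (Suc N) < R / 2" using nat_approx_posE[of "R/2"] R by auto
  have small: "1 / real (Suc (n + N)) < R / 2" for n
  proof -
    have "1 / real (Suc (n + N)) \<le> 1 / real (Suc N)" by (intro divide_left_mono) auto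
    then show ?thesis using N by linarith
  qed
  have cb: "cball x (1 / real (Suc (n + N))) \<subseteq> ball y0 R" if "x \<in> W" for x n
  proof
    fix z assume z: "z \<in> cball x (1 / real (Suc (n + N)))"
    have "dist y0 z \<le> dist y0 x + dist x z" by (rule dist_triangle)
    also have "\<dots> < R/2 + R/2" using that z small[of n] by (intro add_strict_mono) (auto simp: W_def)
    finally show "z \<in> ball y0 R" by simp
  qed
  have cfQ: "continuous_on Q f" by (rule continuous_on_subset[OF cf]) (use QK interior_subset in blast)
  \<comment> \<open>Extension by 0 links the two descriptions: \<open>convolve\<close> on the box
    gives smoothness, \<open>mollify\<close> of \<open>f0\<close> the estimates.\<close>
  define f0 where "f0 = (\<lambda>y. indicator Q y *\<^sub>R f y)"
  have f0i: "integrable lborel f0" unfolding f0_def Q_def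
    by (rule borel_integrable_compact[OF compact_cbox cfQ[unfolded Q_def]])
  define u where "u n = convolve a b f (mollifier (n + N))" for n
  have sets_eq: "LINT y|lborel. \<eta> (x - y) *\<^sub>R f0 y = convolve a b f \<eta> x" if \<eta>: "continuous_on UNIV \<eta>" for \<eta> :: "'e \<Rightarrow> real" and x
  proof -
    have c: "continuous_on (cbox a b) (\<lambda>y. \<eta> (x - y) *\<^sub>R f y)"
      by (intro continuous_on_scaleR cfQ[unfolded Q_def] continuous_on_compose2[OF \<eta>] continuous_intros) auto
    have i: "integrable lborel (\<lambda>y. indicator (cbox a b) y *\<^sub>R (\<eta> (x - y) *\<^sub>R f y))"
      by (rule borel_integrable_compact[OF compact_cbox c])
    have "(LINT y|lborel. \<eta> (x - y) *\<^sub>R f0 y) = (LINT y|lborel. indicator (cbox a b) y *\<^sub>R (\<eta> (x - y) *\<^sub>R f y))"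
      by (intro Bochner_Integration.integral_cong) (auto simp: f0_def Q_def indicator_def)
    also have "\<dots> = (LINT y:cbox a b|lebesgue. \<eta> (x - y) *\<^sub>R f y)"
      unfolding set_lebesgue_integral_def by (rule integral_completion[symmetric]) (use i in auto)
    also have "\<dots> = convolve a b f \<eta> x"
      unfolding convolve_def by (rule set_lebesgue_integral_eq_integral(2)[OF set_integrable_continuous_compact[OF compact_cbox c]])
    finally show ?thesis .
  qed
  have u_moll: "u n x = mollify (n + N) f0 x" for n x
    unfolding u_def mollify_def by (rule sets_eq[OF smooth_on_continuous[OF smooth_on_mollifier], symmetric])
  have smu: "smooth_on UNIV (u n)" for n
    unfolding u_def by (rule smooth_convolve[OF cfQ[unfolded Q_def] smooth_on_mollifier])
  have f0b: "integrable lborel f0" by (rule f0i)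
  have close: "norm (u n x - c) \<le> d" if x: "x \<in> W" and "\<And>y. dist x y \<le> 1 / real (Suc (n + N)) \<Longrightarrow> norm (f y - c) \<le> d" for n x c d
    unfolding u_moll
  proof (rule mollify_close[OF f0b])
    fix y assume y: "dist x y \<le> 1 / real (Suc (n + N))"
    then have "y \<in> Q" using cb[OF x, of n] ballQ by auto
    then show "norm (f0 y - c) \<le> d" using that(2)[OF y] by (simp add: f0_def)
  qed
  have "uniformly_continuous_on Q f" unfolding Q_def
    by (rule compact_uniformly_continuous[OF cfQ[unfolded Q_def] compact_cbox])
  have WQ: "W \<subseteq> Q" using ballQ R by (auto simp: W_def)
  have unif: "uniform_limit W u f sequentially"
  proof (rule uniform_limitI)
    fix e :: real assume e: "e > 0"
    then have "e / 2 > 0" by simp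
    then obtain d where d: "d > 0" "\<And>x y. x \<in> Q \<Longrightarrow> y \<in> Q \<Longrightarrow> dist y x < d \<Longrightarrow> dist (f y) (f x) < e / 2"
      using \<open>uniformly_continuous_on Q f\<close> unfolding uniformly_continuous_on_def by metis
    obtain M where M: "1 / real (Suc M) < d" using nat_approx_posE[OF d(1)] by blast
    show "\<forall>\<^sub>F n in sequentially. \<forall>x\<in>W. dist (u n x) (f x) < e"
    proof (rule eventually_sequentiallyI[of M], intro ballI)
      fix n x assume n: "n \<ge> M" and x: "x \<in> W"
      have "norm (u n x - f x) \<le> e / 2"
      proof (rule close[OF x])
        fix y assume y: "dist x y \<le> 1 / real (Suc (n + N))"
        have "1 / real (Suc (n + N)) \<le> 1 / real (Suc M)" using n by (intro divide_left_mono) auto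
        then have "dist y x < d" using y M by (simp add: dist_commute)
        moreover have "y \<in> Q" using y cb[OF x, of n] ballQ by auto
        ultimately have "dist (f y) (f x) < e / 2" using d(2) x WQ by blast
        then show "norm (f y - f x) \<le> e / 2" by (simp add: dist_norm)
      qed
      then show "dist (u n x) (f x) < e" using e by (simp add: dist_norm)
    qed
  qed
  have uball: "u n ` W \<subseteq> cball (f y0) \<rho>" for n
  proof safe
    fix x assume x: "x \<in> W"
    have "norm (u n x - f y0) \<le> \<rho>"
    proof (rule close[OF x])
      fix y assume "dist x y \<le> 1 / real (Suc (n + N))"
      then have "y \<in> Q" using cb[OF x, of n] ballQ by auto
      then show "norm (f y - f y0) \<le> \<rho>" using fQ[of y] by (simp only: dist_norm norm_minus_commute)
    qed
    then show "u n x \<in> cball (f y0) \<rho>" by (simp add: dist_norm norm_minus_commute)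
  qed
  have Lp: "Lp_seq p W (\<lambda>n. dir_deriv vs (u n))" if vs: "length vs \<le> k" for vs
  proof -
    define j where "j = length vs"
    have wd: "is_weak_derivative GG j f (D j)" and Dp: "set_integrable lebesgue K (\<lambda>x. norm (D j x vs) powr p)"
      using D vs by (auto simp: sobolev_data_def j_def)
    have QKs: "Q \<subseteq> K" using QK interior_subset by blast
    have QGG: "Q \<subseteq> GG" using QKs GG by blast
    have cQ: "compact Q" by (simp add: Q_def)
    have Qs: "Q \<in> sets lebesgue" by (simp add: Q_def)
    have DQ: "set_integrable lebesgue Q (\<lambda>x. D j x vs)"
      using wd cQ QGG unfolding is_weak_derivative_iff locally_integrable_on_def j_def by blast
    have DQp: "set_integrable lebesgue Q (\<lambda>x. norm (D j x vs) powr p)"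
      by (rule set_integrable_subset[OF Dp Qs QKs])
    obtain h where h: "integrable lborel h" "AE x in lebesgue. h x = indicator Q x *\<^sub>R D j x vs"
      using set_integrable_borel_version[OF DQ] by blast
    have hm[measurable]: "h \<in> borel_measurable borel" using h(1) by auto
    have hp: "integrable lborel (\<lambda>x. norm (h x) powr p)"
    proof -
      have "integrable lebesgue (\<lambda>x. norm (h x) powr p)"
      proof (rule integrable_cong_AE_imp)
        show "integrable lebesgue (\<lambda>x. indicator Q x *\<^sub>R (norm (D j x vs) powr p))" using DQp by (simp add: set_integrable_def)
        show "(\<lambda>x. norm (h x) powr p) \<in> borel_measurable lebesgue" by (rule measurable_completion) measurable
        show "AE x in lebesgue. indicator Q x *\<^sub>R (norm (D j x vs) powr p) = norm (h x) powr p"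
          using h(2) by eventually_elim (use p1 in \<open>auto simp: indicator_def\<close>)
      qed
      then show ?thesis by (subst (asm) integrable_completion) measurable
    qed
    \<comment> \<open>One sign \<open>(-1) ^ j\<close> comes from reflecting the mollifier, the
      other from the definition of the weak derivative; they cancel.\<close>
    have eq: "dir_deriv vs (u n) x = mollify (n + N) h x" if x: "x \<in> W" for n x
    proof -
      define \<eta> where "\<eta> y = mollifier (n + N) (x - y)" for y :: 'e
      have bQ: "cball x (1 / real (Suc (n + N))) \<subseteq> ball y0 R" by (rule cb[OF x])
      have t: "test_function GG \<eta>" unfolding \<eta>_def
        by (rule test_function_mollifier) (use bQ ballQ QGG in blast)
      have tb: "test_function (ball y0 R) \<eta>" unfolding \<eta>_def by (rule test_function_mollifier[OF bQ])
      have 1: "dir_deriv vs \<eta> y = (-1) ^ j *\<^sub>R dir_deriv vs (mollifier (n + N)) (x - y)" for y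
        using dir_deriv_reflect[OF smooth_on_mollifier, of vs "n + N" x] by (simp add: \<eta>_def[abs_def] j_def)
      have sd: "smooth_on UNIV (dir_deriv vs (mollifier (n + N) :: 'e \<Rightarrow> real))" by (rule smooth_on_dir_deriv[OF smooth_on_mollifier])
      have "dir_deriv vs (u n) x = (LINT y|lborel. dir_deriv vs (mollifier (n + N)) (x - y) *\<^sub>R f0 y)"
        unfolding u_def dir_deriv_convolve[OF cfQ[unfolded Q_def] smooth_on_mollifier]
        by (rule sets_eq[OF smooth_on_continuous[OF sd], symmetric])
      also have "\<dots> = (LINT y|lebesgue. dir_deriv vs (mollifier (n + N)) (x - y) *\<^sub>R f0 y)"
      proof (rule integral_completion[symmetric])
        have [measurable]: "dir_deriv vs (mollifier (n + N) :: 'e \<Rightarrow> real) \<in> borel_measurable borel" "f0 \<in> borel_measurable borel"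
          using borel_measurable_continuous_onI[OF smooth_on_continuous[OF sd]] f0i by auto
        show "(\<lambda>y. dir_deriv vs (mollifier (n + N)) (x - y) *\<^sub>R f0 y) \<in> borel_measurable lborel" by measurable
      qed
      also have "\<dots> = (LINT y|lebesgue. (-1) ^ j *\<^sub>R (dir_deriv vs \<eta> y *\<^sub>R f y))"
      proof (rule Bochner_Integration.integral_cong[OF refl])
        fix y
        have "dir_deriv vs \<eta> y = 0" if "y \<notin> Q"
          using test_function_dir_deriv[OF tb, of vs] that ballQ by (auto simp: test_function_def)
        moreover have "(-1) ^ j *\<^sub>R dir_deriv vs \<eta> y = dir_deriv vs (mollifier (n + N)) (x - y)"
          unfolding 1 by (simp flip: power_add add: mult_2[symmetric])
        ultimately show "dir_deriv vs (mollifier (n + N)) (x - y) *\<^sub>R f0 y = (-1) ^ j *\<^sub>R (dir_deriv vs \<eta> y *\<^sub>R f y)"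
          by (cases "y \<in> Q") (auto simp: f0_def)
      qed
      also have "\<dots> = (-1) ^ j *\<^sub>R (LINT y|lebesgue. dir_deriv vs \<eta> y *\<^sub>R f y)" by (rule integral_scaleR_right)
      also have "(LINT y|lebesgue. dir_deriv vs \<eta> y *\<^sub>R f y) = (-1) ^ j *\<^sub>R (LINT y|lebesgue. \<eta> y *\<^sub>R D j y vs)"
        using wd t unfolding is_weak_derivative_iff j_def by blast
      also have "(-1) ^ j *\<^sub>R ((-1) ^ j *\<^sub>R (LINT y|lebesgue. \<eta> y *\<^sub>R D j y vs)) = (LINT y|lebesgue. \<eta> y *\<^sub>R D j y vs)"
        by (simp flip: power_add add: mult_2[symmetric])
      also have "\<dots> = mollify (n + N) h x"
        unfolding \<eta>_def by (rule mollify_weak[OF h DQ, symmetric]) (use bQ ballQ in blast)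
      finally show ?thesis .
    qed
    have cont: "continuous_on W (dir_deriv vs (u n))" for n
      by (rule continuous_on_subset[OF smooth_on_continuous[OF smooth_on_dir_deriv[OF smu]]]) simp
    have "Lp_seq p W (\<lambda>n. dir_deriv vs (u n))"
      unfolding Lp_seq_def
    proof (intro conjI allI impI cont; elim conjE)
      fix C assume C: "compact C" "C \<subseteq> W"
      have cC: "continuous_on C (dir_deriv vs (u n))" for n by (rule continuous_on_subset[OF cont C(2)])
      have hpfin: "(\<integral>\<^sup>+x. ennreal (norm (h x) powr p) \<partial>lborel) = ennreal (LINT x|lborel. norm (h x) powr p)"
        by (rule nn_integral_eq_integral[OF hp]) auto
      define B where "B = 2 powr p * (LINT x|lborel. norm (h x) powr p)"
      have "(LINT x:C|lebesgue. norm (dir_deriv vs (u n) x) powr p) \<le> B" for n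
      proof -
        have "ennreal (LINT x:C|lebesgue. norm (dir_deriv vs (u n) x) powr p) = (\<integral>\<^sup>+x. ennreal (indicator C x *\<^sub>R (norm (dir_deriv vs (u n) x) powr p)) \<partial>lborel)"
          by (rule ennreal_set_integral_compact[OF C(1) continuous_on_norm_powr[OF cC p1]]) simp
        also have "\<dots> \<le> (\<integral>\<^sup>+x. ennreal (norm (mollify (n + N) h x) powr p) \<partial>lborel)"
          using C eq by (intro nn_integral_mono ennreal_leI) (auto simp: indicator_def)
        also have "\<dots> \<le> 2 powr p * (\<integral>\<^sup>+x. ennreal (norm (h x) powr p) \<partial>lborel)"
          by (rule mollify_powr_nn_integral_le[OF h(1) hp p1])
        also have "\<dots> = ennreal B" unfolding hpfin B_def by (simp add: ennreal_mult)
        finally show ?thesis by (subst (asm) ennreal_le_iff) (auto simp: B_def)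
      qed
      then show "\<exists>B. \<forall>n. (LINT x:C|lebesgue. norm (dir_deriv vs (u n) x) powr p) \<le> B" by blast
      fix e :: real assume e: "e > 0"
      then have e2: "ennreal (e/2) > 0" by simp
      have "(\<lambda>n. \<integral>\<^sup>+x. norm (mollify (n + N) h x - h x) \<partial>lborel) \<longlonglongrightarrow> 0"
        using mollify_tendsto[OF h(1)] by (rule LIMSEQ_ignore_initial_segment)
      then have "eventually (\<lambda>n. (\<integral>\<^sup>+x. norm (mollify (n + N) h x - h x) \<partial>lborel) < ennreal (e/2)) sequentially"
        using e2 by (intro order_tendstoD) auto
      then obtain M where M: "\<And>n. n \<ge> M \<Longrightarrow> (\<integral>\<^sup>+x. norm (mollify (n + N) h x - h x) \<partial>lborel) < ennreal (e/2)"
        by (auto simp: eventually_sequentially)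
      have "(LINT x:C|lebesgue. norm (dir_deriv vs (u n) x - dir_deriv vs (u l) x)) < e" if n: "n \<ge> M" "l \<ge> M" for n l
      proof -
        have "ennreal (LINT x:C|lebesgue. norm (dir_deriv vs (u n) x - dir_deriv vs (u l) x)) = (\<integral>\<^sup>+x. ennreal (indicator C x *\<^sub>R norm (dir_deriv vs (u n) x - dir_deriv vs (u l) x)) \<partial>lborel)"
          by (rule ennreal_set_integral_compact[OF C(1)]) (auto intro!: continuous_intros cC)
        also have "\<dots> \<le> (\<integral>\<^sup>+x. ennreal (norm (mollify (n + N) h x - mollify (l + N) h x)) \<partial>lborel)"
          using C eq by (intro nn_integral_mono ennreal_leI) (auto simp: indicator_def)
        also have "\<dots> \<le> (\<integral>\<^sup>+x. norm (mollify (n + N) h x - h x) \<partial>lborel) + (\<integral>\<^sup>+x. norm (h x - mollify (l + N) h x) \<partial>lborel)"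
          by (rule nn_integral_norm_triangle) auto
        also have "\<dots> < ennreal (e/2) + ennreal (e/2)"
          using M[OF n(1)] M[OF n(2)] by (intro add_strict_mono) (auto simp: norm_minus_commute)
        also have "\<dots> = ennreal e" using e by (simp flip: ennreal_plus)
        finally show ?thesis by (subst (asm) ennreal_less_iff) (auto intro!: integral_nonneg_compact)
      qed
      then show "\<exists>N. \<forall>n\<ge>N. \<forall>l\<ge>N. (LINT x:C|lebesgue. norm (dir_deriv vs (u n) x - dir_deriv vs (u l) x)) < e" by blast
    qed
    then show ?thesis .
  qed
  have oW: "open W" by (simp add: W_def)
  have "Sob_seq k p W u"
    by (rule Sob_seqI[OF oW p _ Lp]) (rule smooth_on_subset[OF smu], simp)
  moreover have "y0 \<in> W" using R by (simp add: W_def)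
  moreover have "W \<subseteq> K" using WQ QK interior_subset by blast
  ultimately show thesis using that oW unif uball by blast
qed

section \<open>Local membership in the Sobolev space\<close>

text \<open>The counterpart of \<open>sobolev_on\<close> on open sets: the derivatives live on
  \<open>W\<close> itself and are p-integrable up to its boundary, so that two regions can be
  glued.\<close>

definition sobolev_region :: "nat \<Rightarrow> real \<Rightarrow> 'e::euclidean_space set \<Rightarrow> ('e \<Rightarrow> 'f::euclidean_space) \<Rightarrow> bool" where
  "sobolev_region k p W f \<longleftrightarrow> open W \<and> continuous_on W f \<and> (\<forall>j\<le>k. \<exists>D. is_weak_derivative W j f D \<and>
     (\<forall>vs. length vs = j \<longrightarrow> set_integrable lebesgue W (\<lambda>x. norm (D x vs) powr p)))"

text \<open>A subsequence with L^1 differences below \<open>(1/2) ^ n\<close> meets the summability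
  hypothesis of \<open>weak_derivative_limit\<close>. The L^p bounds survive by Fatou's
  lemma.\<close>

lemma sobolev_region_of_seq:
  fixes u :: "nat \<Rightarrow> 'e::euclidean_space \<Rightarrow> 'f::euclidean_space"
  assumes S: "open S" and p: "1 \<le> p" and u: "Sob_seq k p S u" and v: "continuous_on S v"
    and lim: "uniform_limit S u v sequentially" and x0: "x0 \<in> S"
  obtains W where "x0 \<in> W" "W \<subseteq> S" "sobolev_region k p W v"
proof -
  obtain r where r: "r > 0" "cball x0 r \<subseteq> S" using S x0 open_contains_cball by blast
  define W where "W = ball x0 r"
  define C where "C = cball x0 r"
  have C: "compact C" "C \<subseteq> S" "W \<subseteq> C" "open W" "W \<subseteq> S" using r by (auto simp: C_def W_def)
  let ?I = "\<lambda>bs n l. LINT x:C|lebesgue. norm (dir_deriv bs (u n) x - dir_deriv bs (u l) x)"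
  have sm: "smooth_on S (u n)" for n by (rule Sob_seq_smooth[OF u])
  have "\<exists>D. is_weak_derivative W j v D \<and> (\<forall>vs. length vs = j \<longrightarrow> set_integrable lebesgue W (\<lambda>x. norm (D x vs) powr p))" if j: "j \<le> k" for j
  proof -
    have Lp: "Lp_seq p S (\<lambda>n. dir_deriv vs (u n))" if "length vs = j" for vs
      by (rule Sob_seq_dir_deriv[OF p u]) (use that j in simp)
    have cC: "continuous_on C (dir_deriv vs (u n))" for vs n
      by (rule continuous_on_subset[OF smooth_on_continuous[OF smooth_on_dir_deriv[OF sm]] C(2)])
    have "\<exists>N. \<forall>bs\<in>basis_lists j. \<forall>n\<ge>N. \<forall>l\<ge>N. (?I bs n l) < (1/2) ^ i" for i :: nat
    proof -
      have "\<forall>bs. \<exists>N. bs \<in> basis_lists j \<longrightarrow> (\<forall>n\<ge>N. \<forall>l\<ge>N. (?I bs n l) < (1/2) ^ i)"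
      proof (intro allI)
        fix bs :: "'e list"
        have "(1/2) ^ i > (0::real)" by simp
        show "\<exists>N. bs \<in> basis_lists j \<longrightarrow> (\<forall>n\<ge>N. \<forall>l\<ge>N. (?I bs n l) < (1/2) ^ i)"
        proof (cases "bs \<in> basis_lists j")
          case True
          then have "Lp_seq p S (\<lambda>n. dir_deriv bs (u n))" by (intro Lp basis_lists_length)
          then have "\<forall>e>0. \<exists>N. \<forall>n\<ge>N. \<forall>l\<ge>N. (?I bs n l) < e"
            using C(1,2) unfolding Lp_seq_def by simp
          then show ?thesis using \<open>(1/2) ^ i > (0::real)\<close> by blast
        qed simp
      qed
      then obtain N where N: "\<And>bs. bs \<in> basis_lists j \<Longrightarrow> (\<forall>n\<ge>N bs. \<forall>l\<ge>N bs. (?I bs n l) < (1/2) ^ i)"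
        by metis
      have "N bs \<le> Max (insert 0 (N ` basis_lists j))" if "bs \<in> basis_lists j" for bs
        using that by (intro Max_ge) auto
      then show ?thesis using N by (meson order_trans)
    qed
    then obtain N where N: "\<And>i bs n l. bs \<in> basis_lists j \<Longrightarrow> n \<ge> N i \<Longrightarrow> l \<ge> N i \<Longrightarrow> (?I bs n l) < (1/2) ^ i"
      by metis
    \<comment> \<open>The sum dominates both \<open>N i\<close> and the earlier thresholds, so
      \<open>s i\<close> and \<open>s (Suc i)\<close> both pass \<open>N i\<close>; the summand
      \<open>i\<close> sends the indices to infinity.\<close>
    define s where "s i = i + (\<Sum>l\<le>i. N l)" for i
    have sN: "s i \<ge> N i" "s (Suc i) \<ge> N i" "s i \<ge> i" for i
    proof -
      have "N i \<le> (\<Sum>l\<le>i. N l)" by (intro member_le_sum) auto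
      then show "s i \<ge> N i" "s (Suc i) \<ge> N i" by (auto simp: s_def)
    qed (simp add: s_def)
    have slim: "filterlim s sequentially sequentially"
      by (rule filterlim_at_top_mono[OF filterlim_ident]) (use sN(3) in auto)
    have wd: "is_weak_derivative W j (u (s n)) (\<lambda>x vs. dir_deriv vs (u (s n)) x)" for n
      by (rule weak_derivative_smooth[OF C(4) smooth_on_subset[OF sm C(5)]])
    have Ws: "W \<in> sets lebesgue" using C(4) by simp
    have iC: "set_integrable lebesgue C g" "set_integrable lebesgue W g" if "continuous_on C g" for g :: "'e \<Rightarrow> 'x::euclidean_space"
      using set_integrable_continuous_compact[OF C(1) that] set_integrable_subset[OF _ Ws C(3)] by blast+
    have int: "set_integrable lebesgue W (\<lambda>x. dir_deriv bs (u (s n)) x)" for bs n by (rule iC(2)[OF cC])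
    have summ: "summable (\<lambda>n. LINT x:W|lebesgue. norm (dir_deriv bs (u (s (Suc n))) x - dir_deriv bs (u (s n)) x))" if bs: "bs \<in> basis_lists j" for bs
    proof (rule summable_comparison_test')
      show "summable (\<lambda>n. (1/2::real) ^ n)" by (rule summable_geometric) simp
      fix n
      have cd: "continuous_on C (\<lambda>x. norm (dir_deriv bs (u (s (Suc n))) x - dir_deriv bs (u (s n)) x))" by (intro continuous_intros cC)
      have "(LINT x:W|lebesgue. norm (dir_deriv bs (u (s (Suc n))) x - dir_deriv bs (u (s n)) x)) \<le> (LINT x:C|lebesgue. norm (dir_deriv bs (u (s (Suc n))) x - dir_deriv bs (u (s n)) x))"
        unfolding set_lebesgue_integral_def using iC[OF cd, unfolded set_integrable_def] C(3)
        by (intro integral_mono) (auto simp: indicator_def)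
      also have "\<dots> < (1/2) ^ n" by (rule N[OF bs sN(2) sN(1)])
      finally show "norm (LINT x:W|lebesgue. norm (dir_deriv bs (u (s (Suc n))) x - dir_deriv bs (u (s n)) x)) \<le> (1/2) ^ n"
        using integral_nonneg_compact[of W "\<lambda>x. norm (dir_deriv bs (u (s (Suc n))) x - dir_deriv bs (u (s n)) x)"] by simp
    qed
    have limW: "uniform_limit W (\<lambda>n. u (s n)) v sequentially"
    proof (rule uniform_limitI)
      fix e :: real assume "e > 0"
      then have "\<forall>\<^sub>F n in sequentially. \<forall>x\<in>S. dist (u n x) (v x) < e" using lim by (simp add: uniform_limit_iff)
      then have "\<forall>\<^sub>F n in sequentially. \<forall>x\<in>S. dist (u (s n) x) (v x) < e"
        by (rule eventually_compose_filterlim[OF _ slim])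
      then show "\<forall>\<^sub>F n in sequentially. \<forall>x\<in>W. dist (u (s n) x) (v x) < e" by eventually_elim (use C in auto)
    qed
    have vloc: "locally_integrable_on v W" by (rule locally_integrable_continuous[OF continuous_on_subset[OF v C(5)]])
    obtain E where E: "is_weak_derivative W j v E"
      "AE x in lebesgue. x \<in> W \<longrightarrow> (\<forall>vs. length vs = j \<longrightarrow> (\<lambda>n. dir_deriv vs (u (s n)) x) \<longlonglongrightarrow> E x vs)"
      "\<And>vs. length vs = j \<Longrightarrow> set_integrable lebesgue W (\<lambda>x. E x vs)"
      using weak_derivative_limit[OF C(4) wd int summ limW vloc] by blast
    have "set_integrable lebesgue W (\<lambda>x. norm (E x vs) powr p)" if vs: "length vs = j" for vs
    proof -
      obtain B where B: "\<And>n. (LINT x:C|lebesgue. norm (dir_deriv vs (u n) x) powr p) \<le> B" using Lp_seq_bound[OF Lp[OF vs] C(1,2)] by blast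
      have m1: "(\<lambda>x. indicator W x *\<^sub>R E x vs) \<in> borel_measurable lebesgue" using E(3)[OF vs] unfolding set_integrable_def by (rule borel_measurable_integrable)
      have eqp: "indicator W x *\<^sub>R (norm (E x vs) powr p) = norm (indicator W x *\<^sub>R E x vs) powr p" for x
        using p by (auto simp: indicator_def)
      have m2: "(\<lambda>x. indicator W x *\<^sub>R (norm (E x vs) powr p)) \<in> borel_measurable lebesgue"
        unfolding eqp by (rule powr_real_measurable[OF measurable_compose[OF m1 borel_measurable_norm] borel_measurable_const])
      have "(\<integral>\<^sup>+x. ennreal (indicator W x *\<^sub>R (norm (E x vs) powr p)) \<partial>lebesgue) \<le> ennreal B"
      proof (rule nn_integral_le_limit[where S="\<lambda>n x. indicator W x *\<^sub>R (norm (dir_deriv vs (u (s n)) x) powr p)"])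
        have cp: "continuous_on C (\<lambda>x. norm (dir_deriv vs (u (s n)) x) powr p)" for n by (rule continuous_on_norm_powr[OF cC p])
        show "(\<lambda>x. indicator W x *\<^sub>R (norm (dir_deriv vs (u (s n)) x) powr p)) \<in> borel_measurable lebesgue" for n
          using iC(2)[OF cp[of n]] unfolding set_integrable_def by (rule borel_measurable_integrable)
        show "AE x in lebesgue. (\<lambda>n. indicator W x *\<^sub>R (norm (dir_deriv vs (u (s n)) x) powr p)) \<longlonglongrightarrow> indicator W x *\<^sub>R (norm (E x vs) powr p)"
          using E(2)
        proof eventually_elim
          case (elim x)
          show ?case
          proof (cases "x \<in> W")
            case True
            then have "(\<lambda>n. dir_deriv vs (u (s n)) x) \<longlonglongrightarrow> E x vs" using elim vs by blast
            then have "(\<lambda>n. norm (dir_deriv vs (u (s n)) x) powr p) \<longlonglongrightarrow> norm (E x vs) powr p"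
              using p by (intro tendsto_powr2 tendsto_norm tendsto_const) auto
            then show ?thesis using True by simp
          qed simp
        qed
        fix n
        have "(\<integral>\<^sup>+x. ennreal (indicator W x *\<^sub>R (norm (dir_deriv vs (u (s n)) x) powr p)) \<partial>lebesgue) \<le> (\<integral>\<^sup>+x. ennreal (indicator C x *\<^sub>R (norm (dir_deriv vs (u (s n)) x) powr p)) \<partial>lebesgue)"
          using C(3) by (intro nn_integral_mono ennreal_leI) (auto simp: indicator_def)
        also have "\<dots> = ennreal (LINT x:C|lebesgue. norm (dir_deriv vs (u (s n)) x) powr p)"
          unfolding set_lebesgue_integral_def using iC(1)[OF cp[of n]] unfolding set_integrable_def
          by (rule nn_integral_eq_integral) (auto simp: indicator_def)
        also have "\<dots> \<le> ennreal B" using B by (intro ennreal_leI)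
        finally show "(\<integral>\<^sup>+x. ennreal (indicator W x *\<^sub>R (norm (dir_deriv vs (u (s n)) x) powr p)) \<partial>lebesgue) \<le> ennreal B" .
      qed
      then show ?thesis unfolding set_integrable_def
        by (intro integrableI_bounded[OF m2]) (auto intro: le_less_trans simp: indicator_def)
    qed
    then show ?thesis using E(1) by blast
  qed
  moreover have "continuous_on W v" by (rule continuous_on_subset[OF v C(5)])
  ultimately have "sobolev_region k p W v" using C(4) by (simp add: sobolev_region_def)
  then show thesis using that[of W] r C by (auto simp: W_def)
qed

section \<open>Gluing weak derivatives along open covers\<close>

lemma dir_deriv_add:
  assumes "open S" "smooth_on S f" "smooth_on S g" "x \<in> S"
  shows "dir_deriv vs (\<lambda>x. f x + g x) x = dir_deriv vs f x + dir_deriv vs g x"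
  using assms(4)
proof (induction vs arbitrary: x)
  case (Cons v vs)
  have "dd v (dir_deriv vs (\<lambda>x. f x + g x)) x = dd v (\<lambda>x. dir_deriv vs f x + dir_deriv vs g x) x"
    by (rule dd_cong[OF assms(1) Cons.prems Cons.IH])
  also have "\<dots> = dd v (dir_deriv vs f) x + dd v (dir_deriv vs g) x"
    by (intro dd_add smooth_on_differentiable[OF smooth_on_dir_deriv[OF assms(2)]] smooth_on_differentiable[OF smooth_on_dir_deriv[OF assms(3)]] Cons.prems)
  finally show ?case by simp
qed simp

text \<open>Measurability of \<open>g\<close> is not assumed; it follows from completeness of
  Lebesgue measure.\<close>

lemma integrable_AE_lebesgue:
  fixes f g :: "'e::euclidean_space \<Rightarrow> 'f::euclidean_space"
  assumes f: "integrable lebesgue f" and ae: "AE x in lebesgue. f x = g x"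
  shows "integrable lebesgue g"
proof -
  obtain N where N: "N \<in> null_sets lebesgue" "{x. f x \<noteq> g x} \<subseteq> N"
    using ae by (auto simp: eventually_ae_filter)
  have "f absolutely_integrable_on UNIV" using f by (simp add: set_integrable_def)
  then have "g absolutely_integrable_on UNIV"
  proof (rule absolutely_integrable_spike[where S=N])
    show "negligible N" using N(1) by (simp add: negligible_iff_null_sets)
    show "g x = f x" if "x \<in> UNIV - N" for x
      using N(2) that by (metis (mono_tags, lifting) Diff_iff mem_Collect_eq subsetD)
  qed
  then show ?thesis by (simp add: set_integrable_def)
qed

text \<open>The two derivatives agree almost everywhere on the overlap by uniqueness, so a case
  distinction on \<open>W1\<close> glues them. The defining identity is checked by splitting a test
  function with a smooth cutoff.\<close>

lemma sobolev_region_Un: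
  fixes f :: "'e::euclidean_space \<Rightarrow> 'f::euclidean_space"
  assumes 1: "sobolev_region k p W1 f" and 2: "sobolev_region k p W2 f"
  shows "sobolev_region k p (W1 \<union> W2) f"
proof -
  have op: "open W1" "open W2" using 1 2 by (auto simp: sobolev_region_def)
  have cf: "continuous_on (W1 \<union> W2) f" using 1 2 by (intro continuous_on_open_Un) (auto simp: sobolev_region_def)
  have "\<exists>D. is_weak_derivative (W1 \<union> W2) j f D \<and> (\<forall>vs. length vs = j \<longrightarrow> set_integrable lebesgue (W1 \<union> W2) (\<lambda>x. norm (D x vs) powr p))"
    if j: "j \<le> k" for j
  proof -
    obtain D1 where D1: "is_weak_derivative W1 j f D1" "\<And>vs. length vs = j \<Longrightarrow> set_integrable lebesgue W1 (\<lambda>x. norm (D1 x vs) powr p)"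
      using 1 j unfolding sobolev_region_def by blast
    obtain D2 where D2: "is_weak_derivative W2 j f D2" "\<And>vs. length vs = j \<Longrightarrow> set_integrable lebesgue W2 (\<lambda>x. norm (D2 x vs) powr p)"
      using 2 j unfolding sobolev_region_def by blast
    define D where "D x = (if x \<in> W1 then D1 x else D2 x)" for x
    have ae: "AE x in lebesgue. x \<in> W1 \<inter> W2 \<longrightarrow> D1 x vs = D2 x vs" if "length vs = j" for vs
      by (rule weak_derivative_unique[OF _ is_weak_derivative_subset[OF D1(1)] is_weak_derivative_subset[OF D2(1)] that]) (use op in auto)
    have sets: "W1 \<in> sets lebesgue" "W2 \<in> sets lebesgue" "W2 - W1 \<in> sets lebesgue" using op by auto
    \<comment> \<open>\<open>h\<close> is supported in \<open>W1\<close> and equals 1 near the part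
      of \<open>K\<close> outside \<open>W2\<close>. For a test function \<open>\<eta>\<close>
      supported in \<open>K\<close>, the product \<open>h * \<eta>\<close> is then a test function
      on \<open>W1\<close>, and \<open>(1 - h) * \<eta>\<close> is one on \<open>W2\<close>,
      supported in \<open>K - V\<close>.\<close>
    have cut: "\<exists>h :: 'e \<Rightarrow> real. \<exists>L V. smooth_on UNIV h \<and> compact L \<and> L \<subseteq> W1 \<and> (\<forall>x. x \<notin> L \<longrightarrow> h x = 0) \<and> open V \<and> K - V \<subseteq> W2 \<and> V \<subseteq> L \<and> (\<forall>x\<in>V. h x = 1)"
      if K: "compact K" "K \<subseteq> W1 \<union> W2" for K
    proof -
      have c: "compact (K - W2)" using K(1) op(2) by (simp add: compact_diff)
      have s: "K - W2 \<subseteq> W1" using K(2) by auto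
      obtain h :: "'e \<Rightarrow> real" and L V where h: "smooth_on UNIV h" "compact L" "L \<subseteq> W1"
         "\<And>x. x \<notin> L \<Longrightarrow> h x = 0" "open V" "K - W2 \<subseteq> V" "\<And>x. x \<in> V \<Longrightarrow> h x = 1" "\<And>x. 0 \<le> h x \<and> h x \<le> 1"
        using smooth_cutoff[OF c op(1) s] by blast
      have "V \<subseteq> L" using h(4,7) by (metis subsetI zero_neq_one)
      moreover have "K - V \<subseteq> W2" using h(6) by blast
      ultimately show ?thesis using h(1-5,7) by (intro exI[of _ h] exI[of _ L] exI[of _ V]) simp
    qed
    have Dloc: "locally_integrable_on (\<lambda>x. D x vs) (W1 \<union> W2)" if vs: "length vs = j" for vs
      unfolding locally_integrable_on_def
    proof (intro allI impI; elim conjE)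
      fix K assume K: "compact K" "K \<subseteq> W1 \<union> W2"
      obtain h :: "'e \<Rightarrow> real" and L V where h: "smooth_on UNIV h" "compact L" "L \<subseteq> W1" "open V" "K - V \<subseteq> W2" "V \<subseteq> L"
        using cut[OF K] by blast
      have "set_integrable lebesgue (K \<inter> L) (\<lambda>x. D1 x vs)"
        using D1(1) vs h K compact_Int unfolding is_weak_derivative_iff locally_integrable_on_def by (metis inf.coboundedI2)
      moreover have "compact (K - V)" using K h by (simp add: compact_diff)
      then have "set_integrable lebesgue (K - V) (\<lambda>x. D2 x vs)"
        using D2(1) vs h unfolding is_weak_derivative_iff locally_integrable_on_def by blast
      then have "set_integrable lebesgue (K - L) (\<lambda>x. D2 x vs)"
        by (rule set_integrable_subset) (use borel_compact[OF K(1)] borel_compact[OF h(2)] h(6) in auto)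
      ultimately have i: "integrable lebesgue (\<lambda>x. indicator (K \<inter> L) x *\<^sub>R D1 x vs + indicator (K - L) x *\<^sub>R D2 x vs)"
        unfolding set_integrable_def by (rule Bochner_Integration.integrable_add)
      have "AE x in lebesgue. indicator (K \<inter> L) x *\<^sub>R D1 x vs + indicator (K - L) x *\<^sub>R D2 x vs = indicator K x *\<^sub>R D x vs"
        using ae[OF vs]
      proof eventually_elim
        case (elim x)
        show ?case using elim h(3,5,6) K(2) by (auto simp: D_def indicator_def)
      qed
      with i show "set_integrable lebesgue K (\<lambda>x. D x vs)" unfolding set_integrable_def
        by (rule integrable_AE_lebesgue)
    qed
    have "is_weak_derivative (W1 \<union> W2) j f D"
      unfolding is_weak_derivative_iff
    proof (intro conjI allI impI ballI)
      show floc: "locally_integrable_on f (W1 \<union> W2)" by (rule locally_integrable_continuous[OF cf])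
      show "sym_multilinear j (D x)" if "x \<in> W1 \<union> W2" for x
        using D1(1) D2(1) that unfolding is_weak_derivative_iff D_def by auto
      fix vs :: "'e list" assume vs: "length vs = j"
      show "locally_integrable_on (\<lambda>x. D x vs) (W1 \<union> W2)" by (rule Dloc[OF vs])
      fix \<eta> :: "'e \<Rightarrow> real" assume \<eta>: "test_function (W1 \<union> W2) \<eta>"
      obtain K where K: "smooth_on UNIV \<eta>" "compact K" "K \<subseteq> W1 \<union> W2" "\<And>x. x \<notin> K \<Longrightarrow> \<eta> x = 0"
        using \<eta> unfolding test_function_def by blast
      obtain h :: "'e \<Rightarrow> real" and L V where h: "smooth_on UNIV h" "compact L" "L \<subseteq> W1" "\<And>x. x \<notin> L \<Longrightarrow> h x = 0" "open V" "K - V \<subseteq> W2" "V \<subseteq> L" "\<And>x. x \<in> V \<Longrightarrow> h x = 1"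
        using cut[OF K(2,3)] by blast
      define \<eta>1 where "\<eta>1 x = h x * \<eta> x" for x
      define \<eta>2 where "\<eta>2 x = (1 - h x) * \<eta> x" for x
      have s1: "smooth_on UNIV \<eta>1" unfolding \<eta>1_def by (intro smooth_on_mult open_UNIV h K)
      have s2: "smooth_on UNIV \<eta>2" unfolding \<eta>2_def by (intro smooth_on_mult smooth_on_diff smooth_on_const open_UNIV h K)
      have t1: "test_function W1 \<eta>1" by (rule test_functionI[OF s1 h(2,3)]) (use h(4) in \<open>simp add: \<eta>1_def\<close>)
      have "compact (K - V)" using K h by (simp add: compact_diff)
      then have t2: "test_function W2 \<eta>2" by (rule test_functionI[OF s2 _ h(6)]) (use h(8) K(4) in \<open>auto simp: \<eta>2_def\<close>)
      have sum: "\<eta> x = \<eta>1 x + \<eta>2 x" for x by (simp add: \<eta>1_def \<eta>2_def algebra_simps)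
      have dsum: "dir_deriv vs \<eta> x = dir_deriv vs \<eta>1 x + dir_deriv vs \<eta>2 x" for x
        using dir_deriv_add[OF open_UNIV s1 s2, of x vs] unfolding sum[symmetric] by simp
      have t1': "test_function (W1 \<union> W2) \<eta>1" "test_function (W1 \<union> W2) \<eta>2"
        by (rule test_function_mono[OF t1] test_function_mono[OF t2], simp)+
      have e1: "(LINT x|lebesgue. dir_deriv vs \<eta>1 x *\<^sub>R f x) = (-1) ^ j *\<^sub>R (LINT x|lebesgue. \<eta>1 x *\<^sub>R D1 x vs)"
        using D1(1) t1 vs unfolding is_weak_derivative_iff by blast
      have e2: "(LINT x|lebesgue. dir_deriv vs \<eta>2 x *\<^sub>R f x) = (-1) ^ j *\<^sub>R (LINT x|lebesgue. \<eta>2 x *\<^sub>R D2 x vs)"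
        using D2(1) t2 vs unfolding is_weak_derivative_iff by blast
      have z1: "\<eta>1 x *\<^sub>R D1 x vs = \<eta>1 x *\<^sub>R D x vs" for x
        using t1 by (cases "x \<in> W1") (auto simp: D_def test_function_def)
      note i1 = test_integrable[OF t1'(1) Dloc[OF vs]] and i2 = test_integrable[OF t1'(2) Dloc[OF vs]]
      have D2loc: "locally_integrable_on (\<lambda>x. D2 x vs) W2" using D2(1) vs unfolding is_weak_derivative_iff by blast
      have z2: "(LINT x|lebesgue. \<eta>2 x *\<^sub>R D2 x vs) = (LINT x|lebesgue. \<eta>2 x *\<^sub>R D x vs)"
      proof (rule integral_cong_AE)
        show "(\<lambda>x. \<eta>2 x *\<^sub>R D2 x vs) \<in> borel_measurable lebesgue" using test_integrable[OF t2 D2loc] by (rule borel_measurable_integrable)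
        show "(\<lambda>x. \<eta>2 x *\<^sub>R D x vs) \<in> borel_measurable lebesgue" using i2 by (rule borel_measurable_integrable)
        show "AE x in lebesgue. \<eta>2 x *\<^sub>R D2 x vs = \<eta>2 x *\<^sub>R D x vs"
          using ae[OF vs]
        proof eventually_elim
          case (elim x)
          show ?case
          proof (cases "x \<in> W2")
            case True
            then show ?thesis using elim by (auto simp: D_def)
          next
            case False
            then have "\<eta>2 x = 0" using t2 by (auto simp: test_function_def)
            then show ?thesis by simp
          qed
        qed
      qed
      have "(LINT x|lebesgue. dir_deriv vs \<eta> x *\<^sub>R f x) = (LINT x|lebesgue. dir_deriv vs \<eta>1 x *\<^sub>R f x) + (LINT x|lebesgue. dir_deriv vs \<eta>2 x *\<^sub>R f x)"
        unfolding dsum scaleR_add_left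
        by (intro Bochner_Integration.integral_add test_integrable[OF test_function_dir_deriv[OF t1'(1)] floc] test_integrable[OF test_function_dir_deriv[OF t1'(2)] floc])
      also have "\<dots> = (-1) ^ j *\<^sub>R ((LINT x|lebesgue. \<eta>1 x *\<^sub>R D x vs) + (LINT x|lebesgue. \<eta>2 x *\<^sub>R D x vs))"
        unfolding e1 e2 z1 z2 by (simp add: scaleR_add_right)
      also have "(LINT x|lebesgue. \<eta>1 x *\<^sub>R D x vs) + (LINT x|lebesgue. \<eta>2 x *\<^sub>R D x vs) = (LINT x|lebesgue. \<eta> x *\<^sub>R D x vs)"
        unfolding sum scaleR_add_left by (rule Bochner_Integration.integral_add[OF i1 i2, symmetric])
      finally show "(LINT x|lebesgue. dir_deriv vs \<eta> x *\<^sub>R f x) = (-1) ^ j *\<^sub>R (LINT x|lebesgue. \<eta> x *\<^sub>R D x vs)" .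
    qed
    moreover have "set_integrable lebesgue (W1 \<union> W2) (\<lambda>x. norm (D x vs) powr p)" if vs: "length vs = j" for vs
    proof -
      have "set_integrable lebesgue (W2 - W1) (\<lambda>x. norm (D2 x vs) powr p)"
        by (rule set_integrable_subset[OF D2(2)[OF vs] sets(3)]) auto
      then have "integrable lebesgue (\<lambda>x. indicator W1 x *\<^sub>R (norm (D1 x vs) powr p) + indicator (W2 - W1) x *\<^sub>R (norm (D2 x vs) powr p))"
        using D1(2)[OF vs] unfolding set_integrable_def by (intro Bochner_Integration.integrable_add)
      moreover have "(\<lambda>x. indicator W1 x *\<^sub>R (norm (D1 x vs) powr p) + indicator (W2 - W1) x *\<^sub>R (norm (D2 x vs) powr p)) = (\<lambda>x. indicator (W1 \<union> W2) x *\<^sub>R (norm (D x vs) powr p))"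
        by (auto simp: fun_eq_iff indicator_def D_def)
      ultimately show ?thesis by (simp add: set_integrable_def)
    qed
    ultimately show ?thesis by blast
  qed
  then show ?thesis using op cf by (auto simp: sobolev_region_def)
qed

lemma sobolev_region_UN:
  fixes f :: "'e::euclidean_space \<Rightarrow> 'f::euclidean_space"
  assumes "finite I" "\<And>i. i \<in> I \<Longrightarrow> sobolev_region k p (W i) f"
  shows "sobolev_region k p (\<Union>i\<in>I. W i) f"
  using assms
proof (induction I rule: finite_induct)
  case empty
  have z: "dir_deriv vs (\<lambda>_. 0 :: real) x = 0" for vs and x :: 'e
    using dir_deriv_eq_0_outside[of "{}" "\<lambda>_. 0 :: real"] by simp
  have "is_weak_derivative {} j f (\<lambda>x vs. 0)" for j
    unfolding is_weak_derivative_iff locally_integrable_on_def test_function_def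
    by (auto simp: set_integrable_def fun_eq_iff[symmetric] z)
  then show ?case by (auto simp: sobolev_region_def set_integrable_def)
next
  case (insert i I)
  then show ?case using sobolev_region_Un[of k p "W i" f "\<Union>i\<in>I. W i"] by simp
qed

lemma sobolev_on_region:
  assumes W: "sobolev_region k p W f" and K: "compact K" "K \<subseteq> W"
  shows "sobolev_on k p K f"
  unfolding sobolev_on_def
proof (intro conjI allI impI)
  show "continuous_on K f" using W K continuous_on_subset by (auto simp: sobolev_region_def)
  fix j assume j: "j \<le> k"
  obtain D where D: "is_weak_derivative W j f D" "\<And>vs. length vs = j \<Longrightarrow> set_integrable lebesgue W (\<lambda>x. norm (D x vs) powr p)"
    using W j unfolding sobolev_region_def by blast
  have "K \<in> sets lebesgue" using borel_compact[OF K(1)] by simp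
  then have "set_integrable lebesgue K (\<lambda>x. norm (D x vs) powr p)" if "length vs = j" for vs
    using set_integrable_subset[OF D(2)[OF that]] K(2) by blast
  then show "\<exists>G D. open G \<and> K \<subseteq> G \<and> is_weak_derivative G j f D \<and> (\<forall>vs. length vs = j \<longrightarrow> (\<lambda>x. norm (D x vs) powr p) absolutely_integrable_on K)"
    using D W K unfolding sobolev_region_def by blast
qed

lemma sobolev_on_locally:
  assumes K: "compact K" and loc: "\<And>x. x \<in> K \<Longrightarrow> \<exists>W. x \<in> W \<and> sobolev_region k p W f"
  shows "sobolev_on k p K f"
proof -
  obtain W where W: "\<And>x. x \<in> K \<Longrightarrow> x \<in> W x \<and> sobolev_region k p (W x) f" using loc by metis
  have "\<And>x. x \<in> K \<Longrightarrow> open (W x)" "K \<subseteq> (\<Union>x\<in>K. W x)" using W by (auto simp: sobolev_region_def)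
  then obtain I where I: "I \<subseteq> K" "finite I" "K \<subseteq> (\<Union>x\<in>I. W x)"
    using compactE_image[OF K, of K W] by metis
  then have "sobolev_region k p (\<Union>x\<in>I. W x) f" using W by (intro sobolev_region_UN) auto
  then show ?thesis using sobolev_on_region[OF _ K I(3)] by blast
qed

lemma sobolev_region_cong:
  assumes "sobolev_region k p W f" "\<And>x. x \<in> W \<Longrightarrow> f x = g x"
  shows "sobolev_region k p W g"
proof -
  have "continuous_on W g" using assms unfolding sobolev_region_def by (simp cong: continuous_on_cong)
  then show ?thesis using assms is_weak_derivative_cong[of W _ f _ g] unfolding sobolev_region_def by blast
qed

section \<open>Invariance under smooth changes of coordinates\<close>

text \<open>\<open>f\<close> is approximated near \<open>H x0\<close>, the approximations are
  composed with the two coordinate changes, and the limit is identified by uniform convergence. The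
  map \<open>Hi\<close>, inverse to \<open>H\<close> near the point, provides the expansion bound
  for the substitution.\<close>

lemma sobolev_region_compose:
  fixes f :: "'e::euclidean_space \<Rightarrow> 'f::euclidean_space" and H Hi :: "'e \<Rightarrow> 'e" and F :: "'f \<Rightarrow> 'g::euclidean_space"
  assumes p: "p > real DIM('e)" and k: "1 \<le> k" and f: "sobolev_on k p K f" and K: "compact K"
    and S: "open S" "x0 \<in> S" and H: "smooth_on S H" "H x0 \<in> interior K"
    and Hi: "open R" "smooth_on R Hi" "H x0 \<in> R" "\<And>x. x \<in> S \<Longrightarrow> H x \<in> R \<Longrightarrow> Hi (H x) = x"
    and F: "open T" "smooth_on T F" "f (H x0) \<in> T"
  obtains W where "x0 \<in> W" "W \<subseteq> S" "sobolev_region k p W (\<lambda>x. F (f (H x)))"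
proof -
  have p1: "p \<ge> 1" using p DIM_positive[where 'a='e] by linarith
  define y0 where "y0 = H x0"
  obtain \<rho> where \<rho>: "\<rho> > 0" "cball (f y0) \<rho> \<subseteq> T" using F open_contains_cball unfolding y0_def by blast
  obtain V u where V: "open V" "y0 \<in> V" "V \<subseteq> K" "Sob_seq k p V u" "uniform_limit V u f sequentially"
    "\<And>n. u n ` V \<subseteq> cball (f y0) \<rho>"
    using smooth_approximation[OF p f K H(2)[folded y0_def] \<rho>(1)] by blast
  have cf: "continuous_on V f" using f V(3) continuous_on_subset by (auto simp: sobolev_on_iff)
  have fV: "f y \<in> cball (f y0) \<rho>" if "y \<in> V" for y
  proof -
    have "(\<lambda>n. u n y) \<longlonglongrightarrow> f y" by (rule tendsto_uniform_limitI[OF V(5) that])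
    then show ?thesis using V(6) that by - (rule closed_sequentially[OF closed_cball]; blast)
  qed
  \<comment> \<open>Since \<open>k\<close> is positive, order 0 lies below the top order, and the
    functions themselves converge locally uniformly.\<close>
  have UCu: "UC_seq V u" using V(4) k by (cases k) auto
  have sob: "Sob_seq k p V (\<lambda>n x. F (u n x))"
    by (rule Sob_seq_compose_left[OF V(1) p1 F(1) \<rho>(2) compact_cball V(6) F(2) UCu V(4)])
  obtain r where r: "r > 0" "ball y0 r \<subseteq> V \<inter> R" using V(1,2) Hi(1,3) open_contains_ball[of "V \<inter> R"] unfolding y0_def by blast
  define m where "m = real DIM('e)"
  have m: "m \<ge> 1" unfolding m_def using DIM_positive[where 'a='e] by linarith
  \<comment> \<open>The cube around \<open>y0\<close> has side \<open>2 * s\<close>, so its points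
    are within \<open>2 * m * s = r / 2\<close> of the centre.\<close>
  define s where "s = r / (4 * m)"
  have s: "s > 0" using r m by (simp add: s_def)
  define a where "a = y0 - s *\<^sub>R One"
  define b where "b = y0 + s *\<^sub>R One"
  have ab: "b \<bullet> i - a \<bullet> i = 2 * s" if "i \<in> Basis" for i using that by (simp add: a_def b_def inner_diff_left inner_add_left)
  have y0box: "y0 \<in> box a b" using s by (auto simp: a_def b_def mem_box inner_diff_left inner_add_left)
  have Q: "cbox a b \<subseteq> V \<inter> R"
  proof
    fix y assume "y \<in> cbox a b"
    then have "dist y y0 \<le> m * (2 * s)" unfolding m_def using y0box box_subset_cbox ab by (intro dist_le_cube[of _ a b]) auto
    also have "\<dots> < r" using r m by (simp add: s_def)
    finally show "y \<in> V \<inter> R" using r by (auto simp: dist_commute)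
  qed
  obtain L where L: "L > 0" "\<And>x y. x \<in> cbox a b \<Longrightarrow> y \<in> cbox a b \<Longrightarrow> dist (Hi x) (Hi y) \<le> L * dist x y"
    using smooth_lipschitz[OF Hi(1,2), of a b] Q by blast
  define S' where "S' = S \<inter> H -` box a b"
  have cH: "continuous_on S H" by (rule smooth_on_continuous[OF H(1)])
  have oS': "open S'" unfolding S'_def by (rule continuous_open_preimage[OF cH S(1) open_box])
  have x0S': "x0 \<in> S'" using S(2) y0box by (simp add: S'_def y0_def)
  have HS': "H ` S' \<subseteq> cbox a b" using box_subset_cbox by (auto simp: S'_def)
  have sH: "smooth_on S' H" by (rule smooth_on_subset[OF H(1)]) (auto simp: S'_def)
  have bound: "dist x y \<le> L * dist (H x) (H y)" if "x \<in> S'" "y \<in> S'" for x y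
  proof -
    have "H x \<in> cbox a b" "H y \<in> cbox a b" using HS' that by auto
    moreover from this have "Hi (H x) = x" "Hi (H y) = y" using Hi(4) that Q by (auto simp: S'_def)
    ultimately show ?thesis using L(2)[of "H x" "H y"] by simp
  qed
  have HSV: "H ` S' \<subseteq> V" using HS' Q by blast
  have sob': "Sob_seq k p S' (\<lambda>n x. F (u n (H x)))"
  proof (rule Sob_seq_compose_right[OF V(1) oS' p1 sH HSV _ sob])
    fix w :: "nat \<Rightarrow> 'e \<Rightarrow> 'g" assume w: "Lp_seq p V w"
    show "Lp_seq p S' (\<lambda>n x. w n (H x))"
      by (rule Lp_seq_compose[OF w p1 smooth_on_continuous[OF sH] HS' _ _ ab L(1) bound]) (use Q y0box in auto)
  qed
  have cF: "continuous_on (cball (f y0) \<rho>) F" by (rule continuous_on_subset[OF smooth_on_continuous[OF F(2)] \<rho>(2)])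
  have cont: "continuous_on S' (\<lambda>x. F (f (H x)))"
    by (intro continuous_on_compose2[OF cF] continuous_on_compose2[OF cf] smooth_on_continuous[OF sH]) (use HSV fV in auto)
  have lim: "uniform_limit S' (\<lambda>n x. F (u n (H x))) (\<lambda>x. F (f (H x))) sequentially"
  proof (rule uniform_limitI)
    fix e :: real assume "e > 0"
    then obtain d where d: "d > 0" "\<And>y z. y \<in> cball (f y0) \<rho> \<Longrightarrow> z \<in> cball (f y0) \<rho> \<Longrightarrow> dist z y < d \<Longrightarrow> dist (F z) (F y) < e"
      using compact_uniformly_continuous[OF cF compact_cball] unfolding uniformly_continuous_on_def by metis
    have "\<forall>\<^sub>F n in sequentially. \<forall>y\<in>V. dist (u n y) (f y) < d" using V(5) d(1) by (simp add: uniform_limit_iff)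
    then show "\<forall>\<^sub>F n in sequentially. \<forall>x\<in>S'. dist (F (u n (H x))) (F (f (H x))) < e"
    proof eventually_elim
      case (elim n)
      show ?case
      proof
        fix x assume "x \<in> S'"
        then have "H x \<in> V" using HSV by blast
        then show "dist (F (u n (H x))) (F (f (H x))) < e" using elim V(6)[of n] fV by (intro d(2)) auto
      qed
    qed
  qed
  obtain W where "x0 \<in> W" "W \<subseteq> S'" "sobolev_region k p W (\<lambda>x. F (f (H x)))"
    using sobolev_region_of_seq[OF oS' p1 sob' cont lim x0S'] by blast
  then show thesis using that[of W] by (auto simp: S'_def)
qed

section \<open>Charts\<close>

lemma is_chartD:
  assumes "is_chart X c"
  shows "openin X (fst c)" "open (snd c ` fst c)" "inj_on (snd c) (fst c)"
    "homeomorphic_map (subtopology X (fst c)) (top_of_set (snd c ` fst c)) (snd c)"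
    "continuous_map (top_of_set (snd c ` fst c)) (subtopology X (fst c)) (inv_into (fst c) (snd c))"
proof -
  obtain U \<phi> where c: "c = (U, \<phi>)" by (cases c)
  have 1: "openin X U" "open (\<phi> ` U)" and h: "homeomorphic_map (subtopology X U) (top_of_set (\<phi> ` U)) \<phi>"
    using assms by (auto simp: is_chart_def c)
  have top: "topspace (subtopology X U) = U" using openin_subset[OF 1(1)] by auto
  have inj: "inj_on \<phi> U" using homeomorphic_imp_injective_map[OF h] top by simp
  obtain g where g: "homeomorphic_maps (subtopology X U) (top_of_set (\<phi> ` U)) \<phi> g"
    using h homeomorphic_map_maps by blast
  have "continuous_map (top_of_set (\<phi> ` U)) (subtopology X U) (inv_into U \<phi>)"
  proof (rule continuous_map_eq)
    show "continuous_map (top_of_set (\<phi> ` U)) (subtopology X U) g"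
      using g by (simp add: homeomorphic_maps_def)
    fix y assume "y \<in> topspace (top_of_set (\<phi> ` U))"
    then obtain x where "x \<in> U" "y = \<phi> x" by auto
    then show "g y = inv_into U \<phi> y" using g top inj by (simp add: homeomorphic_maps_def)
  qed
  with 1 h inj show "openin X (fst c)" "open (snd c ` fst c)" "inj_on (snd c) (fst c)"
    "homeomorphic_map (subtopology X (fst c)) (top_of_set (snd c ` fst c)) (snd c)"
    "continuous_map (top_of_set (snd c ` fst c)) (subtopology X (fst c)) (inv_into (fst c) (snd c))"
    by (auto simp: c)
qed

lemma chart_continuous:
  assumes "is_chart X c" "W \<subseteq> fst c"
  shows "continuous_map (subtopology X W) euclidean (snd c)"
proof -
  have "continuous_map (subtopology X (fst c)) euclidean (snd c)"
    using homeomorphic_imp_continuous_map[OF is_chartD(4)[OF assms(1)]] continuous_map_into_fulltopology by blast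
  then show ?thesis by (rule continuous_map_from_subtopology_mono[OF _ assms(2)])
qed

lemma chart_inverse_continuous:
  assumes "is_chart X c" "W \<subseteq> snd c ` fst c"
  shows "continuous_map (top_of_set W) X (inv_into (fst c) (snd c))"
  using continuous_map_from_subtopology_mono[OF is_chartD(5)[OF assms(1)] assms(2)] continuous_map_into_fulltopology by blast

lemma chart_open_image:
  assumes c: "is_chart X c" and W: "openin X W" "W \<subseteq> fst c"
  shows "open (snd c ` W)"
proof -
  have "openin (subtopology X (fst c)) W" using W by (metis inf.absorb1 openin_subtopology)
  then have "openin (top_of_set (snd c ` fst c)) (snd c ` W)"
    using homeomorphic_imp_open_map[OF is_chartD(4)[OF c]] by (auto simp: open_map_def)
  then show ?thesis using is_chartD(2)[OF c] openin_open_eq by blast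
qed

lemma chart_compact_image:
  assumes c: "is_chart X c" and K: "compactin X K" "K \<subseteq> fst c"
  shows "compact (snd c ` K)"
proof -
  have "compactin (subtopology X (fst c)) K" using K by (simp add: compactin_subtopology)
  from image_compactin[OF this chart_continuous[OF c order_refl]] show ?thesis by simp
qed

text \<open>Local compactness of Euclidean space, transported by the chart. The open set
  \<open>W\<close> leaves room for a further constraint, such as being mapped into a given target
  chart.\<close>

lemma chart_compact_neighbourhood:
  assumes c: "is_chart X c" and K: "compactin X K" "K \<subseteq> W" and W: "openin X W" "W \<subseteq> fst c"
  obtains L where "compactin X L" "L \<subseteq> W" "K \<subseteq> X interior_of L"
proof -
  let ?\<phi> = "snd c" and ?i = "inv_into (fst c) (snd c)"
  have inj: "inj_on ?\<phi> (fst c)" by (rule is_chartD(3)[OF c])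
  have cK: "compact (?\<phi> ` K)" by (rule chart_compact_image[OF c K(1)]) (use K W in blast)
  obtain e L where L: "e > 0" "compact L" "L \<subseteq> ?\<phi> ` W" "\<And>x. x \<in> ?\<phi> ` K \<Longrightarrow> cball x e \<subseteq> L"
    using compact_neighbourhood[OF cK chart_open_image[OF c W] image_mono[OF K(2)]] by blast
  have LU: "L \<subseteq> ?\<phi> ` fst c" using L(3) W(2) by blast
  have iW: "?i y \<in> W" "?\<phi> (?i y) = y" if "y \<in> L" for y
  proof -
    obtain x where "x \<in> W" "y = ?\<phi> x" using L(3) \<open>y \<in> L\<close> by blast
    then show "?i y \<in> W" "?\<phi> (?i y) = y" using inj W(2) by (auto simp: inv_into_f_f subset_iff)
  qed
  have "compactin (top_of_set L) L" using L(2) by (simp add: compactin_subtopology)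
  then have "compactin X (?i ` L)" by (rule image_compactin[OF _ chart_inverse_continuous[OF c LU]])
  moreover have "?i ` L \<subseteq> W" using iW by blast
  moreover have "K \<subseteq> X interior_of (?i ` L)"
  proof
    fix x assume x: "x \<in> K"
    let ?B = "{z \<in> topspace (subtopology X (fst c)). ?\<phi> z \<in> ball (?\<phi> x) e}"
    have "openin (subtopology X (fst c)) ?B"
      by (rule openin_continuous_map_preimage[OF chart_continuous[OF c order_refl]]) simp
    then have "openin X ?B" by (rule openin_trans_full[OF _ is_chartD(1)[OF c]])
    moreover have "x \<in> ?B" using x K W L(1) compactin_subset_topspace[OF K(1)] by auto
    moreover have "?B \<subseteq> ?i ` L"
    proof
      fix z assume z: "z \<in> ?B"
      then have "?\<phi> z \<in> L" using L(4)[of "?\<phi> x"] x by auto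
      moreover have "?i (?\<phi> z) = z" using z inj by simp
      ultimately show "z \<in> ?i ` L" by (metis imageI)
    qed
    ultimately show "x \<in> X interior_of (?i ` L)" unfolding interior_of_def by blast
  qed
  ultimately show thesis by (rule that)
qed

lemma chart_interior:
  assumes c: "is_chart X c" and L: "L \<subseteq> fst c" "K \<subseteq> X interior_of L"
  shows "snd c ` K \<subseteq> interior (snd c ` L)"
proof -
  have "open (snd c ` (X interior_of L))"
    by (rule chart_open_image[OF c openin_interior_of]) (use L interior_of_subset[of X L] in blast)
  then have "snd c ` (X interior_of L) \<subseteq> interior (snd c ` L)"
    by (intro interior_maximal image_mono interior_of_subset)
  then show ?thesis using L(2) by blast
qed

lemma local_rep_chart:
  assumes "is_chart X c" "x \<in> fst c"
  shows "local_rep c c' f (snd c x) = snd c' (f x)"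
  using inv_into_f_f[OF is_chartD(3)[OF assms(1)] assms(2)] by (simp add: local_rep_def)

lemma continuous_map_local_rep:
  assumes c: "is_chart X c" "is_chart Y c'" and W: "W \<subseteq> fst c" "f ` W \<subseteq> fst c'"
    and f: "continuous_on (snd c ` W) (local_rep c c' f)"
  shows "continuous_map (subtopology X W) Y f"
proof (rule continuous_map_eq)
  let ?j = "inv_into (fst c') (snd c')"
  have img: "local_rep c c' f ` (snd c ` W) \<subseteq> snd c' ` fst c'"
  proof safe
    fix x assume x: "x \<in> W"
    then have "local_rep c c' f (snd c x) = snd c' (f x)" by (intro local_rep_chart[OF c(1)]) (use W in blast)
    then show "local_rep c c' f (snd c x) \<in> snd c' ` fst c'" using W x by auto
  qed
  have 1: "continuous_map (subtopology X W) (top_of_set (snd c ` W)) (snd c)"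
    unfolding continuous_map_in_subtopology using chart_continuous[OF c(1) W(1)] by auto
  have 2: "continuous_map (top_of_set (snd c ` W)) (top_of_set (snd c' ` fst c')) (local_rep c c' f)"
    using f img by (auto simp: continuous_map_in_subtopology)
  show "continuous_map (subtopology X W) Y (?j \<circ> (local_rep c c' f \<circ> snd c))"
    by (rule continuous_map_compose[OF continuous_map_compose[OF 1 2] chart_inverse_continuous[OF c(2) order_refl]])
  fix x assume "x \<in> topspace (subtopology X W)"
  then have "x \<in> fst c" "f x \<in> fst c'" using W by auto
  then show "(?j \<circ> (local_rep c c' f \<circ> snd c)) x = f x"
    using local_rep_chart[OF c(1), of x c' f] inv_into_f_f[OF is_chartD(3)[OF c(2)], of "f x"] by simp
qed

lemma smooth_atlas_cover:
  assumes "smooth_atlas X \<A>" "x \<in> topspace X"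
  obtains c where "c \<in> \<A>" "x \<in> fst c"
  using assms unfolding smooth_atlas_def by (metis (no_types, lifting) UN_E)

lemma compatible_smooth:
  assumes "smooth_atlas X \<A>" "c \<in> \<A>" "c' \<in> \<A>"
  shows "smooth_on (snd c ` (fst c \<inter> fst c')) (snd c' \<circ> inv_into (fst c) (snd c))"
  using assms unfolding smooth_atlas_def compatible_charts_def by (fastforce simp: split_beta)

text \<open>Open sets contained in compact sets cover the manifold by means of charts, and a second
  countable space has the Lindelof property.\<close>

lemma countable_compact_cover:
  assumes X: "second_countable X" "smooth_atlas X \<A>"
  shows "\<exists>L :: nat \<Rightarrow> 'a set. (\<forall>n. compactin X (L n)) \<and> (\<forall>x\<in>topspace X. \<exists>n. x \<in> L n)"
proof -
  define \<U> where "\<U> = {W. openin X W \<and> (\<exists>L. compactin X L \<and> W \<subseteq> L)}"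
  have "topspace X \<subseteq> \<Union>\<U>"
  proof
    fix x assume x: "x \<in> topspace X"
    obtain c where c: "c \<in> \<A>" "x \<in> fst c" using smooth_atlas_cover[OF X(2) x] by blast
    have ch: "is_chart X c" using X(2) c by (auto simp: smooth_atlas_def)
    have "compactin X {x}" using x by simp
    then obtain L where "compactin X L" "{x} \<subseteq> X interior_of L"
      using chart_compact_neighbourhood[OF ch _ _ is_chartD(1)[OF ch] order_refl, of "{x}"] c(2) by auto
    then have "X interior_of L \<in> \<U>" using interior_of_subset[of X L] openin_interior_of[of X L] unfolding \<U>_def by blast
    then show "x \<in> \<Union>\<U>" using \<open>{x} \<subseteq> X interior_of L\<close> by blast
  qed
  moreover have "\<forall>U\<in>\<U>. openin X U" by (simp add: \<U>_def)
  ultimately obtain \<V> where V: "countable \<V>" "\<V> \<subseteq> \<U>" "topspace X \<subseteq> \<Union>\<V>"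
    using second_countable_imp_Lindelof_space[OF X(1)] unfolding Lindelof_space_alt by meson
  have "\<forall>W\<in>insert {} \<V>. \<exists>L. compactin X L \<and> W \<subseteq> L" using V(2) by (auto simp: \<U>_def)
  then obtain L where L: "\<And>W. W \<in> insert {} \<V> \<Longrightarrow> compactin X (L W) \<and> W \<subseteq> L W" by metis
  \<comment> \<open>The empty set is inserted because an enumeration by naturals requires a nonempty
    family; the manifold may be empty.\<close>
  define e where "e = from_nat_into (insert {} \<V>)"
  have r: "range e = insert {} \<V>" unfolding e_def using V(1) by (intro range_from_nat_into) auto
  show ?thesis
  proof (intro exI[of _ "\<lambda>n. L (e n)"] conjI allI ballI)
    show "compactin X (L (e n))" for n using L r by (metis rangeI)
    fix x assume x: "x \<in> topspace X"
    show "\<exists>n. x \<in> L (e n)"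
    proof -
      obtain W where W: "W \<in> \<V>" "x \<in> W" using V(3) x by blast
      then obtain n where "W = e n" using r by (metis insertCI rangeE)
      then show ?thesis using L[of W] W by blast
    qed
  qed
qed

section \<open>Neighbourhoods in the Sobolev-Whitney topologies\<close>

locale sobolev_whitney =
  fixes k :: nat and p :: real
    and X :: "'a topology" and \<A> :: "('a, 'e::euclidean_space) chart set"
    and Y :: "'b topology" and \<B> :: "('b, 'f::euclidean_space) chart set"
  assumes X: "smooth_manifold X \<A>" and Y: "smooth_manifold Y \<B>"
    and k1: "1 \<le> k" and p1: "1 \<le> p" and pm: "real DIM('e) < p"
begin

abbreviation maps where "maps \<equiv> sobolev_maps k p X \<A> Y \<B>"
abbreviation nbhd where "nbhd \<equiv> weak_nbhd k p X \<A> Y \<B>"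
abbreviation nbhds where "nbhds \<equiv> strong_nbhd k p X \<A> Y \<B>"
abbreviation adm where "adm \<equiv> admissible_datum X \<A> \<B>"

definition gap :: "('a, 'e) chart \<Rightarrow> ('b, 'f) chart \<Rightarrow> 'a set \<Rightarrow> ('a \<Rightarrow> 'b) \<Rightarrow> ('a \<Rightarrow> 'b) \<Rightarrow> real" where
  "gap c c' K f g = sobolev_norm k p (snd c ` K) (\<lambda>y. local_rep c c' f y - local_rep c c' g y)"

lemma atlas: "smooth_atlas X \<A>" "smooth_atlas Y \<B>"
  using X Y by (auto simp: smooth_manifold_def)

lemma chart: "c \<in> \<A> \<Longrightarrow> is_chart X c" "c' \<in> \<B> \<Longrightarrow> is_chart Y c'"
  using atlas by (auto simp: smooth_atlas_def)

lemma mem_nbhd: "g \<in> nbhd f (c, c', K, \<epsilon>) \<longleftrightarrow> g \<in> maps \<and> g ` K \<subseteq> fst c' \<and> ereal (gap c c' K f g) < \<epsilon>"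
  by (simp add: weak_nbhd_def gap_def)

lemma mem_nbhds: "g \<in> nbhds f T \<longleftrightarrow> g \<in> maps \<and> (\<forall>t\<in>T. g \<in> nbhd f t)"
  by (simp add: strong_nbhd_def)

lemma adm_iff: "adm f (c, c', K, \<epsilon>) \<longleftrightarrow> c \<in> \<A> \<and> c' \<in> \<B> \<and> compactin X K \<and> K \<subseteq> fst c \<and> f ` K \<subseteq> fst c' \<and> 0 < \<epsilon>"
  by (simp add: admissible_datum_def)

lemma maps_sobolev:
  assumes "f \<in> maps" "c \<in> \<A>" "c' \<in> \<B>" "compactin X K" "K \<subseteq> fst c" "f ` K \<subseteq> fst c'"
  shows "sobolev_on k p (snd c ` K) (local_rep c c' f)"
  using assms unfolding sobolev_maps_def by blast

lemma nbhd_refl: "f \<in> maps \<Longrightarrow> adm f t \<Longrightarrow> f \<in> nbhd f t"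
proof -
  assume f: "f \<in> maps" and a: "adm f t"
  obtain c c' K \<epsilon> where t: "t = (c, c', K, \<epsilon>)" by (cases t)
  have "compact (snd c ` K)" using a chart_compact_image chart unfolding t adm_iff by blast
  then have "gap c c' K f f = 0" unfolding gap_def using sobolev_norm_0[OF _ p1] by simp
  then show ?thesis using a f unfolding t adm_iff mem_nbhd by (simp add: zero_ereal_def)
qed

text \<open>The usual argument that balls are open: the tolerance is reduced by the distance to the
  new centre. An infinite tolerance stays infinite.\<close>

fun recenter :: "('a \<Rightarrow> 'b) \<Rightarrow> ('a \<Rightarrow> 'b) \<Rightarrow> ('a, 'e, 'b, 'f) nbhd_datum \<Rightarrow> ('a, 'e, 'b, 'f) nbhd_datum" where
  "recenter f g (c, c', K, \<epsilon>) = (c, c', K, \<epsilon> - ereal (gap c c' K f g))"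

lemma recenter:
  assumes f: "f \<in> maps" and a: "adm f t" and g: "g \<in> nbhd f t"
  shows "adm g (recenter f g t)" "nbhd g (recenter f g t) \<subseteq> nbhd f t"
proof -
  obtain c c' K \<epsilon> where t: "t = (c, c', K, \<epsilon>)" by (cases t)
  have g': "g \<in> maps" "g ` K \<subseteq> fst c'" "ereal (gap c c' K f g) < \<epsilon>" using g by (auto simp: t mem_nbhd)
  have a': "c \<in> \<A>" "c' \<in> \<B>" "compactin X K" "K \<subseteq> fst c" "f ` K \<subseteq> fst c'" using a by (auto simp: t adm_iff)
  have cK: "compact (snd c ` K)" by (rule chart_compact_image[OF chart(1)[OF a'(1)] a'(3,4)])
  show "adm g (recenter f g t)" using g' a' by (auto simp: t adm_iff ereal_diff_gr0)
  show "nbhd g (recenter f g t) \<subseteq> nbhd f t"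
  proof
    fix h assume "h \<in> nbhd g (recenter f g t)"
    then have h: "h \<in> maps" "h ` K \<subseteq> fst c'" "ereal (gap c c' K g h) < \<epsilon> - ereal (gap c c' K f g)"
      by (auto simp: t mem_nbhd)
    have "gap c c' K f h \<le> gap c c' K f g + gap c c' K g h"
      unfolding gap_def
      by (rule sobolev_norm_triangle[OF maps_sobolev[OF f a'] maps_sobolev[OF g'(1) a'(1-4) g'(2)] maps_sobolev[OF h(1) a'(1-4) h(2)] cK p1])
    then have "ereal (gap c c' K f h) < \<epsilon>" using h(3) by (cases \<epsilon>) auto
    then show "h \<in> nbhd f t" using h by (simp add: t mem_nbhd)
  qed
qed

lemma nbhds_recenter:
  assumes f: "f \<in> maps" and a: "\<forall>t\<in>T. adm f t" and g: "g \<in> nbhds f T"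
  shows "\<forall>t\<in>recenter f g ` T. adm g t" "nbhds g (recenter f g ` T) \<subseteq> nbhds f T"
  using recenter[OF f] a g unfolding mem_nbhds by (blast, fastforce simp: mem_nbhds subset_iff)

lemma nbhds_refl: "f \<in> maps \<Longrightarrow> \<forall>t\<in>T. adm f t \<Longrightarrow> f \<in> nbhds f T"
  by (simp add: mem_nbhds nbhd_refl)

lemma fst_recenter: "fst (recenter f g t) = fst t"
  by (cases t) simp

text \<open>What finite and locally finite sets of data have in common. The last clause lets target
  charts, compact sets and tolerances vary, because local finiteness only concerns the domains of
  the charts on the source.\<close>

definition good_family :: "(('a, 'e, 'b, 'f) nbhd_datum set \<Rightarrow> bool) \<Rightarrow> bool" where
  "good_family P \<longleftrightarrow> (\<forall>T. finite T \<longrightarrow> P T) \<and> (\<forall>T T'. P T \<longrightarrow> P T' \<longrightarrow> P (T \<union> T')) \<and>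
     (\<forall>T h. P T \<longrightarrow> (\<forall>t\<in>T. fst (h t) = fst t) \<longrightarrow> P (h ` T))"

text \<open>A common description of the open sets: \<open>P\<close> is finiteness for the weak
  topology and local finiteness for the strong one.\<close>

definition nbhd_open :: "(('a, 'e, 'b, 'f) nbhd_datum set \<Rightarrow> bool) \<Rightarrow> ('a \<Rightarrow> 'b) set \<Rightarrow> bool" where
  "nbhd_open P U \<longleftrightarrow> U \<subseteq> maps \<and> (\<forall>f\<in>U. \<exists>T. P T \<and> (\<forall>t\<in>T. adm f t) \<and> nbhds f T \<subseteq> U)"

lemma good_finite: "good_family finite"
  by (auto simp: good_family_def)

section \<open>Open sets of the weak and strong topologies\<close>

lemma good_locally_finite: "good_family (locally_finite_data X)"
  unfolding good_family_def
proof (intro conjI allI impI)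
  fix T :: "('a, 'e, 'b, 'f) nbhd_datum set"
  show "locally_finite_data X T" if "finite T"
    unfolding locally_finite_data_def using that openin_topspace[of X] by (metis (no_types, lifting) finite_Collect_conjI finite_subset mem_Collect_eq subsetI)
  show "locally_finite_data X (T \<union> T')" if T: "locally_finite_data X T" and T': "locally_finite_data X T'" for T'
    unfolding locally_finite_data_def
  proof
    fix x assume x: "x \<in> topspace X"
    obtain W where W: "openin X W" "x \<in> W" "finite {t \<in> T. fst (fst t) \<inter> W \<noteq> {}}" using T x unfolding locally_finite_data_def by blast
    obtain W' where W': "openin X W'" "x \<in> W'" "finite {t \<in> T'. fst (fst t) \<inter> W' \<noteq> {}}" using T' x unfolding locally_finite_data_def by blast
    have "finite {t \<in> T \<union> T'. fst (fst t) \<inter> (W \<inter> W') \<noteq> {}}"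
      by (rule finite_subset[OF _ finite_UnI[OF W(3) W'(3)]]) auto
    then show "\<exists>W. openin X W \<and> x \<in> W \<and> finite {t \<in> T \<union> T'. fst (fst t) \<inter> W \<noteq> {}}"
      using W W' by (intro exI[of _ "W \<inter> W'"]) auto
  qed
  show "locally_finite_data X (h ` T)" if T: "locally_finite_data X T" and h: "\<forall>t\<in>T. fst (h t) = fst t" for h
    unfolding locally_finite_data_def
  proof
    fix x assume x: "x \<in> topspace X"
    obtain W where W: "openin X W" "x \<in> W" "finite {t \<in> T. fst (fst t) \<inter> W \<noteq> {}}" using T x unfolding locally_finite_data_def by blast
    have "{t \<in> h ` T. fst (fst t) \<inter> W \<noteq> {}} \<subseteq> h ` {t \<in> T. fst (fst t) \<inter> W \<noteq> {}}"
    proof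
      fix s assume s: "s \<in> {t \<in> h ` T. fst (fst t) \<inter> W \<noteq> {}}"
      then obtain t where t: "t \<in> T" "s = h t" by blast
      then have "fst s = fst t" using h by blast
      then have "fst (fst t) \<inter> W \<noteq> {}" using s by simp
      then show "s \<in> h ` {t \<in> T. fst (fst t) \<inter> W \<noteq> {}}" using t by blast
    qed
    then have "finite {t \<in> h ` T. fst (fst t) \<inter> W \<noteq> {}}" by (rule finite_subset[OF _ finite_imageI[OF W(3)]])
    then show "\<exists>W. openin X W \<and> x \<in> W \<and> finite {t \<in> h ` T. fst (fst t) \<inter> W \<noteq> {}}"
      using W by blast
  qed
qed

lemma nbhd_open_Int:
  assumes P: "good_family P" and U: "nbhd_open P U" "nbhd_open P V"
  shows "nbhd_open P (U \<inter> V)"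
  unfolding nbhd_open_def
proof (intro conjI ballI)
  show "U \<inter> V \<subseteq> maps" using U by (auto simp: nbhd_open_def)
  fix f assume f: "f \<in> U \<inter> V"
  obtain T where T: "P T" "\<forall>t\<in>T. adm f t" "nbhds f T \<subseteq> U" using U(1) f unfolding nbhd_open_def by blast
  obtain T' where T': "P T'" "\<forall>t\<in>T'. adm f t" "nbhds f T' \<subseteq> V" using U(2) f unfolding nbhd_open_def by blast
  have "P (T \<union> T')" using P T(1) T'(1) unfolding good_family_def by blast
  moreover have "nbhds f (T \<union> T') \<subseteq> U \<inter> V" using T(3) T'(3) by (auto simp: mem_nbhds subset_iff)
  ultimately show "\<exists>T. P T \<and> (\<forall>t\<in>T. adm f t) \<and> nbhds f T \<subseteq> U \<inter> V" using T(2) T'(2) by blast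
qed

lemma nbhd_open_Union: "(\<And>U. U \<in> \<U> \<Longrightarrow> nbhd_open P U) \<Longrightarrow> nbhd_open P (\<Union>\<U>)"
  unfolding nbhd_open_def by (meson Union_least Union_upper UnionE order_trans)

lemma nbhd_open_nbhds:
  assumes P: "good_family P" and f: "f \<in> maps" and T: "P T" "\<forall>t\<in>T. adm f t"
  shows "nbhd_open P (nbhds f T)"
  unfolding nbhd_open_def
proof (intro conjI ballI)
  show "nbhds f T \<subseteq> maps" by (auto simp: mem_nbhds)
  fix g assume g: "g \<in> nbhds f T"
  have "P (recenter f g ` T)" using P T(1) fst_recenter[of f g] unfolding good_family_def by simp
  then show "\<exists>T'. P T' \<and> (\<forall>t\<in>T'. adm g t) \<and> nbhds g T' \<subseteq> nbhds f T"
    using nbhds_recenter[OF f T(2) g] by blast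
qed

text \<open>Recentring turns a union of basic sets into a set containing a basic set centred at each
  of its points. In this form closure under intersections is evident, so the predicate handed to
  \<open>topology\<close> is indeed a topology.\<close>

lemma openin_strong: "openin (strong_sobolev_whitney k p X \<A> Y \<B>) U \<longleftrightarrow> nbhd_open (locally_finite_data X) U"
proof -
  let ?P = "locally_finite_data X :: ('a, 'e, 'b, 'f) nbhd_datum set \<Rightarrow> bool"
  let ?B = "{nbhds f T | f T. f \<in> maps \<and> ?P T \<and> (\<forall>t\<in>T. adm f t)}"
  have eq: "(arbitrary union_of (\<lambda>B. B \<in> ?B)) = nbhd_open ?P"
  proof (intro ext iffI)
    fix U assume "(arbitrary union_of (\<lambda>B. B \<in> ?B)) U"
    then obtain \<U> where U: "\<U> \<subseteq> ?B" "U = \<Union>\<U>" unfolding union_of_def by auto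
    have "nbhd_open ?P V" if "V \<in> \<U>" for V
      using U(1) that nbhd_open_nbhds[OF good_locally_finite] by blast
    then show "nbhd_open ?P U" unfolding U(2) by (rule nbhd_open_Union)
  next
    fix U assume U: "nbhd_open ?P U"
    let ?\<U> = "{V \<in> ?B. V \<subseteq> U}"
    have "U \<subseteq> \<Union>?\<U>"
    proof
      fix f assume f: "f \<in> U"
      then obtain T where T: "?P T" "\<forall>t\<in>T. adm f t" "nbhds f T \<subseteq> U" using U unfolding nbhd_open_def by blast
      have fm: "f \<in> maps" using U f by (auto simp: nbhd_open_def)
      show "f \<in> \<Union>?\<U>" using T fm nbhds_refl[OF fm T(2)] by blast
    qed
    then have "\<Union>?\<U> = U" by blast
    moreover have "?\<U> \<subseteq> Collect (\<lambda>B. B \<in> ?B)" by blast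
    ultimately show "(arbitrary union_of (\<lambda>B. B \<in> ?B)) U" unfolding union_of_def arbitrary_def by blast
  qed
  have "istopology (nbhd_open ?P)"
    unfolding istopology_def using nbhd_open_Int[OF good_locally_finite] nbhd_open_Union by blast
  then show ?thesis unfolding strong_sobolev_whitney_def eq by (simp add: topology_inverse')
qed

text \<open>Finite sets of data are finite intersections of sub-basic sets, the empty one standing
  for the whole space; recentring at an arbitrary point gives the other direction.\<close>

lemma openin_weak: "openin (weak_sobolev_whitney k p X \<A> Y \<B>) U \<longleftrightarrow> nbhd_open finite U"
proof
  let ?S = "insert maps {nbhd f t | f t. f \<in> maps \<and> adm f t}"
  assume "openin (weak_sobolev_whitney k p X \<A> Y \<B>) U"
  then have "generate_topology_on ?S U"
    unfolding weak_sobolev_whitney_def openin_topology_generated_by_iff .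
  then show "nbhd_open finite U"
  proof induction
    case Empty
    show ?case by (simp add: nbhd_open_def)
  next
    case (Int a b)
    show ?case by (rule nbhd_open_Int[OF good_finite Int.IH])
  next
    case (UN K)
    show ?case by (rule nbhd_open_Union[OF UN.IH])
  next
    case (Basis s)
    then consider "s = maps" | f t where "s = nbhd f t" "f \<in> maps" "adm f t" by blast
    then show ?case
    proof cases
      case 1
      have "nbhds f {} \<subseteq> maps" for f by (auto simp: mem_nbhds)
      then show ?thesis unfolding 1 nbhd_open_def by (intro conjI ballI exI[of _ "{}"]) auto
    next
      case 2
      have "nbhds f {t} = nbhd f t" by (cases t) (auto simp: mem_nbhds mem_nbhd)
      then show ?thesis using nbhd_open_nbhds[OF good_finite 2(2), of "{t}"] 2 by simp
    qed
  qed
next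
  let ?Z = "weak_sobolev_whitney k p X \<A> Y \<B>"
  assume U: "nbhd_open finite U"
  have om: "openin ?Z maps" unfolding weak_sobolev_whitney_def by (rule topology_generated_by_Basis) simp
  have on: "openin ?Z (nbhd f t)" if "f \<in> maps" "adm f t" for f t
    unfolding weak_sobolev_whitney_def by (rule topology_generated_by_Basis) (use that in blast)
  have os: "openin ?Z (nbhds f T)" if "finite T" "f \<in> maps" "\<forall>t\<in>T. adm f t" for f T
    using that(1,3)
  proof (induction T rule: finite_induct)
    case empty
    have "nbhds f {} = maps" by (auto simp: mem_nbhds)
    then show ?case using om by simp
  next
    case (insert t T)
    have "nbhds f (insert t T) = nbhd f t \<inter> nbhds f T" by (auto simp: mem_nbhds)
    moreover have "openin ?Z (nbhd f t)" by (rule on[OF that(2)]) (use insert.prems in blast)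
    moreover have "openin ?Z (nbhds f T)" by (rule insert.IH) (use insert.prems in blast)
    ultimately show ?case by (simp add: openin_Int)
  qed
  show "openin ?Z U"
  proof (subst openin_subopen, intro ballI)
    fix f assume f: "f \<in> U"
    then obtain T where T: "finite T" "\<forall>t\<in>T. adm f t" "nbhds f T \<subseteq> U" using U unfolding nbhd_open_def by blast
    have fm: "f \<in> maps" using U f by (auto simp: nbhd_open_def)
    show "\<exists>V. openin ?Z V \<and> f \<in> V \<and> V \<subseteq> U" using os[OF T(1) fm T(2)] nbhds_refl[OF fm T(2)] T(3) by blast
  qed
qed

section \<open>The Baire property\<close>

text \<open>A datum in \<open>D\<close> on a slightly larger compact set controls \<open>t\<close>: if the successive gaps on the
  larger set are at most \<open>b, b/2, b/4, \<dots>\<close>, then the limit still maps into the chart and stays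
  within \<open>4 b\<close> of \<open>f\<close>.\<close>

fun controls :: "('a \<Rightarrow> 'b) \<Rightarrow> ('a, 'e, 'b, 'f) nbhd_datum set \<Rightarrow> ('a, 'e, 'b, 'f) nbhd_datum \<Rightarrow> bool" where
  "controls f D (c, c', K, \<epsilon>) \<longleftrightarrow> (\<exists>L b. (c, c', L, ereal b) \<in> D \<and> 0 < b \<and> ereal (4 * b) < \<epsilon> \<and>
     K \<subseteq> X interior_of L \<and> (\<forall>x\<in>L. cball (snd c' (f x)) (2 * b) \<subseteq> snd c' ` fst c'))"

lemma controls_mono: "controls f D t \<Longrightarrow> D \<subseteq> D' \<Longrightarrow> controls f D' t"
  by (cases t) auto

text \<open>Inside the chart domain, the points that \<open>f\<close> sends into the target chart
  form an open set, which leaves room for a larger compact \<open>L\<close>. Its image in the target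
  chart is compact, hence has a margin inside the open chart image.\<close>

lemma control_datum:
  assumes f: "f \<in> maps" and t: "adm f t"
  shows "\<exists>s. fst s = fst t \<and> adm f s \<and> controls f {s} t"
proof -
  obtain c c' K \<epsilon> where tt: "t = (c, c', K, \<epsilon>)" by (cases t)
  have a: "c \<in> \<A>" "c' \<in> \<B>" "compactin X K" "K \<subseteq> fst c" "f ` K \<subseteq> fst c'" "0 < \<epsilon>" using t by (auto simp: tt adm_iff)
  have ch: "is_chart X c" "is_chart Y c'" using a chart by auto
  have cf: "continuous_map X Y f" using f by (simp add: sobolev_maps_def)
  define W where "W = fst c \<inter> {x \<in> topspace X. f x \<in> fst c'}"
  have W: "openin X W" unfolding W_def
    by (intro openin_Int is_chartD(1)[OF ch(1)] openin_continuous_map_preimage[OF cf is_chartD(1)[OF ch(2)]])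
  have KW: "K \<subseteq> W" using a compactin_subset_topspace[OF a(3)] by (auto simp: W_def)
  have Wc: "W \<subseteq> fst c" by (simp add: W_def)
  obtain L where L: "compactin X L" "L \<subseteq> W" "K \<subseteq> X interior_of L"
    using chart_compact_neighbourhood[OF ch(1) a(3) KW W Wc] by blast
  have L': "L \<subseteq> fst c" "f ` L \<subseteq> fst c'" using L(2) by (auto simp: W_def)
  have "compactin Y (f ` L)" by (rule image_compactin[OF L(1) cf])
  then have cp: "compact (snd c' ` f ` L)" by (rule chart_compact_image[OF ch(2) _ L'(2)])
  obtain e where e: "e > 0" "(\<Union>y\<in>snd c' ` f ` L. cball y e) \<subseteq> snd c' ` fst c'"
    using compact_subset_open_imp_cball_epsilon_subset[OF cp is_chartD(2)[OF ch(2)] image_mono[OF L'(2)]] by blast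
  \<comment> \<open>A real number below the tolerance, also if that is infinite. Then
    \<open>b\<close> is small enough for \<open>2 * b\<close> to fit into the margin
    \<open>e\<close> and for \<open>4 * b\<close> to stay within \<open>r\<close>.\<close>
  obtain r where r: "0 < ereal r" "ereal r < \<epsilon>" using ereal_dense2[OF a(6)] by blast
  define b where "b = min (e / 2) (r / 4)"
  have b: "0 < b" "2 * b \<le> e" "4 * b \<le> r" using e r by (auto simp: b_def)
  have "ereal (4 * b) < \<epsilon>" using b(3) r(2) by (meson ereal_less_eq(3) le_less_trans)
  moreover have "cball (snd c' (f x)) (2 * b) \<subseteq> snd c' ` fst c'" if "x \<in> L" for x
    using subset_cball[OF b(2), of "snd c' (f x)"] e(2) that by blast
  ultimately have "controls f {(c, c', L, ereal b)} t" using b(1) L(3) by (auto simp: tt)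
  moreover have "adm f (c, c', L, ereal b)" using a L L' b(1) by (simp add: adm_iff)
  ultimately show ?thesis by (intro exI[of _ "(c, c', L, ereal b)"]) (simp add: tt)
qed

lemma control_family:
  assumes P: "good_family P" and f: "f \<in> maps" and T: "P T" "\<forall>t\<in>T. adm f t"
  obtains D where "P D" "\<forall>t\<in>D. adm f t" "\<forall>t\<in>T. controls f D t"
proof -
  have "\<forall>t\<in>T. \<exists>s. fst s = fst t \<and> adm f s \<and> controls f {s} t" using control_datum[OF f] T(2) by blast
  then obtain h where h: "\<forall>t\<in>T. fst (h t) = fst t \<and> adm f (h t) \<and> controls f {h t} t" by metis
  have "P (h ` T)" using P T(1) h unfolding good_family_def by blast
  moreover have "controls f (h ` T) t" if "t \<in> T" for t
    by (rule controls_mono[of f "{h t}"]) (use h that in auto)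
  ultimately show thesis using h by (intro that) auto
qed

text \<open>Such data are added at every stage so that in the end each point of the source is
  controlled; without them the limit need not exist away from the data prescribed by the open
  sets.\<close>

lemma compact_cover_data:
  assumes f: "f \<in> maps" and L: "compactin X L"
  obtains T where "finite T" "\<forall>t\<in>T. adm f t"
    "\<forall>x\<in>L. \<exists>c c' K \<epsilon>. (c, c', K, \<epsilon>) \<in> T \<and> x \<in> X interior_of K"
proof -
  have cf: "continuous_map X Y f" using f by (simp add: sobolev_maps_def)
  have "\<exists>t. adm f t \<and> x \<in> X interior_of (fst (snd (snd t)))" if x: "x \<in> L" for x
  proof -
    have xX: "x \<in> topspace X" using x compactin_subset_topspace[OF L] by blast
    then have fY: "f x \<in> topspace Y" using continuous_map_image_subset_topspace[OF cf] by blast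
    obtain c where c: "c \<in> \<A>" "x \<in> fst c" using smooth_atlas_cover[OF atlas(1) xX] by blast
    obtain c' where c': "c' \<in> \<B>" "f x \<in> fst c'" using smooth_atlas_cover[OF atlas(2) fY] by blast
    have "adm f (c, c', {x}, 1)" using c c' xX by (simp add: adm_iff)
    then obtain s where s: "fst s = c" "adm f s" "controls f {s} (c, c', {x}, 1)" using control_datum[OF f] by fastforce
    then obtain L b where "(c, c', L, ereal b) = s" "x \<in> X interior_of L" by auto
    then have "x \<in> X interior_of (fst (snd (snd s)))" by (metis fst_conv snd_conv)
    then show ?thesis using s(2) by blast
  qed
  then obtain t where t: "\<And>x. x \<in> L \<Longrightarrow> adm f (t x) \<and> x \<in> X interior_of (fst (snd (snd (t x))))" by metis
  let ?W = "\<lambda>x. X interior_of (fst (snd (snd (t x))))"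
  have "\<exists>\<F>. finite \<F> \<and> \<F> \<subseteq> ?W ` L \<and> L \<subseteq> \<Union>\<F>"
    by (rule compactinD[OF L]) (use t in auto)
  then obtain \<F> where F: "finite \<F>" "\<F> \<subseteq> ?W ` L" "L \<subseteq> \<Union>\<F>" by blast
  obtain I where I: "I \<subseteq> L" "finite I" "\<F> = ?W ` I" using finite_subset_image[OF F(1,2)] by blast
  show thesis
  proof (rule that[of "t ` I"])
    show "finite (t ` I)" "\<forall>t\<in>t ` I. adm f t" using I t by auto
    show "\<forall>x\<in>L. \<exists>c c' K \<epsilon>. (c, c', K, \<epsilon>) \<in> t ` I \<and> x \<in> X interior_of K"
    proof
      fix x assume "x \<in> L"
      then obtain i where "i \<in> I" "x \<in> ?W i" using F(3) I(3) by blast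
      then show "\<exists>c c' K \<epsilon>. (c, c', K, \<epsilon>) \<in> t ` I \<and> x \<in> X interior_of K"
        by (metis imageI prod.collapse)
    qed
  qed
qed

text \<open>Passing every datum on to the next stage with half its tolerance is what produces the
  steps \<open>b, b/2, b/4, ...\<close> on a fixed compact set.\<close>

fun halve :: "('a, 'e, 'b, 'f) nbhd_datum \<Rightarrow> ('a, 'e, 'b, 'f) nbhd_datum" where
  "halve (c, c', K, \<epsilon>) = (c, c', K, \<epsilon> / 2)"

lemma halve_iterate:
  assumes D: "\<And>n. halve ` D n \<subseteq> D (Suc n)" and d: "(c, c', L, ereal b) \<in> D n"
  shows "(c, c', L, ereal (b * (1/2) ^ i)) \<in> D (n + i)"
proof (induction i)
  case (Suc i)
  then have "halve (c, c', L, ereal (b * (1/2) ^ i)) \<in> D (n + Suc i)" using D[of "n + i"] by (metis add_Suc_right imageI subsetD)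
  then show ?case by simp
qed (use d in simp)

end

section \<open>The limit of a controlled sequence of maps\<close>

locale whitney_sequence = sobolev_whitney k p X \<A> Y \<B>
  for k p and X :: "'a topology" and \<A> :: "('a, 'e::euclidean_space) chart set"
    and Y :: "'b topology" and \<B> :: "('b, 'f::euclidean_space) chart set" +
  fixes f :: "nat \<Rightarrow> 'a \<Rightarrow> 'b" and D :: "nat \<Rightarrow> ('a, 'e, 'b, 'f) nbhd_datum set"
  assumes f: "\<And>n. f n \<in> maps" and D: "\<And>n t. t \<in> D n \<Longrightarrow> adm (f n) t"
    and halveD: "\<And>n. halve ` D n \<subseteq> D (Suc n)" and step: "\<And>n. f (Suc n) \<in> nbhds (f n) (D n)"
    and cover: "\<And>x. x \<in> topspace X \<Longrightarrow> \<exists>n c c' K \<epsilon>. x \<in> X interior_of K \<and> K \<subseteq> fst c \<and> controls (f n) (D n) (c, c', K, \<epsilon>)"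
begin

text \<open>The limit is taken in the target manifold, independently of charts; its Hausdorff
  property makes the chosen value the only one. The restriction makes the map extensional, as
  members of the space must be.\<close>

definition limit_map :: "'a \<Rightarrow> 'b" where
  "limit_map = restrict (\<lambda>x. SOME z. limitin Y (\<lambda>n. f n x) z sequentially) (topspace X)"

text \<open>In one pair of charts the representatives converge geometrically. Their limit lies in
  the image of the target chart by the ball condition, so the inverse chart carries it to the
  manifold, where uniqueness of limits identifies it with \<open>limit_map\<close>.\<close>

lemma controlled_limit:
  assumes L: "(c, c', L, ereal b) \<in> D n" "0 < b" and ball: "\<forall>x\<in>L. cball (snd c' (f n x)) (2 * b) \<subseteq> snd c' ` fst c'"
    and K: "compactin X K" "K \<subseteq> X interior_of L"
  shows "limit_map ` L \<subseteq> fst c'" "continuous_on (snd c ` L) (local_rep c c' limit_map)"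
    "sobolev_on k p (snd c ` K) (local_rep c c' limit_map)" "gap c c' K (f n) limit_map \<le> 4 * b"
    "c \<in> \<A>" "c' \<in> \<B>" "L \<subseteq> fst c"
proof -
  have d: "(c, c', L, ereal (b * (1/2) ^ i)) \<in> D (n + i)" for i by (rule halve_iterate[OF halveD L(1)])
  have a: "c \<in> \<A>" "c' \<in> \<B>" "compactin X L" "L \<subseteq> fst c" using D[OF L(1)] by (auto simp: adm_iff)
  then show "c \<in> \<A>" "c' \<in> \<B>" "L \<subseteq> fst c" by auto
  have ch: "is_chart X c" "is_chart Y c'" using a chart by auto
  have LX: "L \<subseteq> topspace X" by (rule compactin_subset_topspace[OF a(3)])
  have fL: "f (n + i) ` L \<subseteq> fst c'" for i using D[OF d[of i]] by (auto simp: adm_iff)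
  define u where "u i = local_rep c c' (f (n + i))" for i
  have cL: "compact (snd c ` L)" by (rule chart_compact_image[OF ch(1) a(3,4)])
  have KL: "K \<subseteq> L" using K(2) interior_of_subset[of X L] by blast
  have cK: "compact (snd c ` K)" by (rule chart_compact_image[OF ch(1) K(1)]) (use KL a(4) in blast)
  have us: "sobolev_on k p (snd c ` L) (u i)" for i unfolding u_def by (rule maps_sobolev[OF f a fL])
  have ustep: "sobolev_norm k p (snd c ` L) (\<lambda>y. u i y - u (Suc i) y) \<le> b * (1/2) ^ i" for i
  proof -
    have "f (Suc (n + i)) \<in> nbhd (f (n + i)) (c, c', L, ereal (b * (1/2) ^ i))" using step[of "n + i"] d[of i] by (simp add: mem_nbhds)
    then show ?thesis by (simp add: mem_nbhd gap_def u_def)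
  qed
  have conv: "\<exists>z. (\<lambda>i. u i y) \<longlonglongrightarrow> z" if y: "y \<in> snd c ` L" for y
  proof -
    have "norm (u (Suc i) y - u i y) \<le> b * (1/2) ^ i" for i
    proof -
      have s: "sobolev_on k p (snd c ` L) (\<lambda>y. u i y - u (Suc i) y)" by (rule sobolev_on_diff[OF us us cL p1])
      then have "norm (u i y - u (Suc i) y) \<le> sup_norm_on (snd c ` L) (\<lambda>y. u i y - u (Suc i) y)"
        by (intro sup_norm_on_upper[OF cL _ y]) (simp add: sobolev_on_iff)
      also have "\<dots> \<le> sobolev_norm k p (snd c ` L) (\<lambda>y. u i y - u (Suc i) y)"
        by (simp add: sobolev_norm_def sobolev_seminorm_nonneg)
      also note ustep
      finally show ?thesis by (simp add: norm_minus_commute)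
    qed
    moreover have "summable (\<lambda>i. b * (1/2) ^ i)" by (intro summable_mult summable_geometric) simp
    ultimately have "summable (\<lambda>i. u (Suc i) y - u i y)" by (rule summable_comparison_test'[where N=0, rotated])
    then have "(\<lambda>i. \<Sum>l<i. u (Suc l) y - u l y) \<longlonglongrightarrow> (\<Sum>i. u (Suc i) y - u i y)" by (rule summable_LIMSEQ)
    then have "(\<lambda>i. u i y - u 0 y) \<longlonglongrightarrow> (\<Sum>i. u (Suc i) y - u i y)"
      unfolding sum_lessThan_telescope[of "\<lambda>l. u l y"] .
    then have "(\<lambda>i. (u i y - u 0 y) + u 0 y) \<longlonglongrightarrow> (\<Sum>i. u (Suc i) y - u i y) + u 0 y" by (intro tendsto_add tendsto_const)
    then show ?thesis by auto
  qed
  then obtain v where v: "\<And>y. y \<in> snd c ` L \<Longrightarrow> (\<lambda>i. u i y) \<longlonglongrightarrow> v y" by metis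
  have vV: "v y \<in> snd c' ` fst c'" if y: "y \<in> snd c ` L" for y
  proof -
    obtain x where x: "x \<in> L" "y = snd c x" using y by blast
    have "norm (u 0 y - v y) \<le> 2 * b"
      \<comment> \<open>Only the sup-bound on \<open>L\<close> is wanted here, hence the empty inner
        compact set.\<close>
      by (rule sobolev_limit(2)[where K="{}", OF _ cL _ p1 L(2) us ustep v y]) auto
    moreover have "u 0 y = snd c' (f n x)" using local_rep_chart[OF ch(1), of x c' "f n"] a(4) x by (auto simp: u_def)
    ultimately have "v y \<in> cball (snd c' (f n x)) (2 * b)" by (simp add: dist_norm)
    then show ?thesis using ball x(1) by blast
  qed
  have lim: "limit_map x \<in> fst c' \<and> snd c' (limit_map x) = v (snd c x)" if x: "x \<in> L" for x
  proof -
    let ?j = "inv_into (fst c') (snd c')"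
    have y: "snd c x \<in> snd c ` L" using x by blast
    have xU: "x \<in> fst c" using a(4) x by blast
    have ux: "u i (snd c x) = snd c' (f (n + i) x)" for i using local_rep_chart[OF ch(1) xU] by (simp add: u_def)
    have fx: "f (n + i) x \<in> fst c'" for i using fL x by blast
    have "limitin (top_of_set (snd c' ` fst c')) (\<lambda>i. u i (snd c x)) (v (snd c x)) sequentially"
      unfolding limitin_subtopology using v[OF y] vV[OF y] fx by (auto simp: ux)
    then have "limitin Y (?j \<circ> (\<lambda>i. u i (snd c x))) (?j (v (snd c x))) sequentially"
      by (rule continuous_map_limit[OF chart_inverse_continuous[OF ch(2) order_refl]])
    also have "?j \<circ> (\<lambda>i. u i (snd c x)) = (\<lambda>i. f (i + n) x)"
      using inv_into_f_f[OF is_chartD(3)[OF ch(2)] fx] by (auto simp: ux add.commute)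
    finally have l: "limitin Y (\<lambda>i. f i x) (?j (v (snd c x))) sequentially" by (rule limitin_sequentially_offset_rev)
    then have "limitin Y (\<lambda>i. f i x) (SOME z. limitin Y (\<lambda>n. f n x) z sequentially) sequentially" by (rule someI)
    moreover have "limit_map x = (SOME z. limitin Y (\<lambda>n. f n x) z sequentially)" using x LX by (auto simp: limit_map_def)
    ultimately have "limitin Y (\<lambda>i. f i x) (limit_map x) sequentially" by simp
    then have "limit_map x = ?j (v (snd c x))"
      by (rule limitin_Hausdorff_unique[OF _ l trivial_limit_sequentially]) (use Y in \<open>simp add: smooth_manifold_def\<close>)
    then show ?thesis using vV[OF y] by (auto intro: inv_into_into f_inv_into_f)
  qed
  then show "limit_map ` L \<subseteq> fst c'" by blast
  have "(\<lambda>i. u i y) \<longlonglongrightarrow> local_rep c c' limit_map y" if "y \<in> snd c ` L" for y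
  proof -
    obtain x where x: "x \<in> L" "y = snd c x" using \<open>y \<in> snd c ` L\<close> by blast
    then have "local_rep c c' limit_map y = v y"
      using lim[OF x(1)] local_rep_chart[OF ch(1), of x c' limit_map] a(4) by auto
    then show ?thesis using v[OF \<open>y \<in> snd c ` L\<close>] by simp
  qed
  from sobolev_limit[OF cK cL chart_interior[OF ch(1) a(4) K(2)] p1 L(2) us ustep this]
  show "continuous_on (snd c ` L) (local_rep c c' limit_map)"
    "sobolev_on k p (snd c ` K) (local_rep c c' limit_map)" "gap c c' K (f n) limit_map \<le> 4 * b"
    by (auto simp: gap_def u_def)
qed

text \<open>Continuity is local, and the interiors of the controlled compact sets cover the source;
  on each of them the map is a chart, a continuous representative and an inverse chart in
  succession.\<close>

lemma continuous_limit_map: "continuous_map X Y limit_map"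
proof -
  let ?I = "{W. openin X W \<and> continuous_map (subtopology X W) Y limit_map}"
  show ?thesis
  proof (rule pasting_lemma[where I="?I" and T="\<lambda>W. W" and f="\<lambda>_. limit_map"])
    fix x assume x: "x \<in> topspace X"
    obtain n c c' K \<epsilon> where K: "x \<in> X interior_of K" "controls (f n) (D n) (c, c', K, \<epsilon>)" using cover[OF x] by blast
    obtain L b where L: "(c, c', L, ereal b) \<in> D n" "0 < b" "K \<subseteq> X interior_of L"
      "\<forall>x\<in>L. cball (snd c' (f n x)) (2 * b) \<subseteq> snd c' ` fst c'" using K(2) by auto
    have KL: "K \<subseteq> L" using L(3) interior_of_subset[of X L] by blast
    note cl = controlled_limit[OF L(1,2,4) compactin_empty empty_subsetI]
    have KL': "X interior_of K \<subseteq> L" using KL interior_of_subset[of X K] by blast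
    have "continuous_map (subtopology X (X interior_of K)) Y limit_map"
      by (rule continuous_map_local_rep[OF chart(1)[OF cl(5)] chart(2)[OF cl(6)] _ _ continuous_on_subset[OF cl(2) image_mono[OF KL']]])
        (use KL' cl(1,7) in auto)
    then show "\<exists>W. W \<in> ?I \<and> x \<in> W \<and> limit_map x = limit_map x"
      using K(1) openin_interior_of[of X K] by (intro exI[of _ "X interior_of K"]) simp
  qed auto
qed

text \<open>The charts \<open>c1\<close>, \<open>c1'\<close> are arbitrary, while control is
  available in the charts \<open>c\<close>, \<open>c'\<close> of a datum near each point. The
  representative in \<open>c1\<close>, \<open>c1'\<close> is the controlled one composed with a
  transition map on either side, and \<open>sobolev_region_compose\<close> transfers membership
  locally.\<close>

lemma limit_map_in_maps: "limit_map \<in> maps"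
  unfolding sobolev_maps_def
proof (intro CollectI conjI ballI allI impI)
  show "limit_map \<in> extensional (topspace X)" by (simp add: limit_map_def)
  show "continuous_map X Y limit_map" by (rule continuous_limit_map)
  fix c1 c1' K1 assume c1: "c1 \<in> \<A>" "c1' \<in> \<B>" and K1': "compactin X K1 \<and> K1 \<subseteq> fst c1 \<and> limit_map ` K1 \<subseteq> fst c1'"
  then have K1: "compactin X K1" "K1 \<subseteq> fst c1" "limit_map ` K1 \<subseteq> fst c1'" by auto
  note ch1 = chart(1)[OF c1(1)] chart(2)[OF c1(2)]
  show "sobolev_on k p (snd c1 ` K1) (local_rep c1 c1' limit_map)"
  proof (rule sobolev_on_locally[OF chart_compact_image[OF ch1(1) K1(1,2)]])
    fix y0 assume "y0 \<in> snd c1 ` K1"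
    then obtain x0 where x0: "x0 \<in> K1" "y0 = snd c1 x0" by blast
    have x0X: "x0 \<in> topspace X" "x0 \<in> fst c1" using x0 K1 compactin_subset_topspace[OF K1(1)] by auto
    obtain n c c' K0 \<epsilon> where K0: "x0 \<in> X interior_of K0" "K0 \<subseteq> fst c" "controls (f n) (D n) (c, c', K0, \<epsilon>)" using cover[OF x0X(1)] by blast
    obtain L b where L: "(c, c', L, ereal b) \<in> D n" "0 < b" "K0 \<subseteq> X interior_of L"
      "\<forall>x\<in>L. cball (snd c' (f n x)) (2 * b) \<subseteq> snd c' ` fst c'" using K0(3) by auto
    have cA: "c \<in> \<A>" using D[OF L(1)] by (simp add: adm_iff)
    have ch: "is_chart X c" by (rule chart(1)[OF cA])
    \<comment> \<open>\<open>K0\<close> comes without compactness, so a compact neighbourhood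
      \<open>K\<close> of the point is chosen inside its interior; there
      \<open>controlled_limit\<close> gives class W^{k,p}.\<close>
    have "compactin X {x0}" using x0X by simp
    then obtain K where K: "compactin X K" "K \<subseteq> X interior_of K0" "x0 \<in> X interior_of K"
      using chart_compact_neighbourhood[OF ch _ _ openin_interior_of[of X K0], of "{x0}"] K0 interior_of_subset[of X K0] by auto
    have KL: "K \<subseteq> X interior_of L" using K(2) interior_of_subset[of X K0] L(3) by blast
    note cl = controlled_limit[OF L(1,2,4) K(1) KL]
    note ch' = chart(2)[OF cl(6)]
    have Kc: "K \<subseteq> fst c" using KL interior_of_subset[of X L] cl(7) by blast
    have gK: "limit_map ` K \<subseteq> fst c'" using KL interior_of_subset[of X L] cl(1) by blast
    let ?i1 = "inv_into (fst c1) (snd c1)" and ?i = "inv_into (fst c) (snd c)" and ?i' = "inv_into (fst c') (snd c')"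
    have i1: "?i1 (snd c1 x) = x" if "x \<in> fst c1" for x by (rule inv_into_f_f[OF is_chartD(3)[OF ch1(1)] that])
    have i: "?i (snd c x) = x" if "x \<in> fst c" for x by (rule inv_into_f_f[OF is_chartD(3)[OF ch] that])
    have i': "?i' (snd c' x) = x" if "x \<in> fst c'" for x by (rule inv_into_f_f[OF is_chartD(3)[OF ch'] that])
    define S where "S = snd c1 ` (fst c1 \<inter> X interior_of K)"
    have oS: "open S" unfolding S_def
      by (rule chart_open_image[OF ch1(1) openin_Int[OF is_chartD(1)[OF ch1(1)] openin_interior_of]]) simp
    have y0S: "y0 \<in> S" using x0 x0X K(3) by (auto simp: S_def)
    have iK: "X interior_of K \<subseteq> K" by (rule interior_of_subset)
    have sH: "smooth_on S (snd c \<circ> ?i1)"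
      by (rule smooth_on_subset[OF compatible_smooth[OF atlas(1) c1(1) cA]]) (use iK Kc in \<open>auto simp: S_def\<close>)
    have Hy: "(snd c \<circ> ?i1) (snd c1 x) = snd c x" if "x \<in> fst c1" for x using i1[OF that] by simp
    have Hy0: "(snd c \<circ> ?i1) y0 = snd c x0" using Hy x0 x0X by simp
    have "snd c ` {x0} \<subseteq> interior (snd c ` K)" by (rule chart_interior[OF ch Kc]) (use K in simp)
    then have H0: "(snd c \<circ> ?i1) y0 \<in> interior (snd c ` K)" unfolding Hy0 by simp
    have oR: "open (snd c ` (fst c \<inter> fst c1))"
      by (rule chart_open_image[OF ch openin_Int[OF is_chartD(1)[OF ch] is_chartD(1)[OF ch1(1)]]]) simp
    have x0c: "x0 \<in> fst c" using K(3) iK Kc by blast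
    have HR: "(snd c \<circ> ?i1) y0 \<in> snd c ` (fst c \<inter> fst c1)" unfolding Hy0 using x0c x0X by blast
    have HiH: "(snd c1 \<circ> ?i) ((snd c \<circ> ?i1) y) = y" if "y \<in> S" for y
      using that i i1 iK Kc by (auto simp: S_def subset_iff)
    have oT: "open (snd c' ` (fst c' \<inter> fst c1'))"
      by (rule chart_open_image[OF ch' openin_Int[OF is_chartD(1)[OF ch'] is_chartD(1)[OF ch1(2)]]]) (rule Int_lower1)
    have g: "local_rep c c' limit_map (snd c x) = snd c' (limit_map x)" if "x \<in> fst c" for x
      by (rule local_rep_chart[OF ch that])
    have x0K: "x0 \<in> K" using K(3) iK by blast
    have FT: "local_rep c c' limit_map ((snd c \<circ> ?i1) y0) \<in> snd c' ` (fst c' \<inter> fst c1')"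
      unfolding Hy0 g[OF x0c] using gK x0K K1(3) x0(1) by blast
    obtain W where W: "y0 \<in> W" "W \<subseteq> S"
      "sobolev_region k p W (\<lambda>y. (snd c1' \<circ> ?i') (local_rep c c' limit_map ((snd c \<circ> ?i1) y)))"
      using sobolev_region_compose[OF pm k1 cl(3) chart_compact_image[OF ch K(1) Kc] oS y0S sH H0 oR
        compatible_smooth[OF atlas(1) cA c1(1)] HR HiH oT compatible_smooth[OF atlas(2) cl(6) c1(2)] FT] by blast
    have "(snd c1' \<circ> ?i') (local_rep c c' limit_map ((snd c \<circ> ?i1) y)) = local_rep c1 c1' limit_map y" if y: "y \<in> W" for y
    proof -
      obtain x where x: "x \<in> fst c1" "x \<in> X interior_of K" "y = snd c1 x" using y W(2) by (auto simp: S_def)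
      have xK: "x \<in> K" using x(2) iK by blast
      then have "limit_map x \<in> fst c'" "x \<in> fst c" using gK Kc by auto
      then show ?thesis using i'[of "limit_map x"] g[of x] Hy[OF x(1)] local_rep_chart[OF ch1(1) x(1), of c1' limit_map] x(3) by simp
    qed
    then have "sobolev_region k p W (local_rep c1 c1' limit_map)" by (rule sobolev_region_cong[OF W(3)])
    then show "\<exists>W. y0 \<in> W \<and> sobolev_region k p W (local_rep c1 c1' limit_map)" using W(1) by blast
  qed
qed

lemma limit_map_nbhd:
  assumes t: "adm (f n) t" "controls (f n) (D n) t"
  shows "limit_map \<in> nbhd (f n) t"
proof -
  obtain c c' K \<epsilon> where tt: "t = (c, c', K, \<epsilon>)" by (cases t)
  obtain L b where L: "(c, c', L, ereal b) \<in> D n" "0 < b" "ereal (4 * b) < \<epsilon>" "K \<subseteq> X interior_of L"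
    "\<forall>x\<in>L. cball (snd c' (f n x)) (2 * b) \<subseteq> snd c' ` fst c'" using t(2) by (auto simp: tt)
  have K: "compactin X K" using t(1) by (simp add: tt adm_iff)
  note cl = controlled_limit[OF L(1,2,5) K L(4)]
  have "ereal (gap c c' K (f n) limit_map) < \<epsilon>" using cl(4) L(3) by (meson ereal_less_eq(3) le_less_trans)
  moreover have "limit_map ` K \<subseteq> fst c'" using cl(1) L(4) interior_of_subset[of X L] by blast
  ultimately show ?thesis using limit_map_in_maps by (simp add: tt mem_nbhd)
qed

end

section \<open>Construction of the sequence and the Baire property\<close>

context sobolev_whitney
begin

text \<open>A state of the recursion is a map with a set of data around it. Density moves the map
  into the next open set within the current neighbourhood, and the data are refined so that every
  later map, and the limit, obey them.\<close>

lemma Baire_nbhd_open: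
  assumes P: "good_family P" and Z: "\<And>U. openin Z U \<longleftrightarrow> nbhd_open P U"
  shows "Baire_space Z"
  unfolding Baire_space_def
proof (intro allI impI; elim conjE)
  fix \<G> assume \<G>: "countable \<G>" and dense: "\<forall>U\<in>\<G>. openin Z U \<and> Z closure_of U = topspace Z"
  have P0: "P {}" and PUn: "P T \<Longrightarrow> P T' \<Longrightarrow> P (T \<union> T')" and Pfin: "finite T \<Longrightarrow> P T"
    and Pimg: "P T \<Longrightarrow> (\<And>t. t \<in> T \<Longrightarrow> fst (h t) = fst t) \<Longrightarrow> P (h ` T)" for T T' h
    using P unfolding good_family_def by auto
  have "openin Z maps" unfolding Z nbhd_open_def
    using P0 by (intro conjI ballI exI[of _ "{}"]) (auto simp: mem_nbhds)
  moreover have "topspace Z \<subseteq> maps" using openin_topspace[of Z] unfolding Z nbhd_open_def by blast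
  ultimately have top: "topspace Z = maps" using openin_subset by blast
  \<comment> \<open>The whole space is inserted so that the enumerated family is nonempty; it is
    open and dense itself.\<close>
  define U where "U = from_nat_into (insert (topspace Z) \<G>)"
  have rU: "range U = insert (topspace Z) \<G>" unfolding U_def using \<G> by (intro range_from_nat_into) auto
  have U: "openin Z (U n)" "Z closure_of (U n) = topspace Z" for n
  proof -
    have "U n \<in> insert (topspace Z) \<G>" using rU by blast
    then show "openin Z (U n)" "Z closure_of (U n) = topspace Z" using dense by auto
  qed
  have sc: "second_countable X" using X by (simp add: smooth_manifold_def)
  obtain L :: "nat \<Rightarrow> 'a set" where "(\<forall>n. compactin X (L n)) \<and> (\<forall>x\<in>topspace X. \<exists>n. x \<in> L n)"
    using countable_compact_cover[OF sc atlas(1)] by (rule exE)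
  then have L: "\<And>n. compactin X (L n)" "\<And>x. x \<in> topspace X \<Longrightarrow> \<exists>n. x \<in> L n" by auto
  show "Z closure_of (topspace Z \<inter> \<Inter>\<G>) = topspace Z"
    unfolding dense_intersects_open
  proof (intro allI impI; elim conjE)
    fix V assume V: "openin Z V" "V \<noteq> {}"
    \<comment> \<open>The data of the state control a family whose neighbourhood lies in
      \<open>W\<close>; this places the limit in \<open>W\<close> as well.\<close>
    define trapped where "trapped s W \<longleftrightarrow> (\<exists>T. (\<forall>t\<in>T. adm (fst s) t) \<and> nbhds (fst s) T \<subseteq> W \<and> (\<forall>t\<in>T. controls (fst s) (snd s) t))" for s W
    define inv where "inv s \<longleftrightarrow> fst s \<in> maps \<and> P (snd s) \<and> (\<forall>t\<in>snd s. adm (fst s) t)" for s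
    define covers where "covers s C \<longleftrightarrow> (\<forall>x\<in>C. \<exists>c c' K \<epsilon>. x \<in> X interior_of K \<and> K \<subseteq> fst c \<and> controls (fst s) (snd s) (c, c', K, \<epsilon>))" for s C
    have trap: "\<exists>D. P D \<and> (\<forall>t\<in>D. adm f t) \<and> trapped (f, D) W" if W: "openin Z W" "f \<in> W" for f W
    proof -
      obtain T where T: "P T" "\<forall>t\<in>T. adm f t" "nbhds f T \<subseteq> W" using W unfolding Z nbhd_open_def by blast
      have "f \<in> maps" using W unfolding Z nbhd_open_def by blast
      then obtain D where "P D" "\<forall>t\<in>D. adm f t" "\<forall>t\<in>T. controls f D t" using control_family[OF P _ T(1,2)] by blast
      then show ?thesis using T unfolding trapped_def by auto
    qed
    \<comment> \<open>The initial state is trapped in \<open>V\<close>, and the state with index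
      \<open>Suc n\<close> in \<open>U n\<close>. The requirement on the initial state is written as
      an implication for \<open>n = 0\<close>, because dependent choice works with one predicate for
      all stages.\<close>
    have "\<exists>F. \<forall>n. (inv (F n) \<and> (n = 0 \<longrightarrow> trapped (F n) V)) \<and>
      (fst (F (Suc n)) \<in> nbhds (fst (F n)) (snd (F n)) \<and> halve ` snd (F n) \<subseteq> snd (F (Suc n)) \<and> trapped (F (Suc n)) (U n) \<and> covers (F (Suc n)) (L n))"
    proof (rule dependent_nat_choice)
      obtain f where f: "f \<in> V" using V(2) by blast
      obtain D where D: "P D" "\<forall>t\<in>D. adm f t" "trapped (f, D) V" using trap[OF V(1) f] by blast
      have "f \<in> maps" using V(1) f top openin_subset by blast
      then show "\<exists>s. inv s \<and> (0 = (0::nat) \<longrightarrow> trapped s V)" using D by (intro exI[of _ "(f, D)"]) (simp add: inv_def)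
    next
      fix s and n :: nat assume "inv s \<and> (n = 0 \<longrightarrow> trapped s V)"
      then have s: "fst s \<in> maps" "P (snd s)" "\<forall>t\<in>snd s. adm (fst s) t" by (auto simp: inv_def)
      have "openin Z (nbhds (fst s) (snd s))" unfolding Z by (rule nbhd_open_nbhds[OF P s])
      moreover have "nbhds (fst s) (snd s) \<noteq> {}" using nbhds_refl[OF s(1,3)] by blast
      ultimately have "U n \<inter> nbhds (fst s) (snd s) \<noteq> {}" using U(2)[of n] unfolding dense_intersects_open by blast
      then obtain g where g: "g \<in> U n" "g \<in> nbhds (fst s) (snd s)" by blast
      have gm: "g \<in> maps" using g(2) by (simp add: mem_nbhds)
      obtain D1 where D1: "P D1" "\<forall>t\<in>D1. adm g t" "trapped (g, D1) (U n)" using trap[OF U(1) g(1)] by blast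
      obtain T where T: "finite T" "\<forall>t\<in>T. adm g t" "\<forall>x\<in>L n. \<exists>c c' K \<epsilon>. (c, c', K, \<epsilon>) \<in> T \<and> x \<in> X interior_of K"
        using compact_cover_data[OF gm L(1)[of n]] by metis
      obtain D2 where D2: "P D2" "\<forall>t\<in>D2. adm g t" "\<forall>t\<in>T. controls g D2 t" using control_family[OF P gm Pfin[OF T(1)] T(2)] by blast
      \<comment> \<open>Old data with halved tolerance keep earlier promises, \<open>D1\<close>
        traps the map in \<open>U n\<close>, and \<open>D2\<close> controls it around the compact
        set \<open>L n\<close>.\<close>
      define E where "E = halve ` snd s \<union> (D1 \<union> D2)"
      have "P (halve ` snd s)" by (rule Pimg[OF s(2)]) (metis fst_conv halve.simps prod_cases4)
      then have PE: "P E" unfolding E_def using D1(1) D2(1) by (intro PUn)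
      have "adm g (halve t)" if "t \<in> snd s" for t
      proof -
        obtain c c' K \<epsilon> where t: "t = (c, c', K, \<epsilon>)" by (cases t)
        have "adm (fst s) t" "g \<in> nbhd (fst s) t" using s(3) g(2) that by (auto simp: mem_nbhds)
        moreover from this have "0 < \<epsilon> / 2" by (cases \<epsilon>) (auto simp: t adm_iff)
        ultimately show ?thesis by (simp add: t adm_iff mem_nbhd)
      qed
      then have "inv (g, E)" using gm PE D1(2) D2(2) by (auto simp: inv_def E_def)
      moreover have "trapped (g, E) (U n)"
      proof -
        obtain T1 where T1: "\<forall>t\<in>T1. adm g t" "nbhds g T1 \<subseteq> U n" "\<forall>t\<in>T1. controls g D1 t" using D1(3) unfolding trapped_def by auto
        have "D1 \<subseteq> E" by (auto simp: E_def)
        then have "\<forall>t\<in>T1. controls g E t" using T1(3) controls_mono[of g D1] by blast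
        then show ?thesis using T1 unfolding trapped_def by (intro exI[of _ T1]) simp
      qed
      moreover have "covers (g, E) (L n)" unfolding covers_def
      proof
        fix x assume "x \<in> L n"
        then obtain c c' K \<epsilon> where t: "(c, c', K, \<epsilon>) \<in> T" "x \<in> X interior_of K" using T(3) by blast
        have "controls g E (c, c', K, \<epsilon>)" by (rule controls_mono[of g D2]) (use D2(3) t in \<open>auto simp: E_def\<close>)
        moreover have "K \<subseteq> fst c" using bspec[OF T(2) t(1)] by (simp add: adm_iff)
        ultimately show "\<exists>c c' K \<epsilon>. x \<in> X interior_of K \<and> K \<subseteq> fst c \<and> controls (fst (g, E)) (snd (g, E)) (c, c', K, \<epsilon>)"
          using t(2) unfolding fst_conv snd_conv by blast
      qed
      ultimately show "\<exists>s'. (inv s' \<and> (Suc n = 0 \<longrightarrow> trapped s' V)) \<and> (fst s' \<in> nbhds (fst s) (snd s) \<and> halve ` snd s \<subseteq> snd s' \<and> trapped s' (U n) \<and> covers s' (L n))"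
        using g(2) by (intro exI[of _ "(g, E)"]) (simp add: E_def)
    qed
    then obtain F where F: "\<And>n. inv (F n)" "trapped (F 0) V" "\<And>n. fst (F (Suc n)) \<in> nbhds (fst (F n)) (snd (F n))"
      "\<And>n. halve ` snd (F n) \<subseteq> snd (F (Suc n))" "\<And>n. trapped (F (Suc n)) (U n)" "\<And>n. covers (F (Suc n)) (L n)"
      by metis
    interpret whitney_sequence k p X \<A> Y \<B> "\<lambda>n. fst (F n)" "\<lambda>n. snd (F n)"
    proof
      show "fst (F n) \<in> maps" "t \<in> snd (F n) \<Longrightarrow> adm (fst (F n)) t" for n t using F(1)[of n] by (auto simp: inv_def)
      show "halve ` snd (F n) \<subseteq> snd (F (Suc n))" "fst (F (Suc n)) \<in> nbhds (fst (F n)) (snd (F n))" for n by (fact F(4), fact F(3))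
      fix x assume "x \<in> topspace X"
      then obtain n where "x \<in> L n" using L(2) by blast
      then show "\<exists>n c c' K \<epsilon>. x \<in> X interior_of K \<and> K \<subseteq> fst c \<and> controls (fst (F n)) (snd (F n)) (c, c', K, \<epsilon>)"
        using F(6)[of n] unfolding covers_def by blast
    qed
    have trapped_limit: "limit_map \<in> W" if "trapped (F n) W" for n W
    proof -
      obtain T where T: "\<forall>t\<in>T. adm (fst (F n)) t" "nbhds (fst (F n)) T \<subseteq> W" "\<forall>t\<in>T. controls (fst (F n)) (snd (F n)) t"
        using \<open>trapped (F n) W\<close> unfolding trapped_def by auto
      have "\<forall>t\<in>T. limit_map \<in> nbhd (fst (F n)) t" using T(1,3) limit_map_nbhd[of n] by blast
      then have "limit_map \<in> nbhds (fst (F n)) T" using limit_map_in_maps by (simp add: mem_nbhds)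
      then show ?thesis using T(2) by blast
    qed
    have "limit_map \<in> V" by (rule trapped_limit[OF F(2)])
    moreover have "limit_map \<in> G" if "G \<in> \<G>" for G
    proof -
      obtain n where "G = U n" using rU \<open>G \<in> \<G>\<close> by (metis insertCI rangeE)
      then show ?thesis using trapped_limit[OF F(5)[of n]] by simp
    qed
    ultimately show "topspace Z \<inter> \<Inter>\<G> \<inter> V \<noteq> {}" using limit_map_in_maps top by blast
  qed
qed

end

theorem theorem3:
  fixes M :: "'a topology" and \<A> :: "('a, real ^ 'm) chart set"
    and N :: "'b topology" and \<B> :: "('b, real ^ 'd) chart set"
    and k :: nat and p :: real
  assumes "smooth_manifold M \<A>" and "smooth_manifold N \<B>"
    and "1 \<le> k" and "1 \<le> p" and "real CARD('m) < p"
  shows "Baire_space (weak_sobolev_whitney k p M \<A> N \<B>) \<and>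
         Baire_space (strong_sobolev_whitney k p M \<A> N \<B>)"
proof -
  interpret sobolev_whitney k p M \<A> N \<B> by unfold_locales (use assms in auto)
  show ?thesis using Baire_nbhd_open[OF good_finite openin_weak] Baire_nbhd_open[OF good_locally_finite openin_strong] by blast
qed

end
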